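(* Let $D \in \mathbb{N}$ be a non-square discriminant and let $d \in \mathbb{N}$ be relatively prime to the conductor of $D$. Then $X_{D,d}^{(3)}$ is non-empty if and only if $d$ satisfies the prime factor condition in $\mathcal{O}_D$. In this case $X_{D,d}^{(3)}$ consists of $2^s$ irreducible components $X_{\mathfrak a}^{(3)}$, where $s$ is the number of splitting prime divisors of $d$. For each component $X_{\mathfrak a}^{(3)}$ defined by the ideal $\mathfrak a$ (and a fixed smart basis $(\eta_2^\sigma,d\eta_1^\sigma)$ of $\mathfrak a$) there is an isomorphism $$\Phi:\ \Gamma_{D,d}(\eta_1,\eta_2)\backslash\mathbb{H}^3\ \cong\ X_{\mathfrak a}^{(3)},\qquad [z]\mapsto[(A_z,H_z,S_z,\rho_z)]$$ between the corresponding Hilbert modular variety and $X_{\mathfrak a}^{(3)}$.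
   Context: A discriminant is an integer $D\equiv0,1\bmod4$. For $D>0$ non-square put $K=\mathbb{Q}(\sqrt D)$, $\mathcal{O}_D=\langle1,\frac{D+\sqrt D}2\rangle_{\mathbb{Z}}$; $x\mapsto x^\sigma$ is the Galois conjugation, $\mathrm{tr}(x)=x+x^\sigma$. The conductor of $D$ is the $f\in\mathbb{N}$ with $D=f^2\Delta_K$, $\Delta_K$ the discriminant of the maximal order. For $d=\prod p_i^{k_i}$ relatively prime to the conductor, $d$ satisfies the prime factor condition in $\mathcal{O}_D$ if no $p_i$ is inert in $K$ and $k_i=1$ whenever $p_i$ ramifies in $K$. A polarization on $V/\Lambda$ is a positive definite Hermitian form $H$ with $E_H=\mathrm{Im}\,H$ integral on $\Lambda$. Real multiplication by $\mathcal{O}_D$ on a polarized Abelian surface is an injective ring homomorphism from $\mathcal{O}_D$ into its endomorphism ring with self-adjoint image, not extending to a strictly larger order of $K$. $X_{D,d}^{(3)}$ is the moduli space of isomorphism classes $[(A,H,S,\rho)]$, where $(A,H)$ is a three-dimensional principally polarized complex Abelian variety, $S\subset A$ a two-dimensional Abelian subvariety whose induced polarization has type $(1,d)$, and $\rho$ is real multiplication by $\mathcal{O}_D$ on $S$; an isomorphism is an isomorphism $f$ of polarized Abelian varieties mapping $S$ onto $S'$ such that $f|_S$ commutes with the $\mathcal{O}_D$-actions. The trace pairing on $K^2$ is $\langle(x,y),(\tilde x,\tilde y)\rangle=\mathrm{tr}(\tilde xy-x\tilde y)$. An ideal $\mathfrak a$ of $\mathcal{O}_D$ is primitive if $\frac1m\mathfrak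 a\subset\mathcal{O}_D$, $m\in\mathbb{Z}$, implies $m=\pm1$. For a primitive ideal $\mathfrak a$ of norm $d$, $X_{\mathfrak a}^{(3)}\subseteq X_{D,d}^{(3)}$ is the locus where the lattice of $S$ (with $E_H$ and its $\mathcal{O}_D$-structure) is isomorphic to $\mathcal{O}_D\oplus\frac1{\sqrt D}\mathfrak a$ with the trace pairing. The components are indexed by the primitive ideals of norm $d$. Smart basis: a $\mathbb{Z}$-basis of $\mathfrak a$ of the form $(\eta_2^\sigma,d\eta_1^\sigma)$, where $(\eta_1,\eta_2)$ is a $\mathbb{Z}$-basis of $\mathcal{O}_D$ with $\eta_1\eta_2^\sigma-\eta_1^\sigma\eta_2=-\sqrt D$. Every primitive ideal of $\mathcal{O}_D$ of norm $d$, where $d$ is relatively prime to the conductor of $D$ and satisfies the prime factor condition in $\mathcal{O}_D$, has one. For $z=(z_1,z_2,z_3)\in\mathbb{H}^3$ let $$\Pi_z=\begin{pmatrix}\eta_1&\eta_2&0&\frac1{\sqrt D}\eta_2^\sigma z_1&\frac{-1}{\sqrt D}\eta_1^\sigma z_1&\frac1d\eta_2\\ \eta_1^\sigma&\eta_2^\sigma&0&\frac{-1}{\sqrt D}\eta_2z_2&\frac1{\sqrt D}\eta_1z_2&\frac1d\eta_2^\sigma\\0&0&1&0&\frac1d&-\frac1dz_3\end{pmatrix},$$ $\Lambda_z=\Pi_z\mathbb{Z}^6$, $A_z=\mathbb{C}^3/\Lambda_z$, $H_z$ the principal polarization for which the columns $(\lambda_1,\lambda_2,\lambda_3,\mu_1,\mu_2,\mu_3)$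 of $\Pi_z$ form a symplectic basis ($E(\lambda_i,\mu_j)=\delta_{ij}$), $S_z=V_2/(V_2\cap\Lambda_z)$ with $V_2=\mathbb{C}^2\times\{0\}$, and $\rho_z(k)(c_1,c_2,0)=(kc_1,k^\sigma c_2,0)$. $\mathrm{SL}_2(\mathcal{O}_D\oplus\frac1{\sqrt D}\mathfrak a)$ is the group of $\begin{pmatrix}a&b\\c&e\end{pmatrix}\in\mathrm{SL}_2(K)$ with $a,e\in\mathcal{O}_D$, $b\in(\frac1{\sqrt D}\mathfrak a)^{-1}$, $c\in\frac1{\sqrt D}\mathfrak a$. The group $\mathrm{SL}_2(\mathcal{O}_D\oplus\frac1{\sqrt D}\mathfrak a)\times\mathrm{SL}_2(\mathbb{Z})$ acts on $\mathbb{H}^3$ by $(A,B).(z_1,z_2,z_3)=(Az_1,A^\sigma z_2,Bz_3)$. With $$S=\begin{pmatrix}0&\frac{\sqrt D}{d}\frac{\eta_2}{\eta_1^\sigma}\\1&0\end{pmatrix},\qquad M_{D,d}(\eta_1,\eta_2)=\begin{pmatrix}\frac d{\eta_2}\mathcal{O}_D&\frac{\sqrt D}{\eta_1^\sigma}\mathcal{O}_D\\ \frac d{\sqrt D\eta_2}\mathfrak a&\frac1{\eta_1^\sigma}\mathfrak a\end{pmatrix}$$ (the set of matrices with entries in the indicated sets), $\Gamma_{D,d}(\eta_1,\eta_2)$ is the subgroup of all $(A,B)\in\mathrm{SL}_2(\mathcal{O}_D\oplus\frac1{\sqrt D}\mathfrak a)\times\mathrm{SL}_2(\mathbb{Z})$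 with $A-SBS^{-1}\in M_{D,d}(\eta_1,\eta_2)$. *)

theory Defs
  imports
    "HOL-Analysis.Analysis"
    "HOL-Algebra.Ideal_Product"
    "HOL-Computational_Algebra.Computational_Algebra"
begin

section \<open>Real quadratic fields and their orders\<close>

text \<open>
  For a non-square \<open>D > 0\<close> the field \<open>K = \<rat>(\<surd>D)\<close> is taken inside the reals, with \<open>\<surd>D\<close> the
  positive root; the second real embedding is the Galois conjugation \<open>galois_conj D\<close>.
\<close>

definition nonsquare_discriminant :: "nat \<Rightarrow> bool" where
  "nonsquare_discriminant D \<longleftrightarrow> D mod 4 \<in> {0, 1} \<and> \<not> (\<exists>k::nat. D = k ^ 2)"

definition quad_field :: "nat \<Rightarrow> real set" where
  "quad_field D = {a + b * sqrt D | a b. a \<in> \<rat> \<and> b \<in> \<rat>}"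

definition galois_conj :: "nat \<Rightarrow> real \<Rightarrow> real" where
  "galois_conj D x = (THE y. \<exists>a\<in>\<rat>. \<exists>b\<in>\<rat>. x = a + b * sqrt D \<and> y = a - b * sqrt D)"

definition tr :: "nat \<Rightarrow> real \<Rightarrow> real" where
  "tr D x = x + galois_conj D x"

definition quad_order :: "nat \<Rightarrow> real set" where
  "quad_order D = {of_int m + of_int n * ((D + sqrt D) / 2) | m n :: int. True}"

definition maximal_order :: "nat \<Rightarrow> real set" where
  "maximal_order D = {x \<in> quad_field D. algebraic_int x}"

definition real_ring :: "real set \<Rightarrow> real ring" where
  "real_ring R = \<lparr>carrier = R, mult = (*), one = 1, zero = 0, add = (+)\<rparr>"

definition zspan :: "'a::real_vector list \<Rightarrow> 'a set" where
  "zspan bs = {\<Sum>i<length bs. real_of_int (c i) *\<^sub>R bs ! i | c. True}"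

definition is_zbasis :: "'a::real_vector list \<Rightarrow> 'a set \<Rightarrow> bool" where
  "is_zbasis bs M \<longleftrightarrow> M = zspan bs \<and>
     (\<forall>c :: nat \<Rightarrow> int. (\<Sum>i<length bs. real_of_int (c i) *\<^sub>R bs ! i) = 0
        \<longrightarrow> (\<forall>i<length bs. c i = 0))"

definition is_quad_order :: "nat \<Rightarrow> real set \<Rightarrow> bool" where
  "is_quad_order D R \<longleftrightarrow> R \<subseteq> quad_field D \<and> 1 \<in> R \<and> (\<forall>x\<in>R. \<forall>y\<in>R. x * y \<in> R) \<and>
     (\<exists>w1 w2. is_zbasis [w1, w2] R)"

definition field_discriminant :: "nat \<Rightarrow> int" where
  "field_discriminant D = (THE \<Delta>. \<exists>w1 w2. is_zbasis [w1, w2] (maximal_order D) \<and>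
     of_int \<Delta> = (w1 * galois_conj D w2 - galois_conj D w1 * w2)\<^sup>2)"

definition conductor :: "nat \<Rightarrow> nat" where
  "conductor D = (THE f. f > 0 \<and> int D = int f ^ 2 * field_discriminant D)"

definition inert :: "nat \<Rightarrow> nat \<Rightarrow> bool" where
  "inert D p \<longleftrightarrow> (let R = real_ring (maximal_order D) in primeideal (PIdl\<^bsub>R\<^esub> (real p)) R)"

definition ramified :: "nat \<Rightarrow> nat \<Rightarrow> bool" where
  "ramified D p \<longleftrightarrow> (let R = real_ring (maximal_order D) in
     \<exists>P. primeideal P R \<and> PIdl\<^bsub>R\<^esub> (real p) = ideal_prod R P P)"

definition splits :: "nat \<Rightarrow> nat \<Rightarrow> bool" where
  "splits D p \<longleftrightarrow> (let R = real_ring (maximal_order D) in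
     \<exists>P Q. primeideal P R \<and> primeideal Q R \<and> P \<noteq> Q \<and> PIdl\<^bsub>R\<^esub> (real p) = ideal_prod R P Q)"

definition prime_factor_condition :: "nat \<Rightarrow> nat \<Rightarrow> bool" where
  "prime_factor_condition D d \<longleftrightarrow> (\<forall>p. prime p \<and> p dvd d \<longrightarrow>
     \<not> inert D p \<and> (ramified D p \<longrightarrow> multiplicity p d = 1))"

definition ideal_norm :: "nat \<Rightarrow> real set \<Rightarrow> nat" where
  "ideal_norm D \<aa> = card (a_rcosets\<^bsub>real_ring (quad_order D)\<^esub> \<aa>)"

text \<open>\<open>m \<noteq> 0\<close> is needed because \<open>x / 0 = 0\<close>.\<close>

definition primitive_ideal :: "nat \<Rightarrow> real set \<Rightarrow> bool" where
  "primitive_ideal D \<aa> \<longleftrightarrow> ideal \<aa> (real_ring (quad_order D)) \<and>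
     (\<forall>m::int. m \<noteq> 0 \<and> (\<forall>x\<in>\<aa>. x / of_int m \<in> quad_order D) \<longrightarrow> m = 1 \<or> m = - 1)"

definition primitive_ideals :: "nat \<Rightarrow> nat \<Rightarrow> real set set" where
  "primitive_ideals D d = {\<aa>. primitive_ideal D \<aa> \<and> ideal_norm D \<aa> = d}"

definition smart_basis :: "nat \<Rightarrow> nat \<Rightarrow> real set \<Rightarrow> real \<Rightarrow> real \<Rightarrow> bool" where
  "smart_basis D d \<aa> \<eta>1 \<eta>2 \<longleftrightarrow>
     is_zbasis [\<eta>1, \<eta>2] (quad_order D) \<and>
     \<eta>1 * galois_conj D \<eta>2 - galois_conj D \<eta>1 * \<eta>2 = - sqrt D \<and>
     is_zbasis [galois_conj D \<eta>2, d * galois_conj D \<eta>1] \<aa>"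


section \<open>Spaces with a sheaf of complex-valued functions\<close>

text \<open>
  A complex space is described by its topology and, for every open \<open>U\<close>, the set \<open>hol X U\<close> of
  functions that are holomorphic on \<open>U\<close>; the values of such functions outside \<open>U\<close> are irrelevant.
\<close>

record 'a fspace =
  tspace :: "'a topology"
  hol :: "'a set \<Rightarrow> ('a \<Rightarrow> complex) set"

text \<open>
  Holomorphic functions on an arbitrary subset \<open>S\<close> of \<open>\<complex>\<^sup>n\<close>: locally on \<open>S\<close>, restrictions of
  complex differentiable functions on open subsets of \<open>\<complex>\<^sup>n\<close>. For open \<open>S\<close> these are the
  holomorphic functions on \<open>S\<close>, for locally analytic \<open>S\<close> the holomorphic functions of the reduced
  analytic space \<open>S\<close>.
\<close>

definition cn_holomorphic_on :: "(complex ^ 'n \<Rightarrow> complex) \<Rightarrow> (complex ^ 'n) set \<Rightarrow> bool" where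
  "cn_holomorphic_on f S \<longleftrightarrow> (\<forall>x\<in>S. \<exists>U F. open U \<and> x \<in> U \<and> (\<forall>y\<in>U \<inter> S. F y = f y) \<and>
     (\<forall>y\<in>U. \<exists>F'. (F has_derivative F') (at y) \<and> (\<forall>c v. F' (c *s v) = c * F' v)))"

text \<open>
  The finest structure on \<open>X\<close> for which all maps \<open>q\<close> with \<open>(P, q) \<in> Q\<close>, defined on \<open>P \<subseteq> \<complex>\<^sup>n\<close>, are
  morphisms.
\<close>

definition final_open :: "'a set \<Rightarrow> ((complex ^ 'n) set \<times> (complex ^ 'n \<Rightarrow> 'a)) set \<Rightarrow> 'a set \<Rightarrow> bool"
  where
  "final_open X Q U \<longleftrightarrow>
     U \<subseteq> X \<and> (\<forall>(P, q)\<in>Q. openin (top_of_set P) {p \<in> P. q p \<in> U})"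

definition final_fspace :: "'a set \<Rightarrow> ((complex ^ 'n) set \<times> (complex ^ 'n \<Rightarrow> 'a)) set \<Rightarrow> 'a fspace"
  where
  "final_fspace X Q =
     \<lparr>tspace = topology (final_open X Q),
      hol = (\<lambda>U. {f. \<forall>(P, q)\<in>Q. cn_holomorphic_on (f \<circ> q) {p \<in> P. q p \<in> U}})\<rparr>"

lemma istopology_final_open: "istopology (final_open X Q)"
  unfolding istopology_def
proof (intro conjI allI impI)
  fix S T assume ST: "final_open X Q S" "final_open X Q T"
  have "openin (top_of_set P) {p \<in> P. q p \<in> S \<inter> T}" if "(P, q) \<in> Q" for P q
  proof -
    have "{p \<in> P. q p \<in> S \<inter> T} = {p \<in> P. q p \<in> S} \<inter> {p \<in> P. q p \<in> T}"
      by blast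
    moreover have "openin (top_of_set P) {p \<in> P. q p \<in> S}" "openin (top_of_set P) {p \<in> P. q p \<in> T}"
      using ST that unfolding final_open_def by blast+
    ultimately show ?thesis
      by (simp only: openin_Int)
  qed
  moreover have "S \<inter> T \<subseteq> X"
    using ST unfolding final_open_def by blast
  ultimately show "final_open X Q (S \<inter> T)"
    unfolding final_open_def by blast
next
  fix \<K> assume *: "\<forall>K\<in>\<K>. final_open X Q K"
  have "openin (top_of_set P) {p \<in> P. q p \<in> \<Union>\<K>}" if "(P, q) \<in> Q" for P q
  proof -
    have "{p \<in> P. q p \<in> \<Union>\<K>} = \<Union>((\<lambda>K. {p \<in> P. q p \<in> K}) ` \<K>)"
      by blast
    moreover have "openin (top_of_set P) K'" if "K' \<in> (\<lambda>K. {p \<in> P. q p \<in> K}) ` \<K>" for K'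
      using * that \<open>(P, q) \<in> Q\<close> unfolding final_open_def by blast
    ultimately show ?thesis
      by (simp only: openin_Union)
  qed
  moreover have "\<Union>\<K> \<subseteq> X"
    using * unfolding final_open_def by blast
  ultimately show "final_open X Q (\<Union>\<K>)"
    unfolding final_open_def by blast
qed

lemma openin_final_fspace: "openin (tspace (final_fspace X Q)) = final_open X Q"
  unfolding final_fspace_def fspace.simps
  by (rule topology_inverse'[OF istopology_final_open])

lemma topspace_final_fspace:
  assumes "\<And>P q. (P, q) \<in> Q \<Longrightarrow> q ` P \<subseteq> X"
  shows "topspace (tspace (final_fspace X Q)) = X"
proof -
  have "openin (top_of_set P) {p \<in> P. q p \<in> X}" if "(P, q) \<in> Q" for P q
  proof -
    have "{p \<in> P. q p \<in> X} = P"
      using assms[OF that] by blast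
    then show ?thesis
      by (simp only: openin_subtopology_self)
  qed
  then have "final_open X Q X"
    unfolding final_open_def by blast
  moreover have "\<And>U. final_open X Q U \<Longrightarrow> U \<subseteq> X"
    unfolding final_open_def by blast
  ultimately show ?thesis
    unfolding topspace_def openin_final_fspace by blast
qed

definition sub_fspace :: "'a fspace \<Rightarrow> 'a set \<Rightarrow> 'a fspace" where
  "sub_fspace X A =
     \<lparr>tspace = subtopology (tspace X) A,
      hol = (\<lambda>V. {f. \<forall>x\<in>V. \<exists>U. openin (tspace X) U \<and> x \<in> U \<and>
                   (\<exists>F\<in>hol X U. \<forall>y\<in>U \<inter> V. F y = f y)})\<rparr>"

definition fspace_iso :: "('a \<Rightarrow> 'b) \<Rightarrow> 'a fspace \<Rightarrow> 'b fspace \<Rightarrow> bool" where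
  "fspace_iso \<Phi> X Y \<longleftrightarrow> homeomorphic_map (tspace X) (tspace Y) \<Phi> \<and>
     (\<forall>V f. openin (tspace Y) V \<longrightarrow>
        (f \<in> hol Y V \<longleftrightarrow> f \<circ> \<Phi> \<in> hol X {x \<in> topspace (tspace X). \<Phi> x \<in> V}))"

definition analytic_subset :: "'a fspace \<Rightarrow> 'a set \<Rightarrow> bool" where
  "analytic_subset X Z \<longleftrightarrow> closedin (tspace X) Z \<and>
     (\<forall>x\<in>topspace (tspace X). \<exists>U F. openin (tspace X) U \<and> x \<in> U \<and> finite F \<and> F \<subseteq> hol X U \<and>
        Z \<inter> U = {y \<in> U. \<forall>f\<in>F. f y = 0})"

definition irreducible_subset :: "'a fspace \<Rightarrow> 'a set \<Rightarrow> bool" where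
  "irreducible_subset X Z \<longleftrightarrow> analytic_subset X Z \<and> Z \<noteq> {} \<and>
     (\<forall>Z1 Z2. analytic_subset X Z1 \<and> analytic_subset X Z2 \<and> Z = Z1 \<union> Z2 \<longrightarrow> Z = Z1 \<or> Z = Z2)"

definition irreducible_components :: "'a fspace \<Rightarrow> 'a set set" where
  "irreducible_components X =
     {Z. irreducible_subset X Z \<and> (\<forall>Z'. irreducible_subset X Z' \<and> Z \<subseteq> Z' \<longrightarrow> Z' = Z)}"


section \<open>Polarized Abelian varieties with real multiplication\<close>

definition full_lattice :: "'a::real_vector set \<Rightarrow> 'a set \<Rightarrow> bool" where
  "full_lattice V \<Lambda> \<longleftrightarrow>
     (\<exists>bs. is_zbasis bs \<Lambda> \<and> independent (set bs) \<and> span (set bs) = V)"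

text \<open>Hermitian forms are complex linear in the first argument.\<close>

definition hermitian :: "(complex ^ 'n \<Rightarrow> complex ^ 'n \<Rightarrow> complex) \<Rightarrow> bool" where
  "hermitian H \<longleftrightarrow> (\<forall>x y z. H (x + y) z = H x z + H y z) \<and>
     (\<forall>c x y. H (c *s x) y = c * H x y) \<and> (\<forall>x y. H y x = cnj (H x y))"

definition polarization :: "(complex ^ 'n \<Rightarrow> complex ^ 'n \<Rightarrow> complex) \<Rightarrow> (complex ^ 'n) set \<Rightarrow> bool"
  where
  "polarization H \<Lambda> \<longleftrightarrow> hermitian H \<and> (\<forall>x. x \<noteq> 0 \<longrightarrow> Re (H x x) > 0) \<and>
     (\<forall>x\<in>\<Lambda>. \<forall>y\<in>\<Lambda>. Im (H x y) \<in> \<int>)"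

definition symplectic_basis ::
  "(complex ^ 'n \<Rightarrow> complex ^ 'n \<Rightarrow> complex) \<Rightarrow> (complex ^ 'n) set \<Rightarrow> nat list \<Rightarrow>
     (complex ^ 'n) list \<Rightarrow> (complex ^ 'n) list \<Rightarrow> bool" where
  "symplectic_basis H \<Lambda> ds ls ms \<longleftrightarrow>
     length ls = length ds \<and> length ms = length ds \<and> is_zbasis (ls @ ms) \<Lambda> \<and>
     (\<forall>i<length ds. \<forall>j<length ds.
        Im (H (ls ! i) (ls ! j)) = 0 \<and> Im (H (ms ! i) (ms ! j)) = 0 \<and>
        Im (H (ls ! i) (ms ! j)) = (if i = j then real (ds ! i) else 0))"

definition has_type ::
  "(complex ^ 'n \<Rightarrow> complex ^ 'n \<Rightarrow> complex) \<Rightarrow> (complex ^ 'n) set \<Rightarrow> nat list \<Rightarrow> bool" where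
  "has_type H \<Lambda> ds \<longleftrightarrow> (\<forall>e\<in>set ds. e > 0) \<and> (\<forall>i. Suc i < length ds \<longrightarrow> ds ! i dvd ds ! Suc i) \<and>
     (\<exists>ls ms. symplectic_basis H \<Lambda> ds ls ms)"

text \<open>
  The endomorphism ring of the complex torus \<open>W / \<Lambda>\<close>, for a full lattice \<open>\<Lambda>\<close> in a complex subspace
  \<open>W\<close> of \<open>\<complex>\<^sup>n\<close>, in its analytic representation. Endomorphisms are functions on \<open>W\<close>
  (extensional, so that they are determined by their values on \<open>W\<close>).
\<close>

definition torus_End :: "(complex ^ 'n) set \<Rightarrow> (complex ^ 'n) set \<Rightarrow> (complex ^ 'n \<Rightarrow> complex ^ 'n) ring"
  where
  "torus_End W \<Lambda> =
     \<lparr>carrier = {T. T \<in> W \<rightarrow>\<^sub>E W \<and> (\<forall>x\<in>W. \<forall>y\<in>W. T (x + y) = T x + T y) \<and>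
                    (\<forall>c. \<forall>x\<in>W. T (c *s x) = c *s T x) \<and> T ` \<Lambda> \<subseteq> \<Lambda>},
      mult = (\<lambda>S T. compose W S T), one = (\<lambda>x\<in>W. x),
      zero = (\<lambda>x\<in>W. 0), add = (\<lambda>S T. \<lambda>x\<in>W. S x + T x)\<rparr>"

definition real_multiplication ::
  "nat \<Rightarrow> (complex ^ 'n) set \<Rightarrow> (complex ^ 'n) set \<Rightarrow> (complex ^ 'n \<Rightarrow> complex ^ 'n \<Rightarrow> complex) \<Rightarrow>
     (real \<Rightarrow> complex ^ 'n \<Rightarrow> complex ^ 'n) \<Rightarrow> bool" where
  "real_multiplication D W \<Lambda> H \<rho> \<longleftrightarrow>
     \<rho> \<in> ring_hom (real_ring (quad_order D)) (torus_End W \<Lambda>) \<and>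
     inj_on \<rho> (quad_order D) \<and>
     (\<forall>k\<in>quad_order D. \<forall>x\<in>W. \<forall>y\<in>W. H (\<rho> k x) y = H x (\<rho> k y)) \<and>
     \<not> (\<exists>R \<rho>'. is_quad_order D R \<and> quad_order D \<subset> R \<and>
          \<rho>' \<in> ring_hom (real_ring R) (torus_End W \<Lambda>) \<and> (\<forall>k\<in>quad_order D. \<rho>' k = \<rho> k))"

text \<open>
  A tuple \<open>(A, H, S, \<rho>)\<close>: \<open>A = \<complex>\<^sup>3 / lat\<close>, polarized by \<open>pol\<close>; the Abelian subvariety \<open>S\<close> is the
  image \<open>sub / (sub \<inter> lat)\<close> of a complex subspace; \<open>act k\<close> only matters for \<open>k\<close> in the order.
\<close>

record rm_threefold =
  lat :: "(complex ^ 3) set"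
  pol :: "complex ^ 3 \<Rightarrow> complex ^ 3 \<Rightarrow> complex"
  sub :: "(complex ^ 3) set"
  act :: "real \<Rightarrow> complex ^ 3 \<Rightarrow> complex ^ 3"

definition is_rm_threefold :: "nat \<Rightarrow> nat \<Rightarrow> rm_threefold \<Rightarrow> bool" where
  "is_rm_threefold D d X \<longleftrightarrow>
     full_lattice UNIV (lat X) \<and> polarization (pol X) (lat X) \<and> has_type (pol X) (lat X) [1, 1, 1] \<and>
     vec.subspace (sub X) \<and> vec.dim (sub X) = 2 \<and> full_lattice (sub X) (sub X \<inter> lat X) \<and>
     has_type (pol X) (sub X \<inter> lat X) [1, d] \<and>
     real_multiplication D (sub X) (sub X \<inter> lat X) (pol X) (act X)"

definition rm_isomorphic :: "nat \<Rightarrow> rm_threefold \<Rightarrow> rm_threefold \<Rightarrow> bool" where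
  "rm_isomorphic D X Y \<longleftrightarrow>
     (\<exists>f. Vector_Spaces.linear (*s) (*s) f \<and> bij f \<and> f ` lat X = lat Y \<and>
        (\<forall>x y. pol Y (f x) (f y) = pol X x y) \<and> f ` sub X = sub Y \<and>
        (\<forall>k\<in>quad_order D. \<forall>x\<in>sub X. f (act X k x) = act Y k (f x)))"

definition rm_class :: "nat \<Rightarrow> nat \<Rightarrow> rm_threefold \<Rightarrow> rm_threefold set" where
  "rm_class D d X = {Y. is_rm_threefold D d Y \<and> rm_isomorphic D X Y}"

definition moduli_set :: "nat \<Rightarrow> nat \<Rightarrow> rm_threefold set set" where
  "moduli_set D d = rm_class D d ` {X. is_rm_threefold D d X}"

definition trace_pairing :: "nat \<Rightarrow> real \<times> real \<Rightarrow> real \<times> real \<Rightarrow> real" where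
  "trace_pairing D u v = tr D (fst v * snd u - fst u * snd v)"

definition ideal_locus :: "nat \<Rightarrow> nat \<Rightarrow> real set \<Rightarrow> rm_threefold set set" where
  "ideal_locus D d \<aa> = rm_class D d ` {X. is_rm_threefold D d X \<and>
     (\<exists>g. bij_betw g (quad_order D \<times> (\<lambda>x. x / sqrt D) ` \<aa>) (sub X \<inter> lat X) \<and>
        (\<forall>u \<in> quad_order D \<times> (\<lambda>x. x / sqrt D) ` \<aa>. \<forall>v \<in> quad_order D \<times> (\<lambda>x. x / sqrt D) ` \<aa>.
           g (u + v) = g u + g v \<and> Im (pol X (g u) (g v)) = trace_pairing D u v) \<and>
        (\<forall>k\<in>quad_order D. \<forall>u \<in> quad_order D \<times> (\<lambda>x. x / sqrt D) ` \<aa>.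
           g (k * fst u, k * snd u) = act X k (g u)))}"


section \<open>The complex structure of the moduli space\<close>

text \<open>
  A matrix in \<open>\<complex>\<^bsup>3\<times>6\<^esup>\<close> is regarded as the homomorphism from \<open>\<int>\<^sup>6\<close> to \<open>\<complex>\<^sup>3\<close> given by its columns.
  As period matrix of a tuple \<open>(A, H, S, \<rho>)\<close> it transports the integral data to \<open>\<int>\<^sup>6\<close>: the
  alternating form becomes \<open>E\<close>, the lattice of \<open>S\<close> becomes \<open>L\<close>, and \<open>k\<close> acts on \<open>L\<close> as \<open>R k\<close>.
  A holomorphic family of tuples has, locally on the base, a holomorphically varying
  period matrix with constant \<open>(E, L, R)\<close>. The set of all period matrices with given \<open>(E, L, R)\<close>
  is a locally closed complex submanifold of \<open>\<complex>\<^bsup>3\<times>6\<^esup>\<close>, the base of the universal such family,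
  and the moduli space carries the finest structure for which the maps that send a period matrix to
  the isomorphism class of its tuple are holomorphic, for all \<open>(E, L, R)\<close>.
\<close>

definition period_hom :: "complex ^ (3 \<times> 6) \<Rightarrow> int ^ 6 \<Rightarrow> complex ^ 3" where
  "period_hom M n = (\<Sum>j\<in>UNIV. of_int (n $ j) *s (\<chi> i. M $ (i, j)))"

definition is_period_matrix ::
  "nat \<Rightarrow> (int ^ 6 \<Rightarrow> int ^ 6 \<Rightarrow> int) \<Rightarrow> (int ^ 6) set \<Rightarrow> (real \<Rightarrow> int ^ 6 \<Rightarrow> int ^ 6) \<Rightarrow>
     rm_threefold \<Rightarrow> complex ^ (3 \<times> 6) \<Rightarrow> bool" where
  "is_period_matrix D E L R X M \<longleftrightarrow>
     bij_betw (period_hom M) UNIV (lat X) \<and>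
     (\<forall>m n. Im (pol X (period_hom M m) (period_hom M n)) = of_int (E m n)) \<and>
     period_hom M ` L = sub X \<inter> lat X \<and>
     (\<forall>k\<in>quad_order D. \<forall>n\<in>L. act X k (period_hom M n) = period_hom M (R k n))"

definition period_domain ::
  "nat \<Rightarrow> nat \<Rightarrow> (int ^ 6 \<Rightarrow> int ^ 6 \<Rightarrow> int) \<Rightarrow> (int ^ 6) set \<Rightarrow> (real \<Rightarrow> int ^ 6 \<Rightarrow> int ^ 6) \<Rightarrow>
     (complex ^ (3 \<times> 6)) set" where
  "period_domain D d E L R = {M. \<exists>X. is_rm_threefold D d X \<and> is_period_matrix D E L R X M}"

definition classifying_maps ::
  "nat \<Rightarrow> nat \<Rightarrow> ((complex ^ (3 \<times> 6)) set \<times> (complex ^ (3 \<times> 6) \<Rightarrow> rm_threefold set)) set" where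
  "classifying_maps D d = {(P, q). \<exists>E L R. P = period_domain D d E L R \<and>
     (\<forall>M\<in>P. \<exists>X. is_rm_threefold D d X \<and> is_period_matrix D E L R X M \<and> q M = rm_class D d X)}"

definition moduli_space :: "nat \<Rightarrow> nat \<Rightarrow> rm_threefold set fspace" where
  "moduli_space D d = final_fspace (moduli_set D d) (classifying_maps D d)"

lemma topspace_moduli_space: "topspace (tspace (moduli_space D d)) = moduli_set D d"
  unfolding moduli_space_def
proof (rule topspace_final_fspace, rule image_subsetI)
  fix P q M assume "(P, q) \<in> classifying_maps D d" "M \<in> P"
  then obtain X where "is_rm_threefold D d X" "q M = rm_class D d X"
    unfolding classifying_maps_def by blast
  then show "q M \<in> moduli_set D d"
    unfolding moduli_set_def by blast
qed


section \<open>The Hilbert modular variety and the varieties over it\<close>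

definition SL2_Z :: "(real ^ 2 ^ 2) set" where
  "SL2_Z = {B. (\<forall>i j. B $ i $ j \<in> \<int>) \<and> det B = 1}"

definition SL2_ideal :: "nat \<Rightarrow> real set \<Rightarrow> (real ^ 2 ^ 2) set" where
  "SL2_ideal D \<aa> = {A. (\<forall>i j. A $ i $ j \<in> quad_field D) \<and> det A = 1 \<and>
     A $ 1 $ 1 \<in> quad_order D \<and> A $ 2 $ 2 \<in> quad_order D \<and>
     (\<forall>x\<in>\<aa>. A $ 1 $ 2 * (x / sqrt D) \<in> quad_order D) \<and>
     A $ 2 $ 1 \<in> (\<lambda>x. x / sqrt D) ` \<aa>}"

definition smart_S :: "nat \<Rightarrow> nat \<Rightarrow> real \<Rightarrow> real \<Rightarrow> real ^ 2 ^ 2" where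
  "smart_S D d \<eta>1 \<eta>2 = vector [vector [0, sqrt D / d * (\<eta>2 / galois_conj D \<eta>1)], vector [1, 0]]"

definition smart_M :: "nat \<Rightarrow> nat \<Rightarrow> real set \<Rightarrow> real \<Rightarrow> real \<Rightarrow> (real ^ 2 ^ 2) set" where
  "smart_M D d \<aa> \<eta>1 \<eta>2 = {C.
     C $ 1 $ 1 \<in> (\<lambda>x. d / \<eta>2 * x) ` quad_order D \<and>
     C $ 1 $ 2 \<in> (\<lambda>x. sqrt D / galois_conj D \<eta>1 * x) ` quad_order D \<and>
     C $ 2 $ 1 \<in> (\<lambda>x. d / (sqrt D * \<eta>2) * x) ` \<aa> \<and>
     C $ 2 $ 2 \<in> (\<lambda>x. 1 / galois_conj D \<eta>1 * x) ` \<aa>}"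

definition Gamma_group ::
  "nat \<Rightarrow> nat \<Rightarrow> real set \<Rightarrow> real \<Rightarrow> real \<Rightarrow> ((real ^ 2 ^ 2) \<times> (real ^ 2 ^ 2)) set" where
  "Gamma_group D d \<aa> \<eta>1 \<eta>2 = {(A, B). A \<in> SL2_ideal D \<aa> \<and> B \<in> SL2_Z \<and>
     A - smart_S D d \<eta>1 \<eta>2 ** B ** matrix_inv (smart_S D d \<eta>1 \<eta>2) \<in> smart_M D d \<aa> \<eta>1 \<eta>2}"

definition upper_half3 :: "(complex ^ 3) set" where
  "upper_half3 = {z. \<forall>i. Im (z $ i) > 0}"

definition moebius :: "real ^ 2 ^ 2 \<Rightarrow> complex \<Rightarrow> complex" where
  "moebius A w = (of_real (A $ 1 $ 1) * w + of_real (A $ 1 $ 2)) /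
                 (of_real (A $ 2 $ 1) * w + of_real (A $ 2 $ 2))"

definition hilbert_act :: "nat \<Rightarrow> (real ^ 2 ^ 2) \<times> (real ^ 2 ^ 2) \<Rightarrow> complex ^ 3 \<Rightarrow> complex ^ 3" where
  "hilbert_act D g z = vector [moebius (fst g) (z $ 1),
     moebius (\<chi> i j. galois_conj D (fst g $ i $ j)) (z $ 2), moebius (snd g) (z $ 3)]"

definition hilbert_orbit ::
  "nat \<Rightarrow> ((real ^ 2 ^ 2) \<times> (real ^ 2 ^ 2)) set \<Rightarrow> complex ^ 3 \<Rightarrow> (complex ^ 3) set" where
  "hilbert_orbit D \<Gamma> z = (\<lambda>g. hilbert_act D g z) ` \<Gamma>"

definition hilbert_modular_variety ::
  "nat \<Rightarrow> ((real ^ 2 ^ 2) \<times> (real ^ 2 ^ 2)) set \<Rightarrow> (complex ^ 3) set fspace" where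
  "hilbert_modular_variety D \<Gamma> =
     final_fspace (hilbert_orbit D \<Gamma> ` upper_half3) {(upper_half3, hilbert_orbit D \<Gamma>)}"

definition period_lambda :: "nat \<Rightarrow> real \<Rightarrow> real \<Rightarrow> (complex ^ 3) list" where
  "period_lambda D \<eta>1 \<eta>2 =
     [vector [of_real \<eta>1, of_real (galois_conj D \<eta>1), 0],
      vector [of_real \<eta>2, of_real (galois_conj D \<eta>2), 0],
      vector [0, 0, 1]]"

definition period_mu :: "nat \<Rightarrow> nat \<Rightarrow> real \<Rightarrow> real \<Rightarrow> complex ^ 3 \<Rightarrow> (complex ^ 3) list" where
  "period_mu D d \<eta>1 \<eta>2 z =
     [vector [of_real (1 / sqrt D * galois_conj D \<eta>2) * z $ 1, of_real (- 1 / sqrt D * \<eta>2) * z $ 2, 0],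
      vector [of_real (- 1 / sqrt D * galois_conj D \<eta>1) * z $ 1, of_real (1 / sqrt D * \<eta>1) * z $ 2,
              of_real (1 / d)],
      vector [of_real (1 / d * \<eta>2), of_real (1 / d * galois_conj D \<eta>2), - of_real (1 / d) * z $ 3]]"

definition threefold_lattice :: "nat \<Rightarrow> nat \<Rightarrow> real \<Rightarrow> real \<Rightarrow> complex ^ 3 \<Rightarrow> (complex ^ 3) set" where
  "threefold_lattice D d \<eta>1 \<eta>2 z = zspan (period_lambda D \<eta>1 \<eta>2 @ period_mu D d \<eta>1 \<eta>2 z)"

definition rm_threefold_of :: "nat \<Rightarrow> nat \<Rightarrow> real \<Rightarrow> real \<Rightarrow> complex ^ 3 \<Rightarrow> rm_threefold" where
  "rm_threefold_of D d \<eta>1 \<eta>2 z =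
     \<lparr>lat = threefold_lattice D d \<eta>1 \<eta>2 z,
      pol = (THE H. polarization H (threefold_lattice D d \<eta>1 \<eta>2 z) \<and>
               symplectic_basis H (threefold_lattice D d \<eta>1 \<eta>2 z) [1, 1, 1]
                 (period_lambda D \<eta>1 \<eta>2) (period_mu D d \<eta>1 \<eta>2 z)),
      sub = {x. x $ 3 = 0},
      act = (\<lambda>k. \<lambda>x\<in>{x. x $ 3 = 0}. vector [of_real k * x $ 1, of_real (galois_conj D k) * x $ 2, 0])\<rparr>"

end

theory Submission
  imports Defs "HOL-Complex_Analysis.Complex_Analysis" "HOL-Number_Theory.Cong"
begin

text \<open>
  Two ingredients decide the theorem: the arithmetic of primitive ideals of \<open>\<O>\<^sub>D\<close>, and a normal form
  for period matrices.

  \<^bold>\<open>Arithmetic.\<close> With \<open>\<omega> = (D + \<surd>D)/2\<close> and its minimal polynomial \<open>x\<^sup>2 - D x + N\<close>, the primitive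
  ideals of norm \<open>d\<close> are exactly the ideals \<open>(d, \<omega> - a)\<close> for the roots \<open>a\<close> of that polynomial modulo
  \<open>d\<close> (\<open>primitive_ideals_eq\<close>). For a prime \<open>p\<close> prime to the conductor, having no root, one double root
  or two roots modulo \<open>p\<close> means that \<open>p\<close> is inert, ramified or split (\<open>prime_decomposition\<close>). The
  Chinese remainder theorem and Hensel's lemma then give \<open>2\<^sup>s\<close> roots modulo \<open>d\<close> when the prime
  factor condition holds, and the absence of roots otherwise.

  \<^bold>\<open>Lattices of surfaces.\<close> On the lattice of \<open>S\<close>, of type \<open>(1, d)\<close>, the self-adjoint operator \<open>\<omega>\<close> is
  determined by a two by two integer matrix acting between a pair of Lagrangian halves; reducing it to
  diagonal form exhibits the lattice as \<open>\<O>\<^sub>D \<oplus> \<aa>/\<surd>D\<close> for a primitive ideal \<open>\<aa>\<close> of norm \<open>d\<close>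
  (\<open>rm_lattice_structure\<close>), and properness of the action is what makes the ideal primitive. The ideal
  can be read off from the lattice (\<open>ideal_recovered\<close>). So the moduli set is the disjoint union of the
  loci \<open>X_\<aa>\<close>.

  \<^bold>\<open>Normal form.\<close> The basis of the lattice of \<open>S\<close> attached to a smart basis of \<open>\<aa>\<close> extends to a
  symplectic basis of the whole unimodular lattice in which the combinatorial position of the sublattice
  is always the same (\<open>extend_to_symplectic\<close>, \<open>standard_marking\<close>). A period matrix with this standard
  marking is, after splitting \<open>\<complex>\<^sup>3\<close> into the two eigenlines of the real multiplication and the orthogonal
  complement of \<open>S\<close>, the matrix \<open>\<Pi>_z\<close> of a unique \<open>z \<in> \<H>\<^sup>3\<close>, and \<open>z\<close> is a rational function of the
  periods (\<open>isomorphic_to_model\<close>, \<open>zeta_eq\<close>). Two points of \<open>\<H>\<^sup>3\<close> give isomorphic tuples precisely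
  when \<open>\<Gamma>\<close> identifies them, since an isomorphism preserves the splitting and is therefore diagonal
  (\<open>isomorphic_is_diagonal\<close>).

  \<^bold>\<open>Geometry.\<close> All points of one space of marked period matrices that meets \<open>X_\<aa>\<close> lie in \<open>X_\<aa>\<close>, and
  there the classifying map factors holomorphically through \<open>\<H>\<^sup>3\<close> (\<open>uniformizing_map\<close>). Hence each
  locus is open and closed, its open sets and holomorphic functions are those of the quotient of
  \<open>\<H>\<^sup>3\<close>, and it is irreducible because a proper analytic subset of the connected space \<open>\<H>\<^sup>3\<close> has empty
  interior.
\<close>

section \<open>Real quadratic fields\<close>

lemma zspan_Nil: "zspan [] = {0}"
 by (simp add: zspan_def)

lemma zspan_Cons: "zspan (b # bs) = {real_of_int c *\<^sub>R b + v | c v. v \<in> zspan bs}"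
proof -
 have step: "(\<Sum>i<length (b # bs). real_of_int (c i) *\<^sub>R (b # bs) ! i) =
   real_of_int (c 0) *\<^sub>R b + (\<Sum>i<length bs. real_of_int (c (Suc i)) *\<^sub>R bs ! i)" for c :: "nat => int"
  by (simp only: list.size add.right_neutral add_Suc_right sum.lessThan_Suc_shift nth_Cons_0 nth_Cons_Suc)
 show ?thesis
 proof (intro equalityI subsetI)
  fix x assume "x \<in> zspan (b # bs)"
  then obtain c where "x = (\<Sum>i<length (b # bs). real_of_int (c i) *\<^sub>R (b # bs) ! i)"
   unfolding zspan_def by blast
  then show "x \<in> {real_of_int c *\<^sub>R b + v | c v. v \<in> zspan bs}"
   unfolding step zspan_def by (intro CollectI exI[of _ "c 0"]) (auto intro: exI[of _ "%i. c (Suc i)"])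
 next
  fix x assume "x \<in> {real_of_int c *\<^sub>R b + v | c v. v \<in> zspan bs}"
  then obtain c0 c where x: "x = real_of_int c0 *\<^sub>R b + (\<Sum>i<length bs. real_of_int (c i) *\<^sub>R bs ! i)"
   unfolding zspan_def by blast
  show "x \<in> zspan (b # bs)"
   unfolding zspan_def x
   by (intro CollectI exI[of _ "case_nat c0 c"]) (unfold step, simp)
 qed
qed

lemma zspan2: "zspan [a, b] = {real_of_int m *\<^sub>R a + real_of_int n *\<^sub>R b | m n. True}"
 by (auto simp: zspan_Cons zspan_Nil)

lemma is_zbasis2_iff:
 fixes a b :: real
 shows "is_zbasis [a, b] M \<longleftrightarrow> M = {real_of_int m * a + real_of_int n * b | m n. True} &
  (ALL m n. real_of_int m * a + real_of_int n * b = 0 --> m = 0 & n = 0)"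
proof -
 have "(\<forall>c :: nat => int. (\<Sum>i<length [a, b]. real_of_int (c i) *\<^sub>R [a, b] ! i) = 0
   --> (\<forall>i<length [a, b]. c i = 0)) \<longleftrightarrow>
  (ALL m n. real_of_int m * a + real_of_int n * b = 0 --> m = 0 & n = 0)" (is "?L \<longleftrightarrow> ?R")
 proof
  assume L: ?L
  show ?R
  proof (intro allI impI)
   fix m n assume "real_of_int m * a + real_of_int n * b = 0"
   then show "m = 0 & n = 0"
   using L[rule_format, of "%i. if i = 0 then m else n" 0]
   L[rule_format, of "%i. if i = 0 then m else n" 1]
   by (simp add: lessThan_Suc numeral_2_eq_2)
  qed
 next
  assume R: ?R
  show ?L
  proof (intro allI impI)
   fix c :: "nat => int" and i
   assume "(\<Sum>i<length [a, b]. real_of_int (c i) *\<^sub>R [a, b] ! i) = 0" "i < length [a, b]"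
   then show "c i = 0"
   using R[rule_format, of "c 0" "c 1"]
   by (auto simp: lessThan_Suc numeral_2_eq_2 less_Suc_eq add.commute)
  qed
 qed
 then show ?thesis
  unfolding is_zbasis_def zspan2 by simp
qed

locale real_quadratic =
 fixes D :: nat
 assumes disc: "nonsquare_discriminant D"
begin

abbreviation s :: real where "s \<equiv> sqrt (real D)"
abbreviation cj :: "real => real" where "cj \<equiv> galois_conj D"
abbreviation KK :: "real set" where "KK \<equiv> quad_field D"
abbreviation Od :: "real set" where "Od \<equiv> quad_order D"

definition om :: real where "om = (real D + s) / 2"
definition nom :: int where "nom = (int D * int D - int D) div 4"

text \<open>
  The minimal polynomial of \<open>om\<close>, as a function on the integers: its roots modulo \<open>d\<close> parametrize the
  primitive ideals of norm \<open>d\<close>.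
\<close>

definition minpol :: "int => int" where "minpol x = x * x - int D * x + nom"

lemma D_pos: "D > 0"
 using disc unfolding nonsquare_discriminant_def by (metis gr0I zero_power2)

lemma s_pos: "s > 0" and s_ne: "s ~= 0"
 using D_pos by auto

lemma s_sq: "s * s = real D"
 by simp

lemma nom: "4 * nom = int D * int D - int D"
proof -
 have "D mod 4 = 0 \<or> D mod 4 = 1"
  using disc unfolding nonsquare_discriminant_def by auto
 then have "int D = 4 * (int D div 4) \<or> int D = 4 * (int D div 4) + 1" by presburger
 then obtain k where k: "int D = 4 * k \<or> int D = 4 * k + 1" by blast
 have "int D * int D - int D = 4 * (4 * k * k - k) \<or> int D * int D - int D = 4 * (4 * k * k + k)"
  using k by (elim disjE) (simp_all add: algebra_simps)
 then show ?thesis unfolding nom_def by (elim disjE) simp_all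
qed

lemma nom_real: "of_int nom = (real D * real D - real D) / 4"
proof -
 have "real_of_int (4 * nom) = of_int (int D * int D - int D)" using nom by simp
 then show ?thesis by simp
qed

lemma s_irrational: "s \<notin> \<rat>"
proof
 assume "s \<in> \<rat>"
 moreover have "algebraic_int s" by (intro algebraic_int_sqrt) auto
 ultimately have "s \<in> \<int>" using rational_algebraic_int_is_int by blast
 then obtain k where k: "s = of_int k" by (auto elim: Ints_cases)
 then have "real D = of_int (k * k)" using s_sq by simp
 then have "int D = k * k" by linarith
 then have "D = nat \<bar>k\<bar> ^ 2"
  by (metis abs_mult_self_eq nat_int nat_power_eq abs_ge_zero power2_eq_square)
 then show False using disc unfolding nonsquare_discriminant_def by blast
qed

lemma rat_coords_zero:
 assumes "a \<in> \<rat>" "b \<in> \<rat>" "a + b * s = 0" shows "a = 0 & b = 0"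
proof (cases "b = 0")
 case False
 then have "s = - a / b" using assms(3) by (simp add: field_simps)
 then have "s \<in> \<rat>" using assms by simp
 then show ?thesis using s_irrational by simp
qed (use assms in auto)

lemma rat_coords_unique:
 assumes "a \<in> \<rat>" "b \<in> \<rat>" "a' \<in> \<rat>" "b' \<in> \<rat>" "a + b * s = a' + b' * s"
 shows "a = a' & b = b'"
 using rat_coords_zero[of "a - a'" "b - b'"] assms by (simp add: algebra_simps)

lemma KK_cases:
 assumes "x \<in> KK" obtains a b where "a \<in> \<rat>" "b \<in> \<rat>" "x = a + b * s"
 using assms unfolding quad_field_def by auto

lemma KK_intro: "a \<in> \<rat> ==> b \<in> \<rat> ==> a + b * s \<in> KK"
 unfolding quad_field_def by auto

lemma cj_coords:
 assumes "a \<in> \<rat>" "b \<in> \<rat>" shows "cj (a + b * s) = a - b * s"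
 unfolding galois_conj_def
proof (rule the_equality)
 show "\<exists>a'\<in>\<rat>. \<exists>b'\<in>\<rat>. a + b * s = a' + b' * s & a - b * s = a' - b' * s"
  using assms by blast
next
 fix y assume "\<exists>a'\<in>\<rat>. \<exists>b'\<in>\<rat>. a + b * s = a' + b' * s & y = a' - b' * s"
 then show "y = a - b * s" using rat_coords_unique assms by metis
qed

lemma Rats_in_KK: "a \<in> \<rat> ==> a \<in> KK"
 using KK_intro[of a 0] by simp
lemma cj_Rats: "a \<in> \<rat> ==> cj a = a"
 using cj_coords[of a 0] by simp

lemma KK_int [simp]: "of_int m \<in> KK" "of_nat n \<in> KK" "numeral k \<in> KK" "0 \<in> KK" "1 \<in> KK"
 by (auto intro: Rats_in_KK)
lemma cj_int [simp]: "cj (of_int m) = of_int m" "cj (of_nat n) = of_nat n" "cj (numeral k) = numeral k"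
  "cj 0 = 0" "cj 1 = 1"
 by (auto intro: cj_Rats)

lemma KK_s [simp]: "s \<in> KK" and cj_s [simp]: "cj s = - s"
 using KK_intro[of 0 1] cj_coords[of 0 1] by auto

lemma KK_add [simp]: assumes "x \<in> KK" "y \<in> KK" shows "x + y \<in> KK"
 and cj_add [simp]: "cj (x + y) = cj x + cj y"
proof -
 obtain a b a' b' where *: "a \<in> \<rat>" "b \<in> \<rat>" "x = a + b * s" "a' \<in> \<rat>" "b' \<in> \<rat>" "y = a' + b' * s"
  using assms by (metis KK_cases)
 have 1: "x + y = (a + a') + (b + b') * s" using * by (simp add: algebra_simps)
 have 2: "a + a' \<in> \<rat>" "b + b' \<in> \<rat>" using * by auto
 show "x + y \<in> KK" unfolding 1 using 2 KK_intro by blast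
 show "cj (x + y) = cj x + cj y" unfolding 1 cj_coords[OF 2] using * cj_coords by (simp add: algebra_simps)
qed

lemma KK_mult [simp]: assumes "x \<in> KK" "y \<in> KK" shows "x * y \<in> KK"
 and cj_mult [simp]: "cj (x * y) = cj x * cj y"
proof -
 obtain a b a' b' where *: "a \<in> \<rat>" "b \<in> \<rat>" "x = a + b * s" "a' \<in> \<rat>" "b' \<in> \<rat>" "y = a' + b' * s"
  using assms by (metis KK_cases)
 have 1: "x * y = (a * a' + b * b' * D) + (a * b' + b * a') * s"
  using * s_sq by (simp add: algebra_simps)
 have 2: "(a - b * s) * (a' - b' * s) = (a * a' + b * b' * D) - (a * b' + b * a') * s"
  using s_sq by (simp add: algebra_simps)
 have 3: "a * a' + b * b' * D \<in> \<rat>" "a * b' + b * a' \<in> \<rat>" using * by auto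
 show "x * y \<in> KK" unfolding 1 using 3 KK_intro by blast
 show "cj (x * y) = cj x * cj y" unfolding 1 cj_coords[OF 3] using * cj_coords 2 by simp
qed

lemma KK_uminus [simp]: assumes "x \<in> KK" shows "- x \<in> KK" and cj_uminus [simp]: "cj (- x) = - cj x"
 using KK_mult[of "-1" x] cj_mult[of "-1" x] assms Rats_in_KK[of "-1"] cj_Rats[of "-1"] by auto

lemma KK_diff [simp]: assumes "x \<in> KK" "y \<in> KK" shows "x - y \<in> KK" and cj_diff [simp]: "cj (x - y) = cj x - cj y"
 using KK_add[of x "- y"] cj_add[of x "- y"] assms by auto

lemma KK_inverse [simp]: assumes "x \<in> KK" shows "inverse x \<in> KK"
 and cj_inverse [simp]: "cj (inverse x) = inverse (cj x)"
proof -
 obtain a b where *: "a \<in> \<rat>" "b \<in> \<rat>" "x = a + b * s" using assms by (rule KK_cases)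
 have both: "inverse x \<in> KK & cj (inverse x) = inverse (cj x)"
 proof (cases "x = 0")
  case False
  then have ne: "a ~= 0 \<or> b ~= 0" using * by auto
  define n where "n = a * a - b * b * D"
  have n: "(a + b * s) * (a - b * s) = n" unfolding n_def using s_sq by (simp add: algebra_simps)
  have "a + (- b) * s ~= 0" using rat_coords_zero[of a "- b"] *(1,2) ne by (metis Rats_minus_iff neg_equal_0_iff_equal)
  then have "a - b * s ~= 0" by simp
  then have n0: "n ~= 0" using n * False by auto
  have nQ: "n \<in> \<rat>" unfolding n_def using * by auto
  have i1: "inverse x = a / n + (- b / n) * s"
   using n n0 * False by (simp add: field_simps)
  have i2: "inverse (a - b * s) = a / n - (- b / n) * s"
   using n n0 \<open>a - b * s ~= 0\<close> by (simp add: field_simps)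
  have q: "a / n \<in> \<rat>" "- b / n \<in> \<rat>" using * nQ by auto
  then show ?thesis
   unfolding i1 using KK_intro[OF q] cj_coords[OF q] cj_coords[OF *(1,2)] i2 * by simp
 qed auto
 then show "inverse x \<in> KK" "cj (inverse x) = inverse (cj x)" by auto
qed

lemma KK_divide [simp]: assumes "x \<in> KK" "y \<in> KK" shows "x / y \<in> KK" and cj_divide [simp]: "cj (x / y) = cj x / cj y"
 using assms by (auto simp: divide_inverse)

lemma KK_cj [simp]: assumes "x \<in> KK" shows "cj x \<in> KK" and cj_cj [simp]: "cj (cj x) = x"
proof -
 obtain a b where *: "a \<in> \<rat>" "b \<in> \<rat>" "x = a + b * s" using assms by (rule KK_cases)
 have "cj x = a + (- b) * s" using * cj_coords by simp
 then show "cj x \<in> KK" "cj (cj x) = x" using * KK_intro[of a "- b"] cj_coords[of a "- b"] by auto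
qed

lemma cj_eq_0 [simp]: assumes "x \<in> KK" shows "cj x = 0 \<longleftrightarrow> x = 0"
 using assms by (metis cj_cj cj_int(4))

lemma om_KK [simp]: "om \<in> KK" and cj_om: "cj om = real D - om"
 unfolding om_def by (auto simp: field_simps)

lemma om_sq: "om * om = real D * om - of_int nom"
 unfolding om_def nom_real using s_sq by (simp add: field_simps)

lemma om_cj: "om * cj om = of_int nom"
 unfolding cj_om by (simp add: algebra_simps om_sq)

lemma om_diff: "om - cj om = s"
 unfolding cj_om om_def by (simp add: field_simps)

lemma Od_eq: "Od = {of_int m + of_int n * om | m n. True}"
 unfolding quad_order_def om_def by simp

lemma Od_cases: assumes "x \<in> Od" obtains m n where "x = of_int m + of_int n * om"
 using assms unfolding Od_eq by auto
lemma Od_intro: "of_int m + of_int n * om \<in> Od"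
 unfolding Od_eq by auto

lemma om_coords_zero:
 assumes "of_int m + of_int n * om = 0" shows "m = 0 & n = 0"
proof -
 have "(of_int m + of_int n * D / 2) + (of_int n / 2) * s = 0"
  using assms unfolding om_def by (simp add: field_simps)
 then have "of_int m + of_int n * real D / 2 = 0" "real_of_int n / 2 = 0"
  using rat_coords_zero[of "of_int m + of_int n * real D / 2" "of_int n / 2"] by auto
 then show ?thesis by auto
qed

lemma om_coords_unique:
 assumes "of_int m + of_int n * om = of_int m' + of_int n' * om" shows "m = m' & n = n'"
 using om_coords_zero[of "m - m'" "n - n'"] assms by (simp add: algebra_simps)

lemma Od_KK [simp]: "x \<in> Od ==> x \<in> KK"
 by (auto elim!: Od_cases)

lemma Od_int [simp]: "of_int m \<in> Od" "of_nat n \<in> Od" "numeral k \<in> Od" "0 \<in> Od" "1 \<in> Od"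
 using Od_intro[of m 0] Od_intro[of "int n" 0] Od_intro[of "numeral k" 0] Od_intro[of 0 0] Od_intro[of 1 0] by auto

lemma Od_om [simp]: "om \<in> Od"
 using Od_intro[of 0 1] by simp

lemma Od_add [simp]: "x \<in> Od ==> y \<in> Od ==> x + y \<in> Od"
proof (elim Od_cases)
 fix m n m' n' assume "x = of_int m + of_int n * om" "y = of_int m' + of_int n' * om"
 then show "x + y \<in> Od" using Od_intro[of "m + m'" "n + n'"] by (simp add: algebra_simps)
qed

lemma om_mult:
 "(of_int m + of_int n * om) * (of_int m' + of_int n' * om) =
  of_int (m * m' - n * n' * nom) + of_int (m * n' + n * m' + n * n' * int D) * om"
proof -
 have "(of_int m + of_int n * om) * (of_int m' + of_int n' * om) =
  of_int m * of_int m' + (of_int m * of_int n' + of_int n * of_int m') * om + of_int n * of_int n' * (om * om)"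
  by (simp add: algebra_simps)
 then show ?thesis unfolding om_sq by (simp add: algebra_simps)
qed

lemma Od_mult [simp]: "x \<in> Od ==> y \<in> Od ==> x * y \<in> Od"
 by (elim Od_cases) (simp only: om_mult Od_intro)

lemma Od_uminus [simp]: "x \<in> Od ==> - x \<in> Od"
 using Od_mult[of "of_int (-1)" x, OF Od_int(1)] by simp

lemma Od_diff [simp]: "x \<in> Od ==> y \<in> Od ==> x - y \<in> Od"
 using Od_add[of x "- y"] by simp

lemma Od_cj [simp]: "x \<in> Od ==> cj x \<in> Od"
 by (elim Od_cases) (simp add: cj_om)

lemma Od_s [simp]: "s \<in> Od"
proof -
 have "s = 2 * om - real D" unfolding om_def by (simp add: field_simps)
 then show ?thesis by simp
qed

lemma is_zbasis_Od: "is_zbasis [1, om] Od"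
 unfolding is_zbasis2_iff Od_eq using om_coords_zero by auto

end

section \<open>The maximal order and the conductor\<close>

text \<open>
  By Gauss's lemma the primitive integral quadratic polynomial of \<open>x\<close> divides a monic integral one, so
  its leading coefficient is a unit.
\<close>

lemma algebraic_int_quadratic:
 fixes x :: real and c0 c1 c2 :: int
 assumes "algebraic_int x" "x \<notin> \<rat>" "c2 ~= 0" "of_int c0 + of_int c1 * x + of_int c2 * x * x = 0"
 shows "\<exists>B C :: int. x * x + of_int B * x + of_int C = 0"
proof -
 obtain p :: "int poly" where p: "poly (map_poly of_int p) x = 0" "lead_coeff p = 1"
  using assms(1) algebraic_int_altdef_ipoly by blast
 have map_mult: "map_poly of_int (f * g) = (map_poly of_int f * map_poly of_int g :: real poly)" for f g
  by (rule poly_eqI) (simp add: coeff_map_poly coeff_mult)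
 have map_add: "map_poly of_int (f + g) = (map_poly of_int f + map_poly of_int g :: real poly)" for f g
  by (rule poly_eqI) (simp add: coeff_map_poly)
 have map_smult: "map_poly of_int (smult k g) = (smult (of_int k) (map_poly of_int g) :: real poly)" for k g
  by (rule poly_eqI) (simp add: coeff_map_poly)
 define m0 where "m0 = [:c0, c1, c2:]"
 define m where "m = primitive_part m0"
 have m0: "m0 ~= 0" "degree m0 = 2" unfolding m0_def using assms(3) by auto
 have cont: "smult (content m0) m = m0" unfolding m_def by simp
 have c_ne: "content m0 ~= 0" using m0 by simp
 have m: "m ~= 0" "degree m = 2" "content m = 1"
  using m0 unfolding m_def by auto
 have "poly (map_poly of_int m0) x = 0"
  unfolding m0_def using assms(3,4) by (simp add: map_poly_pCons algebra_simps)
 then have "poly (map_poly of_int (smult (content m0) m)) x = 0" by (simp only: cont)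
 then have "of_int (content m0) * poly (map_poly of_int m) x = 0"
  by (simp only: map_smult poly_smult)
 then have mx: "poly (map_poly of_int m) x = 0" using c_ne by simp
 obtain q r where qr: "pseudo_divmod p m = (q, r)" by (cases "pseudo_divmod p m") auto
 define c where "c = lead_coeff m ^ (Suc (degree p) - degree m)"
 have div: "smult c p = m * q + r" unfolding c_def using pseudo_divmod(1)[OF m(1) qr] .
 have rdeg: "r = 0 \<or> degree r < 2" using pseudo_divmod(2)[OF m(1) qr] m by simp
 have "poly (map_poly of_int (smult c p)) x = poly (map_poly of_int (m * q + r)) x" using div by simp
 then have rx: "poly (map_poly of_int r) x = 0"
  using mx p by (simp add: map_mult map_add map_smult)
 have "r = [:coeff r 0, coeff r 1:]"
  using rdeg by (intro poly_eqI) (auto simp: coeff_pCons coeff_eq_0 split: nat.splits)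
 then obtain r0 r1 where r: "r = [:r0, r1:]" by blast
 have "poly (map_poly of_int [:r0, r1:]) x = of_int r0 + of_int r1 * x"
  by (cases "r1 = 0"; cases "r0 = 0") (simp_all add: map_poly_pCons)
 then have lin: "of_int r0 + of_int r1 * x = 0" using rx r by simp
 have "r1 = 0"
 proof (rule ccontr)
  assume "r1 ~= 0"
  then have "x = - of_int r0 / of_int r1" using lin by (simp add: field_simps)
  then show False using assms(2) by simp
 qed
 then have "r = 0" using lin r by simp
 then have div: "smult c p = m * q" using div by simp
 have cm0: "c ~= 0" unfolding c_def using m(1) leading_coeff_0_iff[of m] power_not_zero by blast
 have contp: "content p = 1"
  using content_dvd_coeff[of p "degree p"] unfolding p(2) is_unit_content_iff .
 have "normalize c * content p = content m * content q"
  using div content_smult[of c p] content_mult[of m q] by simp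
 then have "content q = normalize c" using contp m by simp
 then have "c dvd lead_coeff q" using content_dvd_coeff[of q "degree q"] by simp
 then obtain k where k: "lead_coeff q = c * k" by blast
 have "c * lead_coeff p = lead_coeff m * lead_coeff q"
  using arg_cong[OF div, of lead_coeff] by (simp add: lead_coeff_mult cm0)
 then have "lead_coeff m * k = 1" using p(2) k cm0 by simp
 then have lc: "coeff m 2 = 1 \<or> coeff m 2 = -1" using m(2) zmult_eq_1_iff by metis
 have "m = [:coeff m 0, coeff m 1, coeff m 2:]"
  using m(2) by (intro poly_eqI) (auto simp: coeff_pCons coeff_eq_0 numeral_2_eq_2 split: nat.splits)
 then obtain A B C where ABC: "m = [:C, B, A:]" "A = 1 \<or> A = -1" using lc by blast
 have "poly (map_poly of_int [:C, B, A:]) x = of_int C + x * (of_int B + x * of_int A)"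
  using ABC(2) by (auto simp add: map_poly_pCons)
 then have e: "of_int C + x * (of_int B + x * of_int A) = 0" using mx ABC by simp
 show ?thesis
 proof (cases "A = 1")
  case True
  then show ?thesis using e by (intro exI[of _ B] exI[of _ C]) (simp add: algebra_simps)
 next
  case False
  then have "A = -1" using ABC by simp
  then show ?thesis using e by (intro exI[of _ "-B"] exI[of _ "-C"]) (simp add: algebra_simps)
 qed
qed

text \<open>
  No square factor can be divided out without leaving the set of discriminants; equivalently, the
  order of discriminant \<open>D\<close> is integrally closed.
\<close>

definition fundamental :: "nat => bool" where
 "fundamental D \<longleftrightarrow> (\<forall>g \<Delta>. g > 1 & D = g\<^sup>2 * \<Delta> --> \<Delta> mod 4 ~= 0 & \<Delta> mod 4 ~= 1)"

context real_quadratic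
begin

lemma algebraic_int_trace_norm:
 assumes x: "x \<in> KK" "algebraic_int x"
 shows "x + cj x \<in> \<int>" and "x * cj x \<in> \<int>"
proof -
 obtain a b where ab: "a \<in> \<rat>" "b \<in> \<rat>" "x = a + b * s" using x by (elim KK_cases)
 have cjx: "cj x = a - b * s" using cj_coords ab by simp
 have both: "x + cj x \<in> \<int> & x * cj x \<in> \<int>"
 proof (cases "b = 0")
  case True
  then have "x \<in> \<int>" using ab x(2) rational_algebraic_int_is_int by simp
  then show ?thesis using True ab cjx by simp
 next
  case False
  have xirr: "x \<notin> \<rat>"
  proof
   assume "x \<in> \<rat>"
   then have "(x - a) / b \<in> \<rat>" using ab(1,2) by (intro Rats_divide Rats_diff)
   moreover have "(x - a) / b = s" using ab(3) False by simp
   ultimately show False using s_irrational by simp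
  qed
  define t n where "t = 2 * a" and "n = a * a - b * b * D"
  have tn: "t \<in> \<rat>" "n \<in> \<rat>" unfolding t_def n_def using ab by auto
  have tr: "x + cj x = t" and nr: "x * cj x = n"
   unfolding t_def n_def cjx unfolding ab(3) using s_sq by (simp_all add: algebra_simps)
  obtain t1 t2 where t12: "t2 > 0" "t = of_int t1 / of_int t2" using tn(1) by (elim Rats_cases') auto
  obtain n1 n2 where n12: "n2 > 0" "n = of_int n1 / of_int n2" using tn(2) by (elim Rats_cases') auto
  have root: "x * x - t * x + n = 0" unfolding tr[symmetric] nr[symmetric] by (simp add: algebra_simps)
  have "of_int (n1 * t2) + of_int (- (t1 * n2)) * x + of_int (t2 * n2) * x * x =
   of_int (t2 * n2) * (x * x - t * x + n)"
  proof -
   have "real_of_int t1 = t * of_int t2" "real_of_int n1 = n * of_int n2" using t12 n12 by simp_all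
   then show ?thesis by (simp add: algebra_simps)
  qed
  then have "of_int (n1 * t2) + of_int (- (t1 * n2)) * x + of_int (t2 * n2) * x * x = 0"
   using root by simp
  moreover have "t2 * n2 ~= 0" using t12 n12 by simp
  ultimately obtain B C :: int where BC: "x * x + of_int B * x + of_int C = 0"
   using algebraic_int_quadratic[OF x(2) xirr] by blast
  have "(of_int B + t) * x + (of_int C - n) = 0" using BC root by (simp add: algebra_simps)
  then have "((of_int B + t) * a + (of_int C - n)) + ((of_int B + t) * b) * s = 0"
   using ab by (simp add: algebra_simps)
  moreover have "(of_int B + t) * a + (of_int C - n) \<in> \<rat>" "(of_int B + t) * b \<in> \<rat>"
   using tn ab by auto
  ultimately have "(of_int B + t) * b = 0 & (of_int B + t) * a + (of_int C - n) = 0"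
   using rat_coords_zero by blast
  then have "t = of_int (- B)" "n = of_int C" using False by auto
  then show ?thesis unfolding tr nr by simp
 qed
 then show "x + cj x \<in> \<int>" "x * cj x \<in> \<int>" by auto
qed

lemma algebraic_int_Od:
 assumes "x \<in> Od" shows "algebraic_int x"
proof -
 have "x + cj x \<in> \<int>" "x * cj x \<in> \<int>"
 proof -
  obtain m n where x: "x = of_int m + of_int n * om" using assms by (elim Od_cases)
  have c: "cj x = of_int m + of_int n * (real D - om)" unfolding x by (simp add: cj_om)
  have "x + cj x = of_int (2 * m + n * int D)" using c x by (simp add: algebra_simps)
  then show "x + cj x \<in> \<int>" by (metis Ints_of_int)
  have "x * cj x = of_int (m * m + m * n * int D) + of_int (n * n) * (om * cj om)"
   unfolding c unfolding cj_om x by (simp add: algebra_simps)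
  then have "x * cj x = of_int (m * m + m * n * int D + n * n * nom)"
   unfolding om_cj by simp
  then show "x * cj x \<in> \<int>" by (metis Ints_of_int)
 qed
 then have "x * cj x \<in> \<int>" "- (x + cj x) \<in> \<int>" by (auto simp only: minus_in_Ints_iff)
 then have "ALL i. coeff [: x * cj x, - (x + cj x), 1 :] i \<in> \<int>"
  unfolding coeff_pCons by (auto simp del: minus_add_distrib split: nat.splits)
 moreover have "poly [: x * cj x, - (x + cj x), 1 :] x = 0" by (simp add: algebra_simps)
 moreover have "lead_coeff [: x * cj x, - (x + cj x), 1 :] = 1" by simp
 ultimately show ?thesis
  by (metis algebraic_int.intros)
qed

lemma integral_in_Od_of_fundamental:
 assumes fund: "fundamental D"
  and x: "x \<in> KK" "x + cj x \<in> \<int>" "x * cj x \<in> \<int>"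
 shows "x \<in> Od"
proof -
 obtain a b where ab: "a \<in> \<rat>" "b \<in> \<rat>" "x = a + b * s" using x by (elim KK_cases)
 have cjx: "cj x = a - b * s" using cj_coords ab by simp
 obtain t where t: "2 * a = of_int t" using x(2) ab cjx by (auto elim: Ints_cases)
 have "x * cj x = a * a - b * b * D" unfolding cjx unfolding ab(3) using s_sq by (simp add: algebra_simps)
 then obtain n where n: "a * a - b * b * D = of_int n" using x(3) by (auto elim: Ints_cases)
 obtain r q where rq: "q > 0" "coprime r q" "2 * b = of_int r / of_int q"
  using ab(2) by (metis Rats_cases' Rats_mult Rats_number_of)
 have "(2 * b) * (2 * b) * D = (2 * a) * (2 * a) - 4 * of_int n" using n by (simp add: algebra_simps)
 then have "of_int r / of_int q * (of_int r / of_int q) * D = real_of_int (t * t - 4 * n)"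
  unfolding t rq by simp
 then have "real_of_int (r * r * int D) = real_of_int (q * q * (t * t - 4 * n))"
  using rq(1) by (simp add: field_simps)
 then have main: "r * r * int D = q * q * (t * t - 4 * n)" by linarith
 have "coprime (q * q) (r * r)" using rq(2) by (simp add: coprime_commute)
 moreover have "q * q dvd int D * (r * r)" using main by (simp add: mult.commute)
 ultimately have "q * q dvd int D" using coprime_dvd_mult_left_iff by blast
 then obtain e where e: "int D = q * q * e" by blast
 have epos: "e > 0" using D_pos e rq(1) by (metis of_nat_0_less_iff zero_less_mult_pos mult_pos_pos)
 have "q * q * (r * r * e) = q * q * (t * t - 4 * n)" using main e by (simp add: algebra_simps)
 then have rt: "r * r * e = t * t - 4 * n" using rq(1) by simp
 have q1: "q = 1"
 proof (rule ccontr)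
  assume "q ~= 1"
  then have "nat q > 1" using rq(1) by simp
  moreover have "D = (nat q)^2 * nat e"
  proof -
   have "int D = int ((nat q)^2 * nat e)" using e rq(1) epos by (simp add: power2_eq_square)
   then show ?thesis by (simp only: of_nat_eq_iff)
  qed
  ultimately have "nat e mod 4 ~= 0 & nat e mod 4 ~= 1" using fund unfolding fundamental_def by blast
  moreover have "int (nat e mod 4) = e mod 4" using epos by (simp add: zmod_int)
  ultimately have "e mod 4 ~= 0" "e mod 4 ~= 1" by auto
  then have e4: "e mod 4 = 2 \<or> e mod 4 = 3" by presburger
  have D4: "int D mod 4 = 0 \<or> int D mod 4 = 1"
   using disc unfolding nonsquare_discriminant_def by (auto, presburger+)
  have sq: "EX k. y * y = 4 * k & even y \<or> y * y = 4 * k + 1 & odd y" for y :: int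
  proof (cases "even y")
   case True
   then obtain k where "y = 2 * k" by (auto elim: evenE)
   then show ?thesis by (intro exI[of _ "k * k"]) simp
  next
   case False
   then obtain k where "y = 2 * k + 1" by (auto elim: oddE)
   then show ?thesis by (intro exI[of _ "k * k + k"]) (simp add: algebra_simps)
  qed
  have "even r"
  proof (rule ccontr)
   assume "odd r"
   then obtain k where k: "r * r = 4 * k + 1" using sq[of r] by blast
   obtain l where l: "t * t = 4 * l \<or> t * t = 4 * l + 1" using sq[of t] by blast
   define w where "w = k * e"
   have "4 * w + e = t * t - 4 * n" using rt k unfolding w_def by (simp add: algebra_simps)
   then have "4 * w + e = 4 * l - 4 * n \<or> 4 * w + e = 4 * l + 1 - 4 * n" using l by auto
   then show False using e4 by presburger
  qed
  then have "odd q" using rq(2) by (auto simp: coprime_def)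
  then obtain k where k: "q * q = 4 * k + 1" using sq[of q] by blast
  define w where "w = k * e"
  have "int D = 4 * w + e" using e k unfolding w_def by (simp add: algebra_simps)
  then have "int D mod 4 = e mod 4" by presburger
  then show False using e4 D4 by auto
 qed
 then have b: "b = of_int r / 2" using rq(3) by simp
 have "even (t - r * int D)"
 proof -
  have "r * r * int D = t * t - 4 * n" using main q1 by simp
  then have "even (r * r * int D) = even (t * t)" by simp
  then show ?thesis by auto
 qed
 then obtain k where k: "t - r * int D = 2 * k" unfolding dvd_def by blast
 have "real_of_int (t - r * int D) = real_of_int (2 * k)" using k by simp
 then have tk: "real_of_int t = of_int r * D + 2 * of_int k" by simp
 have "x = of_int k + of_int r * om"
  using ab(3) t tk unfolding b om_def by (simp add: field_simps)
 then show ?thesis using Od_intro by simp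
qed

text \<open>
  Two bases differ by an integral matrix with integral inverse, and such a matrix has determinant 1 or -1.
\<close>

lemma zbasis_det:
 assumes "is_zbasis [w1, w2] Od"
 shows "w1 * cj w2 - cj w1 * w2 = s \<or> w1 * cj w2 - cj w1 * w2 = - s"
proof -
 have Od: "Od = {of_int m * w1 + of_int n * w2 | m n. True}" using assms is_zbasis2_iff by auto
 have w: "w1 \<in> Od" "w2 \<in> Od" unfolding Od
  by (rule CollectI, rule exI[of _ 1], rule exI[of _ 0], simp) (rule CollectI, rule exI[of _ 0], rule exI[of _ 1], simp)
 obtain a b where 1: "w1 = of_int a + of_int b * om" using w by (elim Od_cases)
 obtain c e where 2: "w2 = of_int c + of_int e * om" using w by (elim Od_cases)
 obtain a' b' where 3: "1 = of_int a' * w1 + of_int b' * w2" using Od_int(5) unfolding Od by blast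
 obtain c' e' where 4: "om = of_int c' * w1 + of_int e' * w2" using Od_om unfolding Od by blast
 define del where "del = w1 * cj w2 - cj w1 * w2"
 have del: "del = - of_int (a * e - b * c) * s"
  unfolding del_def 1 2 om_diff[symmetric] by (simp add: cj_om algebra_simps)
 have "cj (of_int a' * w1 + of_int b' * w2) = of_int a' * cj w1 + of_int b' * cj w2"
  "cj (of_int c' * w1 + of_int e' * w2) = of_int c' * cj w1 + of_int e' * cj w2"
  using w by auto
 then have 5: "1 = of_int a' * cj w1 + of_int b' * cj w2" "cj om = of_int c' * cj w1 + of_int e' * cj w2"
  using 3 4 by (metis cj_int(5), metis)
 have "1 * cj om - 1 * om = (of_int a' * w1 + of_int b' * w2) * (of_int c' * cj w1 + of_int e' * cj w2)
   - (of_int a' * cj w1 + of_int b' * cj w2) * (of_int c' * w1 + of_int e' * w2)"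
  using 3 4 5 by metis
 also have "\<dots> = of_int (a' * e' - b' * c') * del"
  unfolding del_def by (simp add: algebra_simps)
 finally have "- s = of_int (a' * e' - b' * c') * del" using om_diff by simp
 then have "s = of_int (a' * e' - b' * c') * (- del)" by simp
 also have "\<dots> = of_int ((a' * e' - b' * c') * (a * e - b * c)) * s" unfolding del of_int_mult by (simp add: algebra_simps)
 finally have "s = of_int ((a' * e' - b' * c') * (a * e - b * c)) * s" .
 then have "real_of_int ((a' * e' - b' * c') * (a * e - b * c)) = 1" using s_ne by (metis mult_cancel_right1)
 then have "(a' * e' - b' * c') * (a * e - b * c) = 1" by linarith
 then have "a * e - b * c = 1 \<or> a * e - b * c = -1" using zmult_eq_1_iff by metis
 then have "del = - of_int 1 * s \<or> del = - of_int (-1) * s" unfolding del by metis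
 then show ?thesis unfolding del_def by auto
qed

text \<open>
  The conductor and the field discriminant are described by uniqueness. Dividing \<open>D\<close> by the largest
  square for which the quotient is still a discriminant gives the order of all algebraic integers of \<open>K\<close>;
  uniqueness holds because the discriminant of a basis does not depend on the basis.
\<close>

theorem conductor_structure:
 obtains \<Delta> where "real_quadratic \<Delta>" "D = (conductor D)\<^sup>2 * \<Delta>" "conductor D > 0"
  "fundamental \<Delta>"
  "maximal_order D = quad_order \<Delta>" "quad_field D = quad_field \<Delta>"
  "!!x. x \<in> KK ==> galois_conj \<Delta> x = cj x"
proof -
 define F where "F = {f. f > 0 & (\<exists>\<Delta>. D = f^2 * \<Delta> & \<Delta> mod 4 \<in> {0, 1 :: nat})}"
 have "f \<le> D" if "f \<in> F" for f
  using that D_pos unfolding F_def power2_eq_square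
  by (auto intro!: dvd_imp_le)
 then have "finite F" using finite_nat_set_iff_bounded_le by blast
 have "1 \<in> F" unfolding F_def using disc nonsquare_discriminant_def by auto
 define f where "f = Max F"
 have "f \<in> F" using \<open>finite F\<close> \<open>1 \<in> F\<close> Max_in unfolding f_def by blast
 then have "f > 0 & (\<exists>\<Delta>. D = f^2 * \<Delta> & \<Delta> mod 4 \<in> {0, 1})" unfolding F_def mem_Collect_eq .
 then obtain \<Delta> where \<Delta>: "f > 0" "D = f^2 * \<Delta>" "\<Delta> mod 4 \<in> {0, 1}" by (elim conjE exE)
 have nsq: "~ (EX k. \<Delta> = k^2)"
  using \<Delta>(2) disc unfolding nonsquare_discriminant_def by (metis power_mult_distrib)
 interpret E: real_quadratic \<Delta>
  by unfold_locales (use \<Delta> nsq nonsquare_discriminant_def in auto)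
 have fund: "fundamental \<Delta>"
  unfolding fundamental_def
 proof (intro allI impI, rule ccontr)
  fix g \<Delta>' assume that: "g > 1 & \<Delta> = g^2 * \<Delta>'" and "~ (\<Delta>' mod 4 ~= 0 & \<Delta>' mod 4 ~= 1)"
  then have "f * g \<in> F" unfolding F_def using that \<Delta>
   by (auto simp: power_mult_distrib intro!: exI[of _ \<Delta>'])
  then have "f * g \<le> f" unfolding f_def using \<open>finite F\<close> by simp
  then show False using that \<Delta>(1) by simp
 qed
 have sf: "s = real f * E.s" unfolding \<Delta>(2) by (simp add: real_sqrt_mult)
 have KKeq: "KK = E.KK"
 proof (intro equalityI subsetI)
  fix x assume "x \<in> KK"
  then obtain a b where "a \<in> \<rat>" "b \<in> \<rat>" "x = a + b * s" by (elim KK_cases)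
  then show "x \<in> E.KK" using E.KK_intro[of a "b * real f"] sf by (simp add: mult.assoc)
 next
  fix x assume "x \<in> E.KK"
  then obtain a b where "a \<in> \<rat>" "b \<in> \<rat>" "x = a + b * E.s" by (elim E.KK_cases)
  then show "x \<in> KK" using KK_intro[of a "b / real f"] sf \<Delta>(1) by simp
 qed
 have cjeq: "E.cj x = cj x" if xK: "x \<in> KK" for x
 proof -
  obtain a b where ab: "a \<in> \<rat>" "b \<in> \<rat>" "x = a + b * s" using xK by (elim KK_cases)
  then have "cj x = a - b * s" using cj_coords by simp
  moreover have "E.cj x = a - (b * real f) * E.s"
   using E.cj_coords[of a "b * real f"] ab sf by (simp add: mult.assoc)
  ultimately show ?thesis using sf by (simp add: mult.assoc)
 qed
 have max: "maximal_order D = E.Od"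
 proof (intro equalityI subsetI)
  fix x assume "x \<in> maximal_order D"
  then have "x \<in> E.KK" "algebraic_int x" unfolding maximal_order_def using KKeq by auto
  then show "x \<in> E.Od"
   using E.integral_in_Od_of_fundamental[OF fund] E.algebraic_int_trace_norm by blast
 next
  fix x assume "x \<in> E.Od"
  then show "x \<in> maximal_order D" unfolding maximal_order_def using KKeq E.algebraic_int_Od by simp
 qed
 have fd: "field_discriminant D = int \<Delta>"
  unfolding field_discriminant_def
 proof (rule the_equality)
  have "of_int (int \<Delta>) = (1 * cj E.om - cj 1 * E.om)\<^sup>2"
   using E.om_diff cjeq[of E.om] KKeq by (simp add: power2_commute)
  then show "EX w1 w2. is_zbasis [w1, w2] (maximal_order D) & of_int (int \<Delta>) = (w1 * cj w2 - cj w1 * w2)\<^sup>2"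
   unfolding max using E.is_zbasis_Od by blast
 next
  fix \<delta> assume "EX w1 w2. is_zbasis [w1, w2] (maximal_order D) & of_int \<delta> = (w1 * cj w2 - cj w1 * w2)\<^sup>2"
  then obtain w1 w2 where w: "is_zbasis [w1, w2] E.Od" "of_int \<delta> = (w1 * cj w2 - cj w1 * w2)\<^sup>2"
   unfolding max by blast
  have "w1 \<in> E.Od" "w2 \<in> E.Od" using w(1) unfolding is_zbasis2_iff
   by (metis (mono_tags, lifting) mem_Collect_eq add.right_neutral mult_1 mult_zero_left of_int_0 of_int_1,
   metis (mono_tags, lifting) mem_Collect_eq add_0 mult_1 mult_zero_left of_int_0 of_int_1)
  then have "(w1 * cj w2 - cj w1 * w2) = E.s \<or> (w1 * cj w2 - cj w1 * w2) = - E.s"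
   using E.zbasis_det[OF w(1)] cjeq KKeq by auto
  then have "real_of_int \<delta> = real \<Delta>" using w(2) by auto
  then show "\<delta> = int \<Delta>" by linarith
 qed
 have cond: "conductor D = f"
  unfolding conductor_def fd
 proof (rule the_equality)
  show "f > 0 & int D = (int f)\<^sup>2 * int \<Delta>" using \<Delta> by simp
 next
  fix g :: nat assume g: "g > 0 & int D = (int g)\<^sup>2 * int \<Delta>"
  have "int D = (int f)\<^sup>2 * int \<Delta>" by (subst \<Delta>(2)) simp
  with g have "(int g)\<^sup>2 * int \<Delta> = (int f)\<^sup>2 * int \<Delta>" by argo
  moreover have "int \<Delta> ~= 0" using E.D_pos by simp
  ultimately have "(int g)\<^sup>2 = (int f)\<^sup>2" by (metis mult_right_cancel)
  then show "g = f" by simp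
 qed
 show thesis
  by (rule that[OF E.real_quadratic_axioms]) (use cond \<Delta> fund max KKeq cjeq in auto)
qed

lemma conductor_mult_integral:
 assumes "x \<in> KK" "x + cj x \<in> \<int>" "x * cj x \<in> \<int>"
 shows "real (conductor D) * x \<in> Od"
proof -
 obtain \<Delta> where \<Delta>: "real_quadratic \<Delta>" "D = (conductor D)\<^sup>2 * \<Delta>" "conductor D > 0"
  "fundamental \<Delta>"
  "quad_field D = quad_field \<Delta>"
  "!!x. x \<in> KK ==> galois_conj \<Delta> x = cj x"
  by (rule conductor_structure) blast
 interpret E: real_quadratic \<Delta> by (rule \<Delta>(1))
 define f where "f = conductor D"
 have f: "D = f * f * \<Delta>" using \<Delta>(2) unfolding f_def by (simp add: power2_eq_square)
 have sf: "s = real f * E.s" unfolding f by (simp add: real_sqrt_mult)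
 have "x \<in> E.Od" by (rule E.integral_in_Od_of_fundamental) (use \<Delta> assms in auto)
 then obtain m n where x: "x = of_int m + of_int n * E.om" by (elim E.Od_cases)
 have "even (int f * int f - int f)" by simp
 then obtain k where k: "int f * int f - int f = 2 * k" unfolding dvd_def by blast
 have k': "real f = real f * real f - 2 * of_int k"
  using arg_cong[OF k, of real_of_int] by (simp add: algebra_simps)
 have "real f * x = of_int (m * int f) + of_int n * (real f * E.om)" unfolding x by (simp add: algebra_simps)
 also have "real f * E.om = om - of_int (k * int \<Delta>)"
 proof -
  have "real f * E.om = (real f * real \<Delta> + s) / 2" unfolding E.om_def sf by (simp add: algebra_simps)
  also have "\<dots> = ((real f * real f - 2 * of_int k) * real \<Delta> + s) / 2" using k' by simp
  also have "\<dots> = om - of_int (k * int \<Delta>)" unfolding om_def using f by (simp add: field_simps)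
  finally show ?thesis .
 qed
 finally have "real f * x = of_int (m * int f) + of_int n * (om - of_int (k * int \<Delta>))" .
 then have "real f * x \<in> Od" by (simp del: of_int_mult)
 then show ?thesis unfolding f_def .
qed

end

section \<open>Splitting of primes\<close>

lemma real_ring_simps [simp]:
 "carrier (real_ring R) = R" "x \<otimes>\<^bsub>real_ring R\<^esub> y = x * y" "x \<oplus>\<^bsub>real_ring R\<^esub> y = x + y"
 "\<one>\<^bsub>real_ring R\<^esub> = 1" "\<zero>\<^bsub>real_ring R\<^esub> = 0"
 by (simp_all add: real_ring_def)

lemma prime_gcd_combination:
 fixes p u :: int assumes "prime p" "~ p dvd u" shows "EX k l. k * p + l * u = 1"
proof -
 have "coprime p u" using assms prime_imp_coprime by blast
 then show ?thesis using bezout_int[of p u] by (metis coprime_imp_gcd_eq_1)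
qed

context real_quadratic
begin

abbreviation RR :: "real ring" where "RR \<equiv> real_ring Od"

lemma cring_RR: "cring RR"
proof (rule cringI)
 show "abelian_group RR"
 proof (rule abelian_groupI)
  fix x assume "x \<in> carrier RR"
  then show "\<exists>y\<in>carrier RR. y \<oplus>\<^bsub>RR\<^esub> x = \<zero>\<^bsub>RR\<^esub>" by (intro bexI[of _ "-x"]) auto
 qed auto
 show "comm_monoid RR" by (rule comm_monoidI) (auto simp: algebra_simps)
qed (auto simp: algebra_simps)

interpretation RR: cring RR by (rule cring_RR)

lemma RR_a_inv: "x \<in> Od ==> \<ominus>\<^bsub>RR\<^esub> x = - x"
 by (rule RR.minus_equality) auto

lemma RR_idealI:
 assumes "I \<subseteq> Od" "0 \<in> I" "!!x y. x \<in> I ==> y \<in> I ==> x + y \<in> I"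
  "!!x y. x \<in> I ==> y \<in> Od ==> y * x \<in> I"
 shows "ideal I RR"
proof (rule idealI[OF RR.ring_axioms])
 show "subgroup I (add_monoid RR)"
 proof (rule subgroup.intro)
  fix x assume x: "x \<in> I"
  then have "inv\<^bsub>add_monoid RR\<^esub> x = - x" using assms(1) RR_a_inv by (auto simp: a_inv_def)
  then show "inv\<^bsub>add_monoid RR\<^esub> x \<in> I" using assms(4)[OF x, of "-1"] by simp
 qed (use assms in auto)
qed (use assms in \<open>auto simp: mult.commute\<close>)

lemma RR_ideal_closed:
 assumes "ideal I RR"
 shows "I \<subseteq> Od" "0 \<in> I" "x \<in> I ==> y \<in> I ==> x + y \<in> I" "x \<in> I ==> y \<in> I ==> x - y \<in> I"
  "x \<in> I ==> y \<in> Od ==> y * x \<in> I" "x \<in> I ==> y \<in> Od ==> x * y \<in> I"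
proof -
 interpret I: ideal I RR by fact
 show *: "I \<subseteq> Od" "0 \<in> I" "x \<in> I ==> y \<in> I ==> x + y \<in> I" "x \<in> I ==> y \<in> Od ==> y * x \<in> I"
  "x \<in> I ==> y \<in> Od ==> x * y \<in> I" for x y
  using I.a_subset I.additive_subgroup_axioms additive_subgroup.zero_closed[of I RR]
   additive_subgroup.a_closed[of I RR x y] I.I_l_closed[of x y] I.I_r_closed[of x y] by auto
 show "x \<in> I ==> y \<in> I ==> x - y \<in> I"
  using *(3)[of x "-y"] *(4)[of y "-1"] by simp
qed

text \<open>
  The ideal generated by \<open>d\<close> and \<open>om - a\<close>, when \<open>a\<close> is a root of the minimal polynomial modulo \<open>d\<close>.
\<close>

definition root_ideal :: "nat => int => real set" where
 "root_ideal d a = {of_int m + of_int n * om | m n. int d dvd m + n * a}"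

lemma root_ideal_iff: "of_int m + of_int n * om \<in> root_ideal d a \<longleftrightarrow> int d dvd m + n * a"
 unfolding root_ideal_def using om_coords_unique by blast

lemma root_ideal_int: "of_int m \<in> root_ideal d a \<longleftrightarrow> int d dvd m"
 using root_ideal_iff[of m 0 d a] by simp

lemma root_ideal_om: "om - of_int b \<in> root_ideal d a \<longleftrightarrow> int d dvd a - b"
 using root_ideal_iff[of "-b" 1 d a] by (simp add: algebra_simps)

lemma ideal_root_ideal:
 assumes "int d dvd minpol a" shows "ideal (root_ideal d a) RR"
proof (rule RR_idealI)
 show "root_ideal d a \<subseteq> Od" unfolding root_ideal_def Od_eq by blast
 show "0 \<in> root_ideal d a" using root_ideal_int[of 0] by simp
 fix x y
 { assume "x \<in> root_ideal d a" "y \<in> root_ideal d a"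
  then obtain m n m' n' where x: "x = of_int m + of_int n * om" "int d dvd m + n * a"
   and y: "y = of_int m' + of_int n' * om" "int d dvd m' + n' * a" unfolding root_ideal_def by blast
  have "x + y = of_int (m + m') + of_int (n + n') * om" unfolding x y by (simp add: algebra_simps)
  moreover have "int d dvd (m + m') + (n + n') * a"
   using dvd_add[OF x(2) y(2)] by (simp add: algebra_simps)
  ultimately show "x + y \<in> root_ideal d a" using root_ideal_iff by metis }
 { assume "x \<in> root_ideal d a" "y \<in> Od"
  then obtain m n m' n' where x: "x = of_int m + of_int n * om" "int d dvd m + n * a"
   and y: "y = of_int m' + of_int n' * om" unfolding root_ideal_def Od_eq by blast
  have "(m' * m - n' * n * nom) + (m' * n + n' * m + n' * n * int D) * a =
   (m' + n' * a) * (m + n * a) - n' * n * minpol a" unfolding minpol_def by (simp add: algebra_simps)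
  then have "int d dvd (m' * m - n' * n * nom) + (m' * n + n' * m + n' * n * int D) * a"
   using x(2) assms by simp
  then show "y * x \<in> root_ideal d a" unfolding x(1) y om_mult root_ideal_iff . }
qed

lemma minpol_factor: "(om - of_int a) * (cj om - of_int a) = of_int (minpol a)"
 using om_cj unfolding cj_om minpol_def by (simp add: algebra_simps)

lemma minpol_diff: "minpol a - minpol b = (a - b) * (a + b - int D)"
 unfolding minpol_def by (simp add: algebra_simps)

text \<open>
  Completing the square: a double root modulo \<open>p\<close> occurs exactly for \<open>p\<close> dividing \<open>D\<close>.
\<close>

lemma minpol_square: "(2 * a - int D) * (2 * a - int D) = 4 * minpol a + int D"
 unfolding minpol_def using nom by (simp add: algebra_simps)

lemma minpol_dvd_cong: assumes "n dvd a - b" shows "n dvd minpol a \<longleftrightarrow> n dvd minpol b"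
proof -
 have "n dvd minpol a - minpol b" unfolding minpol_diff using assms by simp
 then show ?thesis using dvd_diff_right_iff dvd_add_right_iff by (metis diff_add_cancel)
qed

text \<open>
  The norm form of the order in the coordinates with respect to \<open>1, om\<close>.
\<close>

definition onorm :: "int => int => int" where "onorm m n = m * m + m * n * int D + n * n * nom"

lemma onorm_real: "(of_int m + of_int n * om) * cj (of_int m + of_int n * om) = of_int (onorm m n)"
proof -
 have "cj (of_int m + of_int n * om) = of_int m + of_int n * cj om" by simp
 then have "(of_int m + of_int n * om) * cj (of_int m + of_int n * om) =
  of_int (m * m) + of_int (m * n) * (om + cj om) + of_int (n * n) * (om * cj om)"
  by (simp add: algebra_simps)
 then show ?thesis unfolding om_cj onorm_def by (simp add: cj_om)
qed

lemma onorm_mult: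
 assumes "(of_int m + of_int n * om) * (of_int m' + of_int n' * om) = of_int k + of_int l * om"
 shows "onorm m n * onorm m' n' = onorm k l"
proof -
 have "real_of_int (onorm k l) = of_int (onorm m n) * of_int (onorm m' n')"
  unfolding onorm_real[symmetric] assms[symmetric] by simp
 then show ?thesis by (metis of_int_eq_iff of_int_mult)
qed

abbreviation prin :: "nat => real set" where "prin p \<equiv> PIdl\<^bsub>RR\<^esub> (real p)"

lemma PIdl_iff: "of_int m + of_int n * om \<in> prin p \<longleftrightarrow> int p dvd m & int p dvd n"
proof
 assume "of_int m + of_int n * om \<in> prin p"
 then obtain y where y: "y \<in> Od" "of_int m + of_int n * om = y * real p" unfolding cgenideal_def by auto
 obtain k l where "y = of_int k + of_int l * om" using y(1) by (elim Od_cases)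
 then have "of_int m + of_int n * om = (of_int k + of_int l * om) * real p" using y(2) by simp
 then have "of_int m + of_int n * om = of_int (k * int p) + of_int (l * int p) * om" by (simp add: algebra_simps)
 from om_coords_unique[OF this] show "int p dvd m & int p dvd n" by simp
next
 assume "int p dvd m & int p dvd n"
 then obtain k l where "m = int p * k" "n = int p * l" by (auto elim!: dvdE)
 then have "of_int m + of_int n * om = (of_int k + of_int l * om) * real p" by (simp add: algebra_simps)
 then show "of_int m + of_int n * om \<in> prin p" unfolding cgenideal_def using Od_intro by auto
qed

lemma PIdl_eq: "prin p = {x * real p | x. x \<in> Od}"
 unfolding cgenideal_def by auto

lemma ideal_PIdl: "ideal (prin p) RR"
 by (rule RR.cgenideal_ideal) simp

lemma primeideal_RRI:
 assumes "ideal I RR" "1 \<notin> I" "!!x y. x \<in> Od ==> y \<in> Od ==> x * y \<in> I ==> x \<in> I \<or> y \<in> I"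
 shows "primeideal I RR"
 by (rule primeidealI[OF assms(1) cring_RR]) (use assms in auto)

lemma primeideal_RRD:
 assumes "primeideal I RR"
 shows "ideal I RR" "1 \<notin> I" "x \<in> Od ==> y \<in> Od ==> x * y \<in> I ==> x \<in> I \<or> y \<in> I"
proof -
 interpret I: primeideal I RR by fact
 show "ideal I RR" by (rule I.ideal_axioms)
 then show "1 \<notin> I" using I.I_notcarr I.one_imp_carrier by auto
 show "x \<in> Od ==> y \<in> Od ==> x * y \<in> I ==> x \<in> I \<or> y \<in> I" using I.I_prime[of x y] by simp
qed

lemma prime_int_combination_in_ideal:
 assumes "prime p" "ideal I RR" "~ int p dvd u" "z \<in> Od" "real p * z \<in> I" "of_int u * z \<in> I"
 shows "z \<in> I"
proof -
 obtain k l where kl: "k * int p + l * u = 1"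
  using prime_gcd_combination[of "int p" u] assms by auto
 have "of_int k * (real p * z) + of_int l * (of_int u * z) \<in> I"
  using assms RR_ideal_closed[OF assms(2)] by simp
 also have "of_int k * (real p * z) + of_int l * (of_int u * z) = of_int (k * int p + l * u) * z"
  by (simp add: algebra_simps)
 finally show ?thesis unfolding kl by simp
qed

lemma primeideal_root_ideal:
 assumes "prime p" "int p dvd minpol a" shows "primeideal (root_ideal p a) RR"
proof (rule primeideal_RRI[OF ideal_root_ideal[OF assms(2)]])
 show "1 \<notin> root_ideal p a" using root_ideal_int[of 1] assms(1) by (simp add: prime_nat_iff)
 fix x y assume "x \<in> Od" "y \<in> Od" and xy: "x * y \<in> root_ideal p a"
 then obtain m n m' n' where x: "x = of_int m + of_int n * om"
   and y: "y = of_int m' + of_int n' * om" unfolding Od_eq by blast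
 have "int p dvd (m * m' - n * n' * nom) + (m * n' + n * m' + n * n' * int D) * a"
  using xy unfolding x y om_mult root_ideal_iff .
 also have "(m * m' - n * n' * nom) + (m * n' + n * m' + n * n' * int D) * a =
   (m + n * a) * (m' + n' * a) - n * n' * minpol a" unfolding minpol_def by (simp add: algebra_simps)
 finally have "int p dvd (m + n * a) * (m' + n' * a)"
  using assms(2) by (metis diff_add_cancel dvd_add dvd_mult)
 then have "int p dvd m + n * a \<or> int p dvd m' + n' * a" using assms(1) by (simp add: prime_dvd_mult_iff)
 then show "x \<in> root_ideal p a \<or> y \<in> root_ideal p a" unfolding x y root_ideal_iff .
qed

lemma p_dvd_onorm:
 assumes p: "prime p" and noroot: "~ (EX a. int p dvd minpol a)" and "int p dvd onorm m n"
 shows "int p dvd m & int p dvd n"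
proof (cases "int p dvd n")
 case True
 have "m * m = onorm m n - n * (m * int D + n * nom)" unfolding onorm_def by (simp add: algebra_simps)
 then have "int p dvd m * m" using assms(3) True by simp
 then show ?thesis using p True by (simp add: prime_dvd_mult_iff)
next
 case False
 obtain k l where kl: "k * int p + l * n = 1"
  using prime_gcd_combination[of "int p" n] p False by auto
 have ln: "l * n = 1 - k * int p" using kl by simp
 have "minpol (- (m * l)) - l * l * onorm m n
  = (1 - l * n) * (m * l * int D + nom * (1 + l * n))"
  unfolding onorm_def minpol_def by (simp add: algebra_simps)
 also have "1 - l * n = k * int p" using ln by simp
 finally have "minpol (- (m * l)) = l * l * onorm m n + int p * (k * (m * l * int D + nom * (1 + l * n)))"
  by (simp add: algebra_simps)
 then have "int p dvd minpol (- (m * l))" using assms(3) by simp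
 then show ?thesis using noroot by blast
qed

text \<open>
  The quotient by \<open>p\<close> is \<open>\<int>[x]\<close> modulo \<open>p\<close> and the minimal polynomial, a field exactly if the quadratic
  polynomial has no root modulo \<open>p\<close>. With a root \<open>a\<close>, the product of \<open>om - a\<close> and its conjugate is
  divisible by \<open>p\<close> although no factor is; without a root, the norm form is anisotropic modulo \<open>p\<close>.
\<close>

lemma PIdl_prime_iff:
 assumes p: "prime p"
 shows "primeideal (prin p) RR \<longleftrightarrow> ~ (EX a. int p dvd minpol a)"
proof
 assume pr: "primeideal (prin p) RR"
 show "~ (EX a. int p dvd minpol a)"
 proof
  assume "EX a. int p dvd minpol a"
  then obtain a where a: "int p dvd minpol a" by blast
  have "(om - of_int a) * (cj om - of_int a) \<in> prin p"
   unfolding minpol_factor using PIdl_iff[of "minpol a" 0] a by simp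
  moreover have "om - of_int a \<in> Od" "cj om - of_int a \<in> Od" by simp_all
  ultimately have "om - of_int a \<in> prin p \<or> cj om - of_int a \<in> prin p"
   using primeideal_RRD(3)[OF pr] by blast
  moreover have "om - of_int a = of_int (- a) + of_int 1 * om" by simp
  moreover have "cj om - of_int a = of_int (int D - a) + of_int (- 1) * om" by (simp add: cj_om)
  ultimately have "int p dvd 1 \<or> int p dvd - 1" using PIdl_iff by metis
  then show False using p by (simp add: prime_nat_iff)
 qed
next
 assume noroot: "~ (EX a. int p dvd minpol a)"
 show "primeideal (prin p) RR"
 proof (rule primeideal_RRI[OF ideal_PIdl])
  show "1 \<notin> prin p" using PIdl_iff[of 1 0 p] p by (simp add: prime_nat_iff)
  fix x y assume "x \<in> Od" "y \<in> Od" and xy: "x * y \<in> prin p"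
  then obtain m n m' n' where x: "x = of_int m + of_int n * om"
   and y: "y = of_int m' + of_int n' * om" unfolding Od_eq by blast
  define k l where "k = m * m' - n * n' * nom" and "l = m * n' + n * m' + n * n' * int D"
  have "int p dvd k" "int p dvd l"
   using xy PIdl_iff unfolding x y om_mult k_def l_def by blast+
  moreover have "onorm m n * onorm m' n' = onorm k l"
   by (rule onorm_mult) (simp only: om_mult k_def l_def)
  ultimately have "int p dvd onorm m n * onorm m' n'" unfolding onorm_def by simp
  then have "int p dvd onorm m n \<or> int p dvd onorm m' n'" using p by (simp add: prime_dvd_mult_iff)
  then show "x \<in> prin p \<or> y \<in> prin p"
   unfolding x y PIdl_iff using p_dvd_onorm[OF p noroot] by blast
 qed
qed

lemma root_if_dvd_D:
 assumes p: "prime p" "p dvd D" shows "EX a. int p dvd minpol a"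
proof (cases "p = 2")
 case True
 then have "even (int D)" using p(2) by simp
 then have "even (minpol nom)" unfolding minpol_def by simp
 then show ?thesis using True by auto
next
 case False
 then have "odd p" using p(1) prime_odd_nat prime_ge_2_nat by (metis le_neq_implies_less)
 then obtain k where k: "p = 2 * k + 1" by (auto elim: oddE)
 define a where "a = int D * int (k + 1)"
 have "2 * a - int D = int D * int p" unfolding a_def k by (simp add: algebra_simps)
 then have "4 * minpol a = (int D * int p) * (int D * int p) - int D" using minpol_square[of a] by simp
 moreover have "int p dvd int D" using p(2) by simp
 ultimately have "int p dvd 2 * (2 * minpol a)" by simp
 moreover have "~ int p dvd 2"
  using False p(1) primes_dvd_imp_eq[of p 2] by (metis int_dvd_int_iff of_nat_numeral two_is_prime_nat)
 moreover have "prime (int p)" using p(1) by simp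
 ultimately have "int p dvd minpol a" using prime_dvd_mult_iff by blast
 then show ?thesis by blast
qed

end

context real_quadratic
begin

interpretation RR: cring RR by (rule cring_RR)

lemma ideal_prod_closed:
 assumes "ideal I RR" "ideal J RR"
 shows "ideal (ideal_prod RR I J) RR" "i \<in> I ==> j \<in> J ==> i * j \<in> ideal_prod RR I J"
  "ideal_prod RR I J \<subseteq> I" "ideal_prod RR I J \<subseteq> J"
 using RR.ideal_prod_is_ideal[OF assms] ideal_prod.prod[of i I j J RR] RR.ideal_prod_inter[OF assms]
 by auto

lemma ideal_prod_subsetI:
 assumes "ideal K RR" "!!i j. i \<in> I ==> j \<in> J ==> i * j \<in> K"
 shows "ideal_prod RR I J \<subseteq> K"
proof
 fix x assume "x \<in> ideal_prod RR I J"
 then show "x \<in> K"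
  by (induction rule: ideal_prod.induct) (use assms RR_ideal_closed(3)[OF assms(1)] in auto)
qed

lemma PIdl_subsetI: "ideal K RR ==> real p \<in> K ==> prin p \<subseteq> K"
 unfolding PIdl_eq using RR_ideal_closed(5) by blast

lemma PIdl_mult_mem: "x \<in> Od ==> real p * x \<in> prin p"
 unfolding PIdl_eq by (auto simp: mult.commute)

lemma root_idealE:
 assumes "x \<in> root_ideal p a"
 obtains k n where "x = real p * of_int k + of_int n * (om - of_int a)"
proof -
 obtain m n where x: "x = of_int m + of_int n * om" "int p dvd m + n * a"
  using assms unfolding root_ideal_def by blast
 obtain k where k: "m + n * a = int p * k" using x(2) by (auto elim: dvdE)
 then have "real_of_int (m + n * a) = of_int (int p * k)" by simp
 then have "real_of_int m = real p * of_int k - of_int n * of_int a" by simp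
 then have "x = real p * of_int k + of_int n * (om - of_int a)" unfolding x(1) by (simp add: algebra_simps)
 then show thesis by (rule that)
qed

lemma two_root_diff:
 assumes p: "prime p" "int p dvd minpol a"
 shows "int p dvd 2 * a - int D \<longleftrightarrow> p dvd D"
proof -
 have "p dvd D \<longleftrightarrow> int p dvd 4 * minpol a + int D"
  using p(2) by (simp add: dvd_add_right_iff)
 also have "\<dots> \<longleftrightarrow> int p dvd 2 * a - int D"
  unfolding minpol_square[symmetric] using p(1) by (simp add: prime_dvd_mult_iff)
 finally show ?thesis by simp
qed

lemma om_root_square:
 "(om - of_int a) * (om - of_int a) = of_int (int D - 2 * a) * (om - of_int a) - of_int (minpol a)"
proof -
 have "(om - of_int a) * (om - of_int a) = om * om - 2 * of_int a * om + of_int a * of_int a"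
  by (simp add: algebra_simps)
 then show ?thesis unfolding om_sq minpol_def by (simp add: algebra_simps)
qed

lemma double_root_in_PIdl:
 assumes "prime p" "p dvd D" "int p dvd minpol a"
 shows "(om - of_int a) * (om - of_int a) \<in> prin p"
proof -
 have "int p dvd 2 * a - int D" using two_root_diff assms by blast
 then have d: "int p dvd int D - 2 * a" by (simp add: dvd_diff_commute)
 have "(om - of_int a) * (om - of_int a) =
   of_int (- a * (int D - 2 * a) - minpol a) + of_int (int D - 2 * a) * om"
  unfolding om_root_square by (simp add: algebra_simps)
 moreover have "int p dvd - a * (int D - 2 * a) - minpol a" using d assms by simp
 ultimately show ?thesis using PIdl_iff d by metis
qed

lemma prime_containing_double_root:
 assumes p: "prime p" "p dvd D" "int p dvd minpol a"
  and P: "primeideal P RR" "prin p \<subseteq> P"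
 shows "P = root_ideal p a"
proof -
 note idl = primeideal_RRD(1)[OF P(1)]
 have pP: "real p \<in> P" using P(2) PIdl_mult_mem[of 1] by auto
 have "(om - of_int a) * (om - of_int a) \<in> P" using double_root_in_PIdl[OF p] P(2) by blast
 then have piP: "om - of_int a \<in> P" using primeideal_RRD(3)[OF P(1), of "om - of_int a" "om - of_int a"] by simp
 have sub: "root_ideal p a \<subseteq> P"
 proof
  fix x assume "x \<in> root_ideal p a"
  then obtain k n where "x = real p * of_int k + of_int n * (om - of_int a)" by (rule root_idealE)
  then show "x \<in> P" using pP piP RR_ideal_closed[OF idl] by simp
 qed
 have "x \<in> root_ideal p a" if "x \<in> P" for x
 proof (rule ccontr)
  assume x: "x \<notin> root_ideal p a"
  have "x \<in> Od" using that RR_ideal_closed(1)[OF idl] by blast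
  then obtain m n where mn: "x = of_int m + of_int n * om" by (elim Od_cases)
  have nd: "~ int p dvd m + n * a" using x unfolding mn root_ideal_iff .
  have "of_int (m + n * a) = x - of_int n * (om - of_int a)" unfolding mn by (simp add: algebra_simps)
  also have "\<dots> \<in> P" using that piP RR_ideal_closed[OF idl] by simp
  finally have "of_int (m + n * a) \<in> P" .
  then have "1 \<in> P" using prime_int_combination_in_ideal[OF p(1) idl nd, of 1] pP by simp
  then show False using primeideal_RRD(2)[OF P(1)] by simp
 qed
 then show ?thesis using sub by blast
qed

lemma PIdl_reduced:
 assumes p: "prime p" "~ p dvd D" and x: "x \<in> Od" "x * x \<in> prin p"
 shows "x \<in> prin p"
proof -
 obtain m n where mn: "x = of_int m + of_int n * om" using x(1) by (elim Od_cases)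
 define k l where "k = m * m - n * n * nom" and "l = m * n + n * m + n * n * int D"
 have kl: "int p dvd k" "int p dvd l" using x(2) PIdl_iff unfolding mn om_mult k_def l_def by blast+
 define t where "t = 2 * m + n * int D"
 have pp: "prime (int p)" using p(1) by simp
 have "onorm m n * onorm m n = onorm k l"
  by (rule onorm_mult) (simp only: om_mult k_def l_def)
 then have "int p dvd onorm m n * onorm m n" using kl unfolding onorm_def by simp
 then have pN: "int p dvd onorm m n" using pp by (simp add: prime_dvd_mult_iff)
 have "t * t - 2 * onorm m n = 2 * k + l * int D"
  unfolding t_def k_def l_def onorm_def by (simp add: algebra_simps)
 then have "t * t = 2 * onorm m n + 2 * k + l * int D" by simp
 then have "int p dvd t * t" using kl pN by simp
 then have pt: "int p dvd t" using pp by (simp add: prime_dvd_mult_iff)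
 have "t * t - 4 * onorm m n = n * n * (int D * int D - 4 * nom)"
  unfolding t_def onorm_def by (simp add: algebra_simps)
 then have e: "n * n * int D = t * t - 4 * onorm m n" using nom by simp
 have "int p dvd n * n * int D" unfolding e using pt pN by simp
 then have pn: "int p dvd n" using pp p(2) by (simp add: prime_dvd_mult_iff)
 have "m * m = onorm m n - n * (m * int D + n * nom)" unfolding onorm_def by (simp add: algebra_simps)
 then have "int p dvd m * m" using pN pn by simp
 then have "int p dvd m" using pp by (simp add: prime_dvd_mult_iff)
 then show ?thesis unfolding mn PIdl_iff using pn by simp
qed

text \<open>
  A square of a prime forces nilpotent elements modulo \<open>p\<close>, which exist only if \<open>p\<close> divides \<open>D\<close>. In that
  case \<open>(p, om - a)\<close> squares to \<open>(p)\<close>, provided the double root does not lift modulo \<open>p\<^sup>2\<close>.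
\<close>

lemma PIdl_square_iff:
 assumes p: "prime p" and unram: "!!a. p dvd D ==> ~ int p * int p dvd minpol a"
 shows "(EX P. primeideal P RR & prin p = ideal_prod RR P P) \<longleftrightarrow> p dvd D"
proof
 assume "EX P. primeideal P RR & prin p = ideal_prod RR P P"
 then obtain P where P: "primeideal P RR" "prin p = ideal_prod RR P P" by blast
 note idl = primeideal_RRD(1)[OF P(1)]
 show "p dvd D"
 proof (rule ccontr)
  assume nD: "~ p dvd D"
  have sub: "i \<in> prin p" if "i \<in> P" for i
   using PIdl_reduced[OF p nD, of i] ideal_prod_closed(2)[OF idl idl that that]
   RR_ideal_closed(1)[OF idl] that P(2) by auto
  have "ideal_prod RR P P \<subseteq> PIdl\<^bsub>RR\<^esub> (real (p * p))"
  proof (rule ideal_prod_subsetI[OF ideal_PIdl])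
   fix i j assume "i \<in> P" "j \<in> P"
   then obtain u v where "u \<in> Od" "i = u * real p" "v \<in> Od" "j = v * real p"
   using sub unfolding PIdl_eq by blast
   then show "i * j \<in> PIdl\<^bsub>RR\<^esub> (real (p * p))"
   unfolding PIdl_eq by (auto intro!: exI[of _ "u * v"])
  qed
  then have "of_int (int p) + of_int 0 * om \<in> PIdl\<^bsub>RR\<^esub> (real (p * p))"
   using P(2) PIdl_mult_mem[of 1 p] by auto
  then have "int (p * p) dvd int p" unfolding PIdl_iff by simp
  then show False using p by (simp add: prime_nat_iff)
 qed
next
 assume pD: "p dvd D"
 obtain a where a: "int p dvd minpol a" using root_if_dvd_D[OF p pD] by blast
 let ?P = "root_ideal p a"
 have pr: "primeideal ?P RR" by (rule primeideal_root_ideal[OF p a])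
 note idl = primeideal_RRD(1)[OF pr]
 note prod = ideal_prod_closed[OF idl idl]
 have "ideal_prod RR ?P ?P \<subseteq> prin p"
 proof (rule ideal_prod_subsetI[OF ideal_PIdl])
  fix i j assume "i \<in> ?P" "j \<in> ?P"
  then obtain k n k' n' where ij: "i = real p * of_int k + of_int n * (om - of_int a)"
   "j = real p * of_int k' + of_int n' * (om - of_int a)" by (metis root_idealE)
  have "i * j = real p * (of_int k * j + of_int k' * of_int n * (om - of_int a)) +
   of_int (n * n') * ((om - of_int a) * (om - of_int a))"
   unfolding ij by (simp add: algebra_simps)
  moreover have "j \<in> Od" using ij by simp
  ultimately show "i * j \<in> prin p"
   using double_root_in_PIdl[OF p pD a] PIdl_mult_mem RR_ideal_closed[OF ideal_PIdl] by simp
 qed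
 moreover have "prin p \<subseteq> ideal_prod RR ?P ?P"
 proof (rule PIdl_subsetI[OF prod(1)])
  have pP: "real p \<in> ?P" using root_ideal_int[of "int p"] by simp
  have piP: "om - of_int a \<in> ?P" using root_ideal_om by simp
  obtain u where u: "minpol a = int p * u" using a by (auto elim: dvdE)
  have pu: "~ int p dvd u" using unram[OF pD, of a] p u by auto
  have "int p dvd 2 * a - int D" using two_root_diff[OF p a] pD by simp
  then obtain v where v: "int D - 2 * a = int p * v" by (metis dvd_def dvd_diff_commute)
  have "of_int u * real p = of_int v * (real p * (om - of_int a)) - (om - of_int a) * (om - of_int a)"
   unfolding om_root_square u v by (simp add: algebra_simps)
  also have "\<dots> \<in> ideal_prod RR ?P ?P"
   using prod(2)[OF pP piP] prod(2)[OF piP piP] RR_ideal_closed[OF prod(1)] by simp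
  finally have "of_int u * real p \<in> ideal_prod RR ?P ?P" .
  then show "real p \<in> ideal_prod RR ?P ?P"
   using prime_int_combination_in_ideal[OF p prod(1) pu] prod(2)[OF pP pP] by simp
 qed
 ultimately show "EX P. primeideal P RR & prin p = ideal_prod RR P P" using pr by blast
qed

lemma PIdl_prod_iff:
 assumes p: "prime p"
 shows "(EX P Q. primeideal P RR & primeideal Q RR & P ~= Q & prin p = ideal_prod RR P Q) \<longleftrightarrow>
  (EX a. int p dvd minpol a) & ~ p dvd D"
proof
 assume "EX P Q. primeideal P RR & primeideal Q RR & P ~= Q & prin p = ideal_prod RR P Q"
 then obtain P Q where PQ: "primeideal P RR" "primeideal Q RR" "P ~= Q" "prin p = ideal_prod RR P Q"
  by blast
 note iP = primeideal_RRD(1)[OF PQ(1)] and iQ = primeideal_RRD(1)[OF PQ(2)]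
 have key: False if I: "ideal I RR" "ideal J RR" "1 \<notin> J" "I \<subseteq> prin p"
  "prin p \<subseteq> {real p * j | j. j \<in> J} \<or> prin p = ideal_prod RR I J \<or>
  prin p = ideal_prod RR J I" for I J
 proof -
  have Kid: "ideal {real p * j | j. j \<in> J} RR"
  proof (rule RR_idealI)
   show "{real p * j | j. j \<in> J} \<subseteq> Od" using RR_ideal_closed(1)[OF I(2)] by auto
   show "0 \<in> {real p * j | j. j \<in> J}" using RR_ideal_closed(2)[OF I(2)] by force
   fix x y
   show "x \<in> {real p * j | j. j \<in> J} ==> y \<in> {real p * j | j. j \<in> J} ==> x + y \<in> {real p * j | j. j \<in> J}"
   using RR_ideal_closed(3)[OF I(2)] by (auto simp: distrib_left[symmetric])
   show "x \<in> {real p * j | j. j \<in> J} ==> y \<in> Od ==> y * x \<in> {real p * j | j. j \<in> J}"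
   using RR_ideal_closed(5)[OF I(2)] by (auto simp: mult.left_commute)
  qed
  have ij: "i * j \<in> {real p * j | j. j \<in> J} & j * i \<in> {real p * j | j. j \<in> J}" if ij: "i \<in> I" "j \<in> J" for i j
  proof -
   obtain u where "u \<in> Od" "i = u * real p" using ij(1) I(4) unfolding PIdl_eq by blast
   then have "i * j = real p * (u * j)" "j * i = real p * (u * j)" "u * j \<in> J"
   using RR_ideal_closed(5)[OF I(2)] ij by auto
   then show ?thesis by blast
  qed
  have "prin p \<subseteq> {real p * j | j. j \<in> J}"
   using I(5) ideal_prod_subsetI[OF Kid, of I J] ideal_prod_subsetI[OF Kid, of J I] ij by auto
  moreover have "real p \<in> prin p" using PIdl_mult_mem[of 1] by simp
  ultimately obtain j where "real p = real p * j" "j \<in> J" by blast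
  then show False using I(3) p by (auto simp: prime_gt_0_nat)
 qed
 show "(EX a. int p dvd minpol a) & ~ p dvd D"
 proof
  show "EX a. int p dvd minpol a"
  proof (rule ccontr)
   assume "~ (EX a. int p dvd minpol a)"
   then have pr: "primeideal (prin p) RR" using PIdl_prime_iff[OF p] by blast
   show False
   proof (cases "P \<subseteq> prin p")
   case True
   then show False using key[OF iP iQ primeideal_RRD(2)[OF PQ(2)]] PQ(4) by blast
   next
   case False
   then obtain i where i: "i \<in> P" "i \<notin> prin p" by blast
   have "Q \<subseteq> prin p"
   proof
   fix j assume j: "j \<in> Q"
   have "i * j \<in> prin p" using ideal_prod_closed(2)[OF iP iQ i(1) j] PQ(4) by simp
   then show "j \<in> prin p"
   using primeideal_RRD(3)[OF pr] i j RR_ideal_closed(1)[OF iP] RR_ideal_closed(1)[OF iQ] by blast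
   qed
   then show False using key[OF iQ iP primeideal_RRD(2)[OF PQ(1)]] PQ(4) by blast
   qed
  qed
  show "~ p dvd D"
  proof
   assume pD: "p dvd D"
   obtain a where a: "int p dvd minpol a" using root_if_dvd_D[OF p pD] by blast
   have "P = root_ideal p a" "Q = root_ideal p a"
   using prime_containing_double_root[OF p pD a PQ(1)] prime_containing_double_root[OF p pD a PQ(2)]
   ideal_prod_closed(3,4)[OF iP iQ] unfolding PQ(4) by simp_all
   then show False using PQ(3) by simp
  qed
 qed
next
 assume "(EX a. int p dvd minpol a) & ~ p dvd D"
 then obtain a where a: "int p dvd minpol a" and nD: "~ p dvd D" by blast
 define b where "b = int D - a"
 have b: "int p dvd minpol b" using a unfolding b_def minpol_def by (simp add: algebra_simps)
 have nab: "~ int p dvd a - b" using two_root_diff[OF p a] nD unfolding b_def by (simp add: algebra_simps)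
 let ?P = "root_ideal p a" and ?Q = "root_ideal p b"
 have pr: "primeideal ?P RR" "primeideal ?Q RR" using primeideal_root_ideal p a b by auto
 note iP = primeideal_RRD(1)[OF pr(1)] and iQ = primeideal_RRD(1)[OF pr(2)]
 note prod = ideal_prod_closed[OF iP iQ]
 have piP: "om - of_int a \<in> ?P" "om - of_int b \<in> ?Q" using root_ideal_om by simp_all
 have pP: "real p \<in> ?P" "real p \<in> ?Q" using root_ideal_int[of "int p"] by simp_all
 have ne: "?P ~= ?Q" using piP(1) root_ideal_om[of a p b] nab by (metis dvd_diff_commute)
 have pi2: "(om - of_int a) * (om - of_int b) = - of_int (minpol a)"
  using minpol_factor[of a] unfolding b_def cj_om by (simp add: algebra_simps)
 have "ideal_prod RR ?P ?Q \<subseteq> prin p"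
 proof (rule ideal_prod_subsetI[OF ideal_PIdl])
  fix i j assume "i \<in> ?P" "j \<in> ?Q"
  then obtain k n k' n' where ij: "i = real p * of_int k + of_int n * (om - of_int a)"
   "j = real p * of_int k' + of_int n' * (om - of_int b)" by (metis root_idealE)
  obtain u where u: "minpol a = int p * u" using a by (auto elim: dvdE)
  have "i * j = real p * (of_int k * j + of_int k' * of_int n * (om - of_int a)) +
   of_int (n * n') * ((om - of_int a) * (om - of_int b))"
   unfolding ij by (simp add: algebra_simps)
  also have "\<dots> = real p * (of_int k * j + of_int k' * of_int n * (om - of_int a) - of_int (n * n' * u))"
   unfolding pi2 u by (simp add: algebra_simps)
  finally show "i * j \<in> prin p" using PIdl_mult_mem ij by simp
 qed
 moreover have "prin p \<subseteq> ideal_prod RR ?P ?Q"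
 proof (rule PIdl_subsetI[OF prod(1)])
  have "of_int (a - b) * real p = real p * (om - of_int b) - (om - of_int a) * real p"
   by (simp add: algebra_simps)
  also have "\<dots> \<in> ideal_prod RR ?P ?Q"
   using prod(2)[OF pP(1) piP(2)] prod(2)[OF piP(1) pP(2)] RR_ideal_closed[OF prod(1)] by simp
  finally have "of_int (a - b) * real p \<in> ideal_prod RR ?P ?Q" .
  then show "real p \<in> ideal_prod RR ?P ?Q"
   using prime_int_combination_in_ideal[OF p prod(1) nab] prod(2)[OF pP] by simp
 qed
 ultimately show "EX P Q. primeideal P RR & primeideal Q RR & P ~= Q & prin p = ideal_prod RR P Q"
  using pr ne by blast
qed

text \<open>
  A root modulo \<open>p\<^sup>2\<close> at a ramified prime would show that \<open>D/p\<^sup>2\<close> is again a discriminant, so that \<open>p\<close>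
  divides the conductor.
\<close>

lemma no_double_root_mod_square:
 assumes p: "prime p" "p dvd D" and cond: "~ p dvd conductor D"
 shows "~ int p * int p dvd minpol a"
proof
 assume sq: "int p * int p dvd minpol a"
 have p0: "real p ~= 0" using p(1) by (simp add: prime_gt_0_nat)
 obtain u where u: "minpol a = int p * int p * u" using sq by (auto elim: dvdE)
 have "int p dvd minpol a" using u by simp
 then have "int p dvd 2 * a - int D" using two_root_diff p by blast
 then obtain v where v: "int D - 2 * a = int p * v" by (metis dvd_def dvd_diff_commute)
 define x where "x = (om - of_int a) / real p"
 have c: "cj x = (cj om - of_int a) / real p" unfolding x_def by simp
 have "x + cj x = of_int (int D - 2 * a) / real p" unfolding c x_def using p0 by (simp add: cj_om field_simps)
 then have 1: "x + cj x \<in> \<int>" unfolding v using p0 by simp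
 have "x * cj x = of_int (minpol a) / (real p * real p)" unfolding c x_def using minpol_factor[of a] by simp
 then have 2: "x * cj x \<in> \<int>" unfolding u using p0 by simp
 have "x \<in> KK" unfolding x_def by simp
 from conductor_mult_integral[OF this 1 2] obtain m n where
  "real (conductor D) * x = of_int m + of_int n * om" by (elim Od_cases)
 then have "of_int (- int (conductor D) * a) + of_int (int (conductor D)) * om = of_int (int p * m) + of_int (int p * n) * om"
  unfolding x_def using p0 by (simp add: field_simps)
 then have "int (conductor D) = int p * n" using om_coords_unique by blast
 then show False using cond by (metis dvd_triv_left int_dvd_int_iff)
qed

end

theorem prime_decomposition:
 fixes D p :: nat
 assumes "nonsquare_discriminant D" "prime p" "~ p dvd conductor D"
 shows "inert D p \<longleftrightarrow> ~ (EX a. int p dvd real_quadratic.minpol D a)"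
  and "ramified D p \<longleftrightarrow> p dvd D"
  and "splits D p \<longleftrightarrow> (EX a. int p dvd real_quadratic.minpol D a) & ~ p dvd D"
proof -
 interpret real_quadratic D by unfold_locales (rule assms)
 obtain \<Delta> where \<Delta>: "real_quadratic \<Delta>" "D = (conductor D)\<^sup>2 * \<Delta>" "fundamental \<Delta>"
  "maximal_order D = quad_order \<Delta>" by (rule conductor_structure) blast
 interpret E: real_quadratic \<Delta> by (rule \<Delta>(1))
 define f where "f = conductor D"
 have f: "D = f * f * \<Delta>" using \<Delta>(2) unfolding f_def by (simp add: power2_eq_square)
 have nf: "~ p dvd f" using assms(3) unfolding f_def .
 have pD: "p dvd D \<longleftrightarrow> p dvd \<Delta>" using f nf assms(2) by (simp add: prime_dvd_mult_iff)
 have "even (int f * int f - int f)" by simp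
 then obtain k where k: "int f * int f - int f = 2 * k" unfolding dvd_def by blast
 define c where "c = k * int \<Delta>"
 have "4 * minpol (int f * x + c) = 4 * (int f * int f * E.minpol x)" for x
 proof -
  have "2 * (int f * x + c) - int D = int f * (2 * x - int \<Delta>)"
  proof -
   have "2 * c = (int f * int f - int f) * int \<Delta>" unfolding c_def k by simp
   then show ?thesis unfolding f by (simp add: algebra_simps)
  qed
  then have "4 * minpol (int f * x + c) + int D = int f * int f * ((2 * x - int \<Delta>) * (2 * x - int \<Delta>))"
   unfolding minpol_square[symmetric] by simp
  then show ?thesis unfolding E.minpol_square unfolding f by (simp add: algebra_simps)
 qed
 then have trans: "minpol (int f * x + c) = int f * int f * E.minpol x" for x by simp
 have roots: "(EX a. int p dvd minpol a) \<longleftrightarrow> (EX a. int p dvd E.minpol a)"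
 proof
  assume "EX a. int p dvd E.minpol a"
  then show "EX a. int p dvd minpol a" using trans by (metis dvd_mult)
 next
  assume "EX a. int p dvd minpol a"
  then obtain b where b: "int p dvd minpol b" by blast
  obtain m l where ml: "m * int p + l * int f = 1"
   using prime_gcd_combination[of "int p" "int f"] assms(2) nf by auto
  define x where "x = l * (b - c)"
  have "b - (int f * x + c) = (1 - l * int f) * (b - c)" unfolding x_def by (simp add: algebra_simps)
  also have "1 - l * int f = m * int p" using ml by simp
  finally have "int p dvd b - (int f * x + c)" by simp
  then have "int p dvd int f * int f * E.minpol x" using minpol_dvd_cong b unfolding trans[symmetric] by blast
  then have "int p dvd E.minpol x" using nf assms(2) by (simp add: prime_dvd_mult_iff)
  then show "EX a. int p dvd E.minpol a" by blast
 qed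
 have unram: "~ int p * int p dvd E.minpol a" if "p dvd \<Delta>" for a
 proof
  assume "int p * int p dvd E.minpol a"
  then have "int p * int p dvd minpol (int f * a + c)" unfolding trans by simp
  then show False using no_double_root_mod_square[OF assms(2) _ assms(3)] that pD by blast
 qed
 show "inert D p \<longleftrightarrow> ~ (EX a. int p dvd minpol a)"
  unfolding inert_def Let_def \<Delta>(4) roots by (rule E.PIdl_prime_iff[OF assms(2)])
 show "ramified D p \<longleftrightarrow> p dvd D"
  unfolding ramified_def Let_def \<Delta>(4) pD by (rule E.PIdl_square_iff[OF assms(2) unram])
 show "splits D p \<longleftrightarrow> (EX a. int p dvd minpol a) & ~ p dvd D"
  unfolding splits_def Let_def \<Delta>(4) roots pD by (rule E.PIdl_prod_iff[OF assms(2)])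
qed

section \<open>Counting roots of the minimal polynomial\<close>

context real_quadratic
begin

definition roots_mod :: "nat => int set" where
 "roots_mod n = {x \<in> {0..<int n}. int n dvd minpol x}"

lemma minpol_dvd_mod: "int m dvd minpol (x mod int m) \<longleftrightarrow> int m dvd minpol x"
 by (rule minpol_dvd_cong) (simp add: dvd_diff_commute[of _ "x mod int m"])

text \<open>
  The Chinese remainder theorem.
\<close>

lemma card_roots_mod_mult:
 assumes "coprime m n" "m > 0" "n > 0"
 shows "card (roots_mod (m * n)) = card (roots_mod m) * card (roots_mod n)"
proof -
 have cop: "coprime (int m) (int n)" using assms(1) by simp
 have "bij_betw (%x. (x mod int m, x mod int n)) (roots_mod (m * n)) (roots_mod m \<times> roots_mod n)"
 proof (rule bij_betw_imageI)
  show "inj_on (%x. (x mod int m, x mod int n)) (roots_mod (m * n))"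
  proof (rule inj_onI)
   fix x y assume xy: "x \<in> roots_mod (m * n)" "y \<in> roots_mod (m * n)"
   "(x mod int m, x mod int n) = (y mod int m, y mod int n)"
   then have "int m dvd x - y" "int n dvd x - y" by (auto simp: mod_eq_dvd_iff)
   then have "int m * int n dvd x - y" using cop divides_mult by blast
   then have "x mod (int m * int n) = y mod (int m * int n)" by (simp add: mod_eq_dvd_iff)
   then show "x = y" using xy unfolding roots_mod_def by simp
  qed
  show "(%x. (x mod int m, x mod int n)) ` roots_mod (m * n) = roots_mod m \<times> roots_mod n"
  proof (intro equalityI subsetI)
   fix z assume "z \<in> (%x. (x mod int m, x mod int n)) ` roots_mod (m * n)"
   then obtain x where x: "int (m * n) dvd minpol x" "z = (x mod int m, x mod int n)"
   unfolding roots_mod_def by auto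
   have "int m dvd minpol x" "int n dvd minpol x" using x(1) by (auto dest: dvd_mult_left dvd_mult_right)
   then show "z \<in> roots_mod m \<times> roots_mod n"
   unfolding x(2) roots_mod_def using assms by (auto simp: minpol_dvd_mod)
  next
   fix z assume "z \<in> roots_mod m \<times> roots_mod n"
   then obtain u v where z: "z = (u, v)" "u \<in> roots_mod m" "v \<in> roots_mod n" by blast
   obtain x where x: "[x = u] (mod int m)" "[x = v] (mod int n)"
   using binary_chinese_remainder_int[OF cop] by blast
   define y where "y = x mod (int m * int n)"
   have y: "y mod int m = u" "y mod int n = v"
   using x z unfolding y_def roots_mod_def cong_def by (simp_all add: mod_mod_cancel)
   have "int m dvd minpol y" "int n dvd minpol y"
   using minpol_dvd_mod[of m y] minpol_dvd_mod[of n y] y z unfolding roots_mod_def by auto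
   then have "int m * int n dvd minpol y" using cop divides_mult by blast
   moreover have "0 \<le> y" "y < int m * int n" unfolding y_def using assms by simp_all
   ultimately have "y \<in> roots_mod (m * n)" unfolding roots_mod_def by simp
   then show "z \<in> (%x. (x mod int m, x mod int n)) ` roots_mod (m * n)" using y z(1) by force
  qed
 qed
 from bij_betw_same_card[OF this] show ?thesis by (simp add: card_cartesian_product)
qed

text \<open>
  Hensel lifting: the derivative \<open>2 x - D\<close> is a unit at every root since \<open>p\<close> does not divide \<open>D\<close>.
\<close>

lemma card_roots_mod_prime_power:
 assumes p: "prime p" "~ p dvd D" and "k \<ge> 1"
 shows "card (roots_mod (p ^ k)) = card (roots_mod p)"
 using assms(3)
proof (induction k rule: nat_induct_at_least)
 case base
 then show ?case by simp
next
 case (Suc k)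
 let ?q = "int p ^ k"
 have p0: "int p > 0" using p(1) by (simp add: prime_gt_0_nat)
 have pq: "int p dvd ?q" using Suc(1) by (simp add: dvd_power)
 have unit: "~ int p dvd 2 * x - int D" if "int p dvd minpol x" for x
  using two_root_diff[OF p(1) that] p(2) by blast
 have "bij_betw (%x. x mod ?q) (roots_mod (p ^ Suc k)) (roots_mod (p ^ k))"
 proof (rule bij_betw_imageI)
  show "inj_on (%x. x mod ?q) (roots_mod (p ^ Suc k))"
  proof (rule inj_onI)
   fix x y assume xy: "x \<in> roots_mod (p ^ Suc k)" "y \<in> roots_mod (p ^ Suc k)" "x mod ?q = y mod ?q"
   have "int p ^ Suc k dvd minpol x - minpol y" using xy unfolding roots_mod_def by auto
   then have d: "int p ^ Suc k dvd (x - y) * (x + y - int D)" unfolding minpol_diff .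
   have "?q dvd x - y" using xy(3) by (simp add: mod_eq_dvd_iff)
   then have "int p dvd x - y" using pq dvd_trans by blast
   moreover have "int p dvd minpol x" using xy(1) unfolding roots_mod_def
   by (auto intro: dvd_trans[rotated] simp: dvd_mult_left)
   ultimately have "~ int p dvd x + y - int D"
   proof -
   assume a: "int p dvd x - y" "int p dvd minpol x"
   have "2 * x - int D = (x + y - int D) + (x - y)" by simp
   then show ?thesis using unit[OF a(2)] a(1) by (metis dvd_add)
   qed
   then have "coprime (int p) (x + y - int D)" using p(1) by (simp add: prime_imp_coprime)
   then have "coprime (int p ^ Suc k) (x + y - int D)" by (rule coprime_power_left_iff[THEN iffD2, OF disjI1])
   then have "int p ^ Suc k dvd x - y" using d coprime_dvd_mult_left_iff by blast
   then have "x mod (int p ^ Suc k) = y mod (int p ^ Suc k)" by (simp add: mod_eq_dvd_iff)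
   then show "x = y" using xy(1,2) unfolding roots_mod_def by simp
  qed
  show "(%x. x mod ?q) ` roots_mod (p ^ Suc k) = roots_mod (p ^ k)"
  proof (intro equalityI subsetI)
   fix z assume "z \<in> (%x. x mod ?q) ` roots_mod (p ^ Suc k)"
   then obtain x where x: "int p ^ Suc k dvd minpol x" "z = x mod ?q" unfolding roots_mod_def by auto
   have "?q dvd minpol x" using x(1) by (simp add: dvd_mult_right)
   then show "z \<in> roots_mod (p ^ k)"
   unfolding x(2) roots_mod_def using p0 minpol_dvd_mod[of "p ^ k" x] by simp
  next
   fix u assume u: "u \<in> roots_mod (p ^ k)"
   then obtain w where w: "minpol u = ?q * w" unfolding roots_mod_def by (auto elim: dvdE)
   have "int p dvd minpol u" using w pq by simp
   then have "~ int p dvd 2 * u - int D" by (rule unit)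
   then obtain i l where il: "i * int p + l * (2 * u - int D) = 1"
   using prime_gcd_combination[of "int p" "2 * u - int D"] p(1) by auto
   define t where "t = - w * l"
   obtain r where r: "?q = int p * r" using pq by (auto elim: dvdE)
   have "minpol (u + ?q * t) = minpol u + ?q * t * (2 * u - int D) + ?q * ?q * t * t"
   unfolding minpol_def by (simp add: algebra_simps)
   also have "\<dots> = ?q * (w * (1 - l * (2 * u - int D))) + ?q * ?q * t * t"
   unfolding w t_def by (simp add: algebra_simps)
   also have "1 - l * (2 * u - int D) = i * int p" using il by simp
   also have "?q * (w * (i * int p)) + ?q * ?q * t * t = ?q * int p * (w * i + r * t * t)"
   unfolding r by (simp add: algebra_simps)
   finally have d: "int p ^ Suc k dvd minpol (u + ?q * t)" by (simp add: mult.assoc mult.left_commute)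
   define y where "y = (u + ?q * t) mod (int p ^ Suc k)"
   have "int p ^ Suc k dvd minpol y"
   using minpol_dvd_mod[of "p ^ Suc k" "u + ?q * t"] d unfolding y_def by simp
   then have "y \<in> roots_mod (p ^ Suc k)" unfolding roots_mod_def y_def using p0 by simp
   moreover have "y mod ?q = u" using u unfolding y_def roots_mod_def
   by (simp add: mod_mod_cancel)
   ultimately show "u \<in> (%x. x mod ?q) ` roots_mod (p ^ Suc k)" by force
  qed
 qed
 then have "card (roots_mod (p ^ Suc k)) = card (roots_mod (p ^ k))" by (rule bij_betw_same_card)
 then show ?case using Suc by simp
qed

lemma card_roots_mod_prime:
 assumes p: "prime p" and a: "int p dvd minpol a"
 shows "card (roots_mod p) = (if p dvd D then 1 else 2)"
proof -
 define b where "b = int D - a"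
 have p0: "int p > 0" using p(1) by (simp add: prime_gt_0_nat)
 have b: "int p dvd minpol b" using a unfolding b_def minpol_def by (simp add: algebra_simps)
 have ab: "int p dvd a - b \<longleftrightarrow> p dvd D" using two_root_diff[OF p a] unfolding b_def by (simp add: algebra_simps)
 have "roots_mod p = {a mod int p, b mod int p}"
 proof (intro equalityI subsetI)
  fix x assume x: "x \<in> roots_mod p"
  then have "int p dvd minpol x - minpol a" using a unfolding roots_mod_def by auto
  then have "int p dvd (x - a) * (x - b)" unfolding minpol_diff b_def by (simp add: algebra_simps)
  then have "int p dvd x - a \<or> int p dvd x - b" using p by (simp add: prime_dvd_mult_iff)
  then have "x mod int p = a mod int p \<or> x mod int p = b mod int p" by (simp add: mod_eq_dvd_iff)
  then show "x \<in> {a mod int p, b mod int p}" using x unfolding roots_mod_def by auto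
 next
  fix x assume "x \<in> {a mod int p, b mod int p}"
  then show "x \<in> roots_mod p" unfolding roots_mod_def using p0 a b minpol_dvd_mod by auto
 qed
 moreover have "a mod int p = b mod int p \<longleftrightarrow> p dvd D" using ab by (simp add: mod_eq_dvd_iff)
 ultimately show ?thesis by auto
qed

lemma card_roots_mod:
 assumes "d > 0" "!!p. prime p ==> p dvd d ==> (EX a. int p dvd minpol a) & (p dvd D --> multiplicity p d = 1)"
 shows "card (roots_mod d) = 2 ^ card {p. prime p & p dvd d & ~ p dvd D}"
 using assms
proof (induction d rule: less_induct)
 case (less d)
 show ?case
 proof (cases "d = 1")
  case True
  then have "roots_mod d = {0}" unfolding roots_mod_def by auto
  then have "card (roots_mod d) = 1" by simp
  moreover have "{p. prime p & p dvd d & ~ p dvd D} = {}" using True by (auto simp: prime_nat_iff)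
  ultimately show ?thesis by (simp only: card.empty power_0)
 next
  case False
  then obtain p where p: "prime p" "p dvd d" using prime_factor_nat by blast
  have dn0: "d ~= 0" "~ is_unit p" using less.prems(1) p(1) by (auto simp: prime_nat_iff)
  define k where "k = multiplicity p d"
  obtain m where m: "d = p ^ k * m" "~ p dvd m"
   unfolding k_def using multiplicity_decompose'[OF dn0] by blast
  have k1: "k \<ge> 1" unfolding k_def using p dn0 by (simp add: multiplicity_gt_zero_iff Suc_le_eq)
  have m0: "m > 0" using m dn0 by (cases m) auto
  have pk: "p ^ k > 1" using k1 p(1) by (metis One_nat_def Suc_le_eq one_less_power prime_gt_1_nat)
  have md: "m < d" using m pk m0 by simp
  have cop: "coprime (p ^ k) m" using m(2) p(1) by (simp add: prime_imp_coprime)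
  have mult: "multiplicity q d = multiplicity q m" if "prime q" "q ~= p" for q
  proof -
   have "multiplicity q (p ^ k) = 0"
   using that p(1) by (metis not_dvd_imp_multiplicity_0 prime_dvd_power primes_dvd_imp_eq)
   moreover have "multiplicity q (p ^ k * m) = multiplicity q (p ^ k) + multiplicity q m"
   by (rule prime_elem_multiplicity_mult_distrib) (use that p(1) m0 in \<open>auto simp: prime_gt_0_nat\<close>)
   ultimately show ?thesis using m(1) by simp
  qed
  have IH: "card (roots_mod m) = 2 ^ card {q. prime q & q dvd m & ~ q dvd D}"
  proof (rule less.IH[OF md m0])
   fix q assume q: "prime q" "q dvd m"
   then have "q ~= p" "q dvd d" using m by auto
   then show "(EX a. int q dvd minpol a) & (q dvd D --> multiplicity q m = 1)"
   using less.prems(2)[OF q(1)] mult[OF q(1)] by auto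
  qed
  have cm: "card (roots_mod d) = card (roots_mod (p ^ k)) * card (roots_mod m)"
   unfolding m(1) by (rule card_roots_mod_mult[OF cop less_trans[OF zero_less_one pk] m0])
  obtain a where a: "int p dvd minpol a" using less.prems(2)[OF p] by blast
  have fin: "finite {q. prime q & q dvd m & ~ q dvd D}"
   using finite_divisors_nat[OF m0] by (rule rev_finite_subset) auto
  have dvd_d: "q dvd d \<longleftrightarrow> q = p \<or> q dvd m" if "prime q" for q
  proof -
   have "q dvd d \<longleftrightarrow> q dvd p ^ k \<or> q dvd m" unfolding m(1) using that by (simp add: prime_dvd_mult_iff)
   also have "q dvd p ^ k \<longleftrightarrow> q = p" using that p(1) k1
   by (metis dvd_power dvd_refl le_eq_less_or_eq less_numeral_extra(1) order_less_le_trans prime_dvd_power primes_dvd_imp_eq)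
   finally show ?thesis .
  qed
  show ?thesis
  proof (cases "p dvd D")
   case True
   then have "k = 1" using less.prems(2)[OF p] unfolding k_def by blast
   then have "card (roots_mod (p ^ k)) = 1" using card_roots_mod_prime[OF p(1) a] True by simp
   moreover have "{q. prime q & q dvd d & ~ q dvd D} = {q. prime q & q dvd m & ~ q dvd D}"
   using True dvd_d by auto
   ultimately show ?thesis using cm IH by simp
  next
   case False
   then have "card (roots_mod (p ^ k)) = 2"
   using card_roots_mod_prime_power[OF p(1) _ k1] card_roots_mod_prime[OF p(1) a] by simp
   moreover have "{q. prime q & q dvd d & ~ q dvd D} = insert p {q. prime q & q dvd m & ~ q dvd D}"
   using False dvd_d p by auto
   moreover have "p \<notin> {q. prime q & q dvd m & ~ q dvd D}" using m(2) by simp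
   ultimately show ?thesis using cm IH fin by simp
  qed
 qed
qed

lemma prime_factor_condition_iff:
 assumes d: "d > 0" "coprime d (conductor D)"
 shows "prime_factor_condition D d \<longleftrightarrow>
  (ALL p. prime p & p dvd d --> (EX a. int p dvd minpol a) & (p dvd D --> multiplicity p d = 1))"
proof -
 have "~ p dvd conductor D" if "prime p" "p dvd d" for p
  using d(2) that by (metis coprime_common_divisor not_prime_unit)
 then show ?thesis
  unfolding prime_factor_condition_def using prime_decomposition[OF disc] by metis
qed

lemma card_roots_mod_PFC:
 assumes d: "d > 0" "coprime d (conductor D)" and "prime_factor_condition D d"
 shows "card (roots_mod d) = 2 ^ card {p. prime p & p dvd d & splits D p}"
proof -
 have nc: "~ p dvd conductor D" if "prime p" "p dvd d" for p
  using d(2) that by (metis coprime_common_divisor not_prime_unit)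
 have pfc: "!!p. prime p ==> p dvd d ==> (EX a. int p dvd minpol a) & (p dvd D --> multiplicity p d = 1)"
  using assms prime_factor_condition_iff by blast
 have "{p. prime p & p dvd d & splits D p} = {p. prime p & p dvd d & ~ p dvd D}"
  using prime_decomposition(3)[OF disc _ nc] pfc by blast
 then show ?thesis using card_roots_mod[OF d(1) pfc] by simp
qed

text \<open>
  A root modulo \<open>d\<close> restricts to a root modulo every prime divisor, which is thus not inert; a repeated
  ramified prime divisor is excluded by the absence of double roots modulo its square.
\<close>

lemma prime_factor_condition_if_root:
 assumes d: "d > 0" "coprime d (conductor D)" and a: "int d dvd minpol a"
 shows "prime_factor_condition D d"
 unfolding prime_factor_condition_iff[OF d]
proof (intro allI impI)
 fix p assume p: "prime p & p dvd d"
 have nc: "~ p dvd conductor D" using d(2) p by (metis coprime_common_divisor not_prime_unit)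
 have "int p dvd minpol a" using p a by (meson dvd_trans int_dvd_int_iff)
 moreover have "multiplicity p d = 1" if pD: "p dvd D"
 proof -
  have "~ p ^ 2 dvd d"
  proof
   assume "p ^ 2 dvd d"
   then have "int (p ^ 2) dvd minpol a" using a by (meson dvd_trans int_dvd_int_iff)
   then show False using no_double_root_mod_square[OF _ pD nc] p by (simp add: power2_eq_square)
  qed
  then have "~ 2 \<le> multiplicity p d"
   using d(1) p power_dvd_iff_le_multiplicity[of d p 2] by (auto simp: prime_nat_iff)
  moreover have "multiplicity p d \<ge> 1" using p d(1) by (simp add: multiplicity_gt_zero_iff Suc_le_eq prime_nat_iff)
  ultimately show ?thesis by simp
 qed
 ultimately show "(EX a. int p dvd minpol a) & (p dvd D --> multiplicity p d = 1)" by blast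
qed

end

section \<open>Primitive ideals and smart bases\<close>

lemma int_subgroup_generator:
 assumes "0 \<in> (I :: int set)" "!!x y. x \<in> I ==> y \<in> I ==> x - y \<in> I"
 obtains g where "g \<ge> 0" "g \<in> I" "!!x. x \<in> I ==> g dvd x"
proof (cases "I = {0}")
 case True
 then show thesis using that[of 0] by simp
next
 case False
 have neg: "- x \<in> I" if "x \<in> I" for x using assms(2)[OF assms(1) that] by simp
 have add: "x + y \<in> I" if "x \<in> I" "y \<in> I" for x y using assms(2)[OF that(1) neg[OF that(2)]] by simp
 have mult_nat: "of_nat n * x \<in> I" if "x \<in> I" for n x
  by (induction n) (use assms(1) add that in \<open>auto simp: algebra_simps\<close>)
 have mult: "k * x \<in> I" if "x \<in> I" for k x
 proof (cases "k \<ge> 0")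
  case True
  then show ?thesis using mult_nat[OF that, of "nat k"] by simp
 next
  case False
  then show ?thesis using neg[OF mult_nat[OF that, of "nat (- k)"]] by simp
 qed
 obtain x where x: "x \<in> I" "x ~= 0" using False assms(1) by auto
 then have "\<bar>x\<bar> \<in> I" using neg by (auto simp: abs_if)
 then have ex: "EX n. n > 0 & int n \<in> I" using x(2) by (intro exI[of _ "nat \<bar>x\<bar>"]) simp
 define g where "g = (LEAST n. n > 0 & int n \<in> I)"
 have g: "g > 0" "int g \<in> I" using LeastI_ex[OF ex] unfolding g_def by auto
 have "int g dvd y" if "y \<in> I" for y
 proof (rule ccontr)
  assume nd: "~ int g dvd y"
  have "y mod int g = y - (y div int g) * int g" by (simp add: minus_div_mult_eq_mod)
  then have "y mod int g \<in> I" using assms(2)[OF that mult[OF g(2)]] by simp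
  moreover have pos: "y mod int g > 0" using nd g(1) by (metis dvd_eq_mod_eq_0 of_nat_0_less_iff order_le_less pos_mod_sign)
  ultimately have "nat (y mod int g) > 0 & int (nat (y mod int g)) \<in> I" by simp
  then have "g \<le> nat (y mod int g)" unfolding g_def by (rule Least_le)
  moreover have "y mod int g < int g" using g(1) by simp
  ultimately show False using pos by linarith
 qed
 then show thesis using that[of "int g"] g by simp
qed

context real_quadratic
begin

interpretation RR: cring RR by (rule cring_RR)

lemma rcosets_eq: "a_rcosets\<^bsub>RR\<^esub> I = (%x. (%h. h + x) ` I) ` Od"
 unfolding A_RCOSETS_def' a_r_coset_def' by auto

lemma rcosets_root_ideal:
 assumes "d = 0 \<or> int d dvd minpol a"
 shows "a_rcosets\<^bsub>RR\<^esub> (root_ideal d a) = (%j. (%h. h + of_int j) ` root_ideal d a) ` {j. True}"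
 and "(%h. h + of_int i) ` root_ideal d a = (%h. h + of_int j) ` root_ideal d a \<longleftrightarrow> int d dvd i - j"
proof -
 have closed: "x + y \<in> root_ideal d a" "x - y \<in> root_ideal d a" if xy: "x \<in> root_ideal d a" "y \<in> root_ideal d a" for x y
 proof -
  obtain m n m' n' where x: "x = of_int m + of_int n * om" "int d dvd m + n * a"
   and y: "y = of_int m' + of_int n' * om" "int d dvd m' + n' * a" using xy unfolding root_ideal_def by blast
  have e: "x + y = of_int (m + m') + of_int (n + n') * om" "x - y = of_int (m - m') + of_int (n - n') * om"
   unfolding x y by (simp_all add: algebra_simps)
  have "int d dvd (m + m') + (n + n') * a" "int d dvd (m - m') + (n - n') * a"
   using dvd_add[OF x(2) y(2)] dvd_diff[OF x(2) y(2)] by (simp_all add: algebra_simps)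
  then show "x + y \<in> root_ideal d a" "x - y \<in> root_ideal d a" unfolding e root_ideal_iff .
 qed
 have eq: "(%h. h + x) ` root_ideal d a = (%h. h + y) ` root_ideal d a \<longleftrightarrow> x - y \<in> root_ideal d a" for x y
 proof
  assume e: "(%h. h + x) ` root_ideal d a = (%h. h + y) ` root_ideal d a"
  have "0 \<in> root_ideal d a" using root_ideal_int[of 0] by simp
  then have "x \<in> (%h. h + x) ` root_ideal d a" by force
  then obtain h where "h \<in> root_ideal d a" "x = h + y" unfolding e by blast
  then show "x - y \<in> root_ideal d a" by simp
 next
  assume e: "x - y \<in> root_ideal d a"
  show "(%h. h + x) ` root_ideal d a = (%h. h + y) ` root_ideal d a"
  proof (intro equalityI subsetI)
   fix z assume "z \<in> (%h. h + x) ` root_ideal d a"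
   then obtain h where h: "h \<in> root_ideal d a" "z = h + x" by blast
   then have "z = (h + (x - y)) + y" by simp
   then show "z \<in> (%h. h + y) ` root_ideal d a" using closed(1)[OF h(1) e] by blast
  next
   fix z assume "z \<in> (%h. h + y) ` root_ideal d a"
   then obtain h where h: "h \<in> root_ideal d a" "z = h + y" by blast
   then have "z = (h - (x - y)) + x" by simp
   then show "z \<in> (%h. h + x) ` root_ideal d a" using closed(2)[OF h(1) e] by blast
  qed
 qed
 show "(%h. h + of_int i) ` root_ideal d a = (%h. h + of_int j) ` root_ideal d a \<longleftrightarrow> int d dvd i - j"
  unfolding eq using root_ideal_int[of "i - j"] by simp
 show "a_rcosets\<^bsub>RR\<^esub> (root_ideal d a) = (%j. (%h. h + of_int j) ` root_ideal d a) ` {j. True}"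
  unfolding rcosets_eq
 proof (intro equalityI subsetI)
  fix c assume "c \<in> (%x. (%h. h + x) ` root_ideal d a) ` Od"
  then obtain x where x: "x \<in> Od" "c = (%h. h + x) ` root_ideal d a" by blast
  obtain m n where mn: "x = of_int m + of_int n * om" using x(1) by (elim Od_cases)
  have "x - of_int (m + n * a) = of_int (- n * a) + of_int n * om" unfolding mn by simp
  then have "x - of_int (m + n * a) \<in> root_ideal d a" by (simp only: root_ideal_iff) simp
  then have "c = (%h. h + of_int (m + n * a)) ` root_ideal d a" unfolding x(2) eq .
  then show "c \<in> (%j. (%h. h + of_int j) ` root_ideal d a) ` {j. True}" by blast
 qed auto
qed

text \<open>
  Modulo the ideal, \<open>om\<close> is congruent to an integer, so \<open>0, \<dots>, d - 1\<close> represent all cosets.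
\<close>

lemma ideal_norm_root_ideal:
 assumes "d = 0 \<or> int d dvd minpol a"
 shows "ideal_norm D (root_ideal d a) = d"
proof (cases "d = 0")
 case True
 have "~ finite (a_rcosets\<^bsub>RR\<^esub> (root_ideal d a))"
 proof
  assume "finite (a_rcosets\<^bsub>RR\<^esub> (root_ideal d a))"
  moreover have "inj_on (%j. (%h. h + of_int j) ` root_ideal d a) {j. True}"
   using rcosets_root_ideal(2)[OF assms] True by (intro inj_onI) simp
  ultimately have "finite {j :: int. True}"
   unfolding rcosets_root_ideal(1)[OF assms] by (rule finite_imageD)
  then show False by simp
 qed
 then show ?thesis unfolding ideal_norm_def using True by simp
next
 case False
 have "a_rcosets\<^bsub>RR\<^esub> (root_ideal d a) = (%j. (%h. h + of_int j) ` root_ideal d a) ` {0..<int d}"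
  unfolding rcosets_root_ideal(1)[OF assms]
 proof (intro equalityI subsetI)
  fix c assume "c \<in> (%j. (%h. h + of_int j) ` root_ideal d a) ` {j. True}"
  then obtain j where "c = (%h. h + of_int j) ` root_ideal d a" by blast
  also have "\<dots> = (%h. h + of_int (j mod int d)) ` root_ideal d a"
   unfolding rcosets_root_ideal(2)[OF assms] by simp
  finally show "c \<in> (%j. (%h. h + of_int j) ` root_ideal d a) ` {0..<int d}" using False by auto
 qed auto
 moreover have "inj_on (%j. (%h. h + of_int j) ` root_ideal d a) {0..<int d}"
 proof (rule inj_onI)
  fix i j assume ij: "i \<in> {0..<int d}" "j \<in> {0..<int d}"
   "(%h. h + of_int i) ` root_ideal d a = (%h. h + of_int j) ` root_ideal d a"
  have "i mod int d = j mod int d"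
   using ij(3) unfolding rcosets_root_ideal(2)[OF assms] mod_eq_dvd_iff .
  then show "i = j" using ij(1,2) by (metis atLeastLessThan_iff mod_pos_pos_trivial)
 qed
 ultimately show ?thesis unfolding ideal_norm_def by (simp add: card_image)
qed

lemma primitive_root_ideal:
 assumes "d > 0" "int d dvd minpol a" shows "root_ideal d a \<in> primitive_ideals D d"
proof -
 have "m = 1 \<or> m = - 1" if m: "m ~= 0 & (\<forall>x\<in>root_ideal d a. x / of_int m \<in> Od)" for m :: int
 proof -
  have "om - of_int a \<in> root_ideal d a" using root_ideal_om by simp
  then have "(om - of_int a) / of_int m \<in> Od" using m by blast
  then obtain k l where "(om - of_int a) / of_int m = of_int k + of_int l * om" by (elim Od_cases)
  then have "of_int (- a) + of_int 1 * om = of_int (m * k) + of_int (m * l) * om" using m by (simp add: field_simps)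
  then have "1 = m * l" using om_coords_unique by blast
  then show ?thesis by (metis zmult_eq_1_iff)
 qed
 then show ?thesis
  unfolding primitive_ideals_def primitive_ideal_def
  using ideal_root_ideal[OF assms(2)] ideal_norm_root_ideal assms by blast
qed

text \<open>
  The integers \<open>n\<close> that occur as \<open>om\<close>-coordinates of elements of the ideal form a group; its generator
  divides the whole ideal because the ideal is stable under \<open>om\<close>, hence is 1 by primitivity. This yields
  an element \<open>om - a\<close>, and the integers in the ideal are the multiples of its norm.
\<close>

lemma primitive_ideal_is_root_ideal:
 assumes "d > 0" "\<aa> \<in> primitive_ideals D d"
 shows "EX a. int d dvd minpol a & \<aa> = root_ideal d a"
proof -
 have idl: "ideal \<aa> RR" and prim: "!!m::int. m ~= 0 ==> \<forall>x\<in>\<aa>. x / of_int m \<in> Od ==> m = 1 \<or> m = - 1"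
  and nrm: "ideal_norm D \<aa> = d"
  using assms(2) unfolding primitive_ideals_def primitive_ideal_def by auto
 note cl = RR_ideal_closed[OF idl]
 obtain e where e: "e \<ge> 0" "of_int e \<in> \<aa>" "!!x. of_int x \<in> \<aa> ==> e dvd x"
  using int_subgroup_generator[of "{x. of_int x \<in> \<aa>}"] cl by auto
 obtain g where g: "g \<ge> 0" "EX m. of_int m + of_int g * om \<in> \<aa>"
  "!!m n. of_int m + of_int n * om \<in> \<aa> ==> g dvd n"
 proof (rule int_subgroup_generator[of "{n. EX m. of_int m + of_int n * om \<in> \<aa>}"])
  show "0 \<in> {n. EX m. of_int m + of_int n * om \<in> \<aa>}" using cl(2) by (auto intro: exI[of _ 0])
  fix x y assume "x \<in> {n. EX m. of_int m + of_int n * om \<in> \<aa>}" "y \<in> {n. EX m. of_int m + of_int n * om \<in> \<aa>}"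
  then obtain k l where kl: "of_int k + of_int x * om \<in> \<aa>" "of_int l + of_int y * om \<in> \<aa>" by blast
  have "of_int (k - l) + of_int (x - y) * om \<in> \<aa>"
   using cl(4)[OF kl] by (simp add: algebra_simps)
  then show "x - y \<in> {n. EX m. of_int m + of_int n * om \<in> \<aa>}" by blast
 next
  fix g assume "g \<ge> 0" "g \<in> {n. EX m. of_int m + of_int n * om \<in> \<aa>}"
   "!!x. x \<in> {n. EX m. of_int m + of_int n * om \<in> \<aa>} ==> g dvd x"
  then show thesis by (intro that[of g]) auto
 qed
 have gm: "g dvd m" if "of_int m + of_int n * om \<in> \<aa>" for m n
 proof -
  have "(of_int 0 + of_int 1 * om) * (of_int m + of_int n * om) \<in> \<aa>" using cl(5)[OF that, of om] by simp
  then have "g dvd 0 * n + 1 * m + 1 * n * int D" unfolding om_mult by (rule g(3))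
  then have "g dvd m + n * int D" by simp
  moreover have "g dvd n" using g(3) that by blast
  ultimately show ?thesis by (simp add: dvd_add_left_iff)
 qed
 have sub: "x / of_int g \<in> Od" if xg: "x \<in> \<aa>" "g ~= 0" for x
 proof -
  obtain m n where mn: "x = of_int m + of_int n * om" using cl(1) xg by (meson Od_cases subsetD)
  obtain k l where "m = g * k" "n = g * l" using gm g(3) xg(1) unfolding mn by (metis dvdE)
  then have "x / of_int g = of_int k + of_int l * om" unfolding mn using xg(2) by (simp add: field_simps)
  then show ?thesis using Od_intro by simp
 qed
 have g1: "g = 1"
 proof (cases "g = 0")
  case True
  have "x / of_int 2 \<in> Od" if xa: "x \<in> \<aa>" for x
  proof -
   obtain m n where mn: "x = of_int m + of_int n * om" using cl(1) xa by (meson Od_cases subsetD)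
   have "m = 0" "n = 0" using gm[of m n] g(3)[of m n] xa True unfolding mn by auto
   then have "x = 0" using mn by simp
   then show ?thesis by simp
  qed
  then show ?thesis using prim[of 2] by simp
 next
  case False
  then show ?thesis using prim[of g] sub g(1) by auto
 qed
 obtain m0 where m0: "of_int m0 + of_int 1 * om \<in> \<aa>" using g(2) g1 by blast
 define a where "a = - m0"
 have pia: "om - of_int a \<in> \<aa>" using m0 unfolding a_def by (simp add: add.commute)
 have "of_int (minpol a) \<in> \<aa>" unfolding minpol_factor[symmetric] using cl(6)[OF pia] by simp
 then have ed: "e dvd minpol a" by (rule e(3))
 have eq: "\<aa> = root_ideal (nat e) a"
 proof (intro equalityI subsetI)
  fix x assume x: "x \<in> \<aa>"
  obtain m n where mn: "x = of_int m + of_int n * om" using cl(1) x by (meson Od_cases subsetD)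
  have "x - of_int n * (om - of_int a) \<in> \<aa>" using x pia cl(4,5) by simp
  also have "x - of_int n * (om - of_int a) = of_int (m + n * a)" unfolding mn by (simp add: algebra_simps)
  finally have "e dvd m + n * a" by (rule e(3))
  then show "x \<in> root_ideal (nat e) a" unfolding mn root_ideal_iff using e(1) by simp
 next
  fix x assume "x \<in> root_ideal (nat e) a"
  then obtain k n where "x = real (nat e) * of_int k + of_int n * (om - of_int a)" by (rule root_idealE)
  then have "x = of_int k * of_int e + of_int n * (om - of_int a)" using e(1) by simp
  then show "x \<in> \<aa>" using e(2) pia cl(3,5) by simp
 qed
 have "ideal_norm D \<aa> = nat e" unfolding eq by (rule ideal_norm_root_ideal) (use ed e(1) in simp)
 then have "nat e = d" using nrm by simp
 then show ?thesis using eq ed e(1) by (intro exI[of _ a]) auto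
qed

theorem primitive_ideals_eq:
 assumes "d > 0" shows "bij_betw (root_ideal d) (roots_mod d) (primitive_ideals D d)"
proof (rule bij_betw_imageI)
 show "inj_on (root_ideal d) (roots_mod d)"
 proof (rule inj_onI)
  fix a b assume ab: "a \<in> roots_mod d" "b \<in> roots_mod d" "root_ideal d a = root_ideal d b"
  have "om - of_int a \<in> root_ideal d b" unfolding ab(3)[symmetric] root_ideal_om by simp
  then have "b mod int d = a mod int d" unfolding root_ideal_om by (simp add: mod_eq_dvd_iff)
  then show "a = b" using ab unfolding roots_mod_def by simp
 qed
 show "root_ideal d ` roots_mod d = primitive_ideals D d"
 proof (intro equalityI subsetI)
  fix x assume "x \<in> root_ideal d ` roots_mod d"
  then show "x \<in> primitive_ideals D d" using primitive_root_ideal[OF assms] unfolding roots_mod_def by auto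
 next
  fix x assume "x \<in> primitive_ideals D d"
  then obtain a where a: "int d dvd minpol a" "x = root_ideal d a" using primitive_ideal_is_root_ideal assms by blast
  have "a mod int d \<in> roots_mod d" unfolding roots_mod_def using a(1) assms by (simp add: minpol_dvd_mod)
  moreover have "root_ideal d (a mod int d) = x"
  proof -
   have "int d dvd m + n * (a mod int d) \<longleftrightarrow> int d dvd m + n * a" for m n
   proof -
   have "(m + n * a) - (m + n * (a mod int d)) = int d * (n * (a div int d))"
   by (simp add: minus_mult_div_eq_mod[symmetric] algebra_simps)
   then have "int d dvd (m + n * a) - (m + n * (a mod int d))" by simp
   then show ?thesis by (metis diff_add_cancel dvd_add_right_iff)
   qed
   then show ?thesis unfolding a(2) root_ideal_def by simp
  qed
  ultimately show "x \<in> root_ideal d ` roots_mod d" by blast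
 qed
qed

lemma smart_basis_exists:
 assumes "d > 0" "\<aa> \<in> primitive_ideals D d" shows "\<exists>\<eta>1 \<eta>2. smart_basis D d \<aa> \<eta>1 \<eta>2"
proof -
 obtain a where a: "int d dvd minpol a" "\<aa> = root_ideal d a" using primitive_ideal_is_root_ideal assms by blast
 have "is_zbasis [- 1, cj om - of_int a] Od"
  unfolding is_zbasis2_iff
 proof (intro conjI equalityI subsetI allI impI)
  fix x assume "x \<in> Od"
  then obtain m n where "x = of_int m + of_int n * om" by (elim Od_cases)
  then have "x = of_int (- m - n * int D + n * a) * - 1 + of_int (- n) * (cj om - of_int a)"
   unfolding cj_om by (simp add: algebra_simps)
  then show "x \<in> {of_int m * - 1 + of_int n * (cj om - of_int a) | m n. True}" by blast
 next
  fix m n assume "of_int m * - 1 + of_int n * (cj om - of_int a) = 0"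
  then have "of_int (- m + n * int D - n * a) + of_int (- n) * om = 0" unfolding cj_om by (simp add: algebra_simps)
  from om_coords_zero[OF this] show "m = 0" "n = 0" by auto
 qed auto
 moreover have "(- 1) * cj (cj om - of_int a) - cj (- 1) * (cj om - of_int a) = - s"
  using om_diff by simp
 moreover have "is_zbasis [cj (cj om - of_int a), real d * cj (- 1)] \<aa>"
  unfolding is_zbasis2_iff a(2)
 proof (intro conjI equalityI subsetI allI impI)
  fix x assume "x \<in> root_ideal d a"
  then obtain k n where "x = real d * of_int k + of_int n * (om - of_int a)" by (rule root_idealE)
  then have "x = of_int n * cj (cj om - of_int a) + of_int (- k) * (real d * cj (- 1))" by simp
  then show "x \<in> {of_int m * cj (cj om - of_int a) + of_int n * (real d * cj (- 1)) | m n. True}" by blast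
 next
  fix x assume "x \<in> {of_int m * cj (cj om - of_int a) + of_int n * (real d * cj (- 1)) | m n. True}"
  then obtain m n where "x = of_int m * cj (cj om - of_int a) + of_int n * (real d * cj (- 1))" by blast
  then have "x = of_int (- m * a - n * int d) + of_int m * om" by (simp add: algebra_simps)
  moreover have "int d dvd (- m * a - n * int d) + m * a" by simp
  ultimately show "x \<in> root_ideal d a" using root_ideal_iff by blast
 next
  fix m n assume "of_int m * cj (cj om - of_int a) + of_int n * (real d * cj (- 1)) = 0"
  then have "of_int (- m * a - n * int d) + of_int m * om = 0" by (simp add: algebra_simps)
  from om_coords_zero[OF this] show "m = 0" "n = 0" using assms by auto
 qed
 ultimately show ?thesis unfolding smart_basis_def by blast
qed

end

text \<open>
  The arithmetic data on which the family of period matrices depends.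
\<close>

locale smart = real_quadratic +
 fixes d :: nat and \<aa> :: "real set" and \<eta>1 \<eta>2 :: real
 assumes d_pos: "d > 0" and prim: "\<aa> \<in> primitive_ideals D d" and smart: "smart_basis D d \<aa> \<eta>1 \<eta>2"
begin

lemma idl: "ideal \<aa> RR" using prim unfolding primitive_ideals_def primitive_ideal_def by simp

lemma eta_det: "\<eta>1 * cj \<eta>2 - cj \<eta>1 * \<eta>2 = - s"
 using smart unfolding smart_basis_def by blast

lemma Od_eta: "Od = {of_int m * \<eta>1 + of_int n * \<eta>2 | m n. True}"
 and eta_indep: "of_int m * \<eta>1 + of_int n * \<eta>2 = 0 ==> m = 0 & n = 0"
 using smart unfolding smart_basis_def is_zbasis2_iff by auto

lemma aa_eta: "\<aa> = {of_int m * cj \<eta>2 + of_int n * (real d * cj \<eta>1) | m n. True}"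
 and aa_indep: "of_int m * cj \<eta>2 + of_int n * (real d * cj \<eta>1) = 0 ==> m = 0 & n = 0"
 using smart unfolding smart_basis_def is_zbasis2_iff by auto

lemma eta_Od [simp]: "\<eta>1 \<in> Od" "\<eta>2 \<in> Od"
 unfolding Od_eta by (rule CollectI, rule exI[of _ 1], rule exI[of _ 0], simp)
  (rule CollectI, rule exI[of _ 0], rule exI[of _ 1], simp)

lemma eta_KK [simp]: "\<eta>1 \<in> KK" "\<eta>2 \<in> KK" by simp_all

lemma eta_ne [simp]: "\<eta>1 ~= 0" "\<eta>2 ~= 0" "cj \<eta>1 ~= 0" "cj \<eta>2 ~= 0"
 using eta_indep[of 1 0] eta_indep[of 0 1] by auto

lemma aa_Od: "x \<in> \<aa> ==> x \<in> Od" using RR_ideal_closed(1)[OF idl] by blast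

lemma d_ne [simp]: "real d ~= 0" using d_pos by simp

lemma eta_aa [simp]: "cj \<eta>2 \<in> \<aa>" "real d * cj \<eta>1 \<in> \<aa>"
 unfolding aa_eta by (rule CollectI, rule exI[of _ 1], rule exI[of _ 0], simp)
  (rule CollectI, rule exI[of _ 0], rule exI[of _ 1], simp)

lemma Od_cj_eta: "x \<in> Od ==> EX m n. x = of_int m * cj \<eta>1 + of_int n * cj \<eta>2"
proof -
 assume x: "x \<in> Od"
 then have "cj x \<in> Od" by simp
 then obtain m n where mn: "cj x = of_int m * \<eta>1 + of_int n * \<eta>2" unfolding Od_eta by blast
 have "x = cj (cj x)" using x by simp
 also have "\<dots> = of_int m * cj \<eta>1 + of_int n * cj \<eta>2" unfolding mn by simp
 finally show ?thesis by blast
qed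

lemma int_in_aa: "of_int k \<in> \<aa> \<longleftrightarrow> int d dvd k"
 using primitive_ideal_is_root_ideal[OF d_pos prim] root_ideal_int by blast

lemma Od_norm_int: assumes "x \<in> Od" shows "\<exists>k::int. x * cj x = of_int k"
proof -
 obtain m n where "x = of_int m + of_int n * om" using assms by (elim Od_cases)
 then show ?thesis using onorm_real[of m n] by blast
qed

lemma cj_eta1_mult_in_aa: assumes "x \<in> Od" shows "cj \<eta>1 * x \<in> \<aa> \<longleftrightarrow> x \<in> \<aa>"
proof
 assume "cj \<eta>1 * x \<in> \<aa>"
 obtain u v where uv: "1 = of_int u * cj \<eta>1 + of_int v * cj \<eta>2" using Od_cj_eta[of 1] by auto
 have "x = (of_int u * cj \<eta>1 + of_int v * cj \<eta>2) * x" using uv by simp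
 also have "\<dots> = of_int u * (cj \<eta>1 * x) + (of_int v * x) * cj \<eta>2" by (simp add: algebra_simps)
 finally have e: "x = of_int u * (cj \<eta>1 * x) + (of_int v * x) * cj \<eta>2" .
 have "of_int u * (cj \<eta>1 * x) + (of_int v * x) * cj \<eta>2 \<in> \<aa>"
  using \<open>cj \<eta>1 * x \<in> \<aa>\<close> RR_ideal_closed(3,5)[OF idl] assms eta_aa by simp
 then show "x \<in> \<aa>" using e by simp
next
 assume "x \<in> \<aa>"
 then show "cj \<eta>1 * x \<in> \<aa>" using RR_ideal_closed(5)[OF idl] by simp
qed

text \<open>
  Multiplication by \<open>\<eta>2\<close> (here) and by the conjugate of \<open>\<eta>1\<close> (above) detects membership in the ideal.
  The vectors with coordinates \<open>\<eta>2\<close> and \<open>d \<eta>1\<^sup>\<sigma>/\<surd>D\<close> generate, modulo \<open>d\<close>, the radical of the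
  polarization modulo \<open>d\<close>, which is why the ideal is an invariant of the lattice.
\<close>

lemma eta2_mult_in_d: assumes "x \<in> Od" shows "\<eta>2 * x \<in> (%y. real d * y) ` Od \<longleftrightarrow> x \<in> \<aa>"
proof
 assume "x \<in> \<aa>"
 then obtain m n where x: "x = of_int m * cj \<eta>2 + of_int n * (real d * cj \<eta>1)" unfolding aa_eta by blast
 obtain k where k: "\<eta>2 * cj \<eta>2 = of_int k" using Od_norm_int[of \<eta>2] by auto
 have "of_int k \<in> \<aa>" unfolding k[symmetric] using RR_ideal_closed(5)[OF idl] by simp
 then obtain l where "k = int d * l" unfolding int_in_aa by (auto elim: dvdE)
 then have l: "\<eta>2 * cj \<eta>2 = real d * of_int l" using k by simp
 have "\<eta>2 * x = of_int m * (\<eta>2 * cj \<eta>2) + real d * (of_int n * \<eta>2 * cj \<eta>1)" unfolding x by (simp add: algebra_simps)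
 also have "\<dots> = real d * (of_int m * of_int l + of_int n * \<eta>2 * cj \<eta>1)" unfolding l by (simp add: algebra_simps)
 finally show "\<eta>2 * x \<in> (%y. real d * y) ` Od" by auto
next
 assume "\<eta>2 * x \<in> (%y. real d * y) ` Od"
 then obtain y where y: "y \<in> Od" "\<eta>2 * x = real d * y" by blast
 obtain n m where x: "x = of_int n * cj \<eta>1 + of_int m * cj \<eta>2" using Od_cj_eta[OF assms] by blast
 have "cj \<eta>2 \<in> \<aa>" by simp
 obtain k where k: "\<eta>2 * cj \<eta>2 = of_int k" using Od_norm_int[of \<eta>2] by auto
 have "of_int k \<in> \<aa>" unfolding k[symmetric] using RR_ideal_closed(5)[OF idl] by simp
 then obtain l where l: "k = int d * l" unfolding int_in_aa by (auto elim: dvdE)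
 have "of_int n * (cj \<eta>1 * \<eta>2) = \<eta>2 * x - of_int m * (\<eta>2 * cj \<eta>2)" unfolding x by (simp add: algebra_simps)
 also have "\<dots> = real d * (y - of_int (m * l))" unfolding y k l by (simp add: algebra_simps)
 finally have e: "of_int n * (cj \<eta>1 * \<eta>2) = real d * (y - of_int (m * l))" .
 have "cj \<eta>1 * \<eta>2 \<in> Od" by simp
 then obtain u w where uw: "cj \<eta>1 * \<eta>2 = of_int u + of_int w * om" by (elim Od_cases)
 have "cj \<eta>1 * \<eta>2 - cj (cj \<eta>1 * \<eta>2) = s" using eta_det by simp
 then have "of_int w * (om - cj om) = s" unfolding uw by (simp add: algebra_simps)
 then have w: "w = 1" unfolding om_diff using s_ne by simp
 have "y - of_int (m * l) \<in> Od" using y(1) by simp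
 then obtain u' w' where "y - of_int (m * l) = of_int u' + of_int w' * om" by (elim Od_cases)
 then have "of_int (n * u) + of_int n * om = of_int (int d * u') + of_int (int d * w') * om"
  using e unfolding uw w by (simp add: algebra_simps)
 then have "n = int d * w'" using om_coords_unique by blast
 then have "x = of_int m * cj \<eta>2 + of_int w' * (real d * cj \<eta>1)" unfolding x by simp
 then show "x \<in> \<aa>" unfolding aa_eta by blast
qed

text \<open>
  The multipliers of the ideal form an order. It can exceed the given order only at primes dividing the
  conductor, while \<open>d\<close> lies in the ideal; coprimality of \<open>d\<close> to the conductor settles the claim.
\<close>

lemma multiplier_in_Od:
 assumes cop: "coprime d (conductor D)" and r: "r \<in> KK" "!!x. x \<in> \<aa> ==> r * x \<in> \<aa>"
 shows "r \<in> Od"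
proof -
 obtain \<alpha> \<beta> where 1: "r * cj \<eta>2 = of_int \<alpha> * cj \<eta>2 + of_int \<beta> * (real d * cj \<eta>1)"
  using r(2)[OF eta_aa(1)] unfolding aa_eta by blast
 obtain \<gamma> \<delta> where 2: "r * (real d * cj \<eta>1) = of_int \<gamma> * cj \<eta>2 + of_int \<delta> * (real d * cj \<eta>1)"
  using r(2)[OF eta_aa(2)] unfolding aa_eta by blast
 have "cj \<eta>2 * ((r - of_int \<alpha>) * (r - of_int \<delta>)) = ((r - of_int \<alpha>) * cj \<eta>2) * (r - of_int \<delta>)" by simp
 also have "\<dots> = of_int \<beta> * ((r - of_int \<delta>) * (real d * cj \<eta>1))" using 1 by (simp add: algebra_simps)
 also have "\<dots> = of_int \<beta> * (of_int \<gamma> * cj \<eta>2)" using 2 by (simp add: algebra_simps)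
 finally have "cj \<eta>2 * ((r - of_int \<alpha>) * (r - of_int \<delta>)) = cj \<eta>2 * (of_int \<beta> * of_int \<gamma>)" by simp
 then have root: "(r - of_int \<alpha>) * (r - of_int \<delta>) = of_int (\<beta> * \<gamma>)" by simp
 have "algebraic_int r"
 proof (rule algebraic_int.intros)
  let ?p = "[: of_int (\<alpha> * \<delta> - \<beta> * \<gamma>), of_int (- \<alpha> - \<delta>), 1 :] :: real poly"
  show "lead_coeff ?p = 1" by simp
  show "ALL i. coeff ?p i \<in> \<int>" unfolding coeff_pCons by (auto split: nat.splits)
  show "poly ?p r = 0" using root by (simp add: algebra_simps)
 qed
 then have f: "real (conductor D) * r \<in> Od"
  using algebraic_int_trace_norm[OF r(1)] conductor_mult_integral[OF r(1)] by blast
 have "real d \<in> \<aa>" using int_in_aa[of "int d"] by simp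
 then have dd: "real d * r \<in> Od" using r(2) aa_Od by (metis mult.commute)
 have "coprime (int d) (int (conductor D))" using cop by simp
 then obtain k l where "k * int d + l * int (conductor D) = 1"
  using bezout_int[of "int d" "int (conductor D)"] by (metis coprime_imp_gcd_eq_1)
 then have "real_of_int (k * int d + l * int (conductor D)) = 1" by simp
 then have "(of_int k * real d + of_int l * real (conductor D)) * r = r" by simp
 then have "r = of_int k * (real d * r) + of_int l * (real (conductor D) * r)" by (simp add: algebra_simps)
 then show ?thesis using f dd by (metis Od_add Od_int(1) Od_mult)
qed

end

section \<open>Hermitian forms and lattices\<close>

abbreviation zscale :: "int => 'a::real_vector => 'a" (infixr \<open>*.\<close> 75) where
 "k *. x \<equiv> real_of_int k *\<^sub>R x"

lemma scaleR_eq_smult: "r *\<^sub>R (x :: complex ^ 'n) = of_real r *s x"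
 by (simp add: vec_eq_iff complex_eq_iff)

lemma smult_scaleR: "c *s (r *\<^sub>R (x :: complex ^ 'n)) = r *\<^sub>R (c *s x)"
 by (simp add: vec_eq_iff)

lemma zspan_add: assumes "x \<in> zspan bs" "y \<in> zspan bs" shows "x + y \<in> zspan bs"
proof -
 obtain c c' where "x = (\<Sum>i<length bs. c i *. bs ! i)" "y = (\<Sum>i<length bs. c' i *. bs ! i)"
  using assms unfolding zspan_def by blast
 then have "x + y = (\<Sum>i<length bs. (c i + c' i) *. bs ! i)"
  by (simp add: sum.distrib scaleR_add_left)
 then show ?thesis unfolding zspan_def by (intro CollectI exI[of _ "%i. c i + c' i"]) simp
qed

lemma zspan_zscale: assumes "x \<in> zspan bs" shows "k *. x \<in> zspan bs"
proof -
 obtain c where "x = (\<Sum>i<length bs. c i *. bs ! i)" using assms unfolding zspan_def by blast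
 then have "k *. x = (\<Sum>i<length bs. (k * c i) *. bs ! i)" by (simp add: scaleR_sum_right)
 then show ?thesis unfolding zspan_def by (intro CollectI exI[of _ "%i. k * c i"]) simp
qed

lemma zspan_Cons_iff: "x \<in> zspan (b # bs) \<longleftrightarrow> (EX c. x - c *. b \<in> zspan bs)"
proof
 assume "x \<in> zspan (b # bs)"
 then obtain c v where "x = c *. b + v" "v \<in> zspan bs" unfolding zspan_Cons by blast
 then show "EX c. x - c *. b \<in> zspan bs" by (intro exI[of _ c]) simp
next
 assume "EX c. x - c *. b \<in> zspan bs"
 then obtain c where c: "x - c *. b \<in> zspan bs" by blast
 have "x = c *. b + (x - c *. b)" by simp
 then show "x \<in> zspan (b # bs)" unfolding zspan_Cons using c by blast
qed

lemma zspan4: "zspan [a, b, c, e] = {n1 *. a + n2 *. b + n3 *. c + n4 *. e | n1 n2 n3 n4. True}"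
 by (simp only: set_eq_iff zspan_Cons_iff zspan_Nil singleton_iff mem_Collect_eq diff_diff_eq right_minus_eq simp_thms)

lemma zspan6: "zspan [a1, a2, a3, a4, a5, a6] =
  {n1 *. a1 + n2 *. a2 + n3 *. a3 + n4 *. a4 + n5 *. a5 + n6 *. a6 | n1 n2 n3 n4 n5 n6. True}"
 by (simp only: set_eq_iff zspan_Cons_iff zspan_Nil singleton_iff mem_Collect_eq diff_diff_eq right_minus_eq simp_thms)

locale hermitian_form =
 fixes H :: "complex ^ 'n => complex ^ 'n => complex"
 assumes herm: "hermitian H"
begin

definition E :: "complex ^ 'n => complex ^ 'n => real" where "E x y = Im (H x y)"

lemma H_add_l: "H (x + y) z = H x z + H y z" and H_smult_l: "H (c *s x) y = c * H x y"
 and H_cnj: "H y x = cnj (H x y)"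
 using herm unfolding hermitian_def by blast+

lemma H_add_r: "H x (y + z) = H x y + H x z"
 using H_add_l[of y z x] H_cnj by (metis complex_cnj_add)
lemma H_smult_r: "H x (c *s y) = cnj c * H x y"
 using H_smult_l[of c y x] H_cnj by (metis complex_cnj_mult)
lemma H_scaleR_l: "H (r *\<^sub>R x) y = of_real r * H x y" and H_scaleR_r: "H x (r *\<^sub>R y) = of_real r * H x y"
 by (simp_all add: scaleR_eq_smult H_smult_l H_smult_r)
lemma H_0_l [simp]: "H 0 y = 0" and H_0_r [simp]: "H x 0 = 0"
 using H_scaleR_l[of 0 0 y] H_scaleR_r[of x 0 0] by simp_all
lemma H_minus_l: "H (- x) y = - H x y" and H_minus_r: "H x (- y) = - H x y"
 using H_scaleR_l[of "-1" x y] H_scaleR_r[of x "-1" y] by simp_all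
lemma H_diff_l: "H (x - y) z = H x z - H y z" and H_diff_r: "H z (x - y) = H z x - H z y"
 using H_add_l[of x "- y" z] H_add_r[of z x "- y"] by (simp_all add: H_minus_l H_minus_r)

lemmas H_bilinear = H_add_l H_add_r H_smult_l H_smult_r H_scaleR_l H_scaleR_r H_minus_l H_minus_r H_diff_l H_diff_r

lemma E_add_l: "E (x + y) z = E x z + E y z" and E_add_r: "E x (y + z) = E x y + E x z"
 and E_scaleR_l: "E (r *\<^sub>R x) y = r * E x y" and E_scaleR_r: "E x (r *\<^sub>R y) = r * E x y"
 and E_minus_l: "E (- x) y = - E x y" and E_minus_r: "E x (- y) = - E x y"
 and E_diff_l: "E (x - y) z = E x z - E y z" and E_diff_r: "E z (x - y) = E z x - E z y"
 and E_0 [simp]: "E 0 y = 0" "E x 0 = 0"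
 unfolding E_def by (simp_all add: H_bilinear)

lemmas E_bilinear = E_add_l E_add_r E_scaleR_l E_scaleR_r E_minus_l E_minus_r E_diff_l E_diff_r

lemma E_anti: "E y x = - E x y"
 unfolding E_def by (subst H_cnj) simp
lemma E_self [simp]: "E x x = 0" using E_anti[of x x] by simp

text \<open>
  The alternating form determines the Hermitian form.
\<close>

lemma H_via_E: "H x y = of_real (E (\<i> *s x) y) + \<i> * of_real (E x y)"
 unfolding E_def H_smult_l by (simp add: complex_eq_iff)

end

lemma scaled_square_solve:
 fixes x y z w :: "'v :: real_vector"
 assumes "w = (a * a) *\<^sub>R x + (a * q) *\<^sub>R y + (a * q) *\<^sub>R y + (q * q) *\<^sub>R z"
  and "w = e *\<^sub>R (a *\<^sub>R x + q *\<^sub>R y) - n *\<^sub>R x"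
 shows "(q * q) *\<^sub>R z = (e * a - n - a * a) *\<^sub>R x + ((e - a - a) * q) *\<^sub>R y"
proof -
 have 1: "(q * q) *\<^sub>R z = w - (a * a) *\<^sub>R x - (a * q + a * q) *\<^sub>R y"
  unfolding assms(1) scaleR_add_left by simp
 show ?thesis by (simp only: 1 assms(2)) (simp add: algebra_simps)
qed

text \<open>
  The lattice of an Abelian variety with real multiplication, inside a complex subspace.
\<close>

locale rm_lattice = real_quadratic D + hermitian_form H
 for D :: nat and H :: "complex ^ 'n => complex ^ 'n => complex" +
 fixes W \<Lambda> :: "(complex ^ 'n) set" and \<rho> :: "real => complex ^ 'n => complex ^ 'n"
 assumes W: "vec.subspace W" and lat_W: "\<Lambda> \<subseteq> W" and rm: "real_multiplication D W \<Lambda> H \<rho>"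
begin

lemma rho_hom: "\<rho> \<in> ring_hom RR (torus_End W \<Lambda>)"
 by (rule rm[unfolded real_multiplication_def, THEN conjunct1])

lemma rho_End: "k \<in> Od ==> \<rho> k \<in> carrier (torus_End W \<Lambda>)"
 using ring_hom_memE(1)[OF rho_hom, of k] by simp

lemma W_add: "x \<in> W ==> y \<in> W ==> x + y \<in> W" and W_smult: "x \<in> W ==> c *s x \<in> W"
 and W_scaleR: "x \<in> W ==> r *\<^sub>R x \<in> W" and W_0: "0 \<in> W"
 using W by (auto simp: vec.subspace_add vec.subspace_scale scaleR_eq_smult vec.subspace_0)

lemma rho_End_facts:
 assumes "k \<in> Od"
 shows "\<rho> k \<in> W \<rightarrow>\<^sub>E W" "!!x y. x \<in> W ==> y \<in> W ==> \<rho> k (x + y) = \<rho> k x + \<rho> k y"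
  "!!c x. x \<in> W ==> \<rho> k (c *s x) = c *s \<rho> k x" "!!x. x \<in> \<Lambda> ==> \<rho> k x \<in> \<Lambda>"
proof -
 have "\<rho> k \<in> W \<rightarrow>\<^sub>E W & (\<forall>x\<in>W. \<forall>y\<in>W. \<rho> k (x + y) = \<rho> k x + \<rho> k y) &
   (ALL c. \<forall>x\<in>W. \<rho> k (c *s x) = c *s \<rho> k x) & \<rho> k ` \<Lambda> \<subseteq> \<Lambda>"
  using rho_End[OF assms] unfolding torus_End_def partial_object.select_convs mem_Collect_eq .
 then show "\<rho> k \<in> W \<rightarrow>\<^sub>E W" "!!x y. x \<in> W ==> y \<in> W ==> \<rho> k (x + y) = \<rho> k x + \<rho> k y"
  "!!c x. x \<in> W ==> \<rho> k (c *s x) = c *s \<rho> k x" "!!x. x \<in> \<Lambda> ==> \<rho> k x \<in> \<Lambda>"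
  by blast+
qed

lemma rho_W: "k \<in> Od ==> x \<in> W ==> \<rho> k x \<in> W"
 and rho_lat: "k \<in> Od ==> x \<in> \<Lambda> ==> \<rho> k x \<in> \<Lambda>"
 and rho_addv: "k \<in> Od ==> x \<in> W ==> y \<in> W ==> \<rho> k (x + y) = \<rho> k x + \<rho> k y"
 and rho_smult: "k \<in> Od ==> x \<in> W ==> \<rho> k (c *s x) = c *s \<rho> k x"
 using rho_End_facts[of k] by (blast dest: PiE_mem)+

lemma rho_scaleR: "k \<in> Od ==> x \<in> W ==> \<rho> k (r *\<^sub>R x) = r *\<^sub>R \<rho> k x"
 by (simp add: scaleR_eq_smult rho_smult)

lemma rho_add: "k \<in> Od ==> l \<in> Od ==> x \<in> W ==> \<rho> (k + l) x = \<rho> k x + \<rho> l x"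
 using ring_hom_memE(3)[OF rho_hom, of k l] unfolding torus_End_def by simp
lemma rho_mult: "k \<in> Od ==> l \<in> Od ==> x \<in> W ==> \<rho> (k * l) x = \<rho> k (\<rho> l x)"
 using ring_hom_memE(2)[OF rho_hom, of k l] unfolding torus_End_def by (simp add: compose_def)
lemma rho_one: "x \<in> W ==> \<rho> 1 x = x"
 using ring_hom_memE(4)[OF rho_hom] unfolding torus_End_def by simp
lemma rho_adj: "k \<in> Od ==> x \<in> W ==> y \<in> W ==> H (\<rho> k x) y = H x (\<rho> k y)"
 using rm[unfolded real_multiplication_def, THEN conjunct2, THEN conjunct2, THEN conjunct1] by blast

lemma rho_zero: "x \<in> W ==> \<rho> 0 x = 0"
 using rho_add[of 0 0 x] by simp
lemma rho_minus: "k \<in> Od ==> x \<in> W ==> \<rho> (- k) x = - \<rho> k x"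
 using rho_add[of k "- k" x] rho_zero[of x] by (simp add: eq_neg_iff_add_eq_0 add.commute)
lemma rho_nat: "x \<in> W ==> \<rho> (of_nat n) x = real n *\<^sub>R x"
proof (induction n)
 case (Suc n)
 then show ?case using rho_add[of "of_nat n" 1 x] rho_one[of x] by (simp add: algebra_simps)
qed (simp add: rho_zero)
lemma rho_int: assumes "x \<in> W" shows "\<rho> (of_int m) x = m *. x"
proof (cases "m \<ge> 0")
 case True
 then show ?thesis using rho_nat[OF assms, of "nat m"] by simp
next
 case False
 then have "\<rho> (- of_int m) x = real (nat (- m)) *\<^sub>R x" using rho_nat[OF assms, of "nat (- m)"] by simp
 then show ?thesis using rho_minus[of "of_int m" x] assms False by simp
qed

definition T :: "complex ^ 'n => complex ^ 'n" where "T = \<rho> om"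

lemma rho_coords: assumes "x \<in> W" shows "\<rho> (of_int m + of_int n * om) x = m *. x + n *. T x"
 unfolding T_def using assms rho_add[of "of_int m" "of_int n * om" x] rho_mult[of "of_int n" om x]
 by (simp add: rho_int rho_W)

lemma T_W: "x \<in> W ==> T x \<in> W" and T_lat: "x \<in> \<Lambda> ==> T x \<in> \<Lambda>"
 and T_add: "x \<in> W ==> y \<in> W ==> T (x + y) = T x + T y"
 and T_smult: "x \<in> W ==> T (c *s x) = c *s T x"
 and T_scaleR: "x \<in> W ==> T (r *\<^sub>R x) = r *\<^sub>R T x"
 unfolding T_def using rho_W rho_lat rho_addv rho_smult rho_scaleR by simp_all

lemma T_E: assumes "x \<in> W" "y \<in> W" shows "E (T x) y = E x (T y)"
 unfolding E_def T_def using rho_adj[of om x y] assms by simp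

lemma T_E_self: assumes "x \<in> W" shows "E (T x) x = 0"
 using T_E[OF assms assms] E_anti[of x "T x"] by simp

lemma T_sq: assumes "x \<in> W" shows "T (T x) = real D *\<^sub>R T x - nom *. x"
proof -
 have "T (T x) = \<rho> (om * om) x" unfolding T_def using rho_mult[of om om x] assms by simp
 also have "om * om = of_int (- nom) + of_int (int D) * om" unfolding om_sq by simp
 finally show ?thesis using rho_coords[OF assms, of "- nom" "int D"] by simp
qed

text \<open>
  If \<open>om - a\<close> were divisible by \<open>q\<close> on the lattice, then \<open>(om - a)/q\<close> would act as well, and the
  real multiplication would extend to a larger order.
\<close>

lemma not_scalar_mod_prime:
 assumes q: "q > 1" and La: "!!x. x \<in> \<Lambda> ==> \<exists>y\<in>\<Lambda>. T x - a *. x = real q *\<^sub>R y"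
  and tr: "int q dvd int D - 2 * a" and nm: "int q * int q dvd minpol a"
  and lat: "!!x y. x \<in> \<Lambda> ==> y \<in> \<Lambda> ==> x + y \<in> \<Lambda>" "!!k x. x \<in> \<Lambda> ==> k *. x \<in> \<Lambda>"
 shows False
proof -
 have q0: "real q ~= 0" using q by simp
 obtain t where t: "int D - 2 * a = int q * t" using tr by (auto elim: dvdE)
 obtain u where u: "minpol a = int q * int q * u" using nm by (auto elim: dvdE)
 define r where "r = (om - of_int a) / real q"
 have om_r: "om = of_int a + real q * r" unfolding r_def using q0 by simp
 have r_sq: "r * r = of_int t * r - of_int u"
 proof -
  have e: "om - of_int a = real q * r" using om_r by simp
  have "real q * r * (real q * r) = of_int (int q * t) * (real q * r) - of_int (int q * int q * u)"
   using om_root_square[of a] unfolding e t u .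
  then have "real q * real q * (r * r) = real q * real q * (of_int t * r - of_int u)" by (simp add: algebra_simps)
  then show ?thesis using q0 by simp
 qed
 define R where "R = {of_int m * 1 + of_int n * r | m n. True}"
 have r_indep: "m = 0 & n = 0" if "of_int m * 1 + of_int n * r = 0" for m n :: int
 proof -
  have "real q * (of_int m * 1 + of_int n * r) = of_int (int q * m - n * a) + of_int n * om"
   unfolding om_r by (simp add: algebra_simps)
  then have "of_int (int q * m - n * a) + of_int n * om = 0" using that by simp
  then have "int q * m - n * a = 0" "n = 0" using om_coords_zero by blast+
  then show ?thesis using q by simp
 qed
 have r_unique: "m = m' & n = n'" if "of_int m + of_int n * r = of_int m' + of_int n' * r" for m n m' n' :: int
  using r_indep[of "m - m'" "n - n'"] that by (simp add: algebra_simps)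
 have rK: "r \<in> KK" unfolding r_def by simp
 have R_iff: "x \<in> R \<longleftrightarrow> (EX m n. x = of_int m + of_int n * r)" for x unfolding R_def by simp
 have R_mult: "(of_int m + of_int n * r) * (of_int m' + of_int n' * r) =
   of_int (m * m' - n * n' * u) + of_int (m * n' + n * m' + n * n' * t) * r" for m n m' n'
 proof -
  have "(of_int m + of_int n * r) * (of_int m' + of_int n' * r) =
   of_int m * of_int m' + (of_int m * of_int n' + of_int n * of_int m') * r + of_int n * of_int n' * (r * r)"
   by (simp add: algebra_simps)
  then show ?thesis unfolding r_sq by (simp add: algebra_simps)
 qed
 have ord: "is_quad_order D R"
  unfolding is_quad_order_def
 proof (intro conjI ballI)
  show "R \<subseteq> KK" using rK by (auto simp: R_iff)
  show "1 \<in> R" unfolding R_iff by (intro exI[of _ 1] exI[of _ 0]) simp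
  fix x y assume "x \<in> R" "y \<in> R"
  then show "x * y \<in> R" unfolding R_iff using R_mult by blast
 next
  show "EX w1 w2. is_zbasis [w1, w2] R"
   by (intro exI[of _ 1] exI[of _ r]) (unfold is_zbasis2_iff, use R_def r_indep in blast)
 qed
 have "Od \<subseteq> R"
 proof
  fix x assume "x \<in> Od"
  then obtain m n where "x = of_int m + of_int n * om" by (elim Od_cases)
  then have "x = of_int (m + n * a) + of_int (n * int q) * r" unfolding om_r by (simp add: algebra_simps)
  then show "x \<in> R" unfolding R_iff by blast
 qed
 moreover have "r \<notin> Od"
 proof
  assume "r \<in> Od"
  then obtain m n where mn: "r = of_int m + of_int n * om" by (elim Od_cases)
  have "of_int (a + int q * m) + of_int (int q * n) * om = of_int 0 + of_int 1 * om"
   using om_r unfolding mn by (simp add: algebra_simps)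
  then have "int q * n = 1" using om_coords_unique by blast
  then show False using q pos_zmult_eq_1_iff[of "int q" n] by simp
 qed
 moreover have "r \<in> R" unfolding R_iff by (intro exI[of _ 0] exI[of _ 1]) simp
 ultimately have strict: "Od \<subset> R" by blast
 define N where "N = (%x. (1 / real q) *\<^sub>R (T x - a *. x))"
 have N_W: "N x \<in> W" if "x \<in> W" for x
 proof -
  have "(1 / real q) *\<^sub>R (T x + (- a) *. x) \<in> W" by (intro W_scaleR W_add T_W that)
  then show ?thesis by (simp add: N_def)
 qed
 have N_lat: "N x \<in> \<Lambda>" if "x \<in> \<Lambda>" for x
  using La[OF that] q0 unfolding N_def by auto
 have N_add: "N (x + y) = N x + N y" if "x \<in> W" "y \<in> W" for x y
  unfolding N_def T_add[OF that] by (simp add: algebra_simps)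
 have N_smult: "N (c *s x) = c *s N x" if "x \<in> W" for c x
  unfolding N_def T_smult[OF that] by (simp add: vec_eq_iff right_diff_distrib scaleR_diff_right)
 have N_scaleR: "N (c *\<^sub>R x) = c *\<^sub>R N x" if "x \<in> W" for c x
  using N_smult[OF that] by (simp add: scaleR_eq_smult)
 have T_N: "T x = a *. x + real q *\<^sub>R N x" for x unfolding N_def using q0 by simp
 have N_sq: "N (N x) = t *. N x - u *. x" if x: "x \<in> W" for x
 proof -
  have NxW: "N x \<in> W" using N_W x .
  have "T (T x) = a *. (a *. x + real q *\<^sub>R N x) + real q *\<^sub>R N (a *. x + real q *\<^sub>R N x)"
   using T_N[of "T x"] T_N[of x] by simp
  also have "N (a *. x + real q *\<^sub>R N x) = a *. N x + real q *\<^sub>R N (N x)"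
   using N_add[of "a *. x" "real q *\<^sub>R N x"] N_scaleR x NxW W_scaleR by simp
  finally have "T (T x) = (a * a) *. x + (a * int q) *. N x + (a * int q) *. N x + (real q * real q) *\<^sub>R N (N x)"
   by (simp add: scaleR_add_right mult.commute add.assoc)
  moreover have "T (T x) = real D *\<^sub>R (a *. x + real q *\<^sub>R N x) - nom *. x"
   using T_sq[OF x] T_N[of x] by simp
  ultimately have "(real q * real q) *\<^sub>R N (N x) =
   (real D * of_int a - of_int nom - of_int a * of_int a) *\<^sub>R x + ((real D - of_int a - of_int a) * real q) *\<^sub>R N x"
   by (intro scaled_square_solve[of "T (T x)"]) simp_all
  also have "real D * of_int a - of_int nom - of_int a * of_int a = real q * real q * of_int (- u)"
   using arg_cong[OF u, of real_of_int] unfolding minpol_def by (simp add: algebra_simps)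
  also have "(real D - of_int a - of_int a) * real q = real q * real q * of_int t"
   using arg_cong[OF t, of real_of_int] by (simp add: algebra_simps)
  finally have "(real q * real q) *\<^sub>R N (N x) = (real q * real q) *\<^sub>R (t *. N x - u *. x)"
   by (simp add: algebra_simps)
  then show ?thesis using q0 by simp
 qed
 define cm cn where "cm = (%x. THE m. EX n. x = real_of_int m + real_of_int n * r)"
  and "cn = (%x. THE n. EX m. x = real_of_int m + real_of_int n * r)"
 have cm: "cm (of_int m + of_int n * r) = m" and cn: "cn (of_int m + of_int n * r) = n" for m n
  unfolding cm_def cn_def using r_unique by (intro the_equality; blast)+
 define \<rho>' where "\<rho>' = (%k. \<lambda>x\<in>W. cm k *. x + cn k *. N x)"
 have \<rho>': "\<rho>' (of_int m + of_int n * r) = (\<lambda>x\<in>W. m *. x + n *. N x)" for m n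
  unfolding \<rho>'_def cm cn ..
 have mn_W: "m *. x + n *. N x \<in> W" if "x \<in> W" for m n x
  using that W_add W_scaleR N_W by simp
 have "\<rho>' \<in> ring_hom (real_ring R) (torus_End W \<Lambda>)"
 proof (rule ring_hom_memI)
  fix k assume "k \<in> carrier (real_ring R)"
  then obtain m n where k: "k = of_int m + of_int n * r" using R_iff by auto
  show "\<rho>' k \<in> carrier (torus_End W \<Lambda>)"
   unfolding k \<rho>' torus_End_def using mn_W lat_W
   by (auto simp: N_add N_smult W_add W_smult algebra_simps smult_scaleR vec.scale_right_distrib intro!: lat N_lat)
 next
  fix k l assume "k \<in> carrier (real_ring R)" "l \<in> carrier (real_ring R)"
  then obtain m n m' n' where k: "k = of_int m + of_int n * r" and l: "l = of_int m' + of_int n' * r"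
   using R_iff by auto
  have kl: "k + l = of_int (m + m') + of_int (n + n') * r" unfolding k l by (simp add: algebra_simps)
  show "\<rho>' (k \<oplus>\<^bsub>real_ring R\<^esub> l) = \<rho>' k \<oplus>\<^bsub>torus_End W \<Lambda>\<^esub> \<rho>' l"
   unfolding real_ring_simps kl unfolding k l \<rho>' torus_End_def by (auto simp: algebra_simps)
  have comp: "m *. (m' *. x + n' *. N x) + n *. N (m' *. x + n' *. N x) =
   (m * m' - n * n' * u) *. x + (m * n' + n * m' + n * n' * t) *. N x" if x: "x \<in> W" for x
  proof -
   have 1: "N (m' *. x + n' *. N x) = m' *. N x + n' *. (t *. N x - u *. x)"
   using N_add[of "m' *. x" "n' *. N x"] N_scaleR x N_W[OF x] W_scaleR N_sq[OF x] by simp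
   show ?thesis by (simp only: 1) (simp add: algebra_simps)
  qed
  show "\<rho>' (k \<otimes>\<^bsub>real_ring R\<^esub> l) = \<rho>' k \<otimes>\<^bsub>torus_End W \<Lambda>\<^esub> \<rho>' l"
   unfolding real_ring_simps k l R_mult \<rho>' torus_End_def
   by (auto simp: compose_def mn_W comp)
 next
  have "\<rho>' 1 = (\<lambda>x\<in>W. x)" using \<rho>'[of 1 0] by simp
  then show "\<rho>' \<one>\<^bsub>real_ring R\<^esub> = \<one>\<^bsub>torus_End W \<Lambda>\<^esub>" unfolding torus_End_def by simp
 qed
 moreover have "\<forall>k\<in>Od. \<rho>' k = \<rho> k"
 proof
  fix k assume k: "k \<in> Od"
  then obtain m n where mn: "k = of_int m + of_int n * om" by (elim Od_cases)
  then have e: "k = of_int (m + n * a) + of_int (n * int q) * r" unfolding om_r by (simp add: algebra_simps)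
  show "\<rho>' k = \<rho> k"
  proof (rule extensionalityI[of _ W])
   show "\<rho>' k \<in> extensional W" unfolding \<rho>'_def by simp
   show "\<rho> k \<in> extensional W" using rho_End[OF k] unfolding torus_End_def by (auto simp: PiE_def)
   fix x assume x: "x \<in> W"
   show "\<rho>' k x = \<rho> k x" unfolding mn rho_coords[OF x] T_N[of x] unfolding mn[symmetric] e \<rho>'
   using x by (simp add: algebra_simps)
  qed
 qed
 ultimately show False using rm ord strict unfolding real_multiplication_def by blast
qed

end

section \<open>The lattice of an Abelian surface with real multiplication\<close>

lemma zero_in_zspan: "0 \<in> zspan bs"
 unfolding zspan_def by (intro CollectI exI[of _ "%_. 0"]) simp

lemma zspan_mem: "b \<in> set bs ==> b \<in> zspan bs"
proof (induction bs)
 case (Cons c bs)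
 show ?case
 proof (cases "b = c")
  case True
  then show ?thesis unfolding zspan_Cons
   by (intro CollectI exI[of _ 1] exI[of _ 0]) (simp add: zero_in_zspan)
 next
  case False
  then have "b \<in> zspan bs" using Cons by simp
  then show ?thesis unfolding zspan_Cons by (intro CollectI exI[of _ 0] exI[of _ b]) simp
 qed
qed simp

lemma zspan_subset:
 assumes "x \<in> zspan bs" "!!b. b \<in> set bs ==> b \<in> zspan cs" shows "x \<in> zspan cs"
 using assms
proof (induction bs arbitrary: x)
 case Nil
 then show ?case by (simp add: zspan_Nil zero_in_zspan)
next
 case (Cons b bs)
 then obtain c v where "x = c *. b + v" "v \<in> zspan bs" unfolding zspan_Cons by blast
 then show ?case using Cons by (auto intro!: zspan_add zspan_zscale)
qed

lemma coprime_shift: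
 fixes r v q :: int
 assumes "coprime r v" "q ~= 0" shows "EX x. coprime q (r + x * v)"
proof -
 define P where "P = {p. prime p & p dvd q & ~ p dvd r}"
 have fin: "finite P" unfolding P_def using finite_divisors_int[OF assms(2)] by (rule rev_finite_subset) auto
 define x where "x = \<Prod>P"
 have "False" if p: "prime p" "p dvd q" "p dvd r + x * v" for p
 proof (cases "p dvd r")
  case True
  then have "p dvd x * v" using p(3) by (simp add: dvd_add_right_iff)
  moreover have "~ p dvd v" using assms(1) True p(1) by (metis coprime_common_divisor not_prime_unit)
  ultimately have "p dvd x" using p(1) by (simp add: prime_dvd_mult_iff)
  then obtain p' where p': "p' \<in> P" "p dvd p'" using prime_dvd_prod_iff[OF fin p(1), of "%x. x"] unfolding x_def by auto
  then have "p = p'" using p(1) primes_dvd_imp_eq unfolding P_def by blast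
  then show False using p'(1) True unfolding P_def by simp
 next
  case False
  then have "p \<in> P" unfolding P_def using p by simp
  then have "p dvd x" unfolding x_def using dvd_prodI[OF fin, of p "%x. x"] by simp
  then show False using p(3) False by (simp add: dvd_add_left_iff)
 qed
 then have "~ (EX p. prime p & p dvd gcd q (r + x * v))" by auto
 then have "\<bar>gcd q (r + x * v)\<bar> = 1" using prime_factor_int by blast
 then have "coprime q (r + x * v)" by (simp add: coprime_iff_gcd_eq_1)
 then show ?thesis by blast
qed

lemma gcd_shift:
 fixes r v q :: int
 assumes "q ~= 0" shows "EX x. gcd q (r + x * v) dvd v"
proof (cases "gcd r v = 0")
 case True
 then show ?thesis by simp
next
 case False
 define g where "g = gcd r v"
 obtain r' v' where rv: "r = g * r'" "v = g * v'" unfolding g_def by (metis dvdE gcd_dvd1 gcd_dvd2)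
 have "coprime r' v'" using rv False unfolding g_def
  by (metis div_gcd_coprime gcd_eq_0_iff nonzero_mult_div_cancel_left)
 then obtain x where x: "coprime q (r' + x * v')" using coprime_shift assms by blast
 have "gcd q (g * (r' + x * v')) = gcd q g" using x by (simp add: gcd_mult_right_right_cancel)
 then have "gcd q (r + x * v) dvd v" unfolding rv by (simp add: algebra_simps)
 then show ?thesis by blast
qed

text \<open>
  Smith normal form, stated for an arbitrary property that is stable under unimodular row and column
  operations: the matrices arise from bases, and it is the bases that have to be transformed.
\<close>

lemma diagonalize_2x2:
 fixes Good :: "int => int => int => int => bool"
 assumes row: "!!q r s v a b c e. Good q r s v ==> a * e - b * c = 1 ==>
   Good (a * q + b * s) (a * r + b * v) (c * q + e * s) (c * r + e * v)"
  and col: "!!q r s v a b c e. Good q r s v ==> a * e - b * c = 1 ==>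
   Good (q * a + r * c) (q * b + r * e) (s * a + v * c) (s * b + v * e)"
  and init: "Good q0 r0 s0 v0"
 shows "EX g h. g dvd h & Good g 0 0 h"
proof -
 have clear: "EX a b c e. c * q + e * s = 0 & Good (a * q + b * s) (a * r + b * v) 0 (c * r + e * v)"
  if G: "Good q r s v" for q r s v
 proof (cases "gcd q s = 0")
  case True
  then show ?thesis using G by (intro exI[of _ 1] exI[of _ 0] exI[of _ 0] exI[of _ 1]) simp
 next
  case False
  define g where "g = gcd q s"
  obtain q1 s1 where qs: "q = g * q1" "s = g * s1" unfolding g_def by (metis dvdE gcd_dvd1 gcd_dvd2)
  obtain u w where uw: "u * q + w * s = g" unfolding g_def using bezout_int by blast
  have "g * (u * q1 + w * s1) = g * 1" using uw unfolding qs by (simp add: algebra_simps)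
  moreover have "g ~= 0" using False unfolding g_def .
  ultimately have "u * q1 + w * s1 = 1" using mult_left_cancel by blast
  then have det: "u * q1 - w * (- s1) = 1" by simp
  have z: "(- s1) * q + q1 * s = 0" unfolding qs by (simp add: algebra_simps)
  show ?thesis using row[OF G det] z by (intro exI[of _ u] exI[of _ w] exI[of _ "- s1"] exI[of _ q1]) simp
 qed
 obtain q r v where G: "Good q r 0 v" using clear[OF init] by blast
 show ?thesis
 proof (cases "q = 0")
  case True
  have "Good r 0 v 0" using col[OF G, of 0 0 "-1" 1] True by simp
  then obtain g where "Good g 0 0 0" using clear[of r 0 v 0] by auto
  then show ?thesis by (intro exI[of _ g] exI[of _ 0]) simp
 next
  case False
  obtain x where x: "gcd q (r + x * v) dvd v" using gcd_shift[OF False] by blast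
  define r' where "r' = r + x * v"
  have G2: "Good q r' 0 v" using row[OF G, of 1 1 x 0] unfolding r'_def by simp
  define c where "c = gcd q r'"
  obtain q1 r1 where qr: "q = c * q1" "r' = c * r1" unfolding c_def by (metis dvdE gcd_dvd1 gcd_dvd2)
  obtain u w where uw: "u * q + w * r' = c" unfolding c_def using bezout_int by blast
  have c0: "c ~= 0" unfolding c_def using False by simp
  have "c * (u * q1 + w * r1) = c * 1" using uw unfolding qr by (simp add: algebra_simps)
  then have "u * q1 + w * r1 = 1" using c0 mult_left_cancel by blast
  then have det: "u * q1 - (- r1) * w = 1" by (simp add: mult.commute)
  obtain v1 where v1: "v = c * v1" using x unfolding c_def r'_def by (metis dvdE)
  have 1: "q * u + r' * w = c" using uw by (simp add: algebra_simps)
  have 2: "q * (- r1) + r' * q1 = 0" unfolding qr by (simp add: algebra_simps)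
  have G3: "Good c 0 (v * w) (v * q1)" using col[OF G2 det] unfolding 1 2 by simp
  have 3: "(- v1 * w) * c + 1 * (v * w) = 0" unfolding v1 by simp
  have "Good c 0 0 (v * q1)" using row[OF G3, of 1 1 0 "- v1 * w"] unfolding 3 by simp
  then show ?thesis using v1 by (intro exI[of _ c] exI[of _ "v * q1"]) simp
 qed
qed

context smart
begin

text \<open>
  Coordinates on the order (\<open>kk\<close>) and on the dual factor (\<open>ll\<close>) that are adapted to the smart basis. The
  trace pairing is the standard alternating form in them, and \<open>\<aa>/\<surd>D\<close> is cut out by the condition that
  the second \<open>ll\<close>-coordinate is divisible by \<open>d\<close>.
\<close>

definition kk :: "int => int => real" where "kk m n = of_int m * \<eta>1 + of_int n * \<eta>2"
definition ll :: "int => int => real" where "ll m n = (of_int m * cj \<eta>2 - of_int n * cj \<eta>1) / s"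

lemma kk_Od [simp]: "kk m n \<in> Od" unfolding kk_def by simp
lemma ll_KK [simp]: "ll m n \<in> KK" unfolding ll_def by simp

lemma kk_surj: "x \<in> Od ==> EX m n. x = kk m n" unfolding kk_def using Od_eta by blast

lemma kk_inj: "kk m n = kk m' n' ==> m = m' & n = n'"
 unfolding kk_def using eta_indep[of "m - m'" "n - n'"] by (simp add: algebra_simps)

lemma cj_kk: "cj (kk m n) = of_int m * cj \<eta>1 + of_int n * cj \<eta>2" unfolding kk_def by simp
lemma cj_ll: "cj (ll m n) = (of_int n * \<eta>1 - of_int m * \<eta>2) / s"
 unfolding ll_def by (simp add: minus_divide_left)

lemma ll_inj: assumes "ll m n = ll m' n'" shows "m = m' & n = n'"
proof -
 have "cj (ll m n) = cj (ll m' n')" using assms by simp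
 then have "of_int n * \<eta>1 - of_int m * \<eta>2 = of_int n' * \<eta>1 - of_int m' * \<eta>2"
  unfolding cj_ll using s_ne by simp
 then have "of_int (n' - n) * \<eta>1 + of_int (m - m') * \<eta>2 = 0" by (simp add: algebra_simps)
 from eta_indep[OF this] show ?thesis by simp
qed

lemma ll_add: "ll (m + m') (n + n') = ll m n + ll m' n'" and kk_add: "kk (m + m') (n + n') = kk m n + kk m' n'"
 unfolding ll_def kk_def by (simp_all add: algebra_simps add_divide_distrib diff_divide_distrib)

lemma ll_mem_iff: "ll m n \<in> (%x. x / s) ` \<aa> \<longleftrightarrow> int d dvd n"
proof
 assume "ll m n \<in> (%x. x / s) ` \<aa>"
 then obtain m' n' where "ll m n = (of_int m' * cj \<eta>2 + of_int n' * (real d * cj \<eta>1)) / s" unfolding aa_eta by blast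
 then have "ll m n = ll m' (- (int d * n'))" unfolding ll_def by (simp add: algebra_simps)
 then show "int d dvd n" using ll_inj by (metis dvd_minus_iff dvd_triv_left)
next
 assume "int d dvd n"
 then obtain n' where "n = int d * n'" by (auto elim: dvdE)
 then have "ll m n = (of_int m * cj \<eta>2 + of_int (- n') * (real d * cj \<eta>1)) / s" unfolding ll_def by simp
 then show "ll m n \<in> (%x. x / s) ` \<aa>" unfolding aa_eta by blast
qed

lemma ll_surj: assumes "x \<in> (%x. x / s) ` \<aa>" shows "EX m n. x = ll m (int d * n)"
proof -
 obtain m n where "x = (of_int m * cj \<eta>2 + of_int n * (real d * cj \<eta>1)) / s" using assms unfolding aa_eta by blast
 then have "x = ll m (int d * (- n))" unfolding ll_def by simp
 then show ?thesis by blast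
qed

lemma tr_kk_ll: "tr D (kk a b * ll m n) = - of_int (a * m + b * n)"
proof -
 have "tr D (kk a b * ll m n) =
  ((of_int a * \<eta>1 + of_int b * \<eta>2) * (of_int m * cj \<eta>2 - of_int n * cj \<eta>1)
  + (of_int a * cj \<eta>1 + of_int b * cj \<eta>2) * (of_int n * \<eta>1 - of_int m * \<eta>2)) / s"
  unfolding tr_def cj_mult[OF Od_KK[OF kk_Od] ll_KK] cj_kk cj_ll unfolding kk_def ll_def
  by (simp only: times_divide_eq_right add_divide_distrib)
 also have "\<dots> = of_int (a * m + b * n) * (\<eta>1 * cj \<eta>2 - cj \<eta>1 * \<eta>2) / s"
  by (simp add: algebra_simps)
 also have "\<dots> = - of_int (a * m + b * n)" unfolding eta_det using s_ne by simp
 finally show ?thesis .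
qed

lemma trace_pairing_kk_ll:
 "trace_pairing D (kk a b, ll m n) (kk a' b', ll m' n') = of_int (a * m' + b * n' - a' * m - b' * n)"
proof -
 have "tr D (kk a' b' * ll m n - kk a b * ll m' n') = tr D (kk a' b' * ll m n) - tr D (kk a b * ll m' n')"
  unfolding tr_def by (subst cj_diff) simp_all
 then show ?thesis unfolding trace_pairing_def tr_kk_ll by simp
qed

end

context rm_lattice
begin

definition typed_basis :: "nat => complex ^ 'n => complex ^ 'n => complex ^ 'n => complex ^ 'n => bool" where
 "typed_basis d l1 l2 m1 m2 \<longleftrightarrow> {l1, l2, m1, m2} \<subseteq> \<Lambda> & \<Lambda> \<subseteq> zspan [l1, l2, m1, m2] &
  E l1 m1 = 1 & E l2 m2 = real d & E l1 l2 = 0 & E l1 m2 = 0 & E m1 l2 = 0 & E m1 m2 = 0"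

lemma typed_basis_gram:
 assumes "typed_basis d l1 l2 m1 m2"
 shows "E l1 l1 = 0" "E l1 l2 = 0" "E l1 m1 = 1" "E l1 m2 = 0" "E l2 l1 = 0" "E l2 l2 = 0" "E l2 m1 = 0" "E l2 m2 = real d"
  "E m1 l1 = -1" "E m1 l2 = 0" "E m1 m1 = 0" "E m1 m2 = 0" "E m2 l1 = 0" "E m2 l2 = - real d" "E m2 m1 = 0" "E m2 m2 = 0"
proof -
 have sw: "E y x = - c" if "E x y = c" for x y c using E_anti[of y x] that by simp
 show g: "E l1 l2 = 0" "E l1 m1 = 1" "E l1 m2 = 0" "E l2 m2 = real d" "E m1 l2 = 0" "E m1 m2 = 0"
  using assms unfolding typed_basis_def by blast+
 show "E l1 l1 = 0" "E l2 l2 = 0" "E m1 m1 = 0" "E m2 m2 = 0" by simp_all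
 show "E l2 l1 = 0" "E m1 l1 = -1" "E m2 l1 = 0" "E m2 l2 = - real d" "E l2 m1 = 0" "E m2 m1 = 0"
  using sw[OF g(1)] sw[OF g(2)] sw[OF g(3)] sw[OF g(4)] sw[OF g(5)] sw[OF g(6)] by simp_all
qed

lemma has_type_typed_basis:
 assumes "has_type H \<Lambda> [1, d]"
 obtains l1 l2 m1 m2 where "typed_basis d l1 l2 m1 m2" "\<Lambda> = zspan [l1, l2, m1, m2]"
proof -
 obtain ls ms where sb: "symplectic_basis H \<Lambda> [1, d] ls ms" using assms unfolding has_type_def by blast
 then have len: "length ls = 2" "length ms = 2" unfolding symplectic_basis_def by auto
 obtain l1 l2 where ls: "ls = [l1, l2]" using len(1) by (auto simp: length_Suc_conv numeral_2_eq_2)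
 obtain m1 m2 where ms: "ms = [m1, m2]" using len(2) by (auto simp: length_Suc_conv numeral_2_eq_2)
 have lat: "\<Lambda> = zspan [l1, l2, m1, m2]" using sb unfolding symplectic_basis_def is_zbasis_def ls ms by simp
 have g: "E ([l1, l2] ! i) ([l1, l2] ! j) = 0 & E ([m1, m2] ! i) ([m1, m2] ! j) = 0 &
  E ([l1, l2] ! i) ([m1, m2] ! j) = (if i = j then real ([1, d] ! i) else 0)" if "i < 2" "j < 2" for i j
  using sb that unfolding symplectic_basis_def ls ms E_def by simp
 have gr: "E l2 m1 = 0" "E l1 m1 = 1" "E l2 m2 = real d" "E l1 l2 = 0" "E l1 m2 = 0" "E m1 m2 = 0"
  using g[of 1 0] g[of 0 0] g[of 1 1] g[of 0 1] by simp_all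
 have "{l1, l2, m1, m2} \<subseteq> \<Lambda>" unfolding lat by (simp add: zspan_mem)
 then have "typed_basis d l1 l2 m1 m2"
  unfolding typed_basis_def using gr E_anti[of l2 m1] lat by simp
 then show thesis using that lat by blast
qed

end

context real_quadratic
begin

lemma minpol_ne_0: "minpol a ~= 0"
proof
 assume "minpol a = 0"
 then have "om - of_int a = 0 \<or> cj om - of_int a = 0" using minpol_factor[of a] by simp
 then have "of_int (- a) + of_int 1 * om = 0 \<or> of_int (int D - a) + of_int (- 1) * om = 0" by (auto simp: cj_om)
 then show False using om_coords_zero by (metis one_neq_zero neg_equal_0_iff_equal)
qed

end

context rm_lattice
begin

text \<open>
  The most general shape of a self-adjoint operator in a basis of type \<open>(1, d)\<close>: self-adjointness leaves
  two scalars and one two by two block.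
\<close>

definition tform :: "nat => int => int => complex ^ 'n => complex ^ 'n => complex ^ 'n => complex ^ 'n =>
  int => int => int => int => bool" where
 "tform d p a l1 l2 m1 m2 q r t v \<longleftrightarrow>
  T l1 = p *. l1 + q *. l2 + r *. m2 & T m1 = p *. m1 + t *. l2 + v *. m2 &
  T l2 = a *. l2 + real d *\<^sub>R (v *. l1 - r *. m1) & T m2 = a *. m2 + real d *\<^sub>R (q *. m1 - t *. l1)"

lemma typed_basis_tform:
 assumes tb: "typed_basis d l1 l2 m1 m2" and d: "d > 0"
 shows "EX p a q r s v. tform d p a l1 l2 m1 m2 q r s v"
proof -
 note g = typed_basis_gram[OF tb]
 have mem: "l1 \<in> \<Lambda>" "l2 \<in> \<Lambda>" "m1 \<in> \<Lambda>" "m2 \<in> \<Lambda>" using tb unfolding typed_basis_def by auto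
 then have memW: "l1 \<in> W" "l2 \<in> W" "m1 \<in> W" "m2 \<in> W" using lat_W by auto
 have coords: "EX n1 n2 n3 n4. T x = n1 *. l1 + n2 *. l2 + n3 *. m1 + n4 *. m2" if "x \<in> \<Lambda>" for x
  using T_lat[OF that] tb unfolding typed_basis_def zspan4 by blast
 obtain x1 x2 x3 x4 where X: "T l1 = x1 *. l1 + x2 *. l2 + x3 *. m1 + x4 *. m2" using coords[OF mem(1)] by blast
 obtain y1 y2 y3 y4 where Y: "T m1 = y1 *. l1 + y2 *. l2 + y3 *. m1 + y4 *. m2" using coords[OF mem(3)] by blast
 obtain z1 z2 z3 z4 where Z: "T l2 = z1 *. l1 + z2 *. l2 + z3 *. m1 + z4 *. m2" using coords[OF mem(2)] by blast
 obtain w1 w2 w3 w4 where V: "T m2 = w1 *. l1 + w2 *. l2 + w3 *. m1 + w4 *. m2" using coords[OF mem(4)] by blast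
 note sim = E_bilinear g
 have e1: "x3 = 0" using T_E_self[OF memW(1)] unfolding X by (simp add: sim)
 have e2: "y1 = 0" using T_E_self[OF memW(3)] unfolding Y by (simp add: sim)
 have e3: "z4 = 0" using T_E_self[OF memW(2)] d unfolding Z by (simp add: sim)
 have e4: "w2 = 0" using T_E_self[OF memW(4)] d unfolding V by (simp add: sim)
 have e5: "y3 = x1" using T_E[OF memW(1,3)] unfolding X Y by (simp add: sim)
 have e6: "w4 = z2" using T_E[OF memW(2,4)] d unfolding Z V by (simp add: sim)
 have "- real_of_int z3 = of_int (int d * x4)" using T_E[OF memW(2,1)] unfolding Z X by (simp add: sim)
 then have e7: "z3 = - int d * x4" by linarith
 have "real_of_int z1 = of_int (int d * y4)" using T_E[OF memW(2,3)] unfolding Z Y by (simp add: sim)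
 then have e8: "z1 = int d * y4" by linarith
 have "real_of_int w3 = of_int (int d * x2)" using T_E[OF memW(4,1)] unfolding V X by (simp add: sim)
 then have e9: "w3 = int d * x2" by linarith
 have "real_of_int w1 = of_int (- int d * y2)" using T_E[OF memW(4,3)] unfolding V Y by (simp add: sim)
 then have e10: "w1 = - int d * y2" by linarith
 have "tform d x1 z2 l1 l2 m1 m2 x2 x4 y2 y4"
  unfolding tform_def X Y Z V e1 e2 e3 e4 e5 e6 e7 e8 e9 e10 by (simp add: algebra_simps)
 then show ?thesis by blast
qed

lemma lat_closed:
 assumes "typed_basis d l1 l2 m1 m2" "\<Lambda> = zspan [l1, l2, m1, m2]"
 shows "x \<in> \<Lambda> ==> y \<in> \<Lambda> ==> x + y \<in> \<Lambda>" "x \<in> \<Lambda> ==> k *. x \<in> \<Lambda>"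
 unfolding assms(2) by (rule zspan_add, assumption+) (rule zspan_zscale)

text \<open>
  Changing the hyperbolic planes \<open>\<langle>l1, m1\<rangle>\<close> and \<open>\<langle>l2, m2\<rangle>\<close> by unimodular matrices acts on the block from the
  left and from the right.
\<close>

lemma rm_basis_diagonal:
 assumes tb0: "typed_basis d l1 l2 m1 m2" and lat: "\<Lambda> = zspan [l1, l2, m1, m2]" and d: "d > 0"
 shows "EX p a q v l1 l2 m1 m2. q dvd v & typed_basis d l1 l2 m1 m2 & tform d p a l1 l2 m1 m2 q 0 0 v"
proof -
 obtain p a q0 r0 s0 v0 where tf0: "tform d p a l1 l2 m1 m2 q0 r0 s0 v0" using typed_basis_tform[OF tb0 d] by blast
 note cl = lat_closed[OF tb0 lat]
 define Good where "Good = (%q r s v. EX l1 l2 m1 m2. typed_basis d l1 l2 m1 m2 & tform d p a l1 l2 m1 m2 q r s v)"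
 have "EX g h. g dvd h & Good g 0 0 h"
 proof (rule diagonalize_2x2[where Good = Good])
  show "Good q0 r0 s0 v0" unfolding Good_def using tb0 tf0 by blast
 next
  fix q r s v x y z w :: int
  assume "Good q r s v" and det: "x * w - y * z = 1"
  then obtain l1 l2 m1 m2 where tb: "typed_basis d l1 l2 m1 m2" and tf: "tform d p a l1 l2 m1 m2 q r s v"
   unfolding Good_def by blast
  have mem: "l1 \<in> \<Lambda>" "l2 \<in> \<Lambda>" "m1 \<in> \<Lambda>" "m2 \<in> \<Lambda>" and sp: "\<Lambda> \<subseteq> zspan [l1, l2, m1, m2]"
   using tb unfolding typed_basis_def by auto
  then have memW: "l1 \<in> W" "l2 \<in> W" "m1 \<in> W" "m2 \<in> W" using lat_W by auto
  have detR: "real_of_int x * of_int w - of_int y * of_int z = 1" using arg_cong[OF det, of real_of_int] by simp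
  define l1' m1' where "l1' = x *. l1 + y *. m1" and "m1' = z *. l1 + w *. m1"
  have b1: "l1 = w *. l1' + (- y) *. m1'"
  proof -
   have "w *. l1' + (- y) *. m1' = (of_int x * of_int w - of_int y * of_int z) *\<^sub>R l1"
   unfolding l1'_def m1'_def by (simp add: algebra_simps)
   then show ?thesis unfolding detR by simp
  qed
  have b2: "m1 = (- z) *. l1' + x *. m1'"
  proof -
   have "(- z) *. l1' + x *. m1' = (of_int x * of_int w - of_int y * of_int z) *\<^sub>R m1"
   unfolding l1'_def m1'_def by (simp add: algebra_simps)
   then show ?thesis unfolding detR by simp
  qed
  have "\<Lambda> \<subseteq> zspan [l1', l2, m1', m2]"
  proof
   fix t assume "t \<in> \<Lambda>"
   then have "t \<in> zspan [l1, l2, m1, m2]" using sp by blast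
   then obtain n1 n2 n3 n4 where t: "t = n1 *. l1 + n2 *. l2 + n3 *. m1 + n4 *. m2" unfolding zspan4 by blast
   have "t = (n1 * w - n3 * z) *. l1' + n2 *. l2 + (n3 * x - n1 * y) *. m1' + n4 *. m2"
   unfolding t by (subst b1, subst b2) (simp add: algebra_simps)
   then show "t \<in> zspan [l1', l2, m1', m2]" unfolding zspan4 by blast
  qed
  moreover have "l1' \<in> \<Lambda>" "m1' \<in> \<Lambda>" unfolding l1'_def m1'_def using cl mem by auto
  moreover have "E l1' m1' = 1" unfolding l1'_def m1'_def using detR
   by (simp add: E_bilinear typed_basis_gram[OF tb] algebra_simps)
  ultimately have tb': "typed_basis d l1' l2 m1' m2"
   unfolding typed_basis_def using mem unfolding l1'_def m1'_def by (simp add: E_bilinear typed_basis_gram[OF tb])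
  have T1: "T l1' = x *. T l1 + y *. T m1" "T m1' = z *. T l1 + w *. T m1"
   unfolding l1'_def m1'_def using memW W_scaleR by (simp_all add: T_add T_scaleR)
  have tf': "tform d p a l1' l2 m1' m2 (x * q + y * s) (x * r + y * v) (z * q + w * s) (z * r + w * v)"
  proof -
   have T1': "T l1' = p *. l1' + (x * q + y * s) *. l2 + (x * r + y * v) *. m2"
   "T m1' = p *. m1' + (z * q + w * s) *. l2 + (z * r + w * v) *. m2"
   unfolding T1 using tf unfolding tform_def l1'_def m1'_def by (simp_all add: algebra_simps)
   have "v *. l1 - r *. m1 = (z * r + w * v) *. l1' - (x * r + y * v) *. m1'"
   by (subst b1, subst b2) (simp add: algebra_simps)
   moreover have "q *. m1 - s *. l1 = (x * q + y * s) *. m1' - (z * q + w * s) *. l1'"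
   by (subst b1, subst b2) (simp add: algebra_simps)
   ultimately show ?thesis using T1' tf unfolding tform_def by simp
  qed
  show "Good (x * q + y * s) (x * r + y * v) (z * q + w * s) (z * r + w * v)"
   unfolding Good_def using tb' tf' by blast
 next
  fix q r s v x y z w :: int
  assume "Good q r s v" and det: "x * w - y * z = 1"
  then obtain l1 l2 m1 m2 where tb: "typed_basis d l1 l2 m1 m2" and tf: "tform d p a l1 l2 m1 m2 q r s v"
   unfolding Good_def by blast
  have mem: "l1 \<in> \<Lambda>" "l2 \<in> \<Lambda>" "m1 \<in> \<Lambda>" "m2 \<in> \<Lambda>" and sp: "\<Lambda> \<subseteq> zspan [l1, l2, m1, m2]"
   using tb unfolding typed_basis_def by auto
  then have memW: "l1 \<in> W" "l2 \<in> W" "m1 \<in> W" "m2 \<in> W" using lat_W by auto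
  have detR: "real_of_int x * of_int w - of_int y * of_int z = 1" using arg_cong[OF det, of real_of_int] by simp
  define l2' m2' where "l2' = w *. l2 + (- y) *. m2" and "m2' = (- z) *. l2 + x *. m2"
  have b1: "l2 = x *. l2' + y *. m2'"
  proof -
   have "x *. l2' + y *. m2' = (of_int x * of_int w - of_int y * of_int z) *\<^sub>R l2"
   unfolding l2'_def m2'_def by (simp add: algebra_simps)
   then show ?thesis unfolding detR by simp
  qed
  have b2: "m2 = z *. l2' + w *. m2'"
  proof -
   have "z *. l2' + w *. m2' = (of_int x * of_int w - of_int y * of_int z) *\<^sub>R m2"
   unfolding l2'_def m2'_def by (simp add: algebra_simps)
   then show ?thesis unfolding detR by simp
  qed
  have "\<Lambda> \<subseteq> zspan [l1, l2', m1, m2']"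
  proof
   fix t assume "t \<in> \<Lambda>"
   then have "t \<in> zspan [l1, l2, m1, m2]" using sp by blast
   then obtain n1 n2 n3 n4 where t: "t = n1 *. l1 + n2 *. l2 + n3 *. m1 + n4 *. m2" unfolding zspan4 by blast
   have "t = n1 *. l1 + (n2 * x + n4 * z) *. l2' + n3 *. m1 + (n2 * y + n4 * w) *. m2'"
   unfolding t by (subst b1, subst b2) (simp add: algebra_simps)
   then show "t \<in> zspan [l1, l2', m1, m2']" unfolding zspan4 by blast
  qed
  moreover have "l2' \<in> \<Lambda>" "m2' \<in> \<Lambda>" unfolding l2'_def m2'_def using cl mem by blast+
  moreover have "E l2' m2' = real d"
  proof -
   have "E l2' m2' = real d * (of_int x * of_int w - of_int y * of_int z)" unfolding l2'_def m2'_def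
   by (simp add: E_bilinear typed_basis_gram[OF tb] algebra_simps)
   then show ?thesis unfolding detR by simp
  qed
  ultimately have tb': "typed_basis d l1 l2' m1 m2'"
   unfolding typed_basis_def using mem unfolding l2'_def m2'_def by (simp add: E_bilinear typed_basis_gram[OF tb])
  have T1: "T l2' = w *. T l2 + (- y) *. T m2" "T m2' = (- z) *. T l2 + x *. T m2"
   unfolding l2'_def m2'_def using memW W_scaleR by (simp_all only: T_add T_scaleR)
  have tf2: "T l2 = a *. l2 + real d *\<^sub>R (v *. l1 - r *. m1)" "T m2 = a *. m2 + real d *\<^sub>R (q *. m1 - s *. l1)"
   using tf unfolding tform_def by blast+
  have tf': "tform d p a l1 l2' m1 m2' (q * x + r * z) (q * y + r * w) (s * x + v * z) (s * y + v * w)"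
  proof -
   have T1': "T l2' = a *. l2' + real d *\<^sub>R ((s * y + v * w) *. l1 - (q * y + r * w) *. m1)"
   "T m2' = a *. m2' + real d *\<^sub>R ((q * x + r * z) *. m1 - (s * x + v * z) *. l1)"
   unfolding T1 tf2 unfolding l2'_def m2'_def by (simp_all add: algebra_simps)
   have "q *. l2 + r *. m2 = (q * x + r * z) *. l2' + (q * y + r * w) *. m2'"
   by (subst b1, subst b2) (simp add: algebra_simps)
   moreover have "s *. l2 + v *. m2 = (s * x + v * z) *. l2' + (s * y + v * w) *. m2'"
   by (subst b1, subst b2) (simp add: algebra_simps)
   ultimately show ?thesis using T1' tf unfolding tform_def by (simp add: add.assoc)
  qed
  show "Good (q * x + r * z) (q * y + r * w) (s * x + v * z) (s * y + v * w)"
   unfolding Good_def using tb' tf' by blast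
 qed
 then show ?thesis unfolding Good_def by blast
qed

text \<open>
  In a diagonal basis the relation \<open>om\<^sup>2 = D om - N\<close> gives \<open>p + a = D\<close> and \<open>minpol a = - d q v\<close>. A common
  factor of \<open>q\<close> and \<open>p - a\<close> would divide \<open>om - a\<close> on the lattice, contradicting properness. Because \<open>q\<close>
  and \<open>p - a\<close> are coprime, the basis can be changed so that the first entry of the block becomes 1; then
  \<open>a\<close> is a root modulo \<open>d\<close>, and the basis is the one of \<open>\<O>\<^sub>D \<oplus> \<aa>/\<surd>D\<close> for the ideal belonging to
  that root: \<open>u, w, M1, M2\<close> correspond to \<open>(1, 0), (\<eta>, 0), (0, \<eta>\<^sup>\<sigma>/\<surd>D), (0, - d/\<surd>D)\<close>.
\<close>

theorem rm_lattice_structure: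
 assumes type: "has_type H \<Lambda> [1, d]" and d: "d > 0"
 shows "\<exists>\<aa>\<in>primitive_ideals D d. \<exists>\<eta> u w M1 M2. smart_basis D d \<aa> 1 \<eta> &
  \<Lambda> = zspan [u, w, M1, M2] & E u w = 0 & E u M1 = 1 & E u M2 = 0 & E w M1 = 0 & E w M2 = real d & E M1 M2 = 0 &
  (EX p a c. om = of_int p + \<eta> & om * \<eta> = of_int a * \<eta> + of_int (int d * c) &
   om * cj \<eta> = of_int p * cj \<eta> - of_int (int d * c) & om * real d = of_int a * real d - real d * cj \<eta> &
   T u = p *. u + w & T w = a *. w + (int d * c) *. u & T M1 = p *. M1 + c *. M2 & T M2 = a *. M2 + real d *\<^sub>R M1)"
proof -
 obtain l1 l2 m1 m2 where tb0: "typed_basis d l1 l2 m1 m2" "\<Lambda> = zspan [l1, l2, m1, m2]"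
  using has_type_typed_basis[OF type] by blast
 note cl = lat_closed[OF tb0]
 obtain p a q v l1 l2 m1 m2 where qv: "q dvd v" and tb: "typed_basis d l1 l2 m1 m2"
  and tf: "tform d p a l1 l2 m1 m2 q 0 0 v"
  using rm_basis_diagonal[OF tb0 d] by blast
 note g = typed_basis_gram[OF tb]
 have mem: "l1 \<in> \<Lambda>" "l2 \<in> \<Lambda>" "m1 \<in> \<Lambda>" "m2 \<in> \<Lambda>" and sp: "\<Lambda> \<subseteq> zspan [l1, l2, m1, m2]"
  using tb unfolding typed_basis_def by auto
 have memW: "l1 \<in> W" "l2 \<in> W" "m1 \<in> W" "m2 \<in> W" using mem lat_W by auto
 have Tl1: "T l1 = p *. l1 + q *. l2" and Tm1: "T m1 = p *. m1 + v *. m2"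
  and Tl2: "T l2 = a *. l2 + (int d * v) *. l1" and Tm2: "T m2 = a *. m2 + (int d * q) *. m1"
  using tf unfolding tform_def by simp_all
 have "T (T l1) = p *. T l1 + q *. T l2" using Tl1 memW W_scaleR by (simp add: T_add T_scaleR)
 then have l1eq: "p *. (p *. l1 + q *. l2) + q *. (a *. l2 + (int d * v) *. l1) =
   real D *\<^sub>R (p *. l1 + q *. l2) - nom *. l1"
  using T_sq[OF memW(1)] unfolding Tl1 Tl2 by simp
 have "real_of_int (p * p + q * (int d * v)) = of_int (int D * p - nom)"
  using arg_cong[OF l1eq, of "%x. E x m1"] by (simp add: E_bilinear g)
 then have c1: "p * p + q * (int d * v) = int D * p - nom" by linarith
 have "real d * real_of_int (p * q + q * a) = real d * of_int (int D * q)"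
  using arg_cong[OF l1eq, of "%x. E x m2"] by (simp add: E_bilinear g algebra_simps)
 then have "real_of_int (p * q + q * a) = of_int (int D * q)" using d by simp
 then have c2: "p * q + q * a = int D * q" by linarith
 have pa: "p + a = int D"
 proof (rule ccontr)
  assume "p + a ~= int D"
  moreover have "q * (p + a - int D) = 0" using c2 by (simp add: algebra_simps)
  ultimately have "q = 0" by simp
  then have "minpol p = 0" using c1 unfolding minpol_def by simp
  then show False using minpol_ne_0 by simp
 qed
 have nomeq: "nom = p * a - int d * q * v" using c1 unfolding pa[symmetric] by (simp add: algebra_simps)
 have mpa: "minpol a = - (int d * q * v)" unfolding minpol_def nomeq unfolding pa[symmetric] by (simp add: algebra_simps)
 have cop: "coprime q (p - a)"
 proof (rule ccontr)
  assume "~ coprime q (p - a)"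
  define n where "n = nat (gcd q (p - a))"
  have "q ~= 0 \<or> p - a ~= 0"
  proof (rule ccontr)
   assume "~ (q ~= 0 \<or> p - a ~= 0)"
   then have "minpol a = 0" using mpa by simp
   then show False using minpol_ne_0 by simp
  qed
  then have n0: "gcd q (p - a) > 0" by simp
  moreover have "gcd q (p - a) ~= 1" using \<open>~ coprime q (p - a)\<close> by (simp add: coprime_iff_gcd_eq_1)
  ultimately have "gcd q (p - a) > 1" by linarith
  then have n1: "n > 1" unfolding n_def by simp
  have ng: "int n = gcd q (p - a)" unfolding n_def using n0 by simp
  have nq: "int n dvd q" "int n dvd p - a" unfolding ng by simp_all
  then have nv: "int n dvd v" using qv dvd_trans by blast
  obtain q' where q': "q = int n * q'" using nq(1) by (auto elim: dvdE)
  obtain v' where v': "v = int n * v'" using nv by (auto elim: dvdE)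
  obtain e' where e': "p - a = int n * e'" using nq(2) by (auto elim: dvdE)
  have pe: "real_of_int p = real n * of_int e' + of_int a" using arg_cong[OF e', of real_of_int] by simp
  show False
  proof (rule not_scalar_mod_prime[OF n1])
   show "int n dvd int D - 2 * a" using nq(2) pa[symmetric] by simp
   show "int n * int n dvd minpol a" unfolding mpa q' v' by (simp add: mult.left_commute mult.assoc)
   fix x assume "x \<in> \<Lambda>"
   then have "x \<in> zspan [l1, l2, m1, m2]" using sp by blast
   then obtain n1 n2 n3 n4 where x: "x = n1 *. l1 + n2 *. l2 + n3 *. m1 + n4 *. m2" unfolding zspan4 by blast
   have Tx: "T x = n1 *. T l1 + n2 *. T l2 + n3 *. T m1 + n4 *. T m2"
   unfolding x using memW W_scaleR W_add by (simp add: T_add T_scaleR)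
   define y where "y = n1 *. (e' *. l1 + q' *. l2) + n2 *. ((int d * v') *. l1) + n3 *. (e' *. m1 + v' *. m2) + n4 *. ((int d * q') *. m1)"
   have "y \<in> \<Lambda>" unfolding y_def by (intro cl mem)
   moreover have "T x - a *. x = real n *\<^sub>R y"
   unfolding Tx Tl1 Tl2 Tm1 Tm2 unfolding x y_def q' v' pe by (simp add: pe algebra_simps)
   ultimately show "\<exists>y\<in>\<Lambda>. T x - a *. x = real n *\<^sub>R y" by blast
  next
   fix x y assume "x \<in> \<Lambda>" "y \<in> \<Lambda>" then show "x + y \<in> \<Lambda>" by (rule cl)
  next
   fix k :: int and x assume "x \<in> \<Lambda>" then show "k *. x \<in> \<Lambda>" by (rule cl)
  qed
 qed
 then obtain z y where "z * q + y * (p - a) = 1" using bezout_int[of q "p - a"] by (metis coprime_imp_gcd_eq_1)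
 then have zy: "real_of_int z * of_int q + of_int y * (of_int p - of_int a) = 1"
  by (metis of_int_1 of_int_add of_int_diff of_int_mult)
 define u where "u = l1 + m2"
 define w where "w = q *. l2 + (a - p) *. m2 + (int d * q) *. m1"
 define M2 where "M2 = y *. l2 + (int d * y) *. m1 + z *. m2"
 define M1 where "M1 = m1 + (y * v) *. u"
 have wm: "u \<in> \<Lambda>" "w \<in> \<Lambda>" "M1 \<in> \<Lambda>" "M2 \<in> \<Lambda>"
  unfolding u_def w_def M2_def M1_def by (intro cl mem)+
 have uW: "u \<in> W" "w \<in> W" "M1 \<in> W" "M2 \<in> W" using wm lat_W by auto
 have gram: "E u w = 0" "E u M1 = 1" "E u M2 = 0" "E w M1 = 0"
  unfolding u_def w_def M1_def M2_def by (simp_all add: E_bilinear g algebra_simps)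
 have "E w M2 = real d * (of_int z * of_int q + of_int y * (of_int p - of_int a))"
  unfolding w_def M2_def by (simp add: E_bilinear g algebra_simps)
 then have gram5: "E w M2 = real d" unfolding zy by simp
 have gram6: "E M1 M2 = 0"
  unfolding M1_def M2_def u_def by (simp add: E_bilinear g algebra_simps)
 have l1e: "l1 = u + y *. w + (- q) *. M2"
 proof -
  have "u + y *. w + (- q) *. M2 = l1 + (1 - (of_int z * of_int q + of_int y * (of_int p - of_int a))) *\<^sub>R m2"
   unfolding u_def w_def M2_def by (simp add: algebra_simps)
  then show ?thesis unfolding zy by simp
 qed
 have l2e: "l2 = (y * v * int d) *. u + z *. w + (- int d) *. M1 + (p - a) *. M2"
 proof -
  have "(y * v * int d) *. u + z *. w + (- int d) *. M1 + (p - a) *. M2 =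
   (of_int z * of_int q + of_int y * (of_int p - of_int a)) *\<^sub>R l2
   + (real d * ((of_int z * of_int q + of_int y * (of_int p - of_int a)) - 1)) *\<^sub>R m1"
   unfolding w_def M2_def M1_def by (simp add: algebra_simps)
  then show ?thesis unfolding zy by simp
 qed
 have m1e: "m1 = M1 + (- y * v) *. u" unfolding M1_def by simp
 have m2e: "m2 = u - l1" unfolding u_def by simp
 have in_sp: "u \<in> zspan [u, w, M1, M2]" "w \<in> zspan [u, w, M1, M2]" "M1 \<in> zspan [u, w, M1, M2]" "M2 \<in> zspan [u, w, M1, M2]"
  by (simp_all add: zspan_mem)
 have s1: "l1 \<in> zspan [u, w, M1, M2]" by (subst l1e) (intro zspan_add zspan_zscale in_sp)
 have s2: "l2 \<in> zspan [u, w, M1, M2]" by (subst l2e) (intro zspan_add zspan_zscale in_sp)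
 have s3: "m1 \<in> zspan [u, w, M1, M2]" by (subst m1e) (intro zspan_add zspan_zscale in_sp)
 have "m2 = u + (- 1) *. l1" unfolding m2e by simp
 then have s4: "m2 \<in> zspan [u, w, M1, M2]" using zspan_add[OF in_sp(1) zspan_zscale[OF s1, of "-1"]] by simp
 have lateq: "\<Lambda> = zspan [u, w, M1, M2]"
 proof (intro equalityI subsetI)
  fix x assume "x \<in> \<Lambda>"
  then have "x \<in> zspan [l1, l2, m1, m2]" using sp by blast
  then show "x \<in> zspan [u, w, M1, M2]" by (rule zspan_subset) (use s1 s2 s3 s4 in auto)
 next
  fix x assume "x \<in> zspan [u, w, M1, M2]"
  then show "x \<in> \<Lambda>" unfolding zspan4 using cl wm by (auto intro!: cl)
 qed
 have Tu: "T u = p *. u + w"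
  unfolding u_def T_add[OF memW(1,4)] Tl1 Tm2 w_def by (simp add: algebra_simps)
 have TM2: "T M2 = a *. M2 + real d *\<^sub>R M1"
 proof -
  have "T M2 = y *. T l2 + (int d * y) *. T m1 + z *. T m2"
   unfolding M2_def using memW W_scaleR W_add by (simp only: T_add T_scaleR)
  also have "\<dots> = a *. M2 + (real d * (of_int y * of_int v)) *\<^sub>R u +
   (real d * (of_int z * of_int q + of_int y * (of_int p - of_int a))) *\<^sub>R m1"
   unfolding Tl2 Tm1 Tm2 M2_def u_def by (simp add: algebra_simps)
  finally show ?thesis unfolding zy M1_def by (simp add: algebra_simps)
 qed
 have "T w = T (T u + (- p) *. u)" using Tu by simp
 also have "\<dots> = T (T u) + (- p) *. T u" using uW T_W W_scaleR by (simp only: T_add T_scaleR)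
 also have "\<dots> = (real D - of_int p) *\<^sub>R T u - nom *. u" unfolding T_sq[OF uW(1)] by (simp add: algebra_simps)
 also have "real D - of_int p = of_int a" using arg_cong[OF pa, of real_of_int] by simp
 also have "a *. T u - nom *. u = a *. w + (int d * (q * v)) *. u"
  unfolding Tu nomeq by (simp add: algebra_simps)
 finally have Tw: "T w = a *. w + (int d * (q * v)) *. u" .
 have "real d *\<^sub>R T M1 = T (real d *\<^sub>R M1)" using T_scaleR[OF uW(3)] by simp
 also have "real d *\<^sub>R M1 = T M2 + (- a) *. M2" unfolding TM2 by simp
 also have "T (T M2 + (- a) *. M2) = T (T M2) + (- a) *. T M2" using uW T_W W_scaleR by (simp only: T_add T_scaleR)
 also have "\<dots> = (real D - of_int a) *\<^sub>R T M2 - nom *. M2" unfolding T_sq[OF uW(4)] by (simp add: algebra_simps)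
 also have "real D - of_int a = of_int p" using arg_cong[OF pa, of real_of_int] by simp
 also have "p *. T M2 - nom *. M2 = real d *\<^sub>R (p *. M1 + (q * v) *. M2)"
  unfolding TM2 nomeq by (simp add: algebra_simps)
 finally have TM1: "T M1 = p *. M1 + (q * v) *. M2" using d by simp
 define \<eta> where "\<eta> = om - of_int p"
 define \<aa> where "\<aa> = root_ideal d a"
 have rt: "int d dvd minpol a" unfolding mpa by simp
 have prim: "\<aa> \<in> primitive_ideals D d" unfolding \<aa>_def by (rule primitive_root_ideal[OF d rt])
 have cjo: "cj \<eta> = of_int a - om"
  unfolding \<eta>_def using arg_cong[OF pa, of real_of_int] by (simp add: cj_om)
 have smart: "smart_basis D d \<aa> 1 \<eta>"
  unfolding smart_basis_def
 proof (intro conjI)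
  show "is_zbasis [1, \<eta>] Od"
   unfolding is_zbasis2_iff
  proof (intro conjI equalityI subsetI allI impI)
   fix x assume "x \<in> Od"
   then obtain m n where "x = of_int m + of_int n * om" by (elim Od_cases)
   then have "x = of_int (m + n * p) * 1 + of_int n * \<eta>" unfolding \<eta>_def by (simp add: algebra_simps)
   then show "x \<in> {of_int m * 1 + of_int n * \<eta> | m n. True}" by blast
  next
   fix m n assume "of_int m * 1 + of_int n * \<eta> = 0"
   then have "of_int (m - n * p) + of_int n * om = 0" unfolding \<eta>_def by (simp add: algebra_simps)
   from om_coords_zero[OF this] show "m = 0" "n = 0" by auto
  qed (auto simp: \<eta>_def)
  show "1 * cj \<eta> - cj 1 * \<eta> = - s" unfolding \<eta>_def using om_diff by simp
  show "is_zbasis [cj \<eta>, real d * cj 1] \<aa>"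
   unfolding is_zbasis2_iff \<aa>_def
  proof (intro conjI equalityI subsetI allI impI)
   fix x assume "x \<in> root_ideal d a"
   then obtain k n where "x = real d * of_int k + of_int n * (om - of_int a)" by (rule root_idealE)
   then have "x = of_int (- n) * cj \<eta> + of_int k * (real d * cj 1)" unfolding cjo by (simp add: algebra_simps)
   then show "x \<in> {of_int m * cj \<eta> + of_int n * (real d * cj 1) | m n. True}" by blast
  next
   fix x assume "x \<in> {of_int m * cj \<eta> + of_int n * (real d * cj 1) | m n. True}"
   then obtain m n where "x = of_int m * cj \<eta> + of_int n * (real d * cj 1)" by blast
   then have "x = of_int (m * a + n * int d) + of_int (- m) * om" unfolding cjo by (simp add: algebra_simps)
   moreover have "int d dvd (m * a + n * int d) + (- m) * a" by simp
   ultimately show "x \<in> root_ideal d a" using root_ideal_iff by blast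
  next
   fix m n assume "of_int m * cj \<eta> + of_int n * (real d * cj 1) = 0"
   then have "of_int (m * a + n * int d) + of_int (- m) * om = 0" unfolding cjo by (simp add: algebra_simps)
   from om_coords_zero[OF this] show "m = 0" "n = 0" using d by auto
  qed
 qed
 have Dr: "real D = of_int p + of_int a" using arg_cong[OF pa, of real_of_int] by simp
 have o1: "om * \<eta> = of_int a * \<eta> + of_int (int d * (q * v))"
 proof -
  have "om * \<eta> = (of_int p + of_int a) * om - of_int nom - of_int p * om" unfolding \<eta>_def right_diff_distrib om_sq Dr by simp
  also have "\<dots> = of_int a * \<eta> + of_int (int d * (q * v))" unfolding nomeq \<eta>_def by (simp add: algebra_simps)
  finally show ?thesis .
 qed
 have o2: "om * cj \<eta> = of_int p * cj \<eta> - of_int (int d * (q * v))"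
 proof -
  have "om * cj \<eta> = of_int a * om - ((of_int p + of_int a) * om - of_int nom)" unfolding cjo right_diff_distrib om_sq Dr by simp
  also have "\<dots> = of_int p * cj \<eta> - of_int (int d * (q * v))" unfolding nomeq cjo by (simp add: algebra_simps)
  finally show ?thesis .
 qed
 have o3: "om * real d = of_int a * real d - real d * cj \<eta>" unfolding cjo by (simp add: algebra_simps)
 have o0: "om = of_int p + \<eta>" unfolding \<eta>_def by simp
 show ?thesis
  by (intro bexI[OF _ prim] exI[of _ \<eta>] exI[of _ u] exI[of _ w] exI[of _ M1] exI[of _ M2] conjI
   exI[of _ p] exI[of _ a] exI[of _ "q * v"] smart lateq gram gram5 gram6 o0 o1 o2 o3 Tu Tw TM1 TM2)
qed

end

section \<open>Symplectic period matrices\<close>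

lemma exhaust_6: fixes x :: 6 shows "x = 1 \<or> x = 2 \<or> x = 3 \<or> x = 4 \<or> x = 5 \<or> x = 6"
proof (induct x)
 case (of_int z)
 then have "0 \<le> z" "z < 6" by simp_all
 then have "z = 0 \<or> z = 1 \<or> z = 2 \<or> z = 3 \<or> z = 4 \<or> z = 5" by arith
 then show ?case by auto
qed

lemma UNIV_6: "UNIV = {1::6, 2, 3, 4, 5, 6}"
 using exhaust_6 by auto

lemma forall_6: "(\<forall>i::6. P i) \<longleftrightarrow> P 1 & P 2 & P 3 & P 4 & P 5 & P 6"
 by (metis exhaust_6)

lemma distinct_6 [simp]: "(1::6) ~= 2" "(1::6) ~= 3" "(1::6) ~= 4" "(1::6) ~= 5" "(1::6) ~= 6"
 "(2::6) ~= 3" "(2::6) ~= 4" "(2::6) ~= 5" "(2::6) ~= 6" "(3::6) ~= 4" "(3::6) ~= 5" "(3::6) ~= 6"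
 "(4::6) ~= 5" "(4::6) ~= 6" "(5::6) ~= 6"
 "(2::6) ~= 1" "(3::6) ~= 1" "(4::6) ~= 1" "(5::6) ~= 1" "(6::6) ~= 1"
 "(3::6) ~= 2" "(4::6) ~= 2" "(5::6) ~= 2" "(6::6) ~= 2" "(4::6) ~= 3" "(5::6) ~= 3" "(6::6) ~= 3"
 "(5::6) ~= 4" "(6::6) ~= 4" "(6::6) ~= 5"
 by simp_all

lemma sum_6: "sum f (UNIV :: 6 set) = f 1 + f 2 + f 3 + f 4 + f 5 + f 6"
 unfolding UNIV_6 by (simp add: add.assoc)

definition vec6 :: "'a => 'a => 'a => 'a => 'a => 'a => 'a ^ 6" where
 "vec6 a b c d e f = (\<chi> j. if j = 1 then a else if j = 2 then b else if j = 3 then c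
  else if j = 4 then d else if j = 5 then e else f)"

lemma vec6_nth [simp]: "vec6 a b c d e f $ 1 = a" "vec6 a b c d e f $ 2 = b" "vec6 a b c d e f $ 3 = c"
 "vec6 a b c d e f $ 4 = d" "vec6 a b c d e f $ 5 = e" "vec6 a b c d e f $ 6 = f"
 unfolding vec6_def by simp_all

definition col :: "complex ^ (3 \<times> 6) => 6 => complex ^ 3" where "col M j = (\<chi> i. M $ (i, j))"

definition mat6 :: "(complex ^ 3) ^ 6 => complex ^ (3 \<times> 6)" where "mat6 b = (\<chi> p. b $ snd p $ fst p)"

lemma col_mat6 [simp]: "col (mat6 b) j = b $ j"
 unfolding col_def mat6_def by (simp add: vec_eq_iff)

lemma period_hom_col: "period_hom M n = (\<Sum>j\<in>UNIV. n $ j *. col M j)"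
 unfolding period_hom_def col_def by (simp add: scaleR_eq_smult)

lemma period_hom_6: "period_hom M n = n $ 1 *. col M 1 + n $ 2 *. col M 2 + n $ 3 *. col M 3
  + n $ 4 *. col M 4 + n $ 5 *. col M 5 + n $ 6 *. col M 6"
 unfolding period_hom_col sum_6 ..

lemma period_hom_add: "period_hom M (m + n) = period_hom M m + period_hom M n"
 unfolding period_hom_6 by (simp add: scaleR_add_left algebra_simps)

lemma range_period_hom: "range (period_hom M) = zspan [col M 1, col M 2, col M 3, col M 4, col M 5, col M 6]"
proof (intro equalityI subsetI)
 fix x assume "x \<in> range (period_hom M)"
 then obtain n where "x = period_hom M n" by blast
 then show "x \<in> zspan [col M 1, col M 2, col M 3, col M 4, col M 5, col M 6]"
  unfolding zspan6 period_hom_6 by blast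
next
 fix x assume "x \<in> zspan [col M 1, col M 2, col M 3, col M 4, col M 5, col M 6]"
 then obtain n1 n2 n3 n4 n5 n6 where "x = n1 *. col M 1 + n2 *. col M 2 + n3 *. col M 3
  + n4 *. col M 4 + n5 *. col M 5 + n6 *. col M 6" unfolding zspan6 by blast
 then have "x = period_hom M (vec6 n1 n2 n3 n4 n5 n6)" unfolding period_hom_6 by simp
 then show "x \<in> range (period_hom M)" by blast
qed

text \<open>
  The standard symplectic form. It is needed over the integers for markings and over the reals for their
  real linear extension.
\<close>

definition E0 :: "'a::comm_ring_1 ^ 6 => 'a ^ 6 => 'a" where
 "E0 m n = m $ 1 * n $ 4 - m $ 4 * n $ 1 + m $ 2 * n $ 5 - m $ 5 * n $ 2 + m $ 3 * n $ 6 - m $ 6 * n $ 3"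

text \<open>
  The real linear extension of \<open>period_hom\<close>; for a symplectic basis it is an isomorphism onto \<open>\<complex>\<^sup>3\<close>.
\<close>

definition rhom :: "complex ^ (3 \<times> 6) => real ^ 6 => complex ^ 3" where
 "rhom M r = (\<Sum>j\<in>UNIV. r $ j *\<^sub>R col M j)"

lemma rhom_of_int: "rhom M (\<chi> j. of_int (n $ j)) = period_hom M n"
 unfolding rhom_def period_hom_col by simp

lemma linear_rhom: "linear (rhom M)"
 by (rule linearI) (simp_all add: rhom_def scaleR_add_left sum.distrib scaleR_sum_right)

locale hermitian3 = hermitian_form H for H :: "complex ^ 3 => complex ^ 3 => complex"
begin

definition symp :: "complex ^ (3 \<times> 6) => bool" where
 "symp M \<longleftrightarrow> (ALL i j. E (col M i) (col M j) = E0 (axis i 1) (axis j 1))"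

lemma symp_gram:
 assumes "symp M" shows "E (col M i) (col M j) = E0 (axis i 1) (axis j 1)"
 using assms unfolding symp_def by blast

lemma E_sum_l: "E (sum f A) y = (\<Sum>i\<in>A. E (f i) y)"
 by (induction A rule: infinite_finite_induct) (simp_all add: E_add_l)
lemma E_sum_r: "E x (sum f A) = (\<Sum>i\<in>A. E x (f i))"
 by (induction A rule: infinite_finite_induct) (simp_all add: E_add_r)

lemma E0_axis [simp]:
 "E0 (axis 1 1) (axis 4 1) = (1::real)" "E0 (axis 4 1) (axis 1 1) = (-1::real)"
 "E0 (axis 2 1) (axis 5 1) = (1::real)" "E0 (axis 5 1) (axis 2 1) = (-1::real)"
 "E0 (axis 3 1) (axis 6 1) = (1::real)" "E0 (axis 6 1) (axis 3 1) = (-1::real)"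
 unfolding E0_def axis_def by simp_all

lemma symp_rhom:
 assumes "symp M" shows "E (rhom M r) (rhom M t) = E0 r t"
proof -
 have "E (rhom M r) (rhom M t) = (\<Sum>i\<in>UNIV. \<Sum>j\<in>UNIV. r $ i * (t $ j * E0 (axis i 1) (axis j 1)))"
  unfolding rhom_def E_sum_l E_sum_r E_scaleR_l E_scaleR_r symp_gram[OF assms]
  by (simp add: sum_distrib_left, subst sum.swap, simp add: mult.left_commute)
 also have "\<dots> = E0 r t" unfolding sum_6 E0_def axis_def by simp
 finally show ?thesis .
qed

lemma sympI_gram:
 assumes "E b1 b2 = 0" "E b1 b3 = 0" "E b1 c1 = 1" "E b1 c2 = 0" "E b1 c3 = 0"
  "E b2 b3 = 0" "E b2 c1 = 0" "E b2 c2 = 1" "E b2 c3 = 0" "E b3 c1 = 0" "E b3 c2 = 0" "E b3 c3 = 1"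
  "E c1 c2 = 0" "E c1 c3 = 0" "E c2 c3 = 0"
 shows "symp (mat6 (vec6 b1 b2 b3 c1 c2 c3))"
proof -
 have sw: "E y x = - c" if "E x y = c" for x y c using E_anti[of y x] that by simp
 note asw = assms[THEN sw]
 show ?thesis
  unfolding symp_def forall_6 using assms asw by (simp add: E0_def axis_def)
qed

lemma symp_period_hom:
 assumes "symp M" shows "E (period_hom M m) (period_hom M n) = of_int (E0 m n)"
 unfolding rhom_of_int[symmetric] symp_rhom[OF assms] E0_def by simp

lemma E0_nondegenerate: assumes "!!t. E0 r t = (0::real)" shows "r = 0"
 using assms[of "axis 1 1"] assms[of "axis 2 1"] assms[of "axis 3 1"] assms[of "axis 4 1"] assms[of "axis 5 1"] assms[of "axis 6 1"]
 unfolding E0_def axis_def by (simp add: vec_eq_iff forall_6)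

lemma inj_rhom: assumes "symp M" shows "inj (rhom M)"
proof -
 have "r = 0" if "rhom M r = 0" for r
  using symp_rhom[OF assms, of r] that by (intro E0_nondegenerate) simp
 then show ?thesis using linear_injective_0[OF linear_rhom] by blast
qed

lemma surj_rhom: assumes "symp M" shows "surj (rhom M)"
proof -
 have "dim (range (rhom M)) = dim (UNIV :: (real ^ 6) set)"
  by (rule dim_image_eq[OF linear_rhom]) (use inj_rhom[OF assms] in \<open>simp add: span_UNIV\<close>)
 then have "dim (range (rhom M)) = DIM(complex ^ 3)" by simp
 moreover have "subspace (range (rhom M))" using linear_rhom by (simp add: linear_subspace_image)
 ultimately show ?thesis by (metis dim_eq_full span_eq_iff)
qed

lemma inj_period_hom: assumes "symp M" shows "inj (period_hom M)"
proof (rule injI)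
 fix m n assume "period_hom M m = period_hom M n"
 then have "(\<chi> j. real_of_int (m $ j)) = (\<chi> j. real_of_int (n $ j))"
  unfolding rhom_of_int[symmetric] using inj_rhom[OF assms] by (simp add: inj_eq)
 then show "m = n" by (simp add: vec_eq_iff)
qed

text \<open>
  The lattice of a principal polarization is its own dual.
\<close>

lemma symp_unimodular:
 assumes M: "symp M" and int: "!!y. y \<in> range (period_hom M) ==> E x y \<in> \<int>"
 shows "x \<in> range (period_hom M)"
proof -
 obtain r where r: "x = rhom M r" using surj_rhom[OF M] by (metis surjD)
 have Z: "E0 r (\<chi> j. of_int (n $ j)) \<in> \<int>" for n
  using int[of "period_hom M n"] unfolding r rhom_of_int[symmetric] symp_rhom[OF M] by blast
 have "r $ j \<in> \<int>" for j
  using Z[of "axis 1 1"] Z[of "axis 2 1"] Z[of "axis 3 1"] Z[of "axis 4 1"] Z[of "axis 5 1"] Z[of "axis 6 1"]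
   exhaust_6[of j] unfolding E0_def axis_def by auto
 then have "ALL j. \<exists>k::int. r $ j = of_int k" by (auto elim: Ints_cases)
 then obtain f where "ALL j. r $ j = real_of_int (f j)" by metis
 then have "r = (\<chi> j. of_int ((\<chi> j. f j) $ j))" by (simp add: vec_eq_iff)
 then have "x = period_hom M (\<chi> j. f j)" unfolding r using rhom_of_int by metis
 then show ?thesis by blast
qed

lemma symp_orthogonal: assumes "symp M" "!!y. y \<in> range (period_hom M) ==> E x y = 0" shows "E x y = 0"
proof -
 obtain r where r: "y = rhom M r" using surj_rhom[OF assms(1)] by (metis surjD)
 have "E x (col M j) = 0" for j
 proof -
  have "period_hom M (axis j 1) = col M j" unfolding period_hom_col axis_def
   by (simp add: if_distrib[of "%k. k *. _"] cong: if_cong)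
  then show ?thesis using assms(2) by (metis rangeI)
 qed
 then show ?thesis unfolding r rhom_def E_sum_r E_scaleR_r by simp
qed

text \<open>
  A Hermitian form is determined by its values on a real basis. This makes the polarization in the
  definition of the model threefold unique.
\<close>

lemma symp_agree:
 assumes "symp M" "hermitian H'" and eq: "!!x y. x \<in> range (period_hom M) ==> y \<in> range (period_hom M) ==> Im (H' x y) = Im (H x y)"
 shows "H' = H"
proof -
 interpret H': hermitian_form H' by unfold_locales (rule assms(2))
 have col: "col M j \<in> range (period_hom M)" for j
 proof -
  have "period_hom M (axis j 1) = col M j" unfolding period_hom_col axis_def
   by (simp add: if_distrib[of "%k. k *. _"] cong: if_cong)
  then show ?thesis by (metis rangeI)
 qed
 have "H'.E x y = E x y" for x y
 proof -
  obtain r t where rt: "x = rhom M r" "y = rhom M t" using surj_rhom[OF assms(1)] by (metis surjD)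
  interpret h': hermitian3 H' by unfold_locales
  have "H'.E (col M i) (col M j) = E (col M i) (col M j)" for i j
   using eq[OF col col] unfolding H'.E_def E_def .
  then show ?thesis unfolding rt rhom_def h'.E_sum_l h'.E_sum_r E_sum_l E_sum_r H'.E_bilinear E_bilinear by simp
 qed
 then show ?thesis using H'.H_via_E H_via_E by (intro ext) metis
qed

end

section \<open>The model family\<close>

abbreviation HH where "HH \<equiv> upper_half3"

no_notation fps_nth (infixl \<open>$\<close> 75)

lemma vec3_eqI: "x $ 1 = y $ 1 ==> x $ 2 = y $ 2 ==> x $ 3 = y $ 3 ==> x = (y :: 'a ^ 3)"
 by (simp add: vec_eq_iff forall_3)

context smart
begin

definition kn :: "int ^ 6 => real" where "kn n = kk (n $ 1) (n $ 2)"
definition ln6 :: "int ^ 6 => real" where "ln6 n = ll (n $ 4) (n $ 5)"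

text \<open>
  The coordinates of the sublattice in the standard marking: the third column of the model matrix is
  orthogonal to the surface, and \<open>d \<mu>\<^sub>2 - \<lambda>\<^sub>3\<close> lies in it.
\<close>

definition L0 :: "(int ^ 6) set" where "L0 = {n. n $ 6 = 0 & int d * n $ 3 + n $ 5 = 0}"

definition R0 :: "real => int ^ 6 => int ^ 6" where
 "R0 k n = (SOME n'. n' \<in> L0 & kn n' = k * kn n & ln6 n' = k * ln6 n)"

lemma L0_vec6: "n \<in> L0 ==> n = vec6 (n $ 1) (n $ 2) (n $ 3) (n $ 4) (- (int d * n $ 3)) 0"
 unfolding L0_def by (simp add: vec_eq_iff forall_6 eq_neg_iff_add_eq_0 add.commute)

lemma L0_unique: assumes "m \<in> L0" "n \<in> L0" "kn m = kn n" "ln6 m = ln6 n" shows "m = n"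
proof -
 have "m $ 1 = n $ 1 & m $ 2 = n $ 2" using kk_inj assms(3) unfolding kn_def by blast
 moreover have "m $ 4 = n $ 4 & m $ 5 = n $ 5" using ll_inj assms(4) unfolding ln6_def by blast
 moreover have "m $ 3 = n $ 3"
 proof -
  have "int d * m $ 3 = - m $ 5" "int d * n $ 3 = - n $ 5"
   using assms(1,2) unfolding L0_def mem_Collect_eq by linarith+
  then have "int d * m $ 3 = int d * n $ 3" using calculation by presburger
  then show ?thesis using d_pos by simp
 qed
 ultimately show ?thesis using assms(1,2) unfolding L0_def by (simp add: vec_eq_iff forall_6)
qed

lemma ideal_image_Od: "l \<in> (%x. x / s) ` \<aa> ==> k \<in> Od ==> k * l \<in> (%x. x / s) ` \<aa>"
 using RR_ideal_closed(5)[OF idl] by force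

lemma L0_ln: "n \<in> L0 ==> ln6 n \<in> (%x. x / s) ` \<aa>"
proof -
 assume "n \<in> L0"
 then have "n $ 5 = int d * (- n $ 3)" unfolding L0_def by simp
 then show ?thesis unfolding ln6_def ll_mem_iff by simp
qed

lemma L0_surj: assumes "k \<in> Od" "l \<in> (%x. x / s) ` \<aa>" shows "\<exists>n\<in>L0. kn n = k & ln6 n = l"
proof -
 obtain a b where ab: "k = kk a b" using kk_surj assms(1) by blast
 obtain m n where mn: "l = ll m (int d * n)" using ll_surj assms(2) by blast
 show ?thesis by (rule bexI[of _ "vec6 a b (- n) m (int d * n) 0"]) (simp_all add: ab mn L0_def kn_def ln6_def)
qed

lemma R0_spec: assumes "k \<in> Od" "n \<in> L0"
 shows "R0 k n \<in> L0" "kn (R0 k n) = k * kn n" "ln6 (R0 k n) = k * ln6 n"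
proof -
 have "k * kn n \<in> Od" using assms(1) unfolding kn_def by simp
 moreover have "k * ln6 n \<in> (%x. x / s) ` \<aa>" using ideal_image_Od L0_ln assms by blast
 ultimately have "EX n'. n' \<in> L0 & kn n' = k * kn n & ln6 n' = k * ln6 n" using L0_surj by blast
 from someI_ex[OF this] show "R0 k n \<in> L0" "kn (R0 k n) = k * kn n" "ln6 (R0 k n) = k * ln6 n"
  unfolding R0_def by blast+
qed

lemma R0_eqI: "k \<in> Od ==> n \<in> L0 ==> n' \<in> L0 ==> kn n' = k * kn n ==> ln6 n' = k * ln6 n ==> R0 k n = n'"
 using R0_spec L0_unique by metis

text \<open>
  Points whose first two coordinates are \<open>\<alpha> + \<beta> z\<close> and its conjugate. All lattice points are of this
  form, and \<open>\<alpha>, \<beta>, i, j\<close> are determined by the point.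
\<close>

definition pvec :: "complex ^ 3 => real => real => int => int => complex ^ 3" where
 "pvec z \<alpha> \<beta> i j = vector [of_real \<alpha> + of_real \<beta> * z $ 1, of_real (cj \<alpha>) + of_real (cj \<beta>) * z $ 2,
  (of_int i - of_int j * z $ 3) / of_nat d]"

definition al :: "int ^ 6 => real" where "al n = kn n + of_int (n $ 6) * \<eta>2 / real d"

definition Pz :: "complex ^ 3 => complex ^ (3 \<times> 6)" where
 "Pz z = mat6 (vec6 (period_lambda D \<eta>1 \<eta>2 ! 0) (period_lambda D \<eta>1 \<eta>2 ! 1) (period_lambda D \<eta>1 \<eta>2 ! 2)
   (period_mu D d \<eta>1 \<eta>2 z ! 0) (period_mu D d \<eta>1 \<eta>2 z ! 1) (period_mu D d \<eta>1 \<eta>2 z ! 2))"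

lemma threefold_lattice_eq: "threefold_lattice D d \<eta>1 \<eta>2 z = range (period_hom (Pz z))"
 unfolding range_period_hom threefold_lattice_def Pz_def by (simp add: period_lambda_def period_mu_def)

lemma kn_KK [simp]: "kn n \<in> KK" "ln6 n \<in> KK" "al n \<in> KK"
 unfolding kn_def ln6_def al_def by simp_all

lemma period_hom_Pz: "period_hom (Pz z) n = pvec z (al n) (ln6 n) (int d * n $ 3 + n $ 5) (n $ 6)"
proof (rule vec3_eqI)
 have d0: "(of_nat d :: complex) ~= 0" using d_pos by simp
 have cs: "cj (al n) = of_int (n $ 1) * cj \<eta>1 + of_int (n $ 2) * cj \<eta>2 + of_int (n $ 6) * cj \<eta>2 / real d"
  unfolding al_def kn_def kk_def by simp
 show "period_hom (Pz z) n $ 1 = pvec z (al n) (ln6 n) (int d * n $ 3 + n $ 5) (n $ 6) $ 1"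
  unfolding period_hom_6 Pz_def pvec_def al_def kn_def kk_def ln6_def ll_def
  by (simp add: period_lambda_def period_mu_def scaleR_conv_of_real[where 'a = complex] divide_inverse algebra_simps)
 show "period_hom (Pz z) n $ 2 = pvec z (al n) (ln6 n) (int d * n $ 3 + n $ 5) (n $ 6) $ 2"
  unfolding period_hom_6 Pz_def pvec_def cs ln6_def cj_ll
  by (simp add: period_lambda_def period_mu_def scaleR_conv_of_real[where 'a = complex] divide_inverse algebra_simps)
 show "period_hom (Pz z) n $ 3 = pvec z (al n) (ln6 n) (int d * n $ 3 + n $ 5) (n $ 6) $ 3"
  unfolding period_hom_6 Pz_def pvec_def using d0
  by (simp add: period_lambda_def period_mu_def scaleR_conv_of_real[where 'a = complex] field_simps)
qed

lemma s_ll: "s * ll m n = of_int m * cj \<eta>2 - of_int n * cj \<eta>1"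
 unfolding ll_def using s_ne by simp

lemma pvec_in_lattice:
 assumes "\<alpha> - of_int j * \<eta>2 / real d \<in> Od" "s * \<beta> + of_int i * cj \<eta>1 \<in> \<aa>"
 shows "pvec z \<alpha> \<beta> i j \<in> range (period_hom (Pz z))"
proof -
 obtain a b where ab: "\<alpha> - of_int j * \<eta>2 / real d = kk a b" using kk_surj assms(1) by blast
 obtain m n where mn: "s * \<beta> + of_int i * cj \<eta>1 = of_int m * cj \<eta>2 + of_int n * (real d * cj \<eta>1)"
  using assms(2) unfolding aa_eta by blast
 define n6 where "n6 = vec6 a b n m (i - int d * n) j"
 have 1: "al n6 = \<alpha>" unfolding al_def kn_def n6_def using ab by simp
 have "s * ln6 n6 = s * \<beta>" unfolding ln6_def n6_def s_ll using mn by (simp add: algebra_simps)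
 then have 2: "ln6 n6 = \<beta>" using s_ne by simp
 have "period_hom (Pz z) n6 = pvec z \<alpha> \<beta> i j" unfolding period_hom_Pz 1 2 unfolding n6_def by simp
 then show ?thesis by (metis rangeI)
qed

lemma lattice_coords:
 assumes "x \<in> range (period_hom (Pz z))"
 obtains \<alpha> \<beta> i j where "x = pvec z \<alpha> \<beta> i j" "\<alpha> \<in> KK" "\<beta> \<in> KK" "\<alpha> - of_int j * \<eta>2 / real d \<in> Od" "s * \<beta> + of_int i * cj \<eta>1 \<in> \<aa>"
proof -
 obtain n where n: "x = period_hom (Pz z) n" using assms by blast
 show thesis
 proof (rule that)
  show "x = pvec z (al n) (ln6 n) (int d * n $ 3 + n $ 5) (n $ 6)" unfolding n period_hom_Pz ..
  show "al n - of_int (n $ 6) * \<eta>2 / real d \<in> Od" unfolding al_def kn_def by simp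
  have "s * ln6 n + of_int (int d * n $ 3 + n $ 5) * cj \<eta>1 = of_int (n $ 4) * cj \<eta>2 + of_int (n $ 3) * (real d * cj \<eta>1)"
   unfolding ln6_def s_ll by (simp add: algebra_simps)
  then show "s * ln6 n + of_int (int d * n $ 3 + n $ 5) * cj \<eta>1 \<in> \<aa>" unfolding aa_eta by blast
 qed simp_all
qed

text \<open>
  The form that is the sum of the three forms \<open>x y\<^sup>*/Im z\<^sub>i\<close>, the last one weighted by \<open>d\<close>; it has the
  columns of the model matrix as symplectic basis.
\<close>

definition Hz :: "complex ^ 3 => complex ^ 3 => complex ^ 3 => complex" where
 "Hz z x y = x $ 1 * cnj (y $ 1) / of_real (Im (z $ 1)) + x $ 2 * cnj (y $ 2) / of_real (Im (z $ 2)) +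
  of_nat d * (x $ 3 * cnj (y $ 3)) / of_real (Im (z $ 3))"

lemma hermitian_Hz: "hermitian (Hz z)"
 unfolding hermitian_def Hz_def by (auto simp: add_divide_distrib algebra_simps)

lemma upper_half3_Im: "z \<in> HH ==> Im (z $ i) > 0"
 unfolding upper_half3_def by simp

lemma Hz_positive: assumes "z \<in> HH" "x ~= 0" shows "Re (Hz z x x) > 0"
proof -
 have pos: "Im (z $ 1) > 0" "Im (z $ 2) > 0" "Im (z $ 3) > 0" using upper_half3_Im[OF assms(1)] by blast+
 have "Hz z x x = of_real ((cmod (x $ 1))\<^sup>2 / Im (z $ 1) + (cmod (x $ 2))\<^sup>2 / Im (z $ 2) + d * (cmod (x $ 3))\<^sup>2 / Im (z $ 3))"
  unfolding Hz_def complex_norm_square[symmetric] by simp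
 then have e: "Re (Hz z x x) = (cmod (x $ 1))\<^sup>2 / Im (z $ 1) + (cmod (x $ 2))\<^sup>2 / Im (z $ 2) + d * (cmod (x $ 3))\<^sup>2 / Im (z $ 3)"
  by simp
 have "x $ 1 ~= 0 \<or> x $ 2 ~= 0 \<or> x $ 3 ~= 0" using assms(2) by (auto simp: vec_eq_iff forall_3)
 then have "(cmod (x $ 1))\<^sup>2 / Im (z $ 1) > 0 \<or> (cmod (x $ 2))\<^sup>2 / Im (z $ 2) > 0 \<or> d * (cmod (x $ 3))\<^sup>2 / Im (z $ 3) > 0"
  using pos d_pos by (auto intro!: divide_pos_pos mult_pos_pos)
 moreover have "(cmod (x $ 1))\<^sup>2 / Im (z $ 1) \<ge> 0" "(cmod (x $ 2))\<^sup>2 / Im (z $ 2) \<ge> 0" "d * (cmod (x $ 3))\<^sup>2 / Im (z $ 3) \<ge> 0"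
  using pos by (auto intro!: divide_nonneg_pos)
 ultimately show ?thesis unfolding e by linarith
qed

lemma Im_Hz_pvec:
 assumes "z \<in> HH"
 shows "Im (Hz z (pvec z \<alpha> \<beta> i j) (pvec z \<alpha>' \<beta>' i' j')) =
  (\<alpha>' * \<beta> + cj \<alpha>' * cj \<beta>) - (\<alpha> * \<beta>' + cj \<alpha> * cj \<beta>') + of_int (i * j' - j * i') / d"
proof -
 have pos: "Im (z $ 1) > 0" "Im (z $ 2) > 0" "Im (z $ 3) > 0" using upper_half3_Im[OF assms(1)] by blast+
 have two: "Im ((of_real a + of_real b * w) * cnj (of_real a' + of_real b' * w) / of_real (Im w)) = a' * b - a * b'"
  if "Im w > 0" for a b a' b' w
  using that by (simp add: field_simps)
 have three: "Im (of_nat d * ((of_int i - of_int j * w) / of_nat d * cnj ((of_int i' - of_int j' * w) / of_nat d)) / of_real (Im w)) = of_int (i * j' - j * i') / d"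
  if "Im w > 0" for w
 proof -
  have "of_nat d * ((of_int i - of_int j * w) / of_nat d * cnj ((of_int i' - of_int j' * w) / of_nat d)) / of_real (Im w)
   = ((of_int i - of_int j * w) * cnj (of_int i' - of_int j' * w)) / of_real (Im w * d)"
   using d_pos that by (simp add: field_simps)
  then show ?thesis using that d_pos by (simp add: field_simps del: of_real_mult)
 qed
 show ?thesis unfolding Hz_def pvec_def using two[OF pos(1)] two[OF pos(2)] three[OF pos(3)] by simp
qed

lemma Pz_E0:
 assumes "z \<in> HH"
 shows "Im (Hz z (period_hom (Pz z) m) (period_hom (Pz z) n)) = of_int (E0 m n)"
proof -
 have tr: "al m * ln6 n + cj (al m) * cj (ln6 n) = - of_int (m $ 1 * n $ 4 + m $ 2 * n $ 5) - of_int (m $ 6 * n $ 5) / d" for m n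
 proof -
  have 1: "kn m * ln6 n + cj (kn m) * cj (ln6 n) = - of_int (m $ 1 * n $ 4 + m $ 2 * n $ 5)"
   using tr_kk_ll[of "m $ 1" "m $ 2" "n $ 4" "n $ 5"] unfolding tr_def kn_def ln6_def by simp
  have 2: "\<eta>2 * ln6 n + cj \<eta>2 * cj (ln6 n) = - of_int (n $ 5)"
   using tr_kk_ll[of 0 1 "n $ 4" "n $ 5"] unfolding tr_def kk_def ln6_def by simp
  have "al m * ln6 n + cj (al m) * cj (ln6 n) = (kn m * ln6 n + cj (kn m) * cj (ln6 n)) +
   of_int (m $ 6) / d * (\<eta>2 * ln6 n + cj \<eta>2 * cj (ln6 n))"
   unfolding al_def by (simp add: algebra_simps add_divide_distrib)
  then show ?thesis unfolding 1 2 by simp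
 qed
 show ?thesis unfolding period_hom_Pz Im_Hz_pvec[OF assms] tr E0_def using d_pos by (simp add: field_simps)
qed

end

context hermitian_form
begin

lemma gram4_basis:
 assumes g: "E l1 l2 = 0" "E l1 m1 = 1" "E l1 m2 = 0" "E l2 m1 = 0" "E l2 m2 = e" "E m1 m2 = 0" and e: "e > 0"
 shows "independent {l1, l2, m1, m2}" and "is_zbasis [l1, l2, m1, m2] (zspan [l1, l2, m1, m2])"
proof -
 have sw: "E y x = - c" if "E x y = c" for x y c using E_anti[of y x] that by simp
 note gs = g g[THEN sw]
 have zero: "a = 0 & b = 0 & c = 0 & f = 0" if z: "a *\<^sub>R l1 + b *\<^sub>R l2 + c *\<^sub>R m1 + f *\<^sub>R m2 = 0" for a b c f
 proof -
  have "E (a *\<^sub>R l1 + b *\<^sub>R l2 + c *\<^sub>R m1 + f *\<^sub>R m2) x = 0" for x unfolding z by simp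
  from this[of m1] this[of m2] this[of l1] this[of l2] show ?thesis
   using e by (simp add: E_bilinear gs)
 qed
 have ne: "l1 ~= l2" "l1 ~= m1" "l1 ~= m2" "l2 ~= m1" "l2 ~= m2" "m1 ~= m2"
  using zero[of 1 "-1" 0 0] zero[of 1 0 "-1" 0] zero[of 1 0 0 "-1"] zero[of 0 1 "-1" 0] zero[of 0 1 0 "-1"] zero[of 0 0 1 "-1"]
  by auto
 show "independent {l1, l2, m1, m2}"
 proof (rule independent_if_scalars_zero)
  fix f x assume "(\<Sum>x\<in>{l1, l2, m1, m2}. f x *\<^sub>R x) = 0" and x: "x \<in> {l1, l2, m1, m2}"
  then have "f l1 *\<^sub>R l1 + f l2 *\<^sub>R l2 + f m1 *\<^sub>R m1 + f m2 *\<^sub>R m2 = 0"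
   using ne by (simp add: add.assoc)
  from zero[OF this] show "f x = 0" using x by auto
 qed simp
 show "is_zbasis [l1, l2, m1, m2] (zspan [l1, l2, m1, m2])"
  unfolding is_zbasis_def
 proof (intro conjI allI impI refl)
  fix c :: "nat => int" and i
  assume z: "(\<Sum>i<length [l1, l2, m1, m2]. c i *. [l1, l2, m1, m2] ! i) = 0" and i: "i < length [l1, l2, m1, m2]"
  have "c 0 *. l1 + c 1 *. l2 + c 2 *. m1 + c 3 *. m2 = 0"
   using z by (simp add: eval_nat_numeral)
  from zero[OF this] have "c 0 = 0 & c 1 = 0 & c 2 = 0 & c 3 = 0" by simp
  moreover have "i = 0 \<or> i = 1 \<or> i = 2 \<or> i = 3" using i by auto
  ultimately show "c i = 0" by blast
 qed
qed

lemma symplectic_basis2: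
 assumes g: "E l1 l2 = 0" "E l1 m1 = 1" "E l1 m2 = 0" "E l2 m1 = 0" "E l2 m2 = real d" "E m1 m2 = 0" and d: "d > 0"
  and \<Lambda>: "\<Lambda> = zspan [l1, l2, m1, m2]"
 shows "has_type H \<Lambda> [1, d]" and "full_lattice (span {l1, l2, m1, m2}) \<Lambda>"
proof -
 have sw: "E y x = - c" if "E x y = c" for x y c using E_anti[of y x] that by simp
 have d0: "real d > 0" using d by simp
 note b = gram4_basis[OF g d0]
 show "full_lattice (span {l1, l2, m1, m2}) \<Lambda>" unfolding full_lattice_def
  by (rule exI[of _ "[l1, l2, m1, m2]"]) (use b \<Lambda> in simp)
 have "symplectic_basis H \<Lambda> [1, d] [l1, l2] [m1, m2]"
  unfolding symplectic_basis_def
 proof (intro conjI allI impI)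
  show "is_zbasis ([l1, l2] @ [m1, m2]) \<Lambda>" using b(2) \<Lambda> by simp
  fix i j assume "i < length [1, d]" "j < length [1, d]"
  then have ij: "i = 0 \<or> i = 1" "j = 0 \<or> j = 1" by auto
  show "Im (H ([l1, l2] ! i) ([l1, l2] ! j)) = 0" using ij g(1) sw[OF g(1)] E_self unfolding E_def[symmetric] by auto
  show "Im (H ([m1, m2] ! i) ([m1, m2] ! j)) = 0" using ij g(6) sw[OF g(6)] E_self unfolding E_def[symmetric] by auto
  show "Im (H ([l1, l2] ! i) ([m1, m2] ! j)) = (if i = j then real ([1, d] ! i) else 0)"
   using ij g unfolding E_def[symmetric] by auto
 qed simp_all
 moreover have "ALL i. Suc i < length [1, d] --> [1, d] ! i dvd [1, d] ! Suc i" by auto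
 ultimately show "has_type H \<Lambda> [1, d]" unfolding has_type_def using d by auto
qed

end

lemma period_hom_axis: "period_hom M (axis j 1) = col M j"
 unfolding period_hom_col axis_def by (simp add: if_distrib[of "%k. k *. _"] cong: if_cong)

lemma period_hom_0 [simp]: "period_hom M 0 = 0"
 unfolding period_hom_col by simp

lemma less_6_cases: "i < (6::nat) ==> i = 0 \<or> i = 1 \<or> i = 2 \<or> i = 3 \<or> i = 4 \<or> i = 5"
 by linarith

context hermitian3
begin

lemma sympI: assumes "!!m n. E (period_hom M m) (period_hom M n) = of_int (E0 m n)" shows "symp M"
 unfolding symp_def
proof (intro allI)
 fix i j
 have "E (col M i) (col M j) = of_int (E0 (axis i 1) (axis j 1))" using assms[of "axis i 1" "axis j 1"] by (simp add: period_hom_axis)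
 then show "E (col M i) (col M j) = E0 (axis i 1) (axis j 1)" by (simp add: E0_def axis_def)
qed

lemma symp_independent:
 assumes M: "symp M"
 shows "independent {col M 1, col M 2, col M 3, col M 4, col M 5, col M 6}"
  and "span {col M 1, col M 2, col M 3, col M 4, col M 5, col M 6} = UNIV"
proof -
 let ?B = "{col M 1, col M 2, col M 3, col M 4, col M 5, col M 6}"
 show sp: "span ?B = UNIV"
 proof (intro equalityI subsetI)
  fix x :: "complex ^ 3"
  obtain r where r: "x = rhom M r" using surj_rhom[OF M] by (metis surjD)
  show "x \<in> span ?B" unfolding r rhom_def sum_6 by (intro span_add span_scale span_base) simp_all
 qed simp
 have "card ?B \<le> 6" using card_length[of "[col M 1, col M 2, col M 3, col M 4, col M 5, col M 6]"] by simp
 then have "card ?B \<le> dim (UNIV :: (complex ^ 3) set)" by simp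
 then show "independent ?B" by (intro card_le_dim_spanning[of ?B UNIV]) (use sp in auto)
qed

lemma symp_zbasis:
 assumes M: "symp M"
 shows "is_zbasis [col M 1, col M 2, col M 3, col M 4, col M 5, col M 6] (range (period_hom M))"
 unfolding is_zbasis_def
proof (intro conjI allI impI)
 show "range (period_hom M) = zspan [col M 1, col M 2, col M 3, col M 4, col M 5, col M 6]" by (rule range_period_hom)
 fix c :: "nat => int" and i
 let ?bs = "[col M 1, col M 2, col M 3, col M 4, col M 5, col M 6]"
 assume z: "(\<Sum>i<length ?bs. c i *. ?bs ! i) = 0" and i: "i < length ?bs"
 have "period_hom M (vec6 (c 0) (c 1) (c 2) (c 3) (c 4) (c 5)) = (\<Sum>i<length ?bs. c i *. ?bs ! i)"
  unfolding period_hom_6 by (simp add: eval_nat_numeral add.assoc)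
 then have "vec6 (c 0) (c 1) (c 2) (c 3) (c 4) (c 5) = 0"
  using inj_period_hom[OF M] period_hom_0[of M] unfolding z by (metis injD)
 then have "c 0 = 0 & c 1 = 0 & c 2 = 0 & c 3 = 0 & c 4 = 0 & c 5 = 0"
  by (metis vec6_nth zero_index)
 then show "c i = 0" using less_6_cases[of i] i by auto
qed

lemma symp_full_lattice: assumes M: "symp M" shows "full_lattice UNIV (range (period_hom M))"
 unfolding full_lattice_def
 by (rule exI[of _ "[col M 1, col M 2, col M 3, col M 4, col M 5, col M 6]"])
  (use symp_zbasis[OF M] symp_independent[OF M] in simp)

lemma symplectic_basis3_iff:
 "symplectic_basis H \<Lambda> [1, 1, 1] [b1, b2, b3] [c1, c2, c3] \<longleftrightarrow>
  symp (mat6 (vec6 b1 b2 b3 c1 c2 c3)) & \<Lambda> = range (period_hom (mat6 (vec6 b1 b2 b3 c1 c2 c3)))"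
proof
 assume sb: "symplectic_basis H \<Lambda> [1, 1, 1] [b1, b2, b3] [c1, c2, c3]"
 have g: "E ([b1, b2, b3] ! i) ([b1, b2, b3] ! j) = 0 & E ([c1, c2, c3] ! i) ([c1, c2, c3] ! j) = 0 &
  E ([b1, b2, b3] ! i) ([c1, c2, c3] ! j) = (if i = j then real ([1, 1, 1] ! i) else 0)" if "i < 3" "j < 3" for i j
  using sb that unfolding symplectic_basis_def E_def by simp
 have "symp (mat6 (vec6 b1 b2 b3 c1 c2 c3))"
  by (rule sympI_gram) (use g[of 0 0] g[of 0 1] g[of 0 2] g[of 1 0] g[of 1 1] g[of 1 2] g[of 2 0] g[of 2 1] g[of 2 2] in simp_all)
 moreover have "\<Lambda> = range (period_hom (mat6 (vec6 b1 b2 b3 c1 c2 c3)))"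
  using sb unfolding symplectic_basis_def is_zbasis_def range_period_hom by simp
 ultimately show "symp (mat6 (vec6 b1 b2 b3 c1 c2 c3)) & \<Lambda> = range (period_hom (mat6 (vec6 b1 b2 b3 c1 c2 c3)))" ..
next
 assume "symp (mat6 (vec6 b1 b2 b3 c1 c2 c3)) & \<Lambda> = range (period_hom (mat6 (vec6 b1 b2 b3 c1 c2 c3)))"
 then have M: "symp (mat6 (vec6 b1 b2 b3 c1 c2 c3))" and \<Lambda>: "\<Lambda> = range (period_hom (mat6 (vec6 b1 b2 b3 c1 c2 c3)))" by auto
 have g: "E (vec6 b1 b2 b3 c1 c2 c3 $ i) (vec6 b1 b2 b3 c1 c2 c3 $ j) = E0 (axis i 1) (axis j 1)" for i j
  using symp_gram[OF M, of i j] by simp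
 have G: "E b1 b1 = 0" "E b1 b2 = 0" "E b1 b3 = 0" "E b2 b1 = 0" "E b2 b2 = 0" "E b2 b3 = 0" "E b3 b1 = 0" "E b3 b2 = 0" "E b3 b3 = 0"
  "E c1 c1 = 0" "E c1 c2 = 0" "E c1 c3 = 0" "E c2 c1 = 0" "E c2 c2 = 0" "E c2 c3 = 0" "E c3 c1 = 0" "E c3 c2 = 0" "E c3 c3 = 0"
  "E b1 c1 = 1" "E b1 c2 = 0" "E b1 c3 = 0" "E b2 c1 = 0" "E b2 c2 = 1" "E b2 c3 = 0" "E b3 c1 = 0" "E b3 c2 = 0" "E b3 c3 = 1"
  using g[of 1 1] g[of 1 2] g[of 1 3] g[of 2 1] g[of 2 2] g[of 2 3] g[of 3 1] g[of 3 2] g[of 3 3]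
   g[of 4 4] g[of 4 5] g[of 4 6] g[of 5 4] g[of 5 5] g[of 5 6] g[of 6 4] g[of 6 5] g[of 6 6]
   g[of 1 4] g[of 1 5] g[of 1 6] g[of 2 4] g[of 2 5] g[of 2 6] g[of 3 4] g[of 3 5] g[of 3 6]
  by (simp_all add: E0_def axis_def)
 show "symplectic_basis H \<Lambda> [1, 1, 1] [b1, b2, b3] [c1, c2, c3]"
  unfolding symplectic_basis_def
 proof (intro conjI allI impI)
  show "is_zbasis ([b1, b2, b3] @ [c1, c2, c3]) \<Lambda>" using symp_zbasis[OF M] \<Lambda> by simp
  fix i j assume "i < length [1::nat, 1, 1]" "j < length [1::nat, 1, 1]"
  then have ij: "i = 0 \<or> i = 1 \<or> i = 2" "j = 0 \<or> j = 1 \<or> j = 2" by auto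
  show "Im (H ([b1, b2, b3] ! i) ([b1, b2, b3] ! j)) = 0" unfolding E_def[symmetric]
   using ij by (elim disjE) (simp_all add: G)
  show "Im (H ([c1, c2, c3] ! i) ([c1, c2, c3] ! j)) = 0" unfolding E_def[symmetric]
   using ij by (elim disjE) (simp_all add: G)
  show "Im (H ([b1, b2, b3] ! i) ([c1, c2, c3] ! j)) = (if i = j then real ([1, 1, 1] ! i) else 0)"
   unfolding E_def[symmetric] using ij by (elim disjE) (simp_all add: G)
 qed simp_all
qed

end

definition V2 :: "(complex ^ 3) set" where "V2 = {x. x $ 3 = 0}"

lemma V2_subspace: "vec.subspace V2"
 unfolding V2_def by (auto simp: vec.subspace_def)

lemma V2_dim: "vec.dim V2 = 2"
proof (rule vec.dim_unique[of "{axis 1 1, axis 2 1}"])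
 have ne: "axis 1 1 ~= (axis 2 1 :: complex ^ 3)" by (simp add: axis_eq_axis)
 show "{axis 1 1, axis 2 1} \<subseteq> V2" unfolding V2_def by (auto simp: axis_def)
 show "V2 \<subseteq> vec.span {axis 1 1, axis 2 1}"
 proof
  fix x :: "complex ^ 3" assume "x \<in> V2"
  then have "x = x $ 1 *s axis 1 1 + x $ 2 *s axis 2 1"
   unfolding V2_def by (intro vec3_eqI) (simp_all add: axis_def)
  then show "x \<in> vec.span {axis 1 1, axis 2 1}"
   by (metis insertI1 insertI2 vec.span_add vec.span_base vec.span_scale)
 qed
 show "vec.independent {axis 1 1, axis 2 1 :: complex ^ 3}"
  by (rule vec.independent_mono[OF independent_cart_basis]) (auto simp: cart_basis_def)
 show "card {axis 1 1, axis 2 1 :: complex ^ 3} = 2" using ne by simp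
qed

context smart
begin

abbreviation Xz :: "complex ^ 3 => rm_threefold" where "Xz \<equiv> rm_threefold_of D d \<eta>1 \<eta>2"

lemma pvec_nth [simp]:
 "pvec z \<alpha> \<beta> i j $ 1 = of_real \<alpha> + of_real \<beta> * z $ 1"
 "pvec z \<alpha> \<beta> i j $ 2 = of_real (cj \<alpha>) + of_real (cj \<beta>) * z $ 2"
 "pvec z \<alpha> \<beta> i j $ 3 = (of_int i - of_int j * z $ 3) / of_nat d"
 unfolding pvec_def by simp_all

lemma real_combination_unique:
 assumes "Im w > 0" "of_real \<alpha> + of_real \<beta> * w = of_real \<alpha>' + of_real \<beta>' * w"
 shows "\<alpha> = \<alpha>' & \<beta> = \<beta>'"
proof -
 have "Im (of_real \<alpha> + of_real \<beta> * w) = Im (of_real \<alpha>' + of_real \<beta>' * w)" using assms(2) by simp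
 then have "\<beta> = \<beta>'" using assms(1) by simp
 then show ?thesis using assms(2) by simp
qed

lemma int_combination_unique:
 assumes "Im w > 0" "(of_int i - of_int j * w) / of_nat d = (of_int i' - of_int j' * w) / of_nat d"
 shows "i = i' & j = j'"
proof -
 have "of_int i - of_int j * w = of_int i' - of_int j' * w" using assms(2) d_pos by simp
 then have "of_real (of_int i) + of_real (of_int (- j)) * w = of_real (of_int i') + of_real (of_int (- j')) * w" by simp
 from real_combination_unique[OF assms(1) this] show ?thesis by simp
qed

end

context smart
begin

lemma pvec_unique:
 assumes z: "z \<in> HH" and eq: "pvec z \<alpha> \<beta> i j = pvec z \<alpha>' \<beta>' i' j'"
 shows "\<alpha> = \<alpha>' & \<beta> = \<beta>' & i = i' & j = j'"
proof -
 have "pvec z \<alpha> \<beta> i j $ 1 = pvec z \<alpha>' \<beta>' i' j' $ 1" "pvec z \<alpha> \<beta> i j $ 3 = pvec z \<alpha>' \<beta>' i' j' $ 3" using eq by simp_all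
 then show ?thesis
  using real_combination_unique[OF upper_half3_Im[OF z, of 1]] int_combination_unique[OF upper_half3_Im[OF z, of 3]]
  unfolding pvec_nth by metis
qed

lemma hermitian3_Hz: "hermitian3 (Hz z)"
 by unfold_locales (rule hermitian_Hz)

lemma symp_Pz: assumes "z \<in> HH" shows "hermitian3.symp (Hz z) (Pz z)"
proof -
 interpret h: hermitian3 "Hz z" by (rule hermitian3_Hz)
 show ?thesis by (rule h.sympI) (simp add: h.E_def Pz_E0[OF assms])
qed

lemma period_lists:
 "period_lambda D \<eta>1 \<eta>2 = [period_lambda D \<eta>1 \<eta>2 ! 0, period_lambda D \<eta>1 \<eta>2 ! 1, period_lambda D \<eta>1 \<eta>2 ! 2]"
 "period_mu D d \<eta>1 \<eta>2 z = [period_mu D d \<eta>1 \<eta>2 z ! 0, period_mu D d \<eta>1 \<eta>2 z ! 1, period_mu D d \<eta>1 \<eta>2 z ! 2]"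
 by (simp_all add: period_lambda_def period_mu_def)

lemma symplectic_basis_Pz_iff:
 assumes "hermitian3 H"
 shows "symplectic_basis H (threefold_lattice D d \<eta>1 \<eta>2 z) [1, 1, 1] (period_lambda D \<eta>1 \<eta>2) (period_mu D d \<eta>1 \<eta>2 z)
  \<longleftrightarrow> hermitian3.symp H (Pz z)"
 using hermitian3.symplectic_basis3_iff[OF assms, of "threefold_lattice D d \<eta>1 \<eta>2 z"]
 unfolding threefold_lattice_eq Pz_def[symmetric] by (metis Pz_def period_lists)

lemma Xz_simps [simp]:
 "lat (Xz z) = range (period_hom (Pz z))" "sub (Xz z) = V2"
 "act (Xz z) k = (\<lambda>x\<in>V2. vector [of_real k * x $ 1, of_real (cj k) * x $ 2, 0])"
 unfolding rm_threefold_of_def V2_def by (simp_all add: threefold_lattice_eq)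

lemma polarization_Hz: assumes "z \<in> HH" shows "polarization (Hz z) (range (period_hom (Pz z)))"
 unfolding polarization_def using hermitian_Hz Hz_positive[OF assms] Pz_E0[OF assms] by auto

lemma Xz_pol: assumes z: "z \<in> HH" shows "pol (Xz z) = Hz z"
proof -
 interpret h: hermitian3 "Hz z" by (rule hermitian3_Hz)
 have "(THE H. polarization H (threefold_lattice D d \<eta>1 \<eta>2 z) &
   symplectic_basis H (threefold_lattice D d \<eta>1 \<eta>2 z) [1, 1, 1]
   (period_lambda D \<eta>1 \<eta>2) (period_mu D d \<eta>1 \<eta>2 z)) = Hz z"
 proof (rule the_equality)
  show "polarization (Hz z) (threefold_lattice D d \<eta>1 \<eta>2 z) &
   symplectic_basis (Hz z) (threefold_lattice D d \<eta>1 \<eta>2 z) [1, 1, 1]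
   (period_lambda D \<eta>1 \<eta>2) (period_mu D d \<eta>1 \<eta>2 z)"
   using polarization_Hz[OF z] symplectic_basis_Pz_iff[OF hermitian3_Hz] symp_Pz[OF z] by (simp add: threefold_lattice_eq)
 next
  fix H' assume H': "polarization H' (threefold_lattice D d \<eta>1 \<eta>2 z) &
   symplectic_basis H' (threefold_lattice D d \<eta>1 \<eta>2 z) [1, 1, 1]
   (period_lambda D \<eta>1 \<eta>2) (period_mu D d \<eta>1 \<eta>2 z)"
  interpret h': hermitian3 H' by unfold_locales (use H' polarization_def in blast)
  have s': "h'.symp (Pz z)" using H' symplectic_basis_Pz_iff[OF h'.hermitian3_axioms] by blast
  show "H' = Hz z"
  proof (rule h.symp_agree[OF symp_Pz[OF z] h'.herm])
   fix x y assume "x \<in> range (period_hom (Pz z))" "y \<in> range (period_hom (Pz z))"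
   then obtain m n where "x = period_hom (Pz z) m" "y = period_hom (Pz z) n" by blast
   then show "Im (H' x y) = Im (Hz z x y)"
   using h'.symp_period_hom[OF s'] Pz_E0[OF z] unfolding h'.E_def by simp
  qed
 qed
 then show ?thesis unfolding rm_threefold_of_def by simp
qed

lemma sub_lattice:
 assumes z: "z \<in> HH"
 shows "V2 Int range (period_hom (Pz z)) = {pvec z \<alpha> \<beta> 0 0 | \<alpha> \<beta>. \<alpha> \<in> Od & \<beta> \<in> (%x. x / s) ` \<aa>}"
  and "V2 Int range (period_hom (Pz z)) = period_hom (Pz z) ` L0"
proof -
 have z3: "Im (z $ 3) > 0" by (rule upper_half3_Im[OF z])
 have ij: "i = 0 & j = 0" if "pvec z \<alpha> \<beta> i j \<in> V2" for \<alpha> \<beta> i j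
  using int_combination_unique[OF z3, of i j 0 0] that unfolding V2_def by simp
 have L: "pvec z \<alpha> \<beta> 0 0 \<in> V2" for \<alpha> \<beta> unfolding V2_def by simp
 show "V2 Int range (period_hom (Pz z)) = period_hom (Pz z) ` L0"
 proof (intro equalityI subsetI)
  fix x assume x: "x \<in> V2 Int range (period_hom (Pz z))"
  then obtain n where n: "x = period_hom (Pz z) n" by blast
  have "n \<in> L0" using x ij[of "al n" "ln6 n" "int d * n $ 3 + n $ 5" "n $ 6"] unfolding n period_hom_Pz L0_def by simp
  then show "x \<in> period_hom (Pz z) ` L0" using n by blast
 next
  fix x assume "x \<in> period_hom (Pz z) ` L0"
  then obtain n where n: "x = period_hom (Pz z) n" "n \<in> L0" by blast
  then have "x \<in> V2" using L unfolding L0_def n period_hom_Pz by simp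
  then show "x \<in> V2 Int range (period_hom (Pz z))" using n by blast
 qed
 show "V2 Int range (period_hom (Pz z)) = {pvec z \<alpha> \<beta> 0 0 | \<alpha> \<beta>. \<alpha> \<in> Od & \<beta> \<in> (%x. x / s) ` \<aa>}"
 proof (intro equalityI subsetI)
  fix x assume x: "x \<in> V2 Int range (period_hom (Pz z))"
  then have xr: "x \<in> range (period_hom (Pz z))" by blast
  obtain \<alpha> \<beta> i j where c: "x = pvec z \<alpha> \<beta> i j" "\<alpha> - of_int j * \<eta>2 / real d \<in> Od" "s * \<beta> + of_int i * cj \<eta>1 \<in> \<aa>"
   by (rule lattice_coords[OF xr]) blast
  have i0: "i = 0" "j = 0" using ij[of \<alpha> \<beta> i j] x c(1) by simp_all
  have "s * \<beta> \<in> \<aa>" "\<beta> = s * \<beta> / s" using c(3) i0 s_ne by simp_all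
  then have "\<beta> \<in> (%x. x / s) ` \<aa>" by blast
  then show "x \<in> {pvec z \<alpha> \<beta> 0 0 | \<alpha> \<beta>. \<alpha> \<in> Od & \<beta> \<in> (%x. x / s) ` \<aa>}" using c i0 by auto
 next
  fix x assume "x \<in> {pvec z \<alpha> \<beta> 0 0 | \<alpha> \<beta>. \<alpha> \<in> Od & \<beta> \<in> (%x. x / s) ` \<aa>}"
  then obtain \<alpha> b where c: "x = pvec z \<alpha> (b / s) 0 0" "\<alpha> \<in> Od" "b \<in> \<aa>" by blast
  have "x \<in> range (period_hom (Pz z))" unfolding c(1) by (rule pvec_in_lattice) (use c s_ne in simp_all)
  moreover have "x \<in> V2" unfolding c(1) by (rule L)
  ultimately show "x \<in> V2 Int range (period_hom (Pz z))" by blast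
 qed
qed

lemma al_L0: "n \<in> L0 ==> al n = kn n" unfolding al_def L0_def by simp

lemma period_hom_L0: "n \<in> L0 ==> period_hom (Pz z) n = pvec z (kn n) (ln6 n) 0 0"
 unfolding period_hom_Pz using al_L0 unfolding L0_def by simp

lemma act_pvec:
 assumes "k \<in> KK" "\<alpha> \<in> KK" "\<beta> \<in> KK"
 shows "act (Xz z) k (pvec z \<alpha> \<beta> 0 0) = pvec z (k * \<alpha>) (k * \<beta>) 0 0"
proof -
 have "pvec z \<alpha> \<beta> 0 0 \<in> V2" unfolding V2_def by simp
 then show ?thesis by (intro vec3_eqI) (simp_all add: assms algebra_simps)
qed

text \<open>
  The model matrix is a period matrix for the standard marking; its integral data do not depend on \<open>z\<close>.
\<close>

lemma Xz_marking: assumes z: "z \<in> HH" shows "is_period_matrix D E0 L0 R0 (Xz z) (Pz z)"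
proof -
 interpret h: hermitian3 "Hz z" by (rule hermitian3_Hz)
 show ?thesis
  unfolding is_period_matrix_def
 proof (intro conjI allI ballI)
  show "bij_betw (period_hom (Pz z)) UNIV (lat (Xz z))"
   using h.inj_period_hom[OF symp_Pz[OF z]] by (simp add: bij_betw_def)
  show "Im (pol (Xz z) (period_hom (Pz z) m) (period_hom (Pz z) n)) = of_int (E0 m n)" for m n
   unfolding Xz_pol[OF z] by (rule Pz_E0[OF z])
  show "period_hom (Pz z) ` L0 = sub (Xz z) Int lat (Xz z)" using sub_lattice(2)[OF z] by simp
  fix k n assume k: "k \<in> Od" and n: "n \<in> L0"
  show "act (Xz z) k (period_hom (Pz z) n) = period_hom (Pz z) (R0 k n)"
   unfolding period_hom_L0[OF n] period_hom_L0[OF R0_spec(1)[OF k n]] R0_spec(2,3)[OF k n]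
   by (rule act_pvec) (use k in simp_all)
 qed
qed

lemma V2_span:
 assumes z: "z \<in> HH"
 shows "full_lattice V2 (V2 Int range (period_hom (Pz z))) & has_type (Hz z) (V2 Int range (period_hom (Pz z))) [1, d]"
proof -
 interpret h: hermitian3 "Hz z" by (rule hermitian3_Hz)
 let ?P = "period_hom (Pz z)"
 define l1 l2 m1 nu where "l1 = ?P (axis 1 1)" and "l2 = ?P (axis 2 1)" and "m1 = ?P (axis 4 1)"
  and "nu = ?P (vec6 0 0 (- 1) 0 (int d) 0)"
 note defs = l1_def l2_def m1_def nu_def
 have g: "h.E l1 l2 = 0" "h.E l1 m1 = 1" "h.E l1 nu = 0" "h.E l2 m1 = 0" "h.E l2 nu = real d" "h.E m1 nu = 0"
  unfolding defs h.symp_period_hom[OF symp_Pz[OF z]] by (simp_all add: E0_def axis_def)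
 have nu: "nu = int d *. col (Pz z) 5 - col (Pz z) 3" unfolding nu_def period_hom_6 by simp
 have cols: "l1 = col (Pz z) 1" "l2 = col (Pz z) 2" "m1 = col (Pz z) 4" unfolding defs period_hom_axis by simp_all
 have P: "?P n = n $ 1 *. l1 + n $ 2 *. l2 + n $ 4 *. m1 + (- n $ 3) *. nu" if "n \<in> L0" for n
  by (subst L0_vec6[OF that]) (simp add: nu cols period_hom_6 algebra_simps)
 have lat: "V2 Int range ?P = zspan [l1, l2, m1, nu]"
  unfolding sub_lattice(2)[OF z]
 proof (intro equalityI subsetI)
  fix x assume "x \<in> ?P ` L0"
  then obtain n where "x = ?P n" "n \<in> L0" by blast
  then show "x \<in> zspan [l1, l2, m1, nu]" unfolding zspan4 using P by blast
 next
  fix x assume "x \<in> zspan [l1, l2, m1, nu]"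
  then obtain a b c e where x: "x = a *. l1 + b *. l2 + c *. m1 + e *. nu" unfolding zspan4 by blast
  have n: "vec6 a b (- e) c (int d * e) 0 \<in> L0" unfolding L0_def by simp
  have "x = ?P (vec6 a b (- e) c (int d * e) 0)" unfolding P[OF n] x by simp
  then show "x \<in> ?P ` L0" using n by blast
 qed
 have "span {l1, l2, m1, nu} = V2"
 proof (intro equalityI subsetI)
  have sV: "subspace V2" unfolding V2_def by (auto simp: subspace_def)
  have "{l1, l2, m1, nu} \<subseteq> V2 Int range ?P" unfolding lat by (simp add: zspan_mem)
  then have "span {l1, l2, m1, nu} \<subseteq> V2" using sV by (intro span_minimal) auto
  then show "x \<in> V2" if "x \<in> span {l1, l2, m1, nu}" for x using that by blast
  fix x assume x: "x \<in> V2"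
  obtain r where r: "x = rhom (Pz z) r" using h.surj_rhom[OF symp_Pz[OF z]] by (metis surjD)
  have "x $ 3 = of_real (r $ 3) + of_real (r $ 5) / of_nat d - of_real (r $ 6) * z $ 3 / of_nat d"
   unfolding r rhom_def sum_6 Pz_def
   by (simp add: period_lambda_def period_mu_def scaleR_conv_of_real[where 'a = complex])
  then have "of_real (r $ 3) + of_real (r $ 5) / of_nat d - of_real (r $ 6) * z $ 3 / of_nat d = 0"
   using x unfolding V2_def by simp
  then have "of_nat d * (of_real (r $ 3) + of_real (r $ 5) / of_nat d - of_real (r $ 6) * z $ 3 / of_nat d) = 0" by simp
  then have "of_real (d * r $ 3 + r $ 5) + of_real (- (r $ 6)) * z $ 3 = of_real 0 + of_real 0 * z $ 3"
   using d_pos by (simp add: distrib_left right_diff_distrib)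
  then have r6: "r $ 6 = 0" "r $ 5 = - d * r $ 3"
   using real_combination_unique[OF upper_half3_Im[OF z, of 3]] by fastforce+
  have xe: "x = r $ 1 *\<^sub>R l1 + r $ 2 *\<^sub>R l2 + r $ 4 *\<^sub>R m1 + (- r $ 3) *\<^sub>R nu"
   unfolding r rhom_def sum_6 nu defs period_hom_axis r6 by (simp add: algebra_simps)
  show "x \<in> span {l1, l2, m1, nu}" unfolding xe by (intro span_add span_scale span_base) simp_all
 qed
 then show ?thesis using h.symplectic_basis2[OF g d_pos lat] by simp
qed

lemma KK_multiple_in_Od: assumes "x \<in> KK" shows "\<exists>m::int. m > 0 & of_int m * x \<in> Od"
proof -
 obtain a b where ab: "a \<in> \<rat>" "b \<in> \<rat>" "x = a + b * s" using assms by (elim KK_cases)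
 obtain a1 a2 where a: "a2 > 0" "a = of_int a1 / of_int a2" using ab(1) by (elim Rats_cases') auto
 obtain b1 b2 where b: "b2 > 0" "b = of_int b1 / of_int b2" using ab(2) by (elim Rats_cases') auto
 have "of_int (a2 * b2) * x = of_int (a1 * b2) + of_int (b1 * a2) * s" unfolding ab(3) a(2) b(2) using a(1) b(1) by (simp add: field_simps)
 then have "of_int (a2 * b2) * x \<in> Od" by simp
 then show ?thesis using a(1) b(1) by (intro exI[of _ "a2 * b2"]) auto
qed

text \<open>
  Properness is the point: an element that preserves the lattice of \<open>S\<close> preserves the orbit of \<open>(1, 1)\<close>,
  which is the order itself.
\<close>

lemma Xz_real_multiplication:
 assumes z: "z \<in> HH"
 shows "real_multiplication D V2 (V2 Int range (period_hom (Pz z))) (Hz z) (act (Xz z))"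
proof -
 let ?L = "V2 Int range (period_hom (Pz z))"
 let ?r = "%k. \<lambda>x\<in>V2. vector [of_real k * x $ 1, of_real (cj k) * x $ 2, 0] :: complex ^ 3"
 have act: "act (Xz z) = ?r" by (rule ext) simp
 have V2D: "x $ 3 = 0" if "x \<in> V2" for x using that unfolding V2_def by simp
 have V2v: "vector [a, b, 0] \<in> V2" for a b unfolding V2_def by simp
 have V2c: "x + y \<in> V2" "c *s x \<in> V2" if "x \<in> V2" "y \<in> V2" for x y c using that unfolding V2_def by simp_all
 have hom: "?r \<in> ring_hom RR (torus_End V2 ?L)"
 proof (rule ring_hom_memI)
  fix k assume "k \<in> carrier RR"
  then have k: "k \<in> Od" by simp
  have "?r k x \<in> ?L" if xL: "x \<in> ?L" for x
  proof -
   obtain \<alpha> \<beta> where x: "x = pvec z \<alpha> \<beta> 0 0" "\<alpha> \<in> Od" "\<beta> \<in> (%x. x / s) ` \<aa>" using xL unfolding sub_lattice(1)[OF z] by blast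
   have "\<beta> \<in> KK" using x(3) aa_Od by auto
   then have "?r k x = pvec z (k * \<alpha>) (k * \<beta>) 0 0" using act_pvec[of k \<alpha> \<beta> z] k x by simp
   moreover have "k * \<alpha> \<in> Od" "k * \<beta> \<in> (%x. x / s) ` \<aa>" using k x(2) ideal_image_Od[OF x(3) k] by simp_all
   ultimately show ?thesis unfolding sub_lattice(1)[OF z] by blast
  qed
  then show "?r k \<in> carrier (torus_End V2 ?L)"
   unfolding torus_End_def partial_object.select_convs
   by (intro CollectI conjI ballI allI) (auto simp: V2v V2c intro!: vec3_eqI simp: algebra_simps)
 next
  fix k l assume "k \<in> carrier RR" "l \<in> carrier RR"
  then have kl: "k \<in> Od" "l \<in> Od" by simp_all
  show "?r (k \<otimes>\<^bsub>RR\<^esub> l) = ?r k \<otimes>\<^bsub>torus_End V2 ?L\<^esub> ?r l"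
   unfolding torus_End_def using kl by (auto simp: compose_def V2v algebra_simps intro!: ext vec3_eqI)
  show "?r (k \<oplus>\<^bsub>RR\<^esub> l) = ?r k \<oplus>\<^bsub>torus_End V2 ?L\<^esub> ?r l"
   unfolding torus_End_def using kl by (auto simp: V2v algebra_simps intro!: ext vec3_eqI)
 next
  show "?r \<one>\<^bsub>RR\<^esub> = \<one>\<^bsub>torus_End V2 ?L\<^esub>"
   unfolding torus_End_def by (auto simp: V2D intro!: ext vec3_eqI)
 qed
 have v1: "vector [1, 1, 0] \<in> ?L"
 proof -
  have "vector [1, 1, 0] = pvec z 1 0 0 0" by (rule vec3_eqI) simp_all
  moreover have "0 \<in> (%x. x / s) ` \<aa>" using RR_ideal_closed(2)[OF idl] by force
  ultimately show ?thesis unfolding sub_lattice(1)[OF z] by (metis (mono_tags, lifting) Od_int(5) mem_Collect_eq)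
 qed
 have inj: "inj_on ?r Od"
 proof (rule inj_onI)
  fix k l assume "?r k = ?r l"
  then have "?r k (vector [1, 1, 0]) $ 1 = ?r l (vector [1, 1, 0]) $ 1" by metis
  then show "k = l" using V2v by simp
 qed
 have adj: "Hz z (?r k x) y = Hz z x (?r k y)" if "x \<in> V2" "y \<in> V2" for k x y
  using that unfolding Hz_def by (simp add: mult_ac)
 have ext: False if R: "is_quad_order D R" "Od \<subset> R" "\<rho>' \<in> ring_hom (real_ring R) (torus_End V2 ?L)" "\<forall>k\<in>Od. \<rho>' k = ?r k" for R \<rho>'
 proof -
  obtain r where r: "r \<in> R" "r \<notin> Od" using R(2) by blast
  then have rK: "r \<in> KK" using R(1) unfolding is_quad_order_def by blast
  obtain m :: int where m: "m > 0" "of_int m * r \<in> Od" using KK_multiple_in_Od[OF rK] by blast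
  have mR: "of_int m \<in> R" using R(2) Od_int(1)[of m] by blast
  define v where "v = \<rho>' r (vector [1, 1, 0])"
  have "\<rho>' r \<in> carrier (torus_End V2 ?L)" using ring_hom_memE(1)[OF R(3)] r(1) by simp
  then have "\<rho>' r ` ?L \<subseteq> ?L" unfolding torus_End_def by simp
  then have vL: "v \<in> ?L" unfolding v_def using v1 by blast
  have "\<rho>' (of_int m * r) = compose V2 (\<rho>' (of_int m)) (\<rho>' r)"
   using ring_hom_memE(2)[OF R(3), of "of_int m" r] mR r(1) unfolding torus_End_def by simp
  then have "\<rho>' (of_int m * r) (vector [1, 1, 0]) = \<rho>' (of_int m) v" unfolding v_def by (simp add: compose_def V2v)
  then have e: "?r (of_int m * r) (vector [1, 1, 0]) = ?r (of_int m) v" using R(4) m(2) by simp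
  have vV: "v \<in> V2" using vL by blast
  have "?r (of_int m * r) (vector [1, 1, 0]) $ 1 = ?r (of_int m) v $ 1" using e by simp
  then have "of_int m * of_real r = of_int m * v $ 1" using vV V2v by simp
  then have v1': "v $ 1 = of_real r" using m(1) by simp
  obtain \<alpha> \<beta> where v: "v = pvec z \<alpha> \<beta> 0 0" "\<alpha> \<in> Od" using vL unfolding sub_lattice(1)[OF z] by blast
  have "of_real \<alpha> + of_real \<beta> * z $ 1 = of_real r + of_real 0 * z $ 1" using v1' unfolding v by simp
  then have "\<alpha> = r" using real_combination_unique[OF upper_half3_Im[OF z, of 1]] by blast
  then show False using v(2) r(2) by simp
 qed
 show ?thesis unfolding real_multiplication_def act using hom inj adj ext by blast
qed

lemma Xz_is_rm_threefold: assumes z: "z \<in> HH" shows "is_rm_threefold D d (Xz z)"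
proof -
 interpret h: hermitian3 "Hz z" by (rule hermitian3_Hz)
 have "has_type (Hz z) (range (period_hom (Pz z))) [1, 1, 1]"
  unfolding has_type_def
 proof (intro conjI exI)
  show "symplectic_basis (Hz z) (range (period_hom (Pz z))) [1, 1, 1] (period_lambda D \<eta>1 \<eta>2) (period_mu D d \<eta>1 \<eta>2 z)"
   using symplectic_basis_Pz_iff[OF hermitian3_Hz] symp_Pz[OF z] unfolding threefold_lattice_eq by blast
  show "ALL i. Suc i < length [1, 1, 1::nat] --> [1, 1, 1::nat] ! i dvd [1, 1, 1] ! Suc i"
   by (auto simp: less_Suc_eq nth_Cons')
 qed simp
 moreover have "full_lattice UNIV (range (period_hom (Pz z)))" by (rule h.symp_full_lattice[OF symp_Pz[OF z]])
 ultimately show ?thesis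
  unfolding is_rm_threefold_def Xz_pol[OF z] Xz_simps(1,2)
  using polarization_Hz[OF z] V2_subspace V2_dim V2_span[OF z] Xz_real_multiplication[OF z] by blast
qed

lemma Xz_in_locus: assumes z: "z \<in> HH" shows "rm_class D d (Xz z) \<in> ideal_locus D d \<aa>"
proof -
 let ?I = "(%x. x / s) ` \<aa>"
 let ?g = "%u. pvec z (fst u) (snd u) 0 0"
 have IK: "l \<in> KK" if "l \<in> ?I" for l using that aa_Od by auto
 have bij: "bij_betw ?g (Od \<times> ?I) (V2 Int range (period_hom (Pz z)))"
 proof (rule bij_betw_imageI)
  show "inj_on ?g (Od \<times> ?I)" by (rule inj_onI) (metis pvec_unique[OF z] prod_eqI)
  show "?g ` (Od \<times> ?I) = V2 Int range (period_hom (Pz z))" unfolding sub_lattice(1)[OF z] by force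
 qed
 moreover have "?g (u + v) = ?g u + ?g v & Im (Hz z (?g u) (?g v)) = trace_pairing D u v"
  if "u \<in> Od \<times> ?I" "v \<in> Od \<times> ?I" for u v
 proof
  have K: "fst u \<in> KK" "snd u \<in> KK" "fst v \<in> KK" "snd v \<in> KK" using that IK[of "snd u"] IK[of "snd v"] by (simp_all add: mem_Times_iff)
  show "?g (u + v) = ?g u + ?g v" by (rule vec3_eqI) (simp_all add: K algebra_simps)
  show "Im (Hz z (?g u) (?g v)) = trace_pairing D u v"
   unfolding Im_Hz_pvec[OF z] trace_pairing_def tr_def using K by simp
 qed
 moreover have "?g (k * fst u, k * snd u) = act (Xz z) k (?g u)" if "k \<in> Od" "u \<in> Od \<times> ?I" for k u
 proof -
  have K: "fst u \<in> KK" "snd u \<in> KK" using that IK[of "snd u"] by (simp_all add: mem_Times_iff)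
  show ?thesis using act_pvec[of k "fst u" "snd u" z] K that by simp
 qed
 ultimately show ?thesis
  unfolding ideal_locus_def Xz_pol[OF z, symmetric]
  by (intro imageI CollectI conjI exI[of _ ?g] ballI Xz_is_rm_threefold[OF z]) (simp_all del: Xz_simps(3))
qed

end

section \<open>Isomorphisms in the model family\<close>

lemma matrix_inv_unique:
 fixes A B :: "real ^ 'n ^ 'n"
 assumes "A ** B = mat 1" "B ** A = mat 1" shows "matrix_inv A = B"
proof -
 have "A ** matrix_inv A = mat 1 & matrix_inv A ** A = mat 1"
  unfolding matrix_inv_def by (rule someI[of _ B]) (use assms in simp)
 then have "B ** (A ** matrix_inv A) = B" by simp
 then show ?thesis unfolding matrix_mul_assoc assms(2) by simp
qed

lemma mat2_eqI: "A $ 1 $ 1 = B $ 1 $ 1 ==> A $ 1 $ 2 = B $ 1 $ 2 ==> A $ 2 $ 1 = B $ 2 $ 1 ==> A $ 2 $ 2 = B $ 2 $ 2 ==> A = (B :: 'a ^ 2 ^ 2)"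
 by (simp add: vec_eq_iff forall_2)

context smart
begin

lemma image_scale_iff: "c ~= 0 ==> x \<in> (%y. c * y) ` S \<longleftrightarrow> x / c \<in> (S :: real set)"
 by (auto simp: image_iff intro!: bexI[of _ "x / c"])

lemma smart_conj:
 "A - smart_S D d \<eta>1 \<eta>2 ** B ** matrix_inv (smart_S D d \<eta>1 \<eta>2) = (\<chi> i j. A $ i $ j -
  (if i = 1 then (if j = 1 then B $ 2 $ 2 else s * \<eta>2 / (d * cj \<eta>1) * B $ 2 $ 1)
  else (if j = 1 then B $ 1 $ 2 * (d * cj \<eta>1) / (s * \<eta>2) else B $ 1 $ 1)))"
proof -
 define t where "t = s / d * (\<eta>2 / cj \<eta>1)"
 have t: "t ~= 0" unfolding t_def using s_ne d_pos by simp
 have S: "smart_S D d \<eta>1 \<eta>2 = vector [vector [0, t], vector [1, 0]]" unfolding smart_S_def t_def ..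
 have inv: "matrix_inv (vector [vector [0, t], vector [1, 0]] :: real ^ 2 ^ 2) = vector [vector [0, 1], vector [1 / t, 0]]"
  using t by (intro matrix_inv_unique; intro mat2_eqI) (simp_all add: matrix_matrix_mult_def sum_2 mat_def)
 show ?thesis
  unfolding S inv using t
  by (intro mat2_eqI) (simp_all add: matrix_matrix_mult_def sum_2 t_def field_simps)
qed

text \<open>
  The four membership conditions of the congruence group, with the matrix \<open>S\<close> multiplied out and the
  factors \<open>\<eta>1, \<eta>2\<close> cancelled.
\<close>

lemma Gamma_iff:
 "(A, B) \<in> Gamma_group D d \<aa> \<eta>1 \<eta>2 \<longleftrightarrow> A \<in> SL2_ideal D \<aa> & B \<in> SL2_Z &
  A $ 1 $ 1 - B $ 2 $ 2 \<in> \<aa> & A $ 2 $ 2 - B $ 1 $ 1 \<in> \<aa> &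
  cj \<eta>1 * A $ 1 $ 2 / s - B $ 2 $ 1 * \<eta>2 / d \<in> Od & s * \<eta>2 * A $ 2 $ 1 / d - B $ 1 $ 2 * cj \<eta>1 \<in> \<aa>"
proof (cases "A \<in> SL2_ideal D \<aa> & B \<in> SL2_Z")
 case False
 then show ?thesis unfolding Gamma_group_def by auto
next
 case True
 then have A: "A $ 1 $ 1 \<in> Od" "A $ 2 $ 2 \<in> Od" and B: "!!i j. B $ i $ j \<in> \<int>"
  unfolding SL2_ideal_def SL2_Z_def by auto
 have BO: "B $ i $ j \<in> Od" for i j using B[of i j] by (auto elim: Ints_cases)
 let ?C = "A - smart_S D d \<eta>1 \<eta>2 ** B ** matrix_inv (smart_S D d \<eta>1 \<eta>2)"
 have c: "?C $ 1 $ 1 = A $ 1 $ 1 - B $ 2 $ 2" "?C $ 1 $ 2 = A $ 1 $ 2 - s * \<eta>2 / (d * cj \<eta>1) * B $ 2 $ 1"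
  "?C $ 2 $ 1 = A $ 2 $ 1 - B $ 1 $ 2 * (d * cj \<eta>1) / (s * \<eta>2)" "?C $ 2 $ 2 = A $ 2 $ 2 - B $ 1 $ 1"
  unfolding smart_conj by simp_all
 have 1: "?C $ 1 $ 1 \<in> (%x. d / \<eta>2 * x) ` Od \<longleftrightarrow> A $ 1 $ 1 - B $ 2 $ 2 \<in> \<aa>"
 proof -
  have "?C $ 1 $ 1 \<in> (%x. d / \<eta>2 * x) ` Od \<longleftrightarrow> \<eta>2 * (A $ 1 $ 1 - B $ 2 $ 2) / d \<in> Od"
   unfolding c(1) using d_pos by (subst image_scale_iff) (simp_all add: mult.commute)
  also have "\<dots> \<longleftrightarrow> \<eta>2 * (A $ 1 $ 1 - B $ 2 $ 2) \<in> (%y. real d * y) ` Od" using d_pos by (simp add: image_scale_iff)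
  also have "\<dots> \<longleftrightarrow> A $ 1 $ 1 - B $ 2 $ 2 \<in> \<aa>" by (rule eta2_mult_in_d) (use A BO in simp)
  finally show ?thesis .
 qed
 have 2: "?C $ 1 $ 2 \<in> (%x. s / cj \<eta>1 * x) ` Od \<longleftrightarrow> cj \<eta>1 * A $ 1 $ 2 / s - B $ 2 $ 1 * \<eta>2 / d \<in> Od"
 proof -
  have "(A $ 1 $ 2 - s * \<eta>2 / (d * cj \<eta>1) * B $ 2 $ 1) / (s / cj \<eta>1) = cj \<eta>1 * A $ 1 $ 2 / s - B $ 2 $ 1 * \<eta>2 / d"
   using s_ne d_pos by (simp add: field_simps)
  then show ?thesis unfolding c(2) using s_ne d_pos by (subst image_scale_iff) simp_all
 qed
 have 3: "?C $ 2 $ 1 \<in> (%x. d / (s * \<eta>2) * x) ` \<aa> \<longleftrightarrow> s * \<eta>2 * A $ 2 $ 1 / d - B $ 1 $ 2 * cj \<eta>1 \<in> \<aa>"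
 proof -
  have "(A $ 2 $ 1 - B $ 1 $ 2 * (d * cj \<eta>1) / (s * \<eta>2)) / (d / (s * \<eta>2)) = s * \<eta>2 * A $ 2 $ 1 / d - B $ 1 $ 2 * cj \<eta>1"
   using s_ne d_pos by (simp add: field_simps)
  then show ?thesis unfolding c(3) using s_ne d_pos by (subst image_scale_iff) simp_all
 qed
 have 4: "?C $ 2 $ 2 \<in> (%x. 1 / cj \<eta>1 * x) ` \<aa> \<longleftrightarrow> A $ 2 $ 2 - B $ 1 $ 1 \<in> \<aa>"
 proof -
  have "?C $ 2 $ 2 \<in> (%x. 1 / cj \<eta>1 * x) ` \<aa> \<longleftrightarrow> cj \<eta>1 * (A $ 2 $ 2 - B $ 1 $ 1) \<in> \<aa>"
   unfolding c(4) by (subst image_scale_iff) (simp_all add: mult.commute)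
  also have "\<dots> \<longleftrightarrow> A $ 2 $ 2 - B $ 1 $ 1 \<in> \<aa>" by (rule cj_eta1_mult_in_aa) (use A BO in simp)
  finally show ?thesis .
 qed
 show ?thesis unfolding Gamma_group_def smart_M_def mem_Collect_eq case_prod_conv 1 2 3 4 using True by blast
qed

lemma moebius_denominator:
 assumes w: "Im w > 0" and det: "a * e - b * c = 1"
 shows "of_real c * w + of_real e ~= 0"
  and "Im ((of_real a * w + of_real b) / (of_real c * w + of_real e)) = Im w / (cmod (of_real c * w + of_real e))\<^sup>2"
proof -
 show ne: "of_real c * w + of_real e ~= 0"
 proof
  assume 0: "of_real c * w + of_real e = 0"
  then have "Im (of_real c * w + of_real e) = 0" by simp
  then have "c = 0" using w by simp
  then have "e = 0" using 0 by simp
  then show False using det \<open>c = 0\<close> by simp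
 qed
 have "(of_real a * w + of_real b) / (of_real c * w + of_real e) =
  (of_real a * w + of_real b) * cnj (of_real c * w + of_real e) / of_real ((cmod (of_real c * w + of_real e))\<^sup>2)"
  by (rule complex_div_cnj)
 moreover have "Im ((of_real a * w + of_real b) * cnj (of_real c * w + of_real e)) = (a * e - b * c) * Im w"
  by (simp add: algebra_simps)
 ultimately show "Im ((of_real a * w + of_real b) / (of_real c * w + of_real e)) = Im w / (cmod (of_real c * w + of_real e))\<^sup>2"
  unfolding det by (simp only: Im_divide_of_real mult_1)
qed

definition dg :: "complex => complex => complex => complex ^ 3 => complex ^ 3" where
 "dg a b c x = vector [a * x $ 1, b * x $ 2, c * x $ 3]"

lemma dg_nth [simp]: "dg a b c x $ 1 = a * x $ 1" "dg a b c x $ 2 = b * x $ 2" "dg a b c x $ 3 = c * x $ 3"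
 unfolding dg_def by simp_all

lemma dg_linear: "Vector_Spaces.linear (*s) (*s) (dg a b c)"
 by unfold_locales (auto intro!: vec3_eqI simp: algebra_simps)

lemma dg_inverse: "a ~= 0 ==> b ~= 0 ==> c ~= 0 ==> dg a b c (dg (1/a) (1/b) (1/c) x) = x"
 "a ~= 0 ==> b ~= 0 ==> c ~= 0 ==> dg (1/a) (1/b) (1/c) (dg a b c x) = x"
 by (auto intro!: vec3_eqI)

lemma rm_isomorphic_dg:
 assumes z: "z \<in> HH" and z': "z' \<in> HH" and j: "j1 ~= 0" "j2 ~= 0" "j3 ~= 0"
  and im: "Im (z' $ 1) = Im (z $ 1) / (cmod j1)\<^sup>2" "Im (z' $ 2) = Im (z $ 2) / (cmod j2)\<^sup>2" "Im (z' $ 3) = Im (z $ 3) / (cmod j3)\<^sup>2"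
  and lat: "!!x. x \<in> range (period_hom (Pz z')) ==> dg j1 j2 j3 x \<in> range (period_hom (Pz z))"
 shows "rm_isomorphic D (Xz z) (Xz z')"
proof -
 let ?f = "dg (1/j1) (1/j2) (1/j3)" and ?g = "dg j1 j2 j3"
 note inv = dg_inverse[OF j]
 interpret h: hermitian3 "Hz z" by (rule hermitian3_Hz)
 interpret h': hermitian3 "Hz z'" by (rule hermitian3_Hz)
 have pos: "Im (z $ 1) > 0" "Im (z $ 2) > 0" "Im (z $ 3) > 0" using upper_half3_Im[OF z] by blast+
 have sc: "(1 / j * x) * cnj (1 / j * y) / of_real (Im w / (cmod j)\<^sup>2) = x * cnj y / of_real (Im w)"
  if "j ~= 0" for j x y w
 proof -
  have "j * cnj j ~= 0" using that by simp
  then show ?thesis unfolding of_real_divide complex_norm_square by (simp add: field_simps)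
 qed
 have H: "Hz z' (?f x) (?f y) = Hz z x y" for x y
  unfolding Hz_def dg_nth im times_divide_eq_right[symmetric, of "of_nat d"] sc[OF j(1)] sc[OF j(2)] sc[OF j(3)] by simp
 have bij: "bij ?f" by (rule bij_betw_byWitness[where f' = ?g]) (use inv in auto)
 have into: "?f x \<in> range (period_hom (Pz z'))" if xL: "x \<in> range (period_hom (Pz z))" for x
 proof (rule h'.symp_unimodular[OF symp_Pz[OF z']])
  fix y assume y: "y \<in> range (period_hom (Pz z'))"
  have "h'.E (?f x) y = h'.E (?f x) (?f (?g y))" using inv(2) by simp
  also have "\<dots> = h.E x (?g y)" unfolding h'.E_def h.E_def H ..
  finally have e: "h'.E (?f x) y = h.E x (?g y)" .
  obtain m n where "x = period_hom (Pz z) m" "?g y = period_hom (Pz z) n" using xL lat[OF y] by blast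
  then show "h'.E (?f x) y \<in> \<int>" unfolding e using h.symp_period_hom[OF symp_Pz[OF z]] by simp
 qed
 have im: "?f ` range (period_hom (Pz z)) = range (period_hom (Pz z'))"
 proof (intro equalityI subsetI)
  fix x assume "x \<in> ?f ` range (period_hom (Pz z))" then show "x \<in> range (period_hom (Pz z'))" using into by blast
 next
  fix x assume x: "x \<in> range (period_hom (Pz z'))"
  have "x = ?f (?g x)" using inv(2) by simp
  then show "x \<in> ?f ` range (period_hom (Pz z))" using lat[OF x] by blast
 qed
 have V: "?f ` V2 = V2"
 proof (intro equalityI subsetI)
  fix x assume "x \<in> ?f ` V2" then show "x \<in> V2" unfolding V2_def by auto
 next
  fix x assume x: "x \<in> V2"
  have "x = ?f (?g x)" using inv(2) by simp
  moreover have "?g x \<in> V2" using x unfolding V2_def by simp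
  ultimately show "x \<in> ?f ` V2" by blast
 qed
 have a: "?f (act (Xz z) k x) = act (Xz z') k (?f x)" if "x \<in> V2" for k x
 proof -
  have "?f x \<in> V2" using V that by blast
  then show ?thesis using that by (intro vec3_eqI) simp_all
 qed
 show ?thesis
  unfolding rm_isomorphic_def Xz_pol[OF z] Xz_pol[OF z'] Xz_simps(1,2)
  by (rule exI[of _ ?f]) (use dg_linear bij im H V a in blast)
qed

lemma hilbert_act_nth:
 "hilbert_act D (A, B) z $ 1 = moebius A (z $ 1)" "hilbert_act D (A, B) z $ 2 = moebius (\<chi> i j. cj (A $ i $ j)) (z $ 2)"
 "hilbert_act D (A, B) z $ 3 = moebius B (z $ 3)"
 unfolding hilbert_act_def by simp_all

text \<open>
  The isomorphism is diagonal, given by the automorphy factors of the three coordinates. It preserves the forms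
  because of the transformation rule for imaginary parts, and the congruence conditions say exactly that
  it maps the generators outside the surface into the lattice.
\<close>

lemma Gamma_imp_isomorphic:
 assumes z: "z \<in> HH" and AB: "(A, B) \<in> Gamma_group D d \<aa> \<eta>1 \<eta>2"
 shows "hilbert_act D (A, B) z \<in> HH & rm_isomorphic D (Xz z) (Xz (hilbert_act D (A, B) z))"
proof -
 define a b c e where "a = A $ 1 $ 1" and "b = A $ 1 $ 2" and "c = A $ 2 $ 1" and "e = A $ 2 $ 2"
 note A_def = a_def[symmetric] b_def[symmetric] c_def[symmetric] e_def[symmetric]
 have G: "A \<in> SL2_ideal D \<aa>" "B \<in> SL2_Z" "a - B $ 2 $ 2 \<in> \<aa>" "e - B $ 1 $ 1 \<in> \<aa>"
  "cj \<eta>1 * b / s - B $ 2 $ 1 * \<eta>2 / d \<in> Od" "s * \<eta>2 * c / d - B $ 1 $ 2 * cj \<eta>1 \<in> \<aa>"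
  using AB unfolding Gamma_iff A_def by auto
 have K: "ALL i j. A $ i $ j \<in> KK" using G(1) unfolding SL2_ideal_def by blast
 have A: "a \<in> KK" "b \<in> KK" "c \<in> KK" "e \<in> KK" "a * e - b * c = 1" "a \<in> Od" "e \<in> Od"
  "!!x. x \<in> \<aa> ==> b * (x / s) \<in> Od" "c \<in> (%x. x / s) ` \<aa>"
  using K G(1) unfolding SL2_ideal_def det_2 mem_Collect_eq a_def b_def c_def e_def by blast+
 have sc: "s * c \<in> \<aa>" using A(9) s_ne by auto
 have "ALL i j. \<exists>k::int. B $ i $ j = of_int k" using G(2) unfolding SL2_Z_def by (auto elim!: Ints_cases)
 then obtain bi where bi: "!!i j. B $ i $ j = of_int (bi i j)" by metis
 define a3 b3 c3 e3 where "a3 = bi 1 1" and "b3 = bi 1 2" and "c3 = bi 2 1" and "e3 = bi 2 2"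
 note B = bi[of 1 1, folded a3_def] bi[of 1 2, folded b3_def] bi[of 2 1, folded c3_def] bi[of 2 2, folded e3_def]
 have detB: "real_of_int a3 * of_int e3 - of_int b3 * of_int c3 = 1"
  using G(2) unfolding SL2_Z_def det_2 by (simp add: B)
 have detA': "cj a * cj e - cj b * cj c = 1" using arg_cong[OF A(5), of cj] A(1-4) by simp
 have pos: "Im (z $ 1) > 0" "Im (z $ 2) > 0" "Im (z $ 3) > 0" using upper_half3_Im[OF z] by blast+
 define j1 j2 j3 where "j1 = of_real c * z $ 1 + of_real e" and "j2 = of_real (cj c) * z $ 2 + of_real (cj e)"
  and "j3 = of_real (of_int c3) * z $ 3 + of_real (of_int e3)"
 define z' where "z' = hilbert_act D (A, B) z"
 note m1 = moebius_denominator[OF pos(1) A(5), folded j1_def] and m2 = moebius_denominator[OF pos(2) detA', folded j2_def]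
  and m3 = moebius_denominator[OF pos(3) detB, folded j3_def]
 have z'n: "z' $ 1 = (of_real a * z $ 1 + of_real b) / j1" "z' $ 2 = (of_real (cj a) * z $ 2 + of_real (cj b)) / j2"
  "z' $ 3 = (of_real (of_int a3) * z $ 3 + of_real (of_int b3)) / j3"
  unfolding z'_def hilbert_act_nth moebius_def j1_def j2_def j3_def by (simp_all add: A_def B)
 have im: "Im (z' $ 1) = Im (z $ 1) / (cmod j1)\<^sup>2" "Im (z' $ 2) = Im (z $ 2) / (cmod j2)\<^sup>2" "Im (z' $ 3) = Im (z $ 3) / (cmod j3)\<^sup>2"
  unfolding z'n using m1(2) m2(2) m3(2) by blast+
 have z': "z' \<in> HH"
  unfolding upper_half3_def using im pos m1(1) m2(1) m3(1) by (auto simp: forall_3)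
 have "dg j1 j2 j3 x \<in> range (period_hom (Pz z))" if xL: "x \<in> range (period_hom (Pz z'))" for x
 proof -
  obtain \<alpha> \<beta> i j where x: "x = pvec z' \<alpha> \<beta> i j" "\<alpha> \<in> KK" "\<beta> \<in> KK" "\<alpha> - of_int j * \<eta>2 / real d \<in> Od" "s * \<beta> + of_int i * cj \<eta>1 \<in> \<aa>"
   by (rule lattice_coords[OF xL])
  define \<alpha>0 \<beta>0 where "\<alpha>0 = \<alpha> - of_int j * \<eta>2 / real d" and "\<beta>0 = s * \<beta> + of_int i * cj \<eta>1"
  have ab0: "\<alpha> = \<alpha>0 + of_int j * \<eta>2 / real d" "s * \<beta> = \<beta>0 - of_int i * cj \<eta>1" unfolding \<alpha>0_def \<beta>0_def by simp_all
  have beta: "\<beta> = (\<beta>0 - of_int i * cj \<eta>1) / s" using ab0(2) s_ne by (simp add: field_simps)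
  have ne: "j1 ~= 0" "j2 ~= 0" "j3 ~= 0" using m1(1) m2(1) m3(1) by blast+
  have jm: "j * (u + v * (w / j)) = j * u + v * w" if "j ~= 0" for j u v w :: complex
   using that by (simp add: distrib_left)
  have eq: "dg j1 j2 j3 x = pvec z (\<alpha> * e + \<beta> * b) (\<alpha> * c + \<beta> * a) (i * e3 - j * b3) (j * a3 - i * c3)"
  proof (rule vec3_eqI)
   show "dg j1 j2 j3 x $ 1 = pvec z (\<alpha> * e + \<beta> * b) (\<alpha> * c + \<beta> * a) (i * e3 - j * b3) (j * a3 - i * c3) $ 1"
   unfolding x(1) dg_nth pvec_nth z'n jm[OF ne(1)] by (simp add: j1_def algebra_simps)
   show "dg j1 j2 j3 x $ 2 = pvec z (\<alpha> * e + \<beta> * b) (\<alpha> * c + \<beta> * a) (i * e3 - j * b3) (j * a3 - i * c3) $ 2"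
   unfolding x(1) dg_nth pvec_nth z'n jm[OF ne(2)] using A x(2,3) by (simp add: j2_def algebra_simps)
   have "j3 * ((of_int i - of_int j * ((of_real (of_int a3) * z $ 3 + of_real (of_int b3)) / j3))) = of_int i * j3 - of_int j * (of_real (of_int a3) * z $ 3 + of_real (of_int b3))"
   using ne(3) by (simp add: field_simps)
   also have "\<dots> = of_int (i * e3 - j * b3) - of_int (j * a3 - i * c3) * z $ 3" unfolding j3_def by (simp add: algebra_simps)
   finally show "dg j1 j2 j3 x $ 3 = pvec z (\<alpha> * e + \<beta> * b) (\<alpha> * c + \<beta> * a) (i * e3 - j * b3) (j * a3 - i * c3) $ 3"
   unfolding x(1) dg_nth pvec_nth z'n by (simp only: times_divide_eq_right)
  qed
  show ?thesis unfolding eq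
  proof (rule pvec_in_lattice)
   have e1: "\<alpha> * e + \<beta> * b - of_int (j * a3 - i * c3) * \<eta>2 / real d =
   \<alpha>0 * e + b * (\<beta>0 / s) + of_int j * (\<eta>2 * (e - of_int a3) / d) - of_int i * (cj \<eta>1 * b / s - of_int c3 * \<eta>2 / d)"
   unfolding beta ab0(1) by (simp add: diff_divide_distrib add_divide_distrib algebra_simps)
   have e2: "\<eta>2 * (e - of_int a3) / d \<in> Od"
   using eta2_mult_in_d[of "e - of_int a3"] G(4) A(7) d_pos unfolding B by (simp add: image_scale_iff)
   have e3: "b * (\<beta>0 / s) \<in> Od" using A(8) x(5) unfolding \<beta>0_def by blast
   have e4: "\<alpha>0 \<in> Od" using x(4) unfolding \<alpha>0_def .
   have e5: "cj \<eta>1 * b / s - of_int c3 * \<eta>2 / d \<in> Od" using G(5) unfolding B .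
   show "\<alpha> * e + \<beta> * b - of_int (j * a3 - i * c3) * \<eta>2 / real d \<in> Od"
   unfolding e1 by (intro Od_add Od_diff Od_mult e2 e3 e4 e5 A(7) Od_int(1))
   have "s * (\<alpha> * c + \<beta> * a) + of_int (i * e3 - j * b3) * cj \<eta>1 =
   \<alpha>0 * (s * c) + a * \<beta>0 - of_int i * (cj \<eta>1 * (a - of_int e3)) + of_int j * (s * \<eta>2 * c / d - of_int b3 * cj \<eta>1)"
   proof -
   have "s * (\<alpha> * c + \<beta> * a) = \<alpha> * (s * c) + a * (s * \<beta>)" by (simp add: algebra_simps)
   then show ?thesis unfolding ab0 by (simp add: algebra_simps)
   qed
   moreover have "cj \<eta>1 * (a - of_int e3) \<in> \<aa>" using G(3) A(6) unfolding B by (subst cj_eta1_mult_in_aa) simp_all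
   moreover have "s * \<eta>2 * c / d - of_int b3 * cj \<eta>1 \<in> \<aa>" using G(6) unfolding B .
   moreover have "\<alpha>0 \<in> Od" "\<beta>0 \<in> \<aa>" using x(4,5) unfolding \<alpha>0_def \<beta>0_def by blast+
   ultimately show "s * (\<alpha> * c + \<beta> * a) + of_int (i * e3 - j * b3) * cj \<eta>1 \<in> \<aa>"
   using RR_ideal_closed(3,4,5)[OF idl] sc A(6) by simp
  qed
 qed
 then have "rm_isomorphic D (Xz z) (Xz z')"
  by (rule rm_isomorphic_dg[OF z z' m1(1) m2(1) m3(1) im])
 then show ?thesis using z' unfolding z'_def by blast
qed

end

context smart
begin

text \<open>
  An isomorphism preserves the eigenlines of the real multiplication and the orthogonal complement of
  the surface, which are the coordinate axes. Preserving the forms fixes the absolute values.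
\<close>

lemma isomorphic_is_diagonal:
 assumes z: "z \<in> HH" and z': "z' \<in> HH" and iso: "rm_isomorphic D (Xz z) (Xz z')"
 obtains j1 j2 j3 where "j1 ~= 0" "j2 ~= 0" "j3 ~= 0"
  "Im (z' $ 1) = Im (z $ 1) / (cmod j1)\<^sup>2" "Im (z' $ 2) = Im (z $ 2) / (cmod j2)\<^sup>2" "Im (z' $ 3) = Im (z $ 3) / (cmod j3)\<^sup>2"
  "!!x. x \<in> range (period_hom (Pz z')) ==> dg j1 j2 j3 x \<in> range (period_hom (Pz z))"
proof -
 obtain f where f: "Vector_Spaces.linear (*s) (*s) f & bij f & f ` range (period_hom (Pz z)) = range (period_hom (Pz z')) &
   (ALL x y. Hz z' (f x) (f y) = Hz z x y) & f ` V2 = V2 &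
   (\<forall>k\<in>Od. \<forall>x\<in>V2. f (act (Xz z) k x) = act (Xz z') k (f x))"
  using iso unfolding rm_isomorphic_def Xz_pol[OF z] Xz_pol[OF z'] Xz_simps(1,2) by (elim exE)
 note f1 = f[THEN conjunct1] and f2 = f[THEN conjunct2]
 note lin = f1 and bij = f2[THEN conjunct1] and lat = f2[THEN conjunct2, THEN conjunct1]
 note f4 = f2[THEN conjunct2, THEN conjunct2]
 note H = f4[THEN conjunct1, rule_format] and V = f4[THEN conjunct2, THEN conjunct1]
 note act = f4[THEN conjunct2, THEN conjunct2, rule_format]
 have fsc: "f (c *s x) = c *s f x" and fadd: "f (x + y) = f x + f y" for c x y
  using lin by (simp_all add: vec.linear_scale vec.linear_add)
 have f0: "f x = 0 ==> x = 0" for x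
 proof -
  assume "f x = 0"
  moreover have "f 0 = 0" using fsc[of 0 0] by simp
  ultimately show "x = 0" using bij by (metis bij_def injD)
 qed
 define e1 e2 e3 :: "complex ^ 3" where "e1 = vector [1, 0, 0]" and "e2 = vector [0, 1, 0]" and "e3 = vector [0, 0, 1]"
 note e = e1_def e2_def e3_def
 have eV: "e1 \<in> V2" "e2 \<in> V2" unfolding e V2_def by simp_all
 have fV: "f x \<in> V2" if "x \<in> V2" for x using V that by blast
 have omne: "complex_of_real om ~= complex_of_real (cj om)" using om_diff s_ne by auto
 have "f (act (Xz z) om e1) = f (of_real om *s e1)" using eV
  by (intro arg_cong[of _ _ f] vec3_eqI) (simp_all add: e)
 then have a1: "act (Xz z') om (f e1) = of_real om *s f e1" using act[of om e1] eV fsc by simp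
 have "act (Xz z') om (f e1) $ 2 = of_real (cj om) * f e1 $ 2" using fV[OF eV(1)] by simp
 then have f12: "f e1 $ 2 = 0" unfolding a1 using omne by simp
 have "f (act (Xz z) om e2) = f (of_real (cj om) *s e2)" using eV
  by (intro arg_cong[of _ _ f] vec3_eqI) (simp_all add: e)
 then have a2: "act (Xz z') om (f e2) = of_real (cj om) *s f e2" using act[of om e2] eV fsc by simp
 have "act (Xz z') om (f e2) $ 1 = of_real om * f e2 $ 1" using fV[OF eV(2)] by simp
 then have f21: "f e2 $ 1 = 0" unfolding a2 using omne by simp
 have f3: "f e1 $ 3 = 0" "f e2 $ 3 = 0" using fV eV unfolding V2_def by auto
 define a b c where "a = f e1 $ 1" and "b = f e2 $ 2" and "c = f e3 $ 3"
 have fe1: "f e1 = vector [a, 0, 0]" using f12 f3 by (intro vec3_eqI) (simp_all add: a_def)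
 have fe2: "f e2 = vector [0, b, 0]" using f21 f3 by (intro vec3_eqI) (simp_all add: b_def)
 have a0: "a ~= 0"
 proof
  assume "a = 0"
  then have "f e1 = 0" unfolding fe1 by (intro vec3_eqI) simp_all
  from f0[OF this] show False unfolding e by (metis vector_3(1) zero_index zero_neq_one)
 qed
 have b0: "b ~= 0"
 proof
  assume "b = 0"
  then have "f e2 = 0" unfolding fe2 by (intro vec3_eqI) simp_all
  from f0[OF this] show False unfolding e by (metis vector_3(2) zero_index zero_neq_one)
 qed
 have pos: "Im (z $ 1) > 0" "Im (z $ 2) > 0" "Im (z $ 3) > 0" using upper_half3_Im[OF z] by blast+
 have pos': "Im (z' $ 1) > 0" "Im (z' $ 2) > 0" "Im (z' $ 3) > 0" using upper_half3_Im[OF z'] by blast+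
 have "Hz z' (f e3) (f e1) = 0" "Hz z' (f e3) (f e2) = 0" unfolding H by (simp_all add: e Hz_def)
 then have "f e3 $ 1 = 0" "f e3 $ 2 = 0" unfolding fe1 fe2 Hz_def using a0 b0 pos' by simp_all
 then have fe3: "f e3 = vector [0, 0, c]" by (intro vec3_eqI) (simp_all add: c_def)
 have c0: "c ~= 0"
 proof
  assume "c = 0"
  then have "f e3 = 0" unfolding fe3 by (intro vec3_eqI) simp_all
  from f0[OF this] show False unfolding e by (metis vector_3(3) zero_index zero_neq_one)
 qed
 have fdg: "f x = dg a b c x" for x
 proof -
  have "x = x $ 1 *s e1 + (x $ 2 *s e2 + x $ 3 *s e3)" unfolding e by (intro vec3_eqI) simp_all
  then have "f x = x $ 1 *s f e1 + (x $ 2 *s f e2 + x $ 3 *s f e3)" by (metis fsc fadd)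
  then show ?thesis unfolding fe1 fe2 fe3 by (intro vec3_eqI) simp_all
 qed
 have nrm: "complex_of_real ((cmod w)\<^sup>2) = w * cnj w" for w by (rule complex_norm_square)
 have h: "Hz z' (f e1) (f e1) = Hz z e1 e1" "Hz z' (f e2) (f e2) = Hz z e2 e2" "Hz z' (f e3) (f e3) = Hz z e3 e3"
  using H by simp_all
 have im: "Im w' = Im w / (cmod (1 / u))\<^sup>2" if u: "u ~= 0" "Im w > 0" "Im w' > 0" "u * cnj u / of_real (Im w') = 1 / of_real (Im w)" for u w w'
 proof -
  have "of_real ((cmod u)\<^sup>2 / Im w') = complex_of_real (1 / Im w)" using u(4) unfolding of_real_divide complex_norm_square by simp
  then have "(cmod u)\<^sup>2 / Im w' = 1 / Im w" unfolding of_real_eq_iff .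
  then show ?thesis using u by (simp add: norm_divide power_divide field_simps)
 qed
 have q': "Hz z' (f e1) (f e1) = a * cnj a / of_real (Im (z' $ 1))" "Hz z' (f e2) (f e2) = b * cnj b / of_real (Im (z' $ 2))"
  "Hz z' (f e3) (f e3) = of_nat d * (c * cnj c) / of_real (Im (z' $ 3))"
  unfolding fe1 fe2 fe3 Hz_def by simp_all
 have q: "Hz z e1 e1 = 1 / of_real (Im (z $ 1))" "Hz z e2 e2 = 1 / of_real (Im (z $ 2))"
  "Hz z e3 e3 = of_nat d / of_real (Im (z $ 3))"
  unfolding e Hz_def by simp_all
 have i1: "Im (z' $ 1) = Im (z $ 1) / (cmod (1 / a))\<^sup>2"
  by (rule im[OF a0 pos(1) pos'(1)]) (use h(1) q q' in simp)
 have i2: "Im (z' $ 2) = Im (z $ 2) / (cmod (1 / b))\<^sup>2"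
  by (rule im[OF b0 pos(2) pos'(2)]) (use h(2) q q' in simp)
 have "of_nat d * (c * cnj c) / complex_of_real (Im (z' $ 3)) = of_nat d / of_real (Im (z $ 3))" using h(3) q q' by simp
 then have "of_nat d * (c * cnj c / complex_of_real (Im (z' $ 3))) = of_nat d * (1 / of_real (Im (z $ 3)))" by simp
 then have "c * cnj c / complex_of_real (Im (z' $ 3)) = 1 / of_real (Im (z $ 3))" by (rule mult_left_cancel[THEN iffD1, rotated]) (use d_pos in simp)
 then have i3: "Im (z' $ 3) = Im (z $ 3) / (cmod (1 / c))\<^sup>2"
  by (rule im[OF c0 pos(3) pos'(3)])
 have L: "dg (1 / a) (1 / b) (1 / c) x \<in> range (period_hom (Pz z))" if x: "x \<in> range (period_hom (Pz z'))" for x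
 proof -
  have "x \<in> f ` range (period_hom (Pz z))" using x unfolding lat .
  then obtain y where y: "y \<in> range (period_hom (Pz z))" "x = f y" by (elim imageE) blast
  have "dg (1 / a) (1 / b) (1 / c) x = y" unfolding y(2) fdg by (rule dg_inverse(2)[OF a0 b0 c0])
  then show ?thesis using y(1) by simp
 qed
 show thesis by (rule that[OF _ _ _ i1 i2 i3 L]) (use a0 b0 c0 in simp_all)
qed

lemma pvec_in_latticeD:
 assumes z: "z \<in> HH" and mem: "pvec z \<alpha> \<beta> i j \<in> range (period_hom (Pz z))"
 shows "\<alpha> - of_int j * \<eta>2 / real d \<in> Od" "s * \<beta> + of_int i * cj \<eta>1 \<in> \<aa>" "\<alpha> \<in> KK" "\<beta> \<in> KK"
proof -
 obtain \<alpha>' \<beta>' i' j' where *: "pvec z \<alpha> \<beta> i j = pvec z \<alpha>' \<beta>' i' j'" "\<alpha>' \<in> KK" "\<beta>' \<in> KK"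
  "\<alpha>' - of_int j' * \<eta>2 / real d \<in> Od" "s * \<beta>' + of_int i' * cj \<eta>1 \<in> \<aa>"
  by (rule lattice_coords[OF mem])
 from pvec_unique[OF z *(1)] * show "\<alpha> - of_int j * \<eta>2 / real d \<in> Od" "s * \<beta> + of_int i * cj \<eta>1 \<in> \<aa>" "\<alpha> \<in> KK" "\<beta> \<in> KK"
  by simp_all
qed

text \<open>
  The image of \<open>(\<O>\<^sub>D, 0)\<close> and \<open>(0, \<aa>/\<surd>D)\<close> under the diagonal map gives the first matrix, the images of the
  vectors on the third axis give the second one. Comparing the images of \<open>\<mu>\<^sub>2\<close> and \<open>\<mu>\<^sub>3\<close>, which lie
  neither in the surface nor in its complement, yields the congruences that link the two.
\<close>

lemma isomorphic_imp_Gamma: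
 assumes cop: "coprime d (conductor D)"
  and z: "z \<in> HH" and z': "z' \<in> HH" and iso: "rm_isomorphic D (Xz z) (Xz z')"
 shows "\<exists>g\<in>Gamma_group D d \<aa> \<eta>1 \<eta>2. z' = hilbert_act D g z"
proof -
 obtain j1 j2 j3 where j0: "j1 ~= 0" "j2 ~= 0" "j3 ~= 0"
  and im: "Im (z' $ 1) = Im (z $ 1) / (cmod j1)\<^sup>2" "Im (z' $ 2) = Im (z $ 2) / (cmod j2)\<^sup>2" "Im (z' $ 3) = Im (z $ 3) / (cmod j3)\<^sup>2"
  and L: "!!x. x \<in> range (period_hom (Pz z')) ==> dg j1 j2 j3 x \<in> range (period_hom (Pz z))"
  by (rule isomorphic_is_diagonal[OF z z' iso]) blast
 have pos: "Im (z $ 1) > 0" "Im (z $ 2) > 0" "Im (z $ 3) > 0" using upper_half3_Im[OF z] by blast+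
 have LV: "\<exists>\<alpha> \<beta>. \<alpha> \<in> Od & s * \<beta> \<in> \<aa> & dg j1 j2 j3 (pvec z' \<kappa> l 0 0) = pvec z \<alpha> \<beta> 0 0"
  if kl: "\<kappa> \<in> Od" "s * l \<in> \<aa>" for \<kappa> l
 proof -
  have "dg j1 j2 j3 (pvec z' \<kappa> l 0 0) \<in> range (period_hom (Pz z))"
   by (rule L, rule pvec_in_lattice) (use kl in simp_all)
  moreover have "dg j1 j2 j3 (pvec z' \<kappa> l 0 0) \<in> V2" unfolding V2_def by simp
  ultimately obtain \<alpha> b where "\<alpha> \<in> Od" "b \<in> \<aa>" "dg j1 j2 j3 (pvec z' \<kappa> l 0 0) = pvec z \<alpha> (b / s) 0 0"
   using sub_lattice(1)[OF z] by blast
  then show ?thesis using s_ne by (intro exI[of _ \<alpha>] exI[of _ "b / s"]) simp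
 qed
 obtain e c where ec: "e \<in> Od" "s * c \<in> \<aa>" "dg j1 j2 j3 (pvec z' 1 0 0 0) = pvec z e c 0 0"
  using LV[of 1 0] RR_ideal_closed(2)[OF idl] by auto
 have cK: "c \<in> KK"
 proof -
  have "s * c / s \<in> KK" using ec(2) aa_Od by (intro KK_divide) simp_all
  then show ?thesis using s_ne by simp
 qed
 have "dg j1 j2 j3 (pvec z' 1 0 0 0) $ 1 = pvec z e c 0 0 $ 1" "dg j1 j2 j3 (pvec z' 1 0 0 0) $ 2 = pvec z e c 0 0 $ 2"
  unfolding ec(3) by simp_all
 then have j1: "j1 = of_real e + of_real c * z $ 1" and j2: "j2 = of_real (cj e) + of_real (cj c) * z $ 2"
  by simp_all
 define l0 where "l0 = cj \<eta>2 / s"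
 have l0: "l0 ~= 0" "l0 \<in> KK" "s * l0 \<in> \<aa>" unfolding l0_def using s_ne by simp_all
 obtain \<alpha>1 \<beta>1 where ab: "\<alpha>1 \<in> Od" "s * \<beta>1 \<in> \<aa>" "dg j1 j2 j3 (pvec z' 0 l0 0 0) = pvec z \<alpha>1 \<beta>1 0 0"
  using LV[of 0 l0] l0 by auto
 define a b where "a = \<beta>1 / l0" and "b = \<alpha>1 / l0"
 have \<beta>K: "\<beta>1 \<in> KK"
 proof -
  have "s * \<beta>1 / s \<in> KK" using ab(2) aa_Od by (intro KK_divide) simp_all
  then show ?thesis using s_ne by simp
 qed
 have abK: "a \<in> KK" "b \<in> KK" unfolding a_def b_def using \<beta>K ab(1) l0(2) by simp_all
 have ab1: "\<beta>1 = l0 * a" "\<alpha>1 = l0 * b" unfolding a_def b_def using l0(1) by simp_all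
 have "dg j1 j2 j3 (pvec z' 0 l0 0 0) $ 1 = pvec z \<alpha>1 \<beta>1 0 0 $ 1" "dg j1 j2 j3 (pvec z' 0 l0 0 0) $ 2 = pvec z \<alpha>1 \<beta>1 0 0 $ 2"
  unfolding ab(3) by simp_all
 then have "of_real l0 * (j1 * z' $ 1) = of_real l0 * (of_real b + of_real a * z $ 1)"
  "of_real (cj l0) * (j2 * z' $ 2) = of_real (cj l0) * (of_real (cj b) + of_real (cj a) * z $ 2)"
  unfolding ab1 using l0(2) abK by (simp_all add: algebra_simps)
 then have zj: "j1 * z' $ 1 = of_real b + of_real a * z $ 1" "j2 * z' $ 2 = of_real (cj b) + of_real (cj a) * z $ 2"
  using l0 by simp_all
 have Iab: "l * b \<in> Od & s * (l * a) \<in> \<aa>" if l: "s * l \<in> \<aa>" for l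
 proof -
  obtain \<alpha> \<beta> where *: "\<alpha> \<in> Od" "s * \<beta> \<in> \<aa>" "dg j1 j2 j3 (pvec z' 0 l 0 0) = pvec z \<alpha> \<beta> 0 0"
   using LV[of 0 l] l by auto
  have "dg j1 j2 j3 (pvec z' 0 l 0 0) $ 1 = pvec z \<alpha> \<beta> 0 0 $ 1" unfolding *(3) ..
  then have "of_real l * (j1 * z' $ 1) = of_real \<alpha> + of_real \<beta> * z $ 1" by (simp add: mult_ac)
  then have "of_real (l * b) + of_real (l * a) * z $ 1 = of_real \<alpha> + of_real \<beta> * z $ 1" unfolding zj by (simp add: algebra_simps)
  from real_combination_unique[OF pos(1) this] show ?thesis using * by simp
 qed
 have aO: "a \<in> Od"
 proof (rule multiplier_in_Od[OF cop abK(1)])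
  fix x assume "x \<in> \<aa>"
  then have "s * (x / s * a) \<in> \<aa>" using Iab[of "x / s"] s_ne by simp
  then show "a * x \<in> \<aa>" using s_ne by (simp add: mult.commute)
 qed
 have z'e: "z' $ 1 = (of_real a * z $ 1 + of_real b) / (of_real c * z $ 1 + of_real e)"
  "z' $ 2 = (of_real (cj a) * z $ 2 + of_real (cj b)) / (of_real (cj c) * z $ 2 + of_real (cj e))"
  using zj j0 j1 j2 by (simp_all add: field_simps)
 have im_gen: "a * e - b * c = 1" if "Im w > 0" "j ~= 0" "j = of_real e + of_real c * w" "j * w' = of_real b + of_real a * w" "Im w' = Im w / (cmod j)\<^sup>2"
  for a b c e :: real and w w' j
 proof -
  have "w' * of_real ((cmod j)\<^sup>2) = (j * w') * cnj j" unfolding complex_norm_square by (simp add: mult_ac)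
  then have "Im w' * (cmod j)\<^sup>2 = Im ((of_real b + of_real a * w) * cnj (of_real e + of_real c * w))"
   unfolding that(4) unfolding that(3) by (metis Im_complex_of_real Re_complex_of_real add.right_neutral mult_zero_right times_complex.sel(2) add.commute)
  also have "\<dots> = (a * e - b * c) * Im w" by (simp add: algebra_simps)
  finally have "Im w = (a * e - b * c) * Im w" unfolding that(5) using that(2) by simp
  then show ?thesis using that(1) by simp
 qed
 have det: "a * e - b * c = 1" by (rule im_gen[OF pos(1) j0(1) j1 zj(1) im(1)])
 have third: "\<exists>m n::int. j3 * w = of_int m + of_int n * z $ 3"
  if w: "vector [0, 0, w] = pvec z' \<kappa> l i j" "\<kappa> - of_int j * \<eta>2 / real d \<in> Od" "s * l + of_int i * cj \<eta>1 \<in> \<aa>" for w \<kappa> l i j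
 proof -
  have "dg j1 j2 j3 (pvec z' \<kappa> l i j) \<in> range (period_hom (Pz z))"
   by (rule L, rule pvec_in_lattice) (use w in simp_all)
  then obtain \<alpha> \<beta> m n where *: "dg j1 j2 j3 (vector [0, 0, w]) = pvec z \<alpha> \<beta> m n"
   "\<alpha> - of_int n * \<eta>2 / real d \<in> Od" "s * \<beta> + of_int m * cj \<eta>1 \<in> \<aa>"
   unfolding w(1)[symmetric] using lattice_coords by metis
  have "dg j1 j2 j3 (vector [0, 0, w]) $ 1 = pvec z \<alpha> \<beta> m n $ 1" unfolding *(1) ..
  then have "of_real \<alpha> + of_real \<beta> * z $ 1 = of_real 0 + of_real 0 * z $ 1" by simp
  from real_combination_unique[OF pos(1) this] have 0: "\<alpha> = 0" "\<beta> = 0" by simp_all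
  have "cj \<eta>1 * of_int m \<in> \<aa>" using *(3) unfolding 0 by (simp add: mult.commute)
  then have "of_int m \<in> \<aa>" using cj_eta1_mult_in_aa[of "of_int m"] by simp
  then obtain m' where m': "m = int d * m'" unfolding int_in_aa by (auto elim: dvdE)
  have "- (of_int n * \<eta>2 / real d) \<in> Od" using *(2) unfolding 0 by simp
  then have "- (- (of_int n * \<eta>2 / real d)) \<in> Od" by (rule Od_uminus)
  then have "of_int n * \<eta>2 / real d \<in> Od" by simp
  then have "\<eta>2 * of_int n / real d \<in> Od" by (simp add: mult.commute)
  then have "\<eta>2 * of_int n \<in> (%y. real d * y) ` Od" using d_pos by (simp add: image_scale_iff)
  then have "of_int n \<in> \<aa>" using eta2_mult_in_d[of "of_int n"] by simp
  then obtain n' where n': "n = int d * n'" unfolding int_in_aa by (auto elim: dvdE)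
  have "j3 * w = (of_int m - of_int n * z $ 3) / of_nat d"
   using arg_cong[OF *(1), of "%x. x $ 3"] by simp
  also have "\<dots> = of_int m' + of_int (- n') * z $ 3" unfolding m' n' using d_pos by (simp add: field_simps)
  finally show ?thesis by blast
 qed
 have dn: "(of_nat d :: complex) ~= 0" using d_pos by simp
 have "\<exists>m n::int. j3 * 1 = of_int m + of_int n * z $ 3"
 proof (rule third[of 1 0 0 "int d" 0])
  show "vector [0, 0, 1] = pvec z' 0 0 (int d) 0" using dn by (intro vec3_eqI) simp_all
  show "s * 0 + of_int (int d) * cj \<eta>1 \<in> \<aa>" using eta_aa(2) by simp
 qed simp
 then obtain e3 c3 :: int where j3: "j3 = of_int e3 + of_int c3 * z $ 3" by auto
 have "\<exists>m n::int. j3 * z' $ 3 = of_int m + of_int n * z $ 3"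
 proof (rule third[of "z' $ 3" 0 0 0 "- int d"])
  show "vector [0, 0, z' $ 3] = pvec z' 0 0 0 (- int d)" using dn by (intro vec3_eqI) simp_all
  show "0 - of_int (- int d) * \<eta>2 / real d \<in> Od" using d_pos by simp
  show "s * 0 + of_int 0 * cj \<eta>1 \<in> \<aa>" using RR_ideal_closed(2)[OF idl] by simp
 qed
 then obtain b3 a3 :: int where zj3: "j3 * z' $ 3 = of_int b3 + of_int a3 * z $ 3" by auto
 have det3: "real_of_int a3 * of_int e3 - of_int b3 * of_int c3 = 1"
  by (rule im_gen[OF pos(3) j0(3) _ _ im(3)]) (use j3 zj3 in simp_all)
 have z'3: "z' $ 3 = (of_int a3 * z $ 3 + of_int b3) / (of_int c3 * z $ 3 + of_int e3)"
  using zj3 j0(3) j3 by (simp add: field_simps)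
 have mu2: "pvec z (- cj \<eta>1 / s * b) (- cj \<eta>1 / s * a) e3 (- c3) \<in> range (period_hom (Pz z))"
 proof -
  have "dg j1 j2 j3 (pvec z' 0 (- cj \<eta>1 / s) 1 0) \<in> range (period_hom (Pz z))"
   by (rule L, rule pvec_in_lattice) (use s_ne RR_ideal_closed(2)[OF idl] in simp_all)
  moreover have "dg j1 j2 j3 (pvec z' 0 (- cj \<eta>1 / s) 1 0) = pvec z (- cj \<eta>1 / s * b) (- cj \<eta>1 / s * a) e3 (- c3)"
  proof -
  have "dg j1 j2 j3 (pvec z' 0 q 1 0) = pvec z (q * b) (q * a) e3 (- c3)" if q: "q \<in> KK" for q
  proof (rule vec3_eqI)
   have "dg j1 j2 j3 (pvec z' 0 q 1 0) $ 1 = of_real q * (j1 * z' $ 1)" by simp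
   then show "dg j1 j2 j3 (pvec z' 0 q 1 0) $ 1 = pvec z (q * b) (q * a) e3 (- c3) $ 1"
   unfolding zj by (simp add: algebra_simps)
   have "dg j1 j2 j3 (pvec z' 0 q 1 0) $ 2 = of_real (cj q) * (j2 * z' $ 2)" by simp
   then show "dg j1 j2 j3 (pvec z' 0 q 1 0) $ 2 = pvec z (q * b) (q * a) e3 (- c3) $ 2"
   unfolding zj using abK q by (simp add: algebra_simps)
   show "dg j1 j2 j3 (pvec z' 0 q 1 0) $ 3 = pvec z (q * b) (q * a) e3 (- c3) $ 3"
   using j3 by simp
  qed
  from this[of "- cj \<eta>1 / s"] show ?thesis by simp
  qed
  ultimately show ?thesis by simp
 qed
 have mu3: "pvec z (\<eta>2 / d * e) (\<eta>2 / d * c) (- b3) a3 \<in> range (period_hom (Pz z))"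
 proof -
  have "dg j1 j2 j3 (pvec z' (\<eta>2 / d) 0 0 1) \<in> range (period_hom (Pz z))"
   by (rule L, rule pvec_in_lattice) (use RR_ideal_closed(2)[OF idl] in simp_all)
  moreover have "dg j1 j2 j3 (pvec z' (\<eta>2 / d) 0 0 1) = pvec z (\<eta>2 / d * e) (\<eta>2 / d * c) (- b3) a3"
  proof (rule vec3_eqI)
   show "dg j1 j2 j3 (pvec z' (\<eta>2 / d) 0 0 1) $ 1 = pvec z (\<eta>2 / d * e) (\<eta>2 / d * c) (- b3) a3 $ 1"
   by (simp add: j1 algebra_simps)
   show "dg j1 j2 j3 (pvec z' (\<eta>2 / d) 0 0 1) $ 2 = pvec z (\<eta>2 / d * e) (\<eta>2 / d * c) (- b3) a3 $ 2"
   using ec(1) cK by (simp add: j2 algebra_simps)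
   have "dg j1 j2 j3 (pvec z' (\<eta>2 / d) 0 0 1) $ 3 = - (j3 * z' $ 3) / of_nat d" by simp
   then show "dg j1 j2 j3 (pvec z' (\<eta>2 / d) 0 0 1) $ 3 = pvec z (\<eta>2 / d * e) (\<eta>2 / d * c) (- b3) a3 $ 3"
   unfolding zj3 by simp
  qed
  ultimately show ?thesis by simp
 qed
 define A :: "real ^ 2 ^ 2" where "A = vector [vector [a, b], vector [c, e]]"
 define B :: "real ^ 2 ^ 2" where "B = vector [vector [of_int a3, of_int b3], vector [of_int c3, of_int e3]]"
 have An: "A $ 1 $ 1 = a" "A $ 1 $ 2 = b" "A $ 2 $ 1 = c" "A $ 2 $ 2 = e" unfolding A_def by simp_all
 have Bn: "B $ 1 $ 1 = of_int a3" "B $ 1 $ 2 = of_int b3" "B $ 2 $ 1 = of_int c3" "B $ 2 $ 2 = of_int e3" unfolding B_def by simp_all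
 have "(A, B) \<in> Gamma_group D d \<aa> \<eta>1 \<eta>2"
  unfolding Gamma_iff An Bn
 proof (intro conjI)
  show "A \<in> SL2_ideal D \<aa>"
   unfolding SL2_ideal_def det_2 mem_Collect_eq forall_2 An
  proof (intro conjI ballI)
   show "c \<in> (%x. x / s) ` \<aa>" using ec(2) s_ne by (intro image_eqI[of _ _ "s * c"]) simp_all
   fix x assume "x \<in> \<aa>"
   then show "b * (x / s) \<in> Od" using Iab[of "x / s"] s_ne by (simp add: mult.commute)
  qed (use abK cK ec(1) det aO in simp_all)
  show "B \<in> SL2_Z" unfolding SL2_Z_def det_2 mem_Collect_eq forall_2 Bn using det3 by simp
  note m2 = pvec_in_latticeD(1,2)[OF z mu2] and m3 = pvec_in_latticeD(1,2)[OF z mu3]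
  have "- (cj \<eta>1 * (a - of_int e3)) \<in> \<aa>" using m2(2) s_ne by (simp add: algebra_simps)
  then have "- 1 * (- (cj \<eta>1 * (a - of_int e3))) \<in> \<aa>" by (rule RR_ideal_closed(5)[OF idl]) simp
  then have "cj \<eta>1 * (a - of_int e3) \<in> \<aa>" by simp
  then show "a - of_int e3 \<in> \<aa>" using cj_eta1_mult_in_aa[of "a - of_int e3"] aO by simp
  have "\<eta>2 * (e - of_int a3) / d \<in> Od" using m3(1) by (simp add: algebra_simps diff_divide_distrib)
  then show "e - of_int a3 \<in> \<aa>" using eta2_mult_in_d[of "e - of_int a3"] ec(1) d_pos by (simp add: image_scale_iff)
  have "- (- cj \<eta>1 / s * b - of_int (- c3) * \<eta>2 / real d) \<in> Od" using m2(1) by (rule Od_uminus)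
  then show "cj \<eta>1 * b / s - of_int c3 * \<eta>2 / d \<in> Od" by simp
  show "s * \<eta>2 * c / d - of_int b3 * cj \<eta>1 \<in> \<aa>" using m3(2) by (simp add: algebra_simps)
 qed
 moreover have "z' = hilbert_act D (A, B) z"
  by (rule vec3_eqI) (simp_all add: hilbert_act_nth moebius_def An Bn z'e z'3)
 ultimately show ?thesis by blast
qed

end

context hermitian3
begin

lemma lattice_add: "x \<in> range (period_hom M) ==> y \<in> range (period_hom M) ==> x + y \<in> range (period_hom M)"
 by (elim rangeE) (simp add: period_hom_add[symmetric])

lemma lattice_zscale: assumes "x \<in> range (period_hom M)" shows "k *. x \<in> range (period_hom M)"
proof -
 obtain n where "x = period_hom M n" using assms by blast
 then have "k *. x = period_hom M (\<chi> j. k * n $ j)" by (simp add: period_hom_6 scaleR_add_right)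
 then show ?thesis by (rule ssubst) (rule rangeI)
qed

lemma lattice_diff: assumes "x \<in> range (period_hom M)" "y \<in> range (period_hom M)" shows "x - y \<in> range (period_hom M)"
 using lattice_add[OF assms(1) lattice_zscale[OF assms(2), of "-1"]] by simp

lemma lattice_E_int: assumes "symp M" "x \<in> range (period_hom M)" "y \<in> range (period_hom M)"
 obtains k :: int where "E x y = of_int k"
 using assms symp_period_hom[OF assms(1)] by blast

text \<open>
  The values \<open>E x y\<close> on the lattice form a group \<open>g \<int>\<close>; by unimodularity \<open>x/g\<close> is still a lattice vector.
\<close>

lemma lattice_content:
 assumes M: "symp M" and x: "x \<in> range (period_hom M)" "x ~= 0"
 obtains g x0 y where "g > 0" "x = g *. x0" "x0 \<in> range (period_hom M)" "y \<in> range (period_hom M)" "E x0 y = 1"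
proof -
 let ?L = "range (period_hom M)"
 define I where "I = {k::int. \<exists>y\<in>?L. E x y = of_int k}"
 have z: "0 \<in> ?L" using lattice_zscale[OF x(1), of 0] by simp
 have I0: "0 \<in> I" unfolding I_def using z by (intro CollectI bexI[of _ 0]) simp_all
 have Id: "a - b \<in> I" if ab: "a \<in> I" "b \<in> I" for a b
 proof -
  obtain y y' where "y \<in> ?L" "E x y = of_int a" "y' \<in> ?L" "E x y' = of_int b" using ab unfolding I_def by blast
  then show ?thesis unfolding I_def using lattice_diff[of y M y'] by (intro CollectI bexI[of _ "y - y'"]) (simp_all add: E_diff_r)
 qed
 obtain g where g: "g \<ge> 0" "g \<in> I" "!!k. k \<in> I ==> g dvd k" using int_subgroup_generator[OF I0 Id] by blast
 have "g ~= 0"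
 proof
  assume g0: "g = 0"
  have "E x y = 0" if y: "y \<in> ?L" for y
  proof -
   obtain k where k: "E x y = of_int k" using lattice_E_int[OF M x(1) y] .
   then have "k \<in> I" unfolding I_def using y by blast
   then show ?thesis using g(3)[of k] g0 k by simp
  qed
  then have "E x y = 0" for y using symp_orthogonal[OF M] by blast
  moreover obtain r where r: "x = rhom M r" using surj_rhom[OF M] by (metis surjD)
  ultimately have "E0 r t = 0" for t using symp_rhom[OF M, of r t] by simp
  then have "r = 0" by (rule E0_nondegenerate)
  then show False using r x(2) by (simp add: rhom_def)
 qed
 then have gp: "g > 0" using g(1) by simp
 define x0 where "x0 = (1 / real_of_int g) *\<^sub>R x"
 have xe: "x = g *. x0" unfolding x0_def using gp by simp
 have "x0 \<in> ?L"
 proof (rule symp_unimodular[OF M])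
  fix y assume y: "y \<in> ?L"
  obtain k where k: "E x y = of_int k" using lattice_E_int[OF M x(1) y] .
  then have "g dvd k" using g(3) y unfolding I_def by blast
  then obtain j where "k = g * j" by blast
  then have "E x0 y = of_int j" unfolding x0_def E_scaleR_l k using gp by simp
  then show "E x0 y \<in> \<int>" by simp
 qed
 moreover obtain y where "y \<in> ?L" "E x y = of_int g" using g(2) unfolding I_def by blast
 moreover have "E x0 y = 1" using calculation(3) gp unfolding x0_def E_scaleR_l by simp
 ultimately show thesis using that gp xe by blast
qed

text \<open>
  After splitting off the plane \<open>\<langle>b1, c1\<rangle>\<close>, the remaining columns are determined by \<open>m2\<close>: it must satisfy
  \<open>E b2 m2 = 1\<close> and \<open>E nu m2 = 0\<close>, and \<open>d m2 - nu\<close> must be a primitive vector. The first two conditions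
  can be met because \<open>b2\<close> and \<open>nu\<close> span a saturated sublattice. For the third, \<open>d m2 - nu = g l0\<close> with
  \<open>l0\<close> primitive and \<open>g\<close> prime to \<open>d\<close>; adding to \<open>m2\<close> the projection of \<open>d x\<close>, where \<open>E l0 x = 1\<close>, to the
  orthogonal complement of the sublattice makes it primitive, by a gcd computation.
\<close>

lemma extend_to_symplectic:
 assumes M0: "symp M0" and d: "d > 0"
  and mem: "b1 \<in> range (period_hom M0)" "b2 \<in> range (period_hom M0)" "c1 \<in> range (period_hom M0)" "nu \<in> range (period_hom M0)"
  and gram: "E b1 b2 = 0" "E b1 c1 = 1" "E b1 nu = 0" "E b2 c1 = 0" "E b2 nu = real d" "E c1 nu = 0"
  and sat: "!!g x. x \<in> range (period_hom M0) ==> g > 0 ==> g *. x \<in> zspan [b1, b2, c1, nu] ==> x \<in> zspan [b1, b2, c1, nu]"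
  and proper: "!!g. g > 0 ==> \<exists>x\<in>range (period_hom M0). g *. x \<notin> zspan [b1, b2, c1, nu]"
 shows "EX m2 m3. symp (mat6 (vec6 b1 b2 (real d *\<^sub>R m2 - nu) c1 m2 m3)) &
  range (period_hom (mat6 (vec6 b1 b2 (real d *\<^sub>R m2 - nu) c1 m2 m3))) = range (period_hom M0)"
proof -
 let ?L = "range (period_hom M0)"
 have sw: "E y x = - c" if "E x y = c" for x y c using that E_anti[of y x] by simp
 note clos = lattice_add lattice_diff lattice_zscale
 note gr = gram gram(1)[THEN sw] gram(2)[THEN sw] gram(3)[THEN sw] gram(4)[THEN sw] gram(5)[THEN sw] gram(6)[THEN sw] E_self
 note bil = E_add_l E_add_r E_diff_l E_diff_r E_scaleR_l E_scaleR_r E_minus_l E_minus_r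
 define f where "f x y = \<lfloor>E x y\<rfloor>" for x y
 have f: "E x y = of_int (f x y)" if "x \<in> ?L" "y \<in> ?L" for x y
  using lattice_E_int[OF M0 that] unfolding f_def by (metis floor_of_int)
 have d0: "real d ~= 0" using d by simp

 have span_nu: "\<exists>k::int. E b2 x = of_int k * real d & (\<exists>j::int. E x nu = of_int j * real d)" if x: "x \<in> zspan [b1, b2, c1, nu]" for x
 proof -
  obtain k1 k2 k3 k4 where "x = k1 *. b1 + k2 *. b2 + k3 *. c1 + k4 *. nu" using x unfolding zspan4 by blast
  then have "E b2 x = of_int k4 * real d" "E x nu = of_int k2 * real d" by (simp_all add: bil gr)
  then show ?thesis by blast
 qed
 have b2ne: "b2 ~= 0" using gram(5) d0 by auto
 obtain x0 where x0: "x0 \<in> ?L" "E b2 x0 = 1"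
 proof -
  obtain g u y where u: "g > 0" "b2 = g *. u" "u \<in> ?L" "y \<in> ?L" "E u y = 1" by (rule lattice_content[OF M0 mem(2) b2ne])
  have "g *. u \<in> zspan [b1, b2, c1, nu]" unfolding u(2)[symmetric] by (rule zspan_mem) simp
  from span_nu[OF sat[OF u(3,1) this]] obtain j :: int where j: "E u nu = of_int j * real d" by blast
  have "real d = of_int (g * j) * real d" using gram(5) unfolding u(2) by (simp add: bil j)
  then have "real_of_int (g * j) = of_int 1" using d0 by simp
  then have "g * j = 1" unfolding of_int_eq_iff .
  then have "g = 1" using u(1) by (simp add: zmult_eq_1_iff)
  then show thesis using that u by simp
 qed
 \<comment> \<open>Subtracting a multiple of \<open>b2\<close> makes \<open>nu\<close> orthogonal to \<open>x0\<close> and keeps \<open>E b2 nu = d\<close>.\<close>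
 define nu' where "nu' = nu - f nu x0 *. b2"
 have nu'L: "nu' \<in> ?L" unfolding nu'_def using mem by (intro clos)
 have b2nu': "E b2 nu' = real d" unfolding nu'_def by (simp add: bil gr)
 have nu'x0: "E nu' x0 = 0" unfolding nu'_def by (simp add: bil x0 f[OF mem(4) x0(1)])
 have "nu' ~= 0" using b2nu' d0 by auto
 then obtain y' where y': "y' \<in> ?L" "E nu' y' = 1"
 proof -
  assume ne: "nu' ~= 0"
  obtain g u y where u: "g > 0" "nu' = g *. u" "u \<in> ?L" "y \<in> ?L" "E u y = 1" by (rule lattice_content[OF M0 nu'L ne])
  have "nu' = 0 *. b1 + (- f nu x0) *. b2 + 0 *. c1 + 1 *. nu" unfolding nu'_def by simp
  then have "nu' \<in> zspan [b1, b2, c1, nu]" unfolding zspan4 by blast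
  then have "g *. u \<in> zspan [b1, b2, c1, nu]" unfolding u(2) .
  from span_nu[OF sat[OF u(3,1) this]] obtain k :: int where k: "E b2 u = of_int k * real d" by blast
  have "real d = of_int (g * k) * real d" using b2nu' unfolding u(2) by (simp add: bil k)
  then have "real_of_int (g * k) = of_int 1" using d0 by simp
  then have "g * k = 1" unfolding of_int_eq_iff .
  then have "g = 1" using u(1) by (simp add: zmult_eq_1_iff)
  then show thesis using that u by simp
 qed
 define y0 where "y0 = y' - f b2 y' *. x0"
 have y0L: "y0 \<in> ?L" unfolding y0_def using y'(1) x0(1) by (intro clos)
 have b2y0: "E b2 y0 = 0" unfolding y0_def by (simp add: bil x0 f[OF mem(2) y'(1)])
 have "E nu' y0 = 1" unfolding y0_def by (simp add: bil y' nu'x0)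
 then have nuy0: "E nu y0 = 1" unfolding nu'_def by (simp add: bil b2y0)
 define x1 where "x1 = x0 - f nu x0 *. y0"
 have x1L: "x1 \<in> ?L" unfolding x1_def using x0(1) y0L by (intro clos)
 have x1: "E b2 x1 = 1" "E nu x1 = 0" unfolding x1_def by (simp_all add: bil x0 b2y0 nuy0 f[OF mem(4) x0(1)])
 define fx where "fx x = x + f c1 x *. b1 - f b1 x *. c1" for x
 have fixL: "fx x \<in> ?L" if "x \<in> ?L" for x unfolding fx_def using that mem by (intro clos)
 have fixE: "E b1 (fx x) = 0" "E c1 (fx x) = 0" "E b2 (fx x) = E b2 x" "E nu (fx x) = E nu x" if "x \<in> ?L" for x
  unfolding fx_def using f[OF mem(1) that] f[OF mem(3) that] by (simp_all add: bil gr)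
 define good where "good m \<longleftrightarrow> m \<in> ?L & E b1 m = 0 & E c1 m = 0 & E b2 m = 1 & E nu m = 0" for m
 have g1: "good (fx x1)" unfolding good_def using fixL[OF x1L] fixE[OF x1L] x1 by simp
 define proj where "proj x = int d *. x - ((- int d * f c1 x) *. b1 + (- f nu x) *. b2 + (int d * f b1 x) *. c1 + f b2 x *. nu)" for x
 have projL: "proj x \<in> ?L" if "x \<in> ?L" for x unfolding proj_def using that mem by (intro clos)
 have projE: "E b1 (proj x) = 0" "E c1 (proj x) = 0" "E b2 (proj x) = 0" "E nu (proj x) = 0" if x: "x \<in> ?L" for x
  unfolding proj_def using f[OF mem(1) x] f[OF mem(2) x] f[OF mem(3) x] f[OF mem(4) x] by (simp_all add: bil gr)
 have good_proj: "good (m + proj x)" if "good m" "x \<in> ?L" for m x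
  using that projL[OF that(2)] projE[OF that(2)] lattice_add unfolding good_def by (simp add: bil)
 \<comment> \<open>If \<open>d m2 - nu\<close> vanishes, any non-zero vector orthogonal to the sublattice repairs this.\<close>
 obtain m where gm: "good m" and l3ne: "int d *. m - nu ~= 0"
 proof (cases "int d *. fx x1 - nu = 0")
  case True
  obtain x where x: "x \<in> ?L" "int d *. x \<notin> zspan [b1, b2, c1, nu]" using proper[of "int d"] d by auto
  have "proj x ~= 0"
  proof
   assume "proj x = 0"
   then have "int d *. x = (- int d * f c1 x) *. b1 + (- f nu x) *. b2 + (int d * f b1 x) *. c1 + f b2 x *. nu"
   unfolding proj_def by (simp only: right_minus_eq)
   then show False using x(2) unfolding zspan4 by blast
  qed
  moreover have "int d *. (fx x1 + proj x) - nu = int d *. proj x" using True by (simp add: scaleR_add_right)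
  ultimately have "int d *. (fx x1 + proj x) - nu ~= 0" using d0 by simp
  with good_proj[OF g1 x(1)] show thesis by (rule that)
 qed (use that g1 in blast)
 define l where "l = int d *. m - nu"
 have mL: "m \<in> ?L" and mE: "E b1 m = 0" "E c1 m = 0" "E b2 m = 1" "E nu m = 0" using gm unfolding good_def by blast+
 have lL: "l \<in> ?L" unfolding l_def using mL mem by (intro clos)
 have lE: "E b1 l = 0" "E c1 l = 0" "E b2 l = 0" "E nu l = 0" unfolding l_def by (simp_all add: bil mE gr)
 have lne: "l ~= 0" using l3ne unfolding l_def .
 obtain g l0 x where g: "g > 0" "l = g *. l0" "l0 \<in> ?L" "x \<in> ?L" "E l0 x = 1" by (rule lattice_content[OF M0 lL lne])
 have l0E: "E b1 l0 = 0" "E c1 l0 = 0" "E b2 l0 = 0" "E nu l0 = 0" using lE g(1) unfolding g(2) by (simp_all add: bil)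
 have cop: "coprime g (int d)"
 proof -
  have "E l y0 = real d * E m y0 - 1" unfolding l_def by (simp add: bil nuy0)
  then have "of_int (g * f l0 y0) = real_of_int (int d * f m y0 - 1)" unfolding g(2) by (simp add: bil f[OF g(3) y0L] f[OF mL y0L])
  then have "g * f l0 y0 = int d * f m y0 - 1" unfolding of_int_eq_iff .
  then have "int d * f m y0 - g * f l0 y0 = 1" by simp
  then show ?thesis by (metis coprime_commute coprimeI dvd_diff dvd_mult2)
 qed
 define k where "k = f (proj x) x"
 have "coprime (g + int d * k) (int d)" using cop by (metis coprime_iff_gcd_eq_1 gcd.commute gcd_add_mult mult.commute add.commute)
 then have "coprime (g + int d * k) (int d * int d)" by simp
 then obtain \<alpha> \<beta> where ab: "\<alpha> * (g + int d * k) + \<beta> * (int d * int d) = 1" by (metis bezout_int coprime_iff_gcd_eq_1)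
 \<comment> \<open>The pairing of \<open>d m2 - nu\<close> with \<open>\<alpha> x - \<beta> l0\<close> becomes the left side of the Bezout identity.\<close>
 define m2 where "m2 = m + proj x"
 have gm2: "good m2" unfolding m2_def by (rule good_proj[OF gm g(4)])
 have m2L: "m2 \<in> ?L" and m2E: "E b1 m2 = 0" "E c1 m2 = 0" "E b2 m2 = 1" "E nu m2 = 0" using gm2 unfolding good_def by blast+
 define l3 where "l3 = real d *\<^sub>R m2 - nu"
 have l3e: "l3 = g *. l0 + int d *. proj x" unfolding l3_def m2_def g(2)[symmetric] l_def by (simp add: scaleR_add_right)
 have l3L: "l3 \<in> ?L" unfolding l3e using g(3) projL[OF g(4)] by (intro clos)
 have l3E: "E b1 l3 = 0" "E c1 l3 = 0" "E b2 l3 = 0" "E nu l3 = 0" unfolding l3_def by (simp_all add: bil m2E gr)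
 have l3m2: "E l3 m2 = 0" unfolding l3_def by (simp add: bil m2E gr)
 have l3m2': "E m2 l3 = 0" using sw[OF l3m2] by simp
 define y where "y = \<alpha> *. x - \<beta> *. l0"
 have yL: "y \<in> ?L" unfolding y_def using g(3,4) by (intro clos)
 have pl0: "E (proj x) l0 = real d * E x l0" unfolding proj_def by (simp add: bil l0E)
 have pl0': "E (proj x) l0 = - real d" unfolding pl0 using sw[OF g(5)] by simp
 have pxx: "E (proj x) x = of_int k" unfolding k_def using f[OF projL[OF g(4)] g(4)] .
 have "E l3 y = of_int (\<alpha> * (g + int d * k) + \<beta> * (int d * int d))" unfolding l3e y_def
  by (simp add: bil pl0' pxx g(5) E_self algebra_simps)
 then have l3y: "E l3 y = 1" unfolding ab by simp
 define y2 where "y2 = fx y"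
 have y2L: "y2 \<in> ?L" unfolding y2_def by (rule fixL[OF yL])
 have y2E: "E b1 y2 = 0" "E c1 y2 = 0" unfolding y2_def using fixE[OF yL] by simp_all
 have l3y2: "E l3 y2 = 1" unfolding y2_def fx_def using l3E[THEN sw] by (simp add: bil l3y)
 define m3 where "m3 = y2 + f m2 y2 *. b2 - f b2 y2 *. m2"
 have m3L: "m3 \<in> ?L" unfolding m3_def using y2L mem m2L by (intro clos)
 have m3E: "E b1 m3 = 0" "E c1 m3 = 0" "E b2 m3 = 0" "E m2 m3 = 0" "E l3 m3 = 1"
  unfolding m3_def using f[OF mem(2) y2L] f[OF m2L y2L] l3E[THEN sw] l3m2 m2E[THEN sw]
  by (simp_all add: bil y2E m2E gr l3y2 E_self)
 have sy: "symp (mat6 (vec6 b1 b2 l3 c1 m2 m3))"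
  by (rule sympI_gram) (use gr m2E m3E l3E l3E[THEN sw] l3m2 in simp_all)
 have inL: "v \<in> ?L" if v: "v \<in> range (period_hom (mat6 (vec6 b1 b2 l3 c1 m2 m3)))" for v
 proof -
  obtain n where "v = period_hom (mat6 (vec6 b1 b2 l3 c1 m2 m3)) n" using v by blast
  then have ve: "v = n $ 1 *. b1 + n $ 2 *. b2 + n $ 3 *. l3 + n $ 4 *. c1 + n $ 5 *. m2 + n $ 6 *. m3"
   by (simp add: period_hom_6)
  show ?thesis unfolding ve by (intro clos mem m2L m3L l3L)
 qed
 have "v \<in> range (period_hom (mat6 (vec6 b1 b2 l3 c1 m2 m3)))" if v: "v \<in> ?L" for v
 proof (rule symp_unimodular[OF sy])
  fix w assume "w \<in> range (period_hom (mat6 (vec6 b1 b2 l3 c1 m2 m3)))"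
  then show "E v w \<in> \<int>" using f[OF v inL] by simp
 qed
 then have "range (period_hom (mat6 (vec6 b1 b2 l3 c1 m2 m3))) = ?L" using inL by blast
 then show ?thesis using sy unfolding l3_def by blast
qed

end

section \<open>Markings of the sublattice by an ideal\<close>

text \<open>
  The condition on the lattice of \<open>S\<close> that defines the locus of \<open>\<aa>\<close>.
\<close>

definition ideal_marking :: "nat => real set => rm_threefold => (real \<times> real => complex ^ 3) => bool" where
 "ideal_marking D \<aa> X g \<longleftrightarrow> bij_betw g (quad_order D \<times> (%x. x / sqrt D) ` \<aa>) (sub X Int lat X) &
   (\<forall>u \<in> quad_order D \<times> (%x. x / sqrt D) ` \<aa>. \<forall>v \<in> quad_order D \<times> (%x. x / sqrt D) ` \<aa>.
   g (u + v) = g u + g v & Im (pol X (g u) (g v)) = trace_pairing D u v) &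
   (\<forall>k\<in>quad_order D. \<forall>u \<in> quad_order D \<times> (%x. x / sqrt D) ` \<aa>.
   g (k * fst u, k * snd u) = act X k (g u))"

lemma ideal_locus_eq:
 "ideal_locus D d \<aa> = rm_class D d ` {X. is_rm_threefold D d X & (EX g. ideal_marking D \<aa> X g)}"
 unfolding ideal_locus_def ideal_marking_def ..

lemma vec_linear_iff:
 "Vector_Spaces.linear (*s) (*s) f \<longleftrightarrow> (ALL x y. f (x + y) = f x + f y) & (ALL c x. f (c *s x) = c *s f (x :: complex ^ 'n))"
 unfolding Vector_Spaces.linear_def module_hom_def module_hom_axioms_def
 by (auto intro: vec.vector_space_axioms vec.module_axioms)

lemma rm_isomorphic_iff:
 "rm_isomorphic D X Y \<longleftrightarrow> (EX f. (ALL x y. f (x + y) = f x + f y) & (ALL c x. f (c *s x) = c *s f x) & bij f & f ` lat X = lat Y &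
   (ALL x y. pol Y (f x) (f y) = pol X x y) & f ` sub X = sub Y &
   (\<forall>k\<in>quad_order D. \<forall>x\<in>sub X. f (act X k x) = act Y k (f x)))"
 unfolding rm_isomorphic_def vec_linear_iff by (simp add: conj_assoc)

lemma rm_isomorphic_refl: "rm_isomorphic D X X"
 unfolding rm_isomorphic_iff by (rule exI[of _ id]) simp

lemma rm_isomorphic_trans:
 assumes "rm_isomorphic D X Y" "rm_isomorphic D Y Z" shows "rm_isomorphic D X Z"
proof -
 obtain f where f: "ALL x y. f (x + y) = f x + f y" "ALL c x. f (c *s x) = c *s f x" "bij f" "f ` lat X = lat Y"
  "ALL x y. pol Y (f x) (f y) = pol X x y" "f ` sub X = sub Y" "\<forall>k\<in>quad_order D. \<forall>x\<in>sub X. f (act X k x) = act Y k (f x)"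
  using assms(1) unfolding rm_isomorphic_iff by (elim exE conjE)
 obtain g where g: "ALL x y. g (x + y) = g x + g y" "ALL c x. g (c *s x) = c *s g x" "bij g" "g ` lat Y = lat Z"
  "ALL x y. pol Z (g x) (g y) = pol Y x y" "g ` sub Y = sub Z" "\<forall>k\<in>quad_order D. \<forall>x\<in>sub Y. g (act Y k x) = act Z k (g x)"
  using assms(2) unfolding rm_isomorphic_iff by (elim exE conjE)
 show ?thesis unfolding rm_isomorphic_iff
 proof (intro exI[of _ "g \<circ> f"] conjI ballI)
  show "bij (g \<circ> f)" using f(3) g(3) by (rule bij_comp)
  show "(g \<circ> f) ` lat X = lat Z" "(g \<circ> f) ` sub X = sub Z" unfolding image_comp[symmetric] f g by (rule refl)+
  fix k x assume "k \<in> quad_order D" "x \<in> sub X"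
  moreover have "f x \<in> sub Y" using f(6) calculation(2) by blast
  ultimately show "(g \<circ> f) (act X k x) = act Z k ((g \<circ> f) x)" using f(7) g(7) by simp
 qed (use f g in simp_all)
qed

lemma rm_isomorphic_sym:
 assumes "rm_isomorphic D X Y" shows "rm_isomorphic D Y X"
proof -
 obtain f where f: "ALL x y. f (x + y) = f x + f y" "ALL c x. f (c *s x) = c *s f x" "bij f" "f ` lat X = lat Y"
  "ALL x y. pol Y (f x) (f y) = pol X x y" "f ` sub X = sub Y" "\<forall>k\<in>quad_order D. \<forall>x\<in>sub X. f (act X k x) = act Y k (f x)"
  using assms(1) unfolding rm_isomorphic_iff by (elim exE conjE)
 define h where "h = inv_into UNIV f"
 have fh: "f (h x) = x" for x unfolding h_def by (rule surj_f_inv_f[OF bij_is_surj[OF f(3)]])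
 have hf: "h (f x) = x" for x unfolding h_def by (rule inv_f_f[OF bij_is_inj[OF f(3)]])
 have eqI: "x = y" if e: "f x = f y" for x y by (rule injD[OF bij_is_inj[OF f(3)] e])
 show ?thesis unfolding rm_isomorphic_iff
 proof (intro exI[of _ h] conjI ballI allI)
  show "bij h" unfolding h_def using f(3) by (rule bij_imp_bij_inv)
  show "h (x + y) = h x + h y" for x y by (rule eqI) (simp add: fh f)
  show "h (c *s x) = c *s h x" for c x by (rule eqI) (simp add: fh f)
  show "pol X (h x) (h y) = pol Y x y" for x y using f(5)[rule_format, of "h x" "h y"] by (simp add: fh)
  show "h ` lat Y = lat X" "h ` sub Y = sub X" unfolding f(4,6)[symmetric] image_image hf by simp_all
  fix k x assume k: "k \<in> quad_order D" and "x \<in> sub Y"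
  then obtain y where y: "y \<in> sub X" "x = f y" using f(6) by blast
  show "h (act Y k x) = act X k (h x)" unfolding y(2) f(7)[rule_format, OF k y(1), symmetric] hf ..
 qed
qed

lemma rm_class_eq_iff:
 assumes "is_rm_threefold D d X" "is_rm_threefold D d Y"
 shows "rm_class D d X = rm_class D d Y \<longleftrightarrow> rm_isomorphic D X Y"
proof
 assume "rm_class D d X = rm_class D d Y"
 moreover have "Y \<in> rm_class D d Y" unfolding rm_class_def using assms rm_isomorphic_refl by simp
 ultimately show "rm_isomorphic D X Y" unfolding rm_class_def by auto
next
 assume "rm_isomorphic D X Y"
 then show "rm_class D d X = rm_class D d Y" unfolding rm_class_def
  using rm_isomorphic_trans rm_isomorphic_sym by blast
qed

lemma ideal_marking_isomorphic:
 assumes "rm_isomorphic D X Y" "ideal_marking D \<aa> X g" and sub: "!!u. u \<in> quad_order D \<times> (%x. x / sqrt D) ` \<aa> ==> g u \<in> sub X"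
 shows "EX g'. ideal_marking D \<aa> Y g'"
proof -
 obtain f where f: "ALL x y. f (x + y) = f x + f y" "ALL c x. f (c *s x) = c *s f x" "bij f" "f ` lat X = lat Y"
  "ALL x y. pol Y (f x) (f y) = pol X x y" "f ` sub X = sub Y" "\<forall>k\<in>quad_order D. \<forall>x\<in>sub X. f (act X k x) = act Y k (f x)"
  using assms(1) unfolding rm_isomorphic_iff by (elim exE conjE)
 have "f ` (sub X Int lat X) = sub Y Int lat Y" using f(3,4,6) by (simp add: bij_is_inj image_Int)
 then have "bij_betw f (sub X Int lat X) (sub Y Int lat Y)" using f(3) unfolding bij_betw_def bij_def
  by (auto intro: inj_on_subset)
 then have "bij_betw (f \<circ> g) (quad_order D \<times> (%x. x / sqrt D) ` \<aa>) (sub Y Int lat Y)"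
  using assms(2) unfolding ideal_marking_def by (blast intro: bij_betw_trans)
 moreover have "(f \<circ> g) (u + v) = (f \<circ> g) u + (f \<circ> g) v & Im (pol Y ((f \<circ> g) u) ((f \<circ> g) v)) = trace_pairing D u v"
  if "u \<in> quad_order D \<times> (%x. x / sqrt D) ` \<aa>" "v \<in> quad_order D \<times> (%x. x / sqrt D) ` \<aa>" for u v
 proof -
  have "g (u + v) = g u + g v & Im (pol X (g u) (g v)) = trace_pairing D u v"
   using assms(2) that unfolding ideal_marking_def by blast
  then show ?thesis using f(1,5) by simp
 qed
 moreover have "(f \<circ> g) (k * fst u, k * snd u) = act Y k ((f \<circ> g) u)"
  if "k \<in> quad_order D" "u \<in> quad_order D \<times> (%x. x / sqrt D) ` \<aa>" for k u
 proof -
  have "g (k * fst u, k * snd u) = act X k (g u)" using assms(2) that unfolding ideal_marking_def by blast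
  then show ?thesis using f(7) that(1) sub[OF that(2)] by simp
 qed
 ultimately show ?thesis unfolding ideal_marking_def by blast
qed

lemma ideal_locus_iff:
 assumes X: "is_rm_threefold D d X"
 shows "rm_class D d X \<in> ideal_locus D d \<aa> \<longleftrightarrow> (EX g. ideal_marking D \<aa> X g)"
proof
 assume "rm_class D d X \<in> ideal_locus D d \<aa>"
 then obtain Y g where Y: "is_rm_threefold D d Y" "rm_class D d X = rm_class D d Y" "ideal_marking D \<aa> Y g"
  unfolding ideal_locus_eq by blast
 then have "rm_isomorphic D Y X" using rm_class_eq_iff[OF X Y(1)] rm_isomorphic_sym by blast
 then show "EX g. ideal_marking D \<aa> X g"
 proof (rule ideal_marking_isomorphic[OF _ Y(3)])
  fix u assume "u \<in> quad_order D \<times> (%x. x / sqrt D) ` \<aa>"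
  then show "g u \<in> sub Y" using Y(3) bij_betwE unfolding ideal_marking_def by blast
 qed
next
 assume "EX g. ideal_marking D \<aa> X g"
 then show "rm_class D d X \<in> ideal_locus D d \<aa>" unfolding ideal_locus_eq using X by blast
qed

locale rm3 = real_quadratic D for D :: nat +
 fixes d :: nat and X :: rm_threefold
 assumes X: "is_rm_threefold D d X"
begin

lemma pol_herm: "hermitian (pol X)" and pol_pos: "x ~= 0 ==> Re (pol X x x) > 0"
 and sub_subspace: "vec.subspace (sub X)" and sub_dim: "vec.dim (sub X) = 2"
 and sub_type: "has_type (pol X) (sub X Int lat X) [1, d]"
 and lat_type: "has_type (pol X) (lat X) [1, 1, 1]"
 and rm_X: "real_multiplication D (sub X) (sub X Int lat X) (pol X) (act X)"
 using X unfolding is_rm_threefold_def polarization_def by blast+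

end

sublocale rm3 \<subseteq> hermitian3 "pol X" by unfold_locales (rule pol_herm)
sublocale rm3 \<subseteq> rm_lattice D "pol X" "sub X" "sub X Int lat X" "act X"
 by unfold_locales (auto simp: sub_subspace rm_X)

context rm3
begin

lemma d_gt_0: "d > 0" using sub_type unfolding has_type_def by simp

lemma symp_lat: obtains M0 where "symp M0" "lat X = range (period_hom M0)"
proof -
 obtain ls ms where lm: "symplectic_basis (pol X) (lat X) [1, 1, 1] ls ms" using lat_type unfolding has_type_def by blast
 then have "length ls = 3" "length ms = 3" unfolding symplectic_basis_def by simp_all
 then obtain b1 b2 b3 c1 c2 c3 where b: "ls = [b1, b2, b3]" "ms = [c1, c2, c3]"
  by (auto simp: length_Suc_conv eval_nat_numeral)
 from lm[unfolded b symplectic_basis3_iff] show thesis by (intro that[of "mat6 (vec6 b1 b2 b3 c1 c2 c3)"]) (elim conjE, assumption)+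
qed

text \<open>
  The basis found in \<open>rm_lattice_structure\<close> has the multiplication table of \<open>\<O>\<^sub>D \<oplus> \<aa>/\<surd>D\<close>, so the
  correspondence of bases is equivariant.
\<close>

lemma ideal_marking_exists: "\<exists>\<aa>\<in>primitive_ideals D d. EX g. ideal_marking D \<aa> X g"
proof -
 from rm_lattice_structure[OF sub_type d_gt_0] obtain \<aa> \<eta> u w M1 M2 p a c
  where aa: "\<aa> \<in> primitive_ideals D d" and sb: "smart_basis D d \<aa> 1 \<eta>" and lat: "sub X Int lat X = zspan [u, w, M1, M2]"
   and gram: "E u w = 0" "E u M1 = 1" "E u M2 = 0" "E w M1 = 0" "E w M2 = real d" "E M1 M2 = 0"
   and om: "om = of_int p + \<eta>" "om * \<eta> = of_int a * \<eta> + of_int (int d * c)"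
   "om * cj \<eta> = of_int p * cj \<eta> - of_int (int d * c)" "om * real d = of_int a * real d - real d * cj \<eta>"
   and Tb: "T u = p *. u + w" "T w = a *. w + (int d * c) *. u" "T M1 = p *. M1 + c *. M2" "T M2 = a *. M2 + real d *\<^sub>R M1"
  by (elim bexE exE conjE)
 interpret sm: smart D d \<aa> 1 \<eta> by unfold_locales (use d_gt_0 aa sb in simp_all)
 have sw: "E y x = - c" if "E x y = c" for x y c using E_anti[of y x] that by simp
 note gr = gram gram[THEN sw] E_self
 note bil = E_add_l E_add_r E_scaleR_l E_scaleR_r
 have mem: "u \<in> sub X" "w \<in> sub X" "M1 \<in> sub X" "M2 \<in> sub X" using lat zspan_mem[of _ "[u, w, M1, M2]"] by auto
 define G where "G a b m n = a *. u + b *. w + m *. M1 + n *. M2" for a b m n :: int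
 define V where "V a b m n = (sm.kk a b, sm.ll m (int d * n))" for a b m n :: int
 have V_inj: "a = a' & b = b' & m = m' & n = n'" if e: "V a b m n = V a' b' m' n'" for a b m n a' b' m' n'
  using e sm.kk_inj[of a b a' b'] sm.ll_inj[of m "int d * n" m' "int d * n'"] d_gt_0 unfolding V_def by simp
 have G_inj: "a = a' & b = b' & m = m' & n = n'" if e: "G a b m n = G a' b' m' n'" for a b m n a' b' m' n'
 proof -
  have "E (G a b m n) x = E (G a' b' m' n') x" for x using e by simp
  from this[of M1] this[of M2] this[of u] this[of w] show ?thesis
   unfolding G_def using d_gt_0 by (simp add: bil gr)
 qed
 let ?dom = "Od \<times> (%x. x / s) ` \<aa>"
 have V_dom: "V a b m n \<in> ?dom" for a b m n unfolding V_def using sm.ll_mem_iff[of m "int d * n"] by (simp add: sm.kk_def)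
 have dom: "EX a b m n. v = V a b m n" if v: "v \<in> ?dom" for v
 proof -
  obtain x y where xy: "v = (x, y)" "x \<in> Od" "y \<in> (%x. x / s) ` \<aa>" using v by blast
  then show ?thesis unfolding V_def using sm.kk_surj[OF xy(2)] sm.ll_surj[OF xy(3)] by auto
 qed
 define g where "g v = (THE y. EX a b m n. v = V a b m n & y = G a b m n)" for v
 have gV: "g (V a b m n) = G a b m n" for a b m n unfolding g_def
  by (rule the_equality) (use V_inj in blast)+
 have V_add: "V a b m n + V a' b' m' n' = V (a + a') (b + b') (m + m') (n + n')" for a b m n a' b' m' n'
  unfolding V_def by (simp add: sm.kk_add sm.ll_add distrib_left)
 have G_add: "G a b m n + G a' b' m' n' = G (a + a') (b + b') (m + m') (n + n')" for a b m n a' b' m' n'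
  unfolding G_def by (simp add: scaleR_add_left)
 have om_V: "(om * fst (V x y m n), om * snd (V x y m n)) = V (p * x + int d * c * y) (x + a * y) (p * m + int d * n) (c * m + a * n)" for x y m n
 proof -
  have 1: "om * sm.kk x y = sm.kk (p * x + int d * c * y) (x + a * y)"
  proof -
   have "om * sm.kk x y = of_int x * om + of_int y * (om * \<eta>)" unfolding sm.kk_def by (simp add: algebra_simps)
   also have "\<dots> = of_int x * (of_int p + \<eta>) + of_int y * (of_int a * \<eta> + of_int (int d * c))" unfolding om(2) unfolding om(1) ..
   finally show ?thesis unfolding sm.kk_def by (simp add: algebra_simps)
  qed
  have "s * (om * sm.ll m (int d * n)) = om * (s * sm.ll m (int d * n))" by simp
  also have "\<dots> = of_int m * (om * cj \<eta>) - of_int n * (om * real d)" unfolding sm.s_ll by (simp add: algebra_simps)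
  also have "\<dots> = s * sm.ll (p * m + int d * n) (int d * (c * m + a * n))" unfolding om(3,4) sm.s_ll by (simp add: algebra_simps)
  finally have "om * sm.ll m (int d * n) = sm.ll (p * m + int d * n) (int d * (c * m + a * n))" using s_ne by simp
  then show ?thesis unfolding V_def fst_conv snd_conv 1 by simp
 qed
 have T_G: "T (G x y m n) = G (p * x + int d * c * y) (x + a * y) (p * m + int d * n) (c * m + a * n)" for x y m n
 proof -
  have "T (G x y m n) = x *. T u + y *. T w + m *. T M1 + n *. T M2" unfolding G_def using mem W_add W_scaleR
   by (simp add: T_add T_scaleR)
  then show ?thesis unfolding Tb G_def by (simp add: scaleR_add_left scaleR_add_right mult_ac)
 qed
 have "ideal_marking D \<aa> X g" unfolding ideal_marking_def
 proof (intro conjI ballI)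
  show "bij_betw g ?dom (sub X Int lat X)" unfolding bij_betw_def
  proof
   show "inj_on g ?dom"
   proof (rule inj_onI)
   fix v v' assume v: "v \<in> ?dom" "v' \<in> ?dom" "g v = g v'"
   obtain a b m n a' b' m' n' where e: "v = V a b m n" "v' = V a' b' m' n'" using dom[OF v(1)] dom[OF v(2)] by blast
   from v(3) have "G a b m n = G a' b' m' n'" unfolding e gV .
   from G_inj[OF this] show "v = v'" unfolding e by simp
   qed
   show "g ` ?dom = sub X Int lat X"
   proof (intro equalityI subsetI)
   fix x assume "x \<in> g ` ?dom"
   then obtain v where v: "v \<in> ?dom" "x = g v" by blast
   obtain a b m n where e: "v = V a b m n" using dom[OF v(1)] by blast
   have "x = G a b m n" unfolding v(2) e gV ..
   then show "x \<in> sub X Int lat X" unfolding lat zspan4 G_def by blast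
   next
   fix x assume "x \<in> sub X Int lat X"
   then obtain a b m n where "x = G a b m n" unfolding lat zspan4 G_def by blast
   then have "x = g (V a b m n)" unfolding gV .
   then show "x \<in> g ` ?dom" using V_dom by blast
   qed
  qed
 next
  fix v v' assume v: "v \<in> ?dom" "v' \<in> ?dom"
  obtain a b m n a' b' m' n' where e: "v = V a b m n" "v' = V a' b' m' n'" using dom[OF v(1)] dom[OF v(2)] by blast
  show "g (v + v') = g v + g v'" unfolding e V_add gV G_add ..
  have "E (G a b m n) (G a' b' m' n') = of_int (a * m' + b * (int d * n') - a' * m - b' * (int d * n))"
   unfolding G_def by (simp add: bil gr)
  also have "\<dots> = trace_pairing D v v'" unfolding e V_def sm.trace_pairing_kk_ll ..
  finally show "Im (pol X (g v) (g v')) = trace_pairing D v v'" unfolding E_def e gV .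
 next
  fix k v assume k: "k \<in> Od" and v: "v \<in> ?dom"
  obtain x y m n where e: "v = V x y m n" using dom[OF v] by blast
  obtain i j where kij: "k = of_int i + of_int j * om" using k by (rule Od_cases)
  have sc: "(of_int i * fst (V x y m n), of_int i * snd (V x y m n)) = V (i * x) (i * y) (i * m) (i * n)" for i x y m n
   unfolding V_def by (simp add: sm.kk_def sm.ll_def algebra_simps)
  have scG: "i *. G x y m n = G (i * x) (i * y) (i * m) (i * n)" for i x y m n
   unfolding G_def by (simp add: scaleR_add_right)
  define q where "q = V (p * x + int d * c * y) (x + a * y) (p * m + int d * n) (c * m + a * n)"
  have q: "om * fst (V x y m n) = fst q" "om * snd (V x y m n) = snd q" unfolding q_def using om_V[of x y m n] by (metis fst_conv snd_conv)+
  have "(k * fst v, k * snd v) = (of_int i * fst (V x y m n), of_int i * snd (V x y m n)) + (of_int j * fst q, of_int j * snd q)"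
   unfolding q[symmetric] kij e by (simp add: algebra_simps)
  then have "g (k * fst v, k * snd v) = i *. G x y m n + j *. T (G x y m n)"
   unfolding q_def sc V_add gV T_G scG G_add by (simp add: gV)
  also have "\<dots> = act X k (G x y m n)" unfolding kij
   by (rule rho_coords[symmetric]) (use mem W_add W_scaleR in \<open>simp add: G_def\<close>)
  finally show "g (k * fst v, k * snd v) = act X k (g v)" unfolding e gV .
 qed
 then show ?thesis using aa by blast
qed

end

locale marked3 = rm3 D d X + smart D d \<aa> \<eta>1 \<eta>2
 for D d :: nat and X \<aa> \<eta>1 \<eta>2 +
 fixes g :: "real \<times> real => complex ^ 3"
 assumes mark: "ideal_marking D \<aa> X g"
begin

abbreviation dom where "dom \<equiv> Od \<times> (%x. x / s) ` \<aa>"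

lemma g_bij: "bij_betw g dom (sub X Int lat X)" 
 and g_add: "u \<in> dom ==> v \<in> dom ==> g (u + v) = g u + g v"
 and g_E: "u \<in> dom ==> v \<in> dom ==> E (g u) (g v) = trace_pairing D u v"
 and g_act: "k \<in> Od ==> u \<in> dom ==> g (k * fst u, k * snd u) = act X k (g u)"
 using mark unfolding ideal_marking_def E_def by blast+

lemma g_mem: "u \<in> dom ==> g u \<in> sub X" "u \<in> dom ==> g u \<in> lat X"
 using bij_betwE[OF g_bij] by blast+

lemma g_int: assumes "u \<in> dom" shows "g (of_int k * fst u, of_int k * snd u) = k *. g u"
 using g_act[of "of_int k" u] rho_int[OF g_mem(1)[OF assms]] assms by simp

definition G where "G a b m n = g (kk a b, ll m (int d * n))"

lemma G_dom: "(kk a b, ll m (int d * n)) \<in> dom"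
 using ll_mem_iff[of m "int d * n"] by (simp add: kk_def)

lemma G_surj: assumes "x \<in> sub X Int lat X" obtains a b m n where "x = G a b m n"
proof -
 obtain v where v: "v \<in> dom" "x = g v" using g_bij assms unfolding bij_betw_def by blast
 obtain p q where pq: "v = (p, q)" "p \<in> Od" "q \<in> (%x. x / s) ` \<aa>" using v(1) by blast
 obtain a b where 1: "p = kk a b" using kk_surj[OF pq(2)] by blast
 obtain m n where 2: "q = ll m (int d * n)" using ll_surj[OF pq(3)] by blast
 show thesis by (rule that[of a b m n]) (simp add: v(2) pq(1) 1 2 G_def)
qed

lemma G_add: "G a b m n + G a' b' m' n' = G (a + a') (b + b') (m + m') (n + n')"
 using g_add[OF G_dom[of a b m n] G_dom[of a' b' m' n']] unfolding G_def by (simp add: kk_add ll_add distrib_left)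

lemma G_scale: "k *. G a b m n = G (k * a) (k * b) (k * m) (k * n)"
proof -
 have "(of_int k * kk a b, of_int k * ll m (int d * n)) = (kk (k * a) (k * b), ll (k * m) (int d * (k * n)))"
  by (simp add: kk_def ll_def algebra_simps)
 then show ?thesis using g_int[OF G_dom[of a b m n], of k] unfolding G_def by simp
qed

lemma G_E: "E (G a b m n) (G a' b' m' n') = of_int (a * m' + b * (int d * n') - a' * m - b' * (int d * n))"
 unfolding G_def g_E[OF G_dom G_dom] trace_pairing_kk_ll ..

lemma G_basis: "G a b m n = a *. G 1 0 0 0 + b *. G 0 1 0 0 + m *. G 0 0 1 0 + n *. G 0 0 0 1"
 by (simp add: G_scale G_add)

lemma G_span: "sub X Int lat X = zspan [G 1 0 0 0, G 0 1 0 0, G 0 0 1 0, G 0 0 0 1]"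
proof -
 have "G a b m n \<in> sub X Int lat X" for a b m n unfolding G_def using g_mem[OF G_dom] by blast
 moreover have "EX a b m n. x = G a b m n" if "x \<in> sub X Int lat X" for x using G_surj[OF that] by metis
 ultimately show ?thesis unfolding zspan4 G_basis[symmetric] by blast
qed

text \<open>
  Intrinsic description of the ideal: it consists of the \<open>k\<close> that map the radical of the polarization
  modulo \<open>d\<close> into \<open>d\<close> times the lattice.
\<close>

lemma ideal_recovered:
 assumes k: "k \<in> Od"
 shows "k \<in> \<aa> \<longleftrightarrow> (\<forall>x\<in>sub X Int lat X. (\<forall>y\<in>sub X Int lat X. \<exists>j::int. E x y = of_int j * real d) -->
  (\<exists>y\<in>sub X Int lat X. act X k x = real d *\<^sub>R y))" (is "_ \<longleftrightarrow> ?R")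
proof
 have d0: "real d ~= 0" using d_pos by simp
 have zs: "real d *\<^sub>R x = int d *. x" for x :: "complex ^ 3" by simp
 have Gmem: "G a b m n \<in> sub X Int lat X" for a b m n unfolding G_def using g_mem[OF G_dom] by blast
 {
  assume ka: "k \<in> \<aa>"
  show ?R
  proof (intro ballI impI)
   fix x assume x: "x \<in> sub X Int lat X" and R: "\<forall>y\<in>sub X Int lat X. \<exists>j::int. E x y = of_int j * real d"
   obtain a b m n where xe: "x = G a b m n" using x by (rule G_surj)
   obtain a' where "E x (G 0 0 1 0) = of_int a' * real d" using R Gmem by blast
   then have "real_of_int a = of_int (a' * int d)" unfolding xe G_E by simp
   then have a: "a = a' * int d" unfolding of_int_eq_iff .
   obtain m' where "E x (G 1 0 0 0) = of_int m' * real d" using R Gmem by blast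
   then have "real_of_int (- m) = of_int (m' * int d)" unfolding xe G_E by simp
   then have "- m = m' * int d" unfolding of_int_eq_iff .
   then have m: "m = - m' * int d" by simp
   have "\<eta>2 * k \<in> (%y. real d * y) ` Od" using eta2_mult_in_d[OF k] ka by simp
   then obtain e where e: "e \<in> Od" "\<eta>2 * k = real d * e" by blast
   define v where "v = (k * (of_int a' * \<eta>1) + of_int b * e, k * (of_int (- m') * cj \<eta>2 - of_int n * cj \<eta>1) / s)"
   have vd: "v \<in> dom"
   proof -
   have "k * (of_int (- m') * cj \<eta>2 - of_int n * cj \<eta>1) \<in> \<aa>" using ka by (rule RR_ideal_closed(6)[OF idl]) simp
   then have 2: "k * (of_int (- m') * cj \<eta>2 - of_int n * cj \<eta>1) / s \<in> (%x. x / s) ` \<aa>" by (rule imageI)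
   have 1: "k * (of_int a' * \<eta>1) + of_int b * e \<in> Od" using k e(1) by simp
   show ?thesis unfolding v_def by (rule SigmaI[OF 1 2])
   qed
   have "(of_int (int d) * fst v, of_int (int d) * snd v) = (k * kk a b, k * ll m (int d * n))"
   unfolding v_def kk_def ll_def a m by (simp add: algebra_simps) (simp add: e(2) mult.commute[of e])
   then have "act X k x = int d *. g v" using g_int[OF vd, of "int d"] g_act[OF k G_dom[of a b m n]] unfolding xe G_def by simp
   then show "\<exists>y\<in>sub X Int lat X. act X k x = real d *\<^sub>R y" unfolding zs using g_mem[OF vd] by blast
  qed
 }
 assume R: ?R
 have "\<exists>j::int. E (G 0 1 0 0) y = of_int j * real d" if y: "y \<in> sub X Int lat X" for y
  by (rule G_surj[OF y]) (auto simp: G_E)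
 then obtain y where y: "y \<in> sub X Int lat X" "act X k (G 0 1 0 0) = real d *\<^sub>R y" using R Gmem by blast
 obtain v where v: "v \<in> dom" "y = g v" using g_bij y(1) unfolding bij_betw_def by blast
 have e: "(kk 0 1, ll 0 (int d * 0)) = (\<eta>2, 0)" unfolding kk_def ll_def by simp
 have ed: "(\<eta>2, 0) \<in> dom" using G_dom[of 0 1 0 0] unfolding e .
 have "g (k * \<eta>2, k * 0) = g (of_int (int d) * fst v, of_int (int d) * snd v)"
  using g_act[OF k ed] y(2) g_int[OF v(1), of "int d"] unfolding G_def e v(2) by simp
 moreover have "(k * \<eta>2, k * 0) \<in> dom" using k ed by auto
 moreover have "(of_int (int d) * fst v, of_int (int d) * snd v) \<in> dom"
 proof -
  have v1: "fst v \<in> Od" "snd v \<in> (%x. x / s) ` \<aa>" using v(1) by (simp_all add: mem_Times_iff)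
  have "of_int (int d) * snd v \<in> (%x. x / s) ` \<aa>" by (rule ideal_image_Od[OF v1(2)]) simp
  moreover have "of_int (int d) * fst v \<in> Od" using v1(1) by simp
  ultimately show ?thesis by (simp only: mem_Times_iff fst_conv snd_conv)
 qed
 ultimately have "k * \<eta>2 = real d * fst v" using g_bij unfolding bij_betw_def by (auto dest: inj_onD)
 moreover have "fst v \<in> Od" using v(1) by auto
 ultimately have "\<eta>2 * k \<in> (%y. real d * y) ` Od"
  by (intro image_eqI[of _ _ "fst v"]) (simp_all only: mult.commute[of \<eta>2 k])
 then show "k \<in> \<aa>" using eta2_mult_in_d[OF k] by simp
qed

lemma standard_marking: "EX M. is_period_matrix D E0 L0 R0 X M"
proof -
 obtain M0 where M0: "symp M0" "lat X = range (period_hom M0)" by (rule symp_lat)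
 have Gm: "G a b m n \<in> range (period_hom M0)" for a b m n using g_mem(2)[OF G_dom] unfolding M0(2) G_def .
 have sat: "x \<in> zspan [G 1 0 0 0, G 0 1 0 0, G 0 0 1 0, G 0 0 0 1]"
  if x: "x \<in> range (period_hom M0)" "k > 0" "k *. x \<in> zspan [G 1 0 0 0, G 0 1 0 0, G 0 0 1 0, G 0 0 0 1]" for k x
 proof -
  have "k *. x \<in> sub X" using x(3) unfolding G_span[symmetric] by blast
  then have "(1 / real_of_int k) *\<^sub>R (k *. x) \<in> sub X" by (rule W_scaleR)
  then have "x \<in> sub X" using x(2) by simp
  then show ?thesis unfolding G_span[symmetric] M0(2) using x(1) by blast
 qed
 have proper: "\<exists>x\<in>range (period_hom M0). k *. x \<notin> zspan [G 1 0 0 0, G 0 1 0 0, G 0 0 1 0, G 0 0 0 1]" if k: "k > 0" for k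
 proof (rule ccontr)
  assume "~ ?thesis"
  then have "k *. x \<in> zspan [G 1 0 0 0, G 0 1 0 0, G 0 0 1 0, G 0 0 0 1]" if "x \<in> range (period_hom M0)" for x using that by blast
  then have "x \<in> zspan [G 1 0 0 0, G 0 1 0 0, G 0 0 1 0, G 0 0 0 1]" if "x \<in> range (period_hom M0)" for x using that sat k by blast
  then have "x \<in> sub X" if "x \<in> range (period_hom M0)" for x using that unfolding G_span[symmetric] by blast
  then have c: "col M0 j \<in> sub X" for j using period_hom_axis by (metis rangeI)
  have "x \<in> sub X" for x
  proof -
   obtain r where r: "x = rhom M0 r" using surj_rhom[OF M0(1)] by (metis surjD)
   show ?thesis unfolding r rhom_def sum_6 by (intro W_add W_scaleR c)
  qed
  then have "sub X = UNIV" by blast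
  then have "vec.dim (UNIV :: (complex ^ 3) set) = 2" using sub_dim by simp
  then show False unfolding vec_dim_card by simp
 qed
 have "EX m2 m3. symp (mat6 (vec6 (G 1 0 0 0) (G 0 1 0 0) (real d *\<^sub>R m2 - G 0 0 0 1) (G 0 0 1 0) m2 m3)) &
  range (period_hom (mat6 (vec6 (G 1 0 0 0) (G 0 1 0 0) (real d *\<^sub>R m2 - G 0 0 0 1) (G 0 0 1 0) m2 m3))) = range (period_hom M0)"
  by (rule extend_to_symplectic[OF M0(1) d_pos Gm Gm Gm Gm]) (use sat proper in \<open>simp_all add: G_E\<close>)
 then obtain m2 m3 where sy: "symp (mat6 (vec6 (G 1 0 0 0) (G 0 1 0 0) (real d *\<^sub>R m2 - G 0 0 0 1) (G 0 0 1 0) m2 m3))"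
  and ra: "range (period_hom (mat6 (vec6 (G 1 0 0 0) (G 0 1 0 0) (real d *\<^sub>R m2 - G 0 0 0 1) (G 0 0 1 0) m2 m3))) = lat X"
  unfolding M0(2) by blast
 define M where "M = mat6 (vec6 (G 1 0 0 0) (G 0 1 0 0) (real d *\<^sub>R m2 - G 0 0 0 1) (G 0 0 1 0) m2 m3)"
 have ph: "period_hom M n = g (kn n, ln6 n) & (kn n, ln6 n) \<in> dom" if n: "n \<in> L0" for n
 proof -
  have n5: "n $ 5 = int d * (- n $ 3)" and n6: "n $ 6 = 0" using n unfolding L0_def by simp_all
  have "period_hom M n = n $ 1 *. G 1 0 0 0 + n $ 2 *. G 0 1 0 0 + n $ 4 *. G 0 0 1 0 + (- n $ 3) *. G 0 0 0 1"
   unfolding M_def period_hom_6 n5 n6 by (simp add: scaleR_diff_right algebra_simps)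
  then have "period_hom M n = G (n $ 1) (n $ 2) (n $ 4) (- n $ 3)" unfolding G_basis[symmetric] .
  then show ?thesis using G_dom[of "n $ 1" "n $ 2" "n $ 4" "- n $ 3"] unfolding G_def kn_def ln6_def n5 by simp
 qed
 have "is_period_matrix D E0 L0 R0 X M" unfolding is_period_matrix_def
 proof (intro conjI allI ballI)
  show "bij_betw (period_hom M) UNIV (lat X)" unfolding bij_betw_def using inj_period_hom[OF sy] ra unfolding M_def by blast
  show "Im (pol X (period_hom M m) (period_hom M n)) = of_int (E0 m n)" for m n
   using symp_period_hom[OF sy] unfolding M_def E_def .
  show "period_hom M ` L0 = sub X Int lat X"
  proof (intro equalityI subsetI)
   fix x assume "x \<in> period_hom M ` L0"
   then show "x \<in> sub X Int lat X" using ph g_mem by auto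
  next
   fix x assume "x \<in> sub X Int lat X"
   then obtain v where v: "v \<in> dom" "x = g v" using g_bij unfolding bij_betw_def by blast
   have "fst v \<in> Od" "snd v \<in> (%x. x / s) ` \<aa>" using v(1) by (simp_all add: mem_Times_iff)
   from L0_surj[OF this] obtain n where "n \<in> L0" "kn n = fst v" "ln6 n = snd v" by blast
   then show "x \<in> period_hom M ` L0" using ph[of n] v by (intro image_eqI[of _ _ n]) simp_all
  qed
  fix k n assume k: "k \<in> Od" and n: "n \<in> L0"
  have "act X k (period_hom M n) = g (k * kn n, k * ln6 n)" using ph[OF n] g_act[OF k, of "(kn n, ln6 n)"] by simp
  also have "\<dots> = period_hom M (R0 k n)" using ph[OF R0_spec(1)[OF k n]] R0_spec(2,3)[OF k n] by simp
  finally show "act X k (period_hom M n) = period_hom M (R0 k n)" .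
 qed
 then show ?thesis by blast
qed

end

text \<open>
  The loci of different ideals are disjoint.
\<close>

lemma ideal_marking_unique:
 assumes "nonsquare_discriminant D" "is_rm_threefold D d X"
  and aa: "\<aa> \<in> primitive_ideals D d" "ideal_marking D \<aa> X g" and bb: "\<bb> \<in> primitive_ideals D d" "ideal_marking D \<bb> X g'"
 shows "\<aa> = \<bb>"
proof -
 interpret rm3 D d X by unfold_locales (rule assms)+
 obtain \<eta>1 \<eta>2 where 1: "smart_basis D d \<aa> \<eta>1 \<eta>2" using smart_basis_exists[OF d_gt_0 aa(1)] by blast
 obtain \<theta>1 \<theta>2 where 2: "smart_basis D d \<bb> \<theta>1 \<theta>2" using smart_basis_exists[OF d_gt_0 bb(1)] by blast
 interpret A: marked3 D d X \<aa> \<eta>1 \<eta>2 g by unfold_locales (use d_gt_0 aa 1 in simp_all)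
 interpret B: marked3 D d X \<bb> \<theta>1 \<theta>2 g' by unfold_locales (use d_gt_0 bb 2 in simp_all)
 have "\<aa> \<subseteq> Od" "\<bb> \<subseteq> Od" using RR_ideal_closed(1)[OF A.idl] RR_ideal_closed(1)[OF B.idl] .
 moreover have "k \<in> \<aa> \<longleftrightarrow> k \<in> \<bb>" if k: "k \<in> Od" for k
  unfolding A.ideal_recovered[OF k] B.ideal_recovered[OF k] ..
 ultimately show ?thesis by blast
qed

section \<open>Periods determine the point of the upper half space\<close>

definition det3 :: "complex ^ 3 => complex ^ 3 => complex ^ 3 => complex" where
 "det3 a b c = a $ 1 * (b $ 2 * c $ 3 - b $ 3 * c $ 2) - a $ 2 * (b $ 1 * c $ 3 - b $ 3 * c $ 1) + a $ 3 * (b $ 1 * c $ 2 - b $ 2 * c $ 1)"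

text \<open>
  Cramer's rule is used to express \<open>z\<close> by the periods; this is the non-vanishing of its denominator.
\<close>

lemma det3_nonzero:
 assumes "!!x y z. x *s a + y *s b + z *s c = 0 ==> x = 0 & y = 0 & z = 0"
 shows "det3 a b c ~= 0"
proof -
 define A :: "complex ^ 3 ^ 3" where "A = (\<chi> i. vector [a $ i, b $ i, c $ i])"
 have "A *v v = v $ 1 *s a + v $ 2 *s b + v $ 3 *s c" for v
  by (rule vec3_eqI) (simp_all add: A_def matrix_vector_mult_def sum_3)
 then have "v = 0" if "A *v v = 0" for v using assms[of "v $ 1" "v $ 2" "v $ 3"] that by (intro vec3_eqI) simp_all
 then have "EX B. B ** A = mat 1" unfolding matrix_left_invertible_ker by blast
 then have "invertible A" unfolding invertible_left_inverse .
 then have "det A ~= 0" unfolding invertible_det_nz .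
 moreover have "det A = det3 a b c" unfolding det_3 det3_def A_def by (simp add: algebra_simps)
 ultimately show ?thesis by simp
qed

context smart
begin

text \<open>
  The point \<open>z\<close> of a period matrix \<open>\<Pi>_z\<close>, expressed in a way that is invariant under linear changes of
  coordinates of \<open>\<complex>\<^sup>3\<close> and rational in the entries.
\<close>

definition zeta :: "complex ^ (3 \<times> 6) => complex ^ 3" where
 "zeta M = (let l1 = col M 1; l2 = col M 2; l3 = col M 3; dd = det3 l1 l2 l3; x = det3 (col M 4) l2 l3; y = det3 l1 (col M 4) l3 in
  vector [of_real (s / cj \<eta>2) * ((of_real \<eta>1 * x + of_real \<eta>2 * y) / dd),
   of_real (- s / \<eta>2) * ((of_real (cj \<eta>1) * x + of_real (cj \<eta>2) * y) / dd),
   - of_nat d * (det3 l1 l2 (col M 6) / dd)])"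

end

text \<open>
  A tuple with a standard period matrix.
\<close>

locale period3 = rm3 D d X + smart D d \<aa> \<eta>1 \<eta>2
 for D d :: nat and X \<aa> \<eta>1 \<eta>2 +
 fixes M :: "complex ^ (3 \<times> 6)"
 assumes per: "is_period_matrix D E0 L0 R0 X M"
begin

lemma per_E: "E (period_hom M m) (period_hom M n) = of_int (E0 m n)"
 and per_lat: "lat X = range (period_hom M)"
 and per_L: "period_hom M ` L0 = sub X Int lat X"
 and per_act: "k \<in> Od ==> n \<in> L0 ==> act X k (period_hom M n) = period_hom M (R0 k n)"
 using per unfolding is_period_matrix_def E_def bij_betw_def by blast+

lemma per_symp: "symp M" by (rule sympI) (rule per_E)

definition l1 where "l1 = col M 1"
definition l2 where "l2 = col M 2"
definition l3 where "l3 = col M 3"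
definition m1 where "m1 = col M 4"
definition m2 where "m2 = col M 5"
definition m3 where "m3 = col M 6"

lemmas cols = l1_def l2_def l3_def m1_def m2_def m3_def

lemma ph: "period_hom M n = n $ 1 *. l1 + n $ 2 *. l2 + n $ 3 *. l3 + n $ 4 *. m1 + n $ 5 *. m2 + n $ 6 *. m3"
 unfolding cols by (rule period_hom_6)

lemma gram: "E l1 l2 = 0" "E l1 l3 = 0" "E l1 m1 = 1" "E l1 m2 = 0" "E l1 m3 = 0" "E l2 l3 = 0" "E l2 m1 = 0" "E l2 m2 = 1" "E l2 m3 = 0"
 "E l3 m1 = 0" "E l3 m2 = 0" "E l3 m3 = 1" "E m1 m2 = 0" "E m1 m3 = 0" "E m2 m3 = 0"
 unfolding cols symp_gram[OF per_symp] by (simp_all add: E0_def axis_def)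

lemma sw: "E x y = c ==> E y x = - c" using E_anti[of x y] by simp

lemmas gr = gram gram[THEN sw] E_self
lemmas bil = E_add_l E_add_r E_diff_l E_diff_r E_scaleR_l E_scaleR_r E_minus_l E_minus_r

lemma L0_mem: "n \<in> L0 ==> period_hom M n \<in> sub X" using per_L by blast

lemma mem: "l1 \<in> sub X" "l2 \<in> sub X" "m1 \<in> sub X" "int d *. m2 - l3 \<in> sub X"
proof -
 have "vec6 1 0 0 0 0 0 \<in> L0" "vec6 0 1 0 0 0 0 \<in> L0" "vec6 0 0 0 1 0 0 \<in> L0" "vec6 0 0 (-1) 0 (int d) 0 \<in> L0" by (simp_all add: L0_def)
 from this[THEN L0_mem] show "l1 \<in> sub X" "l2 \<in> sub X" "m1 \<in> sub X" "int d *. m2 - l3 \<in> sub X"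
  unfolding ph by simp_all
qed

text \<open>
  Solving \<open>\<lambda>\<^sub>1 = \<eta>1 e1 + \<eta>1\<^sup>\<sigma> e2\<close> and \<open>\<lambda>\<^sub>2 = \<eta>2 e1 + \<eta>2\<^sup>\<sigma> e2\<close> gives the two eigenvectors of the real
  multiplication.
\<close>

definition e1 where "e1 = (- 1 / s) *\<^sub>R (cj \<eta>2 *\<^sub>R l1 - cj \<eta>1 *\<^sub>R l2)"
definition e2 where "e2 = (- 1 / s) *\<^sub>R (\<eta>1 *\<^sub>R l2 - \<eta>2 *\<^sub>R l1)"

lemma W_diff: "x \<in> sub X ==> y \<in> sub X ==> x - y \<in> sub X"
 using W_add[of x "(-1) *\<^sub>R y"] W_scaleR[of y "-1"] by simp

lemma e_mem: "e1 \<in> sub X" "e2 \<in> sub X" unfolding e1_def e2_def by (intro W_scaleR W_diff mem)+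

lemma det_inv: "(- 1 / s) * (\<eta>1 * cj \<eta>2 - cj \<eta>1 * \<eta>2) = 1" unfolding eta_det using s_ne by simp

lemma l_e: "l1 = \<eta>1 *\<^sub>R e1 + cj \<eta>1 *\<^sub>R e2" "l2 = \<eta>2 *\<^sub>R e1 + cj \<eta>2 *\<^sub>R e2"
proof -
 have "\<eta>1 *\<^sub>R e1 + cj \<eta>1 *\<^sub>R e2 = ((- 1 / s) * (\<eta>1 * cj \<eta>2 - cj \<eta>1 * \<eta>2)) *\<^sub>R l1"
  unfolding e1_def e2_def by (simp add: algebra_simps)
 then show "l1 = \<eta>1 *\<^sub>R e1 + cj \<eta>1 *\<^sub>R e2" unfolding det_inv by simp
 have "\<eta>2 *\<^sub>R e1 + cj \<eta>2 *\<^sub>R e2 = ((- 1 / s) * (\<eta>1 * cj \<eta>2 - cj \<eta>1 * \<eta>2)) *\<^sub>R l2"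
  unfolding e1_def e2_def by (simp add: algebra_simps)
 then show "l2 = \<eta>2 *\<^sub>R e1 + cj \<eta>2 *\<^sub>R e2" unfolding det_inv by simp
qed

lemma kk_e: "a *. l1 + b *. l2 = kk a b *\<^sub>R e1 + cj (kk a b) *\<^sub>R e2"
proof -
 have "cj (kk a b) = of_int a * cj \<eta>1 + of_int b * cj \<eta>2" by (simp add: kk_def)
 then show ?thesis unfolding l_e kk_def by (simp add: algebra_simps)
qed

lemma act_kk: assumes k: "k \<in> Od" shows "act X k (a *. l1 + b *. l2) = (k * kk a b) *\<^sub>R e1 + cj (k * kk a b) *\<^sub>R e2"
proof -
 let ?n = "vec6 a b 0 0 0 0"
 have n: "?n \<in> L0" by (simp add: L0_def)
 obtain a' b' where ab: "k * kk a b = kk a' b'" using kk_surj[of "k * kk a b"] k by (auto simp: kk_def)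
 have "R0 k ?n = vec6 a' b' 0 0 0 0"
  by (rule R0_eqI[OF k n]) (simp_all add: L0_def kn_def ln6_def ab ll_def)
 then have "act X k (a *. l1 + b *. l2) = a' *. l1 + b' *. l2" using per_act[OF k n] unfolding ph by simp
 then show ?thesis unfolding kk_e ab .
qed

lemma act_e: assumes k: "k \<in> Od" shows "act X k e1 = k *\<^sub>R e1" "act X k e2 = cj k *\<^sub>R e2"
proof -
 have kK: "cj (k * \<eta>1) = cj k * cj \<eta>1" "cj (k * \<eta>2) = cj k * cj \<eta>2" using k by simp_all
 have al: "act X k l1 = (k * \<eta>1) *\<^sub>R e1 + cj (k * \<eta>1) *\<^sub>R e2" "act X k l2 = (k * \<eta>2) *\<^sub>R e1 + cj (k * \<eta>2) *\<^sub>R e2"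
  using act_kk[OF k, of 1 0] act_kk[OF k, of 0 1] by (simp_all add: kk_def)
 have lin: "act X k (r *\<^sub>R (x *\<^sub>R l1 - y *\<^sub>R l2)) = r *\<^sub>R (x *\<^sub>R act X k l1 - y *\<^sub>R act X k l2)" for r x y
 proof -
  have "act X k (r *\<^sub>R (x *\<^sub>R l1 + (- y) *\<^sub>R l2)) = r *\<^sub>R (x *\<^sub>R act X k l1 + (- y) *\<^sub>R act X k l2)"
   using mem W_scaleR W_add by (simp only: rho_scaleR[OF k] rho_addv[OF k])
  then show ?thesis by simp
 qed
 have "act X k e1 = (- 1 / s) *\<^sub>R (cj \<eta>2 *\<^sub>R act X k l1 - cj \<eta>1 *\<^sub>R act X k l2)"
  using lin[of "- 1 / s" "cj \<eta>2" "cj \<eta>1"] unfolding e1_def .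
 also have "\<dots> = ((- 1 / s) * (\<eta>1 * cj \<eta>2 - cj \<eta>1 * \<eta>2)) *\<^sub>R (k *\<^sub>R e1)"
  unfolding al kK by (simp add: algebra_simps)
 finally show "act X k e1 = k *\<^sub>R e1" unfolding det_inv by simp
 have e2': "e2 = (1 / s) *\<^sub>R (\<eta>2 *\<^sub>R l1 - \<eta>1 *\<^sub>R l2)" unfolding e2_def by (simp add: algebra_simps)
 have "act X k e2 = (1 / s) *\<^sub>R (\<eta>2 *\<^sub>R act X k l1 - \<eta>1 *\<^sub>R act X k l2)"
  using lin[of "1 / s" "\<eta>2" "\<eta>1"] unfolding e2' .
 also have "\<dots> = ((- 1 / s) * (\<eta>1 * cj \<eta>2 - cj \<eta>1 * \<eta>2)) *\<^sub>R (cj k *\<^sub>R e2)"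
  unfolding al kK by (simp add: algebra_simps)
 finally show "act X k e2 = cj k *\<^sub>R e2" unfolding det_inv by simp
qed

text \<open>
  Eigenvectors of a self-adjoint operator with different real eigenvalues are orthogonal.
\<close>

lemma H_e12: "pol X e1 e2 = 0" "pol X e2 e1 = 0"
proof -
 have o: "om \<in> Od" by simp
 have "pol X (act X om e1) e2 = pol X e1 (act X om e2)" by (rule rho_adj[OF o e_mem])
 then have "complex_of_real om * pol X e1 e2 = complex_of_real (cj om) * pol X e1 e2" unfolding act_e[OF o] by (simp add: H_bilinear)
 moreover have "om ~= cj om" using om_diff s_ne by auto
 ultimately show "pol X e1 e2 = 0" by simp
 then show "pol X e2 e1 = 0" using H_cnj[of e2 e1] by simp
qed

text \<open>
  The sublattice spans a complex subspace over the reals, so \<open>E\<close>-orthogonality implies \<open>H\<close>-orthogonality.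
\<close>

lemma orthogonal_to_sub:
 assumes y: "!!n. n \<in> L0 ==> E y (period_hom M n) = 0" and x: "x \<in> sub X"
 shows "pol X y x = 0"
proof -
 have Ey: "E y x = 0" if x: "x \<in> sub X" for x
 proof -
  obtain bs where bs: "is_zbasis bs (sub X Int lat X)" "span (set bs) = sub X"
   using X unfolding is_rm_threefold_def full_lattice_def by (elim conjE exE)
  have e: "sub X Int lat X = zspan bs" using bs(1) unfolding is_zbasis_def by (rule conjunct1)
  have z: "E y v = 0" if v: "v \<in> set bs" for v
  proof -
   have "v \<in> period_hom M ` L0" unfolding per_L e using v by (rule zspan_mem)
   then show ?thesis using y by (elim imageE) simp
  qed
  have "x \<in> span (set bs)" using x bs(2) by simp
  then show ?thesis by (induction rule: span_induct_alt) (simp_all add: bil z)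
 qed
 have "E (\<i> *s y) x = E y (- (\<i> *s x))" unfolding E_def H_smult_l by (simp add: H_minus_r H_smult_r)
 also have "\<dots> = 0" unfolding E_minus_r using Ey[OF W_smult[OF x]] by simp
 finally show ?thesis using H_via_E[of y x] Ey[OF x] by simp
qed

lemma l3_orth: assumes "x \<in> sub X" shows "pol X l3 x = 0" "pol X x l3 = 0"
proof -
 show "pol X l3 x = 0"
 proof (rule orthogonal_to_sub[OF _ assms])
  show "E l3 (period_hom M n) = 0" if "n \<in> L0" for n using that unfolding ph L0_def by (simp add: bil gr)
 qed
 then show "pol X x l3 = 0" using H_cnj[of x l3] by simp
qed

lemma ne: "e1 ~= 0" "e2 ~= 0" "l3 ~= 0"
proof -
 have E1: "E e1 m1 = - (cj \<eta>2 / s)" "E e2 m1 = \<eta>2 / s" unfolding e1_def e2_def by (simp_all add: bil gr)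
 show "e1 ~= 0" "e2 ~= 0" using E1 s_ne by auto
 show "l3 ~= 0" using gram(12) by auto
qed

lemma E_e_m1: "E e1 m1 = - (cj \<eta>2 / s)" "E e2 m1 = \<eta>2 / s" unfolding e1_def e2_def by (simp_all add: bil gr)

definition F where "F c = c $ 1 *s e1 + c $ 2 *s e2 + c $ 3 *s l3" for c :: "complex ^ 3"

lemma F_add: "F (x + y) = F x + F y" and F_smult: "F (c *s x) = c *s F x"
 unfolding F_def by (simp_all add: vec.scale_left_distrib vec.scale_right_distrib)

lemma F_scaleR: "F (r *\<^sub>R x) = r *\<^sub>R F x" unfolding scaleR_eq_smult by (rule F_smult)

lemma H_F: "pol X (F x) (F y) = x $ 1 * cnj (y $ 1) * pol X e1 e1 + x $ 2 * cnj (y $ 2) * pol X e2 e2 + x $ 3 * cnj (y $ 3) * pol X l3 l3"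
 unfolding F_def by (simp add: H_bilinear H_e12 l3_orth e_mem)

lemma F_zero: assumes "F c = 0" shows "c = 0"
proof -
 have nz: "pol X v v ~= 0" if "v ~= 0" for v using pol_pos[OF that] by auto
 have "pol X (F c) (F y) = 0" for y unfolding assms by simp
 from this[of "axis 1 1"] this[of "axis 2 1"] this[of "axis 3 1"] have "c $ 1 = 0" "c $ 2 = 0" "c $ 3 = 0"
  unfolding H_F using nz[OF ne(1)] nz[OF ne(2)] nz[OF ne(3)] by (simp_all add: axis_def)
 then show ?thesis by (intro vec3_eqI) simp_all
qed

lemma linear_F: "linear F" by (rule linearI) (simp_all add: F_add F_scaleR)

lemma F_inj: "inj F" using linear_injective_0[OF linear_F] F_zero by blast

lemma F_surj: "surj F" by (rule linear_injective_imp_surjective[OF linear_F F_inj]) (rule refl)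

lemma F_sub: "F c \<in> sub X \<longleftrightarrow> c $ 3 = 0"
proof
 assume "F c \<in> sub X"
 then have "pol X (F c) l3 = 0" by (rule l3_orth(2))
 then have "c $ 3 * pol X l3 l3 = 0" unfolding F_def by (simp add: H_bilinear l3_orth e_mem)
 then show "c $ 3 = 0" using pol_pos[OF ne(3)] by auto
next
 assume "c $ 3 = 0"
 then show "F c \<in> sub X" unfolding F_def using e_mem by (simp add: W_add W_smult)
qed

definition w where "w = inv_into UNIV F m1"
lemma F_w: "F w = m1" unfolding w_def by (rule surj_f_inv_f[OF F_surj])
lemma w3: "w $ 3 = 0" using F_sub[of w] mem(3) unfolding F_w by simp
lemma m1_e: "m1 = w $ 1 *s e1 + w $ 2 *s e2" using F_w w3 unfolding F_def by simp

lemma kap_orth: assumes "x \<in> sub X" shows "pol X (int d *. m3 - l2) x = 0"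
proof (rule orthogonal_to_sub[OF _ assms])
 fix n assume "n \<in> L0"
 then have "n $ 5 = - int d * n $ 3" "n $ 6 = 0" unfolding L0_def by simp_all
 then show "E (int d *. m3 - l2) (period_hom M n) = 0" unfolding ph by (simp add: bil gr)
qed

definition kap where "kap = inv_into UNIV F (int d *. m3 - l2) $ 3"
lemma m3_e: "int d *. m3 - l2 = kap *s l3"
proof -
 define c where "c = inv_into UNIV F (int d *. m3 - l2)"
 have c: "F c = int d *. m3 - l2" unfolding c_def by (rule surj_f_inv_f[OF F_surj])
 have "pol X (F c) e1 = 0" "pol X (F c) e2 = 0" unfolding c using kap_orth e_mem by blast+
 then have "c $ 1 * pol X e1 e1 = 0" "c $ 2 * pol X e2 e2 = 0" unfolding F_def by (simp_all add: H_bilinear H_e12 l3_orth e_mem)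
 then have "c $ 1 = 0" "c $ 2 = 0" using pol_pos[OF ne(1)] pol_pos[OF ne(2)] by auto
 then show ?thesis using c unfolding F_def kap_def c_def by simp
qed

definition z :: "complex ^ 3" where
 "z = vector [of_real (s / cj \<eta>2) * w $ 1, of_real (- s / \<eta>2) * w $ 2, - kap]"

lemma w_z: "w $ 1 = of_real (cj \<eta>2 / s) * z $ 1" "w $ 2 = of_real (- \<eta>2 / s) * z $ 2"
 unfolding z_def using s_ne by simp_all

text \<open>
  The vector \<open>d \<mu>\<^sub>2 - \<lambda>\<^sub>3\<close> is determined by \<open>\<mu>\<^sub>1\<close>, because \<open>d \<eta>1\<^sup>\<sigma> \<eta>2\<close> maps \<open>\<mu>\<^sub>1\<close> to a non-zero integral
  multiple of it.
\<close>

lemma nu_e: "int d *. m2 - l3 = of_real (- real d * cj \<eta>1 / s) *s (z $ 1 *s e1) + of_real (real d * \<eta>1 / s) *s (z $ 2 *s e2)"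
proof -
 define k where "k = real d * cj \<eta>1 * \<eta>2"
 have k: "k \<in> Od" unfolding k_def by simp
 obtain N where N: "\<eta>2 * cj \<eta>2 = of_int N" using Od_norm_int[of \<eta>2] by auto
 have Nne: "real_of_int N ~= 0" unfolding N[symmetric] by simp
 let ?n = "vec6 0 0 0 1 0 0" and ?n' = "vec6 0 0 N 0 (- int d * N) 0"
 have "s * ln6 ?n' = s * (k * ln6 ?n)" unfolding mult.left_commute[of s k] ln6_def s_ll k_def by (simp add: N[symmetric] s_ll)
 then have "ln6 ?n' = k * ln6 ?n" using s_ne by simp
 then have "R0 k ?n = ?n'" by (intro R0_eqI[OF k]) (simp_all add: L0_def kn_def kk_def)
 then have "act X k m1 = N *. l3 - (int d * N) *. m2" using per_act[OF k, of ?n] unfolding ph by (simp add: L0_def)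
 then have a: "act X k m1 = (- of_int N) *\<^sub>R (int d *. m2 - l3)" by (simp add: algebra_simps)
 have "act X k m1 = w $ 1 *s (k *\<^sub>R e1) + w $ 2 *s (cj k *\<^sub>R e2)"
  unfolding m1_e using e_mem W_smult k by (simp add: rho_addv rho_smult act_e)
 moreover have "cj k = real d * \<eta>1 * cj \<eta>2" unfolding k_def by simp
 ultimately have b: "act X k m1 = of_real (of_int N) *s (of_real (real d * cj \<eta>1 / s) *s (z $ 1 *s e1) + of_real (- real d * \<eta>1 / s) *s (z $ 2 *s e2))"
  unfolding w_z k_def N[symmetric] scaleR_eq_smult by (simp add: vec.scale_right_distrib algebra_simps)
 have "of_int N *\<^sub>R (int d *. m2 - l3) = - act X k m1" unfolding a by simp
 also have "\<dots> = of_int N *\<^sub>R (of_real (- real d * cj \<eta>1 / s) *s (z $ 1 *s e1) + of_real (real d * \<eta>1 / s) *s (z $ 2 *s e2))"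
  unfolding b scaleR_eq_smult[of "of_int N"] by (simp add: vec.scale_right_distrib)
 finally show ?thesis using Nne by simp
qed

lemma h_real: "pol X v v = of_real (Re (pol X v v))"
 using H_cnj[of v v] by (metis Reals_cnj_iff of_real_Re)

lemma z_pos: "pol X e1 e1 = 1 / of_real (Im (z $ 1))" "pol X e2 e2 = 1 / of_real (Im (z $ 2))"
 "pol X l3 l3 = of_nat d / of_real (Im (z $ 3))" and z_upper: "z \<in> HH"
proof -
 define h1 h2 h3 where "h1 = Re (pol X e1 e1)" and "h2 = Re (pol X e2 e2)" and "h3 = Re (pol X l3 l3)"
 have h: "pol X e1 e1 = of_real h1" "pol X e2 e2 = of_real h2" "pol X l3 l3 = of_real h3"
  unfolding h1_def h2_def h3_def by (rule h_real)+
 have hp: "h1 > 0" "h2 > 0" "h3 > 0" unfolding h1_def h2_def h3_def using ne pol_pos by blast+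
 have "pol X e1 m1 = cnj (of_real (cj \<eta>2 / s) * z $ 1) * of_real h1" "pol X e2 m1 = cnj (of_real (- \<eta>2 / s) * z $ 2) * of_real h2"
  unfolding m1_e w_z by (simp_all add: H_bilinear H_e12 h)
 then have "E e1 m1 = - (cj \<eta>2 / s) * (Im (z $ 1) * h1)" "E e2 m1 = (\<eta>2 / s) * (Im (z $ 2) * h2)" unfolding E_def by simp_all
 then have i1: "Im (z $ 1) * h1 = 1" and i2: "Im (z $ 2) * h2 = 1" unfolding E_e_m1 using s_ne by simp_all
 have "real d * E l3 m3 = E l3 (int d *. m3 - l2)" by (simp add: bil gr)
 also have "\<dots> = Im (cnj kap * of_real h3)" unfolding m3_e E_def H_smult_r h ..
 finally have i3: "Im (z $ 3) * h3 = real d" unfolding gram z_def by simp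
 have zp: "Im (z $ 1) > 0" "Im (z $ 2) > 0" "Im (z $ 3) > 0"
  using i1 i2 i3 hp d_pos by (metis zero_less_mult_pos2 zero_less_one of_nat_0_less_iff)+
 then show "z \<in> HH" unfolding upper_half3_def forall_3 by simp
 have inv: "complex_of_real h = of_real c / of_real x" if "x * h = c" "x > 0" for x h c :: real
  using that unfolding of_real_divide[symmetric] of_real_eq_iff by (simp add: field_simps)
 show "pol X e1 e1 = 1 / of_real (Im (z $ 1))" "pol X e2 e2 = 1 / of_real (Im (z $ 2))"
 "pol X l3 l3 = of_nat d / of_real (Im (z $ 3))"
  unfolding h using inv[OF i1 zp(1)] inv[OF i2 zp(2)] inv[OF i3 zp(3)] by simp_all
qed

lemma F_cols: "F (col (Pz z) j) = col M j"
proof -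
 have dn: "(of_nat d :: complex) ~= 0" using d_pos by simp
 have c: "col M 1 = l1" "col M 2 = l2" "col M 3 = l3" "col M 4 = m1" "col M 5 = m2" "col M 6 = m3" unfolding cols by simp_all
 have 1: "F (col (Pz z) 1) = col M 1" unfolding c by (simp add: Pz_def period_lambda_def F_def l_e(1) scaleR_eq_smult)
 have 2: "F (col (Pz z) 2) = col M 2" unfolding c by (simp add: Pz_def period_lambda_def F_def l_e(2) scaleR_eq_smult)
 have 3: "F (col (Pz z) 3) = col M 3" unfolding c by (simp add: Pz_def period_lambda_def F_def)
 have 4: "F (col (Pz z) 4) = col M 4" unfolding c by (simp add: Pz_def period_mu_def F_def m1_e w_z)
 have "of_nat d *s m2 = int d *. m2 - l3 + l3" by (simp add: scaleR_eq_smult)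
 then have "of_nat d *s m2 = of_nat d *s F (col (Pz z) 5)" unfolding nu_e F_def using dn
  by (simp add: Pz_def period_mu_def vec.scale_right_distrib mult.assoc)
 then have 5: "F (col (Pz z) 5) = col M 5" unfolding c using dn by simp
 have "of_nat d *s m3 = l2 + (int d *. m3 - l2)" by (simp add: scaleR_eq_smult)
 then have "of_nat d *s m3 = of_nat d *s F (col (Pz z) 6)" unfolding m3_e unfolding l_e(2) F_def using dn
  by (simp add: Pz_def period_mu_def z_def vec.scale_right_distrib scaleR_eq_smult)
 then have 6: "F (col (Pz z) 6) = col M 6" unfolding c using dn by simp
 show ?thesis using exhaust_6[of j] 1 2 3 4 5 6 by auto
qed

lemma F_period_hom: "F (period_hom (Pz z) n) = period_hom M n"
 unfolding period_hom_6 F_add F_scaleR F_cols ..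

text \<open>
  In the coordinates \<open>e1, e2, \<lambda>\<^sub>3\<close> the period matrix is \<open>\<Pi>_z\<close>.
\<close>

theorem isomorphic_to_model: "rm_isomorphic D (Xz z) X"
 unfolding rm_isomorphic_iff Xz_pol[OF z_upper] Xz_simps(1,2)
proof (intro exI[of _ F] conjI allI ballI)
 show "bij F" using F_inj F_surj by (simp add: bij_def)
 show "F ` range (period_hom (Pz z)) = lat X" unfolding per_lat image_image F_period_hom ..
 show "pol X (F x) (F y) = Hz z x y" for x y unfolding H_F z_pos Hz_def by simp
 show "F ` V2 = sub X"
 proof (intro equalityI subsetI)
  fix x assume "x \<in> sub X"
  moreover obtain c where c: "x = F c" using F_surj by (metis surjD)
  ultimately show "x \<in> F ` V2" using F_sub[of c] unfolding V2_def by auto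
 qed (auto simp: F_sub V2_def)
 fix k x assume k: "k \<in> Od" and x: "x \<in> V2"
 then have x3: "x $ 3 = 0" unfolding V2_def by simp
 have "F (act (Xz z) k x) = of_real k *s (x $ 1 *s e1) + of_real (cj k) *s (x $ 2 *s e2)" unfolding F_def using x by simp
 moreover have "act X k (F x) = x $ 1 *s (k *\<^sub>R e1) + x $ 2 *s (cj k *\<^sub>R e2)"
  unfolding F_def x3 using e_mem W_smult k by (simp add: rho_addv rho_smult act_e)
 ultimately show "F (act (Xz z) k x) = act X k (F x)" by (simp add: scaleR_eq_smult mult.commute)
qed (simp_all add: F_add F_smult)

lemma det3_lambda: "det3 l1 l2 l3 ~= 0"
proof (rule det3_nonzero)
 fix a b c assume "a *s l1 + b *s l2 + c *s l3 = 0"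
 then have "F (vector [a * of_real \<eta>1 + b * of_real \<eta>2, a * of_real (cj \<eta>1) + b * of_real (cj \<eta>2), c]) = 0"
  unfolding F_def l_e scaleR_eq_smult by (simp add: vec.scale_right_distrib vec.scale_left_distrib algebra_simps)
 then have v: "vector [a * of_real \<eta>1 + b * of_real \<eta>2, a * of_real (cj \<eta>1) + b * of_real (cj \<eta>2), c] = (0 :: complex ^ 3)" by (rule F_zero)
 have p: "a * of_real \<eta>1 + b * of_real \<eta>2 = 0" "a * of_real (cj \<eta>1) + b * of_real (cj \<eta>2) = 0" "c = 0"
  using arg_cong[OF v, of "%x. x $ 1"] arg_cong[OF v, of "%x. x $ 2"] arg_cong[OF v, of "%x. x $ 3"] by simp_all
 have dc: "complex_of_real (\<eta>1 * cj \<eta>2 - cj \<eta>1 * \<eta>2) ~= 0" unfolding eta_det using s_ne by simp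
 have "a * complex_of_real (\<eta>1 * cj \<eta>2 - cj \<eta>1 * \<eta>2) = (a * of_real \<eta>1 + b * of_real \<eta>2) * of_real (cj \<eta>2) - (a * of_real (cj \<eta>1) + b * of_real (cj \<eta>2)) * of_real \<eta>2"
  by (simp add: algebra_simps)
 then have a0: "a = 0" unfolding p using dc by simp
 then show "a = 0 & b = 0 & c = 0" using p by simp
qed

lemma zeta_eq: "zeta M = z"
proof -
 have dc: "complex_of_real (\<eta>1 * cj \<eta>2 - cj \<eta>1 * \<eta>2) ~= 0" unfolding eta_det using s_ne by simp
 define x y where "x = of_real (- 1 / s) * (w $ 1 * of_real (cj \<eta>2) - w $ 2 * of_real \<eta>2)"
  and "y = of_real (- 1 / s) * (w $ 2 * of_real \<eta>1 - w $ 1 * of_real (cj \<eta>1))"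
 have m1: "m1 = x *s l1 + y *s l2" unfolding m1_e e1_def e2_def x_def y_def scaleR_eq_smult
  by (simp add: vec.scale_right_distrib vec.scale_left_distrib vec.scale_right_diff_distrib vec.scale_left_diff_distrib algebra_simps)
 have xw: "of_real \<eta>1 * x + of_real \<eta>2 * y = of_real ((- 1 / s) * (\<eta>1 * cj \<eta>2 - cj \<eta>1 * \<eta>2)) * w $ 1"
  "of_real (cj \<eta>1) * x + of_real (cj \<eta>2) * y = of_real ((- 1 / s) * (\<eta>1 * cj \<eta>2 - cj \<eta>1 * \<eta>2)) * w $ 2"
  unfolding x_def y_def by (simp_all add: algebra_simps)
 have d1: "det3 m1 l2 l3 = x * det3 l1 l2 l3" "det3 l1 m1 l3 = y * det3 l1 l2 l3" unfolding m1 det3_def by (simp_all add: algebra_simps)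
 have "of_nat d *s m3 = l2 + kap *s l3" using m3_e by (simp add: scaleR_eq_smult algebra_simps)
 then have "of_nat d * m3 $ j = l2 $ j + kap * l3 $ j" for j by (metis vector_add_component vector_smult_component)
 moreover have "of_nat d * det3 l1 l2 m3 = l1 $ 1 * (l2 $ 2 * (of_nat d * m3 $ 3) - l2 $ 3 * (of_nat d * m3 $ 2)) - l1 $ 2 * (l2 $ 1 * (of_nat d * m3 $ 3) - l2 $ 3 * (of_nat d * m3 $ 1)) + l1 $ 3 * (l2 $ 1 * (of_nat d * m3 $ 2) - l2 $ 2 * (of_nat d * m3 $ 1))"
  unfolding det3_def by (simp add: algebra_simps)
 ultimately have d3: "of_nat d * det3 l1 l2 m3 = kap * det3 l1 l2 l3" unfolding det3_def by (simp add: algebra_simps)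
 have q: "(of_real \<eta>1 * det3 m1 l2 l3 + of_real \<eta>2 * det3 l1 m1 l3) / det3 l1 l2 l3 = w $ 1"
  "(of_real (cj \<eta>1) * det3 m1 l2 l3 + of_real (cj \<eta>2) * det3 l1 m1 l3) / det3 l1 l2 l3 = w $ 2"
  "of_nat d * det3 l1 l2 m3 / det3 l1 l2 l3 = kap"
  using xw unfolding d1 d3 det_inv using det3_lambda by (simp_all add: add_divide_distrib)
 show ?thesis unfolding zeta_def Let_def cols[symmetric] q z_def
  by (rule vec3_eqI) (use q(3) in simp_all)
qed

end

section \<open>Complex differentiable functions of several variables\<close>

definition cdiff :: "(complex ^ 'n => complex) => complex ^ 'n => bool" where
 "cdiff f x \<longleftrightarrow> (EX F'. (f has_derivative F') (at x) & (ALL c v. F' (c *s v) = c * F' v))"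

lemma cdiffI: "(f has_derivative F') (at x) ==> (!!c v. F' (c *s v) = c * F' v) ==> cdiff f x"
 unfolding cdiff_def by blast

lemma cdiff_const: "cdiff (%x. c) x"
 by (rule cdiffI[OF has_derivative_const]) simp

lemma cdiff_nth: "cdiff (%x. x $ i) x"
 by (rule cdiffI[OF bounded_linear_imp_has_derivative[OF bounded_linear_vec_nth]]) simp

lemma cdiff_add: assumes "cdiff f x" "cdiff g x" shows "cdiff (%x. f x + g x) x"
proof -
 obtain f' g' where f: "(f has_derivative f') (at x)" "ALL c v. f' (c *s v) = c * f' v"
  and g: "(g has_derivative g') (at x)" "ALL c v. g' (c *s v) = c * g' v" using assms unfolding cdiff_def by blast
 show ?thesis by (rule cdiffI[OF has_derivative_add[OF f(1) g(1)]]) (use f(2) g(2) in \<open>simp add: distrib_left\<close>)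
qed

lemma cdiff_mult: assumes "cdiff f x" "cdiff g x" shows "cdiff (%x. f x * g x) x"
proof -
 obtain f' g' where f: "(f has_derivative f') (at x)" "ALL c v. f' (c *s v) = c * f' v"
  and g: "(g has_derivative g') (at x)" "ALL c v. g' (c *s v) = c * g' v" using assms unfolding cdiff_def by blast
 show ?thesis by (rule cdiffI[OF has_derivative_mult[OF f(1) g(1)]]) (use f(2) g(2) in \<open>simp add: algebra_simps\<close>)
qed

lemma cdiff_uminus: "cdiff f x ==> cdiff (%x. - f x) x"
 using cdiff_mult[OF cdiff_const[of "-1"], of f x] by simp

lemma cdiff_diff: "cdiff f x ==> cdiff g x ==> cdiff (%x. f x - g x) x"
 using cdiff_add[of f x "%x. - g x"] cdiff_uminus[of g x] by simp

lemma cdiff_divide: assumes "cdiff f x" "cdiff g x" "g x ~= 0" shows "cdiff (%x. f x / g x) x"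
proof -
 obtain g' where g: "(g has_derivative g') (at x)" "ALL c v. g' (c *s v) = c * g' v" using assms(2) unfolding cdiff_def by blast
 have "cdiff (%x. inverse (g x)) x"
  by (rule cdiffI[OF Deriv.has_derivative_inverse[OF assms(3) g(1)]]) (use g(2) in simp)
 from cdiff_mult[OF assms(1) this] show ?thesis by (simp add: divide_inverse)
qed

lemma cdiff_divide_const: "cdiff f x ==> cdiff (%x. f x / c) x"
 using cdiff_mult[OF _ cdiff_const[of "inverse c"], of f x] by (simp add: divide_inverse)

lemmas cdiff_intros = cdiff_const cdiff_nth cdiff_uminus cdiff_add cdiff_diff cdiff_mult cdiff_divide_const

lemma cdiff_continuous: "cdiff f x ==> isCont f x"
 unfolding cdiff_def using has_derivative_continuous by blast

lemma cdiff_transform: "cdiff f x ==> open U ==> x \<in> U ==> (!!y. y \<in> U ==> f y = g y) ==> cdiff g x"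
 unfolding cdiff_def using has_derivative_transform_within_open by blast

lemma bounded_linear_smult_left: "bounded_linear (%c. c *s (v :: complex ^ 'n))"
 unfolding linear_conv_bounded_linear[symmetric]
 by (rule linearI) (simp_all add: vec.scale_left_distrib scaleR_eq_smult scaleR_conv_of_real)

lemma cdiff_vector:
 fixes Z :: "complex ^ 'm => complex ^ 'n"
 assumes "!!i. cdiff (%x. Z x $ i) x"
 obtains Z' where "(Z has_derivative Z') (at x)" "!!c v. Z' (c *s v) = c *s Z' v"
proof -
 obtain F' where F: "!!i. ((%x. Z x $ i) has_derivative F' i) (at x)" "!!i c v. F' i (c *s v) = c * F' i v"
  using assms unfolding cdiff_def by metis
 have "((%x. Z x $ i *s axis i 1) has_derivative (%h. F' i h *s (axis i 1 :: complex ^ 'n))) (at x)" for i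
  by (rule bounded_linear.has_derivative[OF bounded_linear_smult_left F(1)])
 then have "((%x. \<Sum>i\<in>UNIV. Z x $ i *s axis i 1) has_derivative (%h. \<Sum>i\<in>UNIV. F' i h *s (axis i 1 :: complex ^ 'n))) (at x)"
  by (rule has_derivative_sum)
 then have "(Z has_derivative (%h. \<Sum>i\<in>UNIV. F' i h *s (axis i 1 :: complex ^ 'n))) (at x)"
  unfolding basis_expansion .
 then show thesis by (rule that) (simp add: F(2) vec.scale_sum_right)
qed

lemma cdiff_vector_continuous:
 fixes Z :: "complex ^ 'm => complex ^ 'n"
 assumes "!!i. cdiff (%x. Z x $ i) x" shows "isCont Z x"
 using cdiff_vector[of Z x, OF assms] has_derivative_continuous by metis

lemma cdiff_compose:
 fixes Z :: "complex ^ 'm => complex ^ 'n"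
 assumes "!!i. cdiff (%x. Z x $ i) x" "cdiff f (Z x)" shows "cdiff (f \<circ> Z) x"
proof -
 obtain Z' where Z: "(Z has_derivative Z') (at x)" "!!c v. Z' (c *s v) = c *s Z' v" using cdiff_vector[of Z x, OF assms(1)] by blast
 obtain f' where f: "(f has_derivative f') (at (Z x))" "ALL c v. f' (c *s v) = c * f' v" using assms(2) unfolding cdiff_def by blast
 show ?thesis by (rule cdiffI[OF diff_chain_at[OF Z(1) f(1)]]) (use Z(2) f(2) in simp)
qed

lemma holo_iff: "cn_holomorphic_on f S \<longleftrightarrow>
  (\<forall>x\<in>S. EX U F. open U & x \<in> U & (\<forall>y\<in>U Int S. F y = f y) & (\<forall>y\<in>U. cdiff F y))"
 unfolding cn_holomorphic_on_def cdiff_def ..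

lemma holoI:
 assumes "!!x. x \<in> S ==> EX U F. open U & x \<in> U & (\<forall>y\<in>U Int S. F y = f y) & (\<forall>y\<in>U. cdiff F y)"
 shows "cn_holomorphic_on f S" unfolding holo_iff using assms by blast

lemma holoE:
 assumes "cn_holomorphic_on f S" "x \<in> S"
 obtains U F where "open U" "x \<in> U" "!!y. y \<in> U ==> y \<in> S ==> F y = f y" "!!y. y \<in> U ==> cdiff F y"
proof -
 obtain U F where "open U & x \<in> U & (\<forall>y\<in>U Int S. F y = f y) & (\<forall>y\<in>U. cdiff F y)"
  using assms unfolding holo_iff by meson
 then show thesis by (intro that[of U F]) auto
qed

lemma holo_open: assumes "open S" "cn_holomorphic_on f S" "x \<in> S" shows "cdiff f x"
proof -
 obtain U F where U: "open U" "x \<in> U" "!!y. y \<in> U ==> y \<in> S ==> F y = f y" "!!y. y \<in> U ==> cdiff F y"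
  by (rule holoE[OF assms(2,3)]) blast
 show ?thesis by (rule cdiff_transform[OF U(4)[OF U(2)] open_Int[OF U(1) assms(1)]]) (use U assms in auto)
qed

lemma holo_subset: assumes "cn_holomorphic_on f S" "T \<subseteq> S" shows "cn_holomorphic_on f T"
proof (rule holoI)
 fix x assume "x \<in> T"
 then have "x \<in> S" using assms(2) by blast
 then obtain U F where "open U" "x \<in> U" "!!y. y \<in> U ==> y \<in> S ==> F y = f y" "!!y. y \<in> U ==> cdiff F y"
  by (rule holoE[OF assms(1)]) blast
 then show "EX U F. open U & x \<in> U & (\<forall>y\<in>U Int T. F y = f y) & (\<forall>y\<in>U. cdiff F y)"
  using assms(2) by (intro exI[of _ U] exI[of _ F]) auto
qed

lemma holo_cong:
 assumes "cn_holomorphic_on f S" "!!x. x \<in> S ==> f x = g x" shows "cn_holomorphic_on g S"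
proof (rule holoI)
 fix x assume "x \<in> S"
 then obtain U F where "open U" "x \<in> U" "!!y. y \<in> U ==> y \<in> S ==> F y = f y" "!!y. y \<in> U ==> cdiff F y"
  by (rule holoE[OF assms(1)]) blast
 then show "EX U F. open U & x \<in> U & (\<forall>y\<in>U Int S. F y = g y) & (\<forall>y\<in>U. cdiff F y)"
  using assms(2) by (intro exI[of _ U] exI[of _ F]) auto
qed

lemma holo_local:
 assumes "!!x. x \<in> S ==> EX O'. open O' & x \<in> O' & cn_holomorphic_on f (S Int O')"
 shows "cn_holomorphic_on f S"
proof (rule holoI)
 fix x assume x: "x \<in> S"
 then obtain O' where O': "open O'" "x \<in> O'" "cn_holomorphic_on f (S Int O')" using assms by blast
 have "x \<in> S Int O'" using x O' by blast
 then obtain U F where U: "open U" "x \<in> U" "!!y. y \<in> U ==> y \<in> S Int O' ==> F y = f y" "!!y. y \<in> U ==> cdiff F y"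
  by (rule holoE[OF O'(3)]) blast
 show "EX U F. open U & x \<in> U & (\<forall>y\<in>U Int S. F y = f y) & (\<forall>y\<in>U. cdiff F y)"
  by (rule exI[of _ "U Int O'"], rule exI[of _ F]) (use U O' in auto)
qed

lemma holo_const: "cn_holomorphic_on (%x. c) S"
 by (rule holoI, rule exI[of _ UNIV], rule exI[of _ "%x. c"]) (simp add: cdiff_const)

lemma holo_compose:
 fixes Z :: "complex ^ 'm => complex ^ 'n"
 assumes f: "cn_holomorphic_on f T" and ZT: "!!x. x \<in> S ==> Z x \<in> T"
  and Z: "!!x. x \<in> S ==> EX U. open U & x \<in> U & (\<forall>y\<in>U. ALL i. cdiff (%x. Z x $ i) y)"
 shows "cn_holomorphic_on (f \<circ> Z) S"
proof (rule holoI)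
 fix x assume x: "x \<in> S"
 obtain U where U: "open U" "x \<in> U" "!!y i. y \<in> U ==> cdiff (%x. Z x $ i) y" using Z[OF x] by blast
 obtain W G where W: "open W" "Z x \<in> W" "!!y. y \<in> W ==> y \<in> T ==> G y = f y" "!!y. y \<in> W ==> cdiff G y"
  by (rule holoE[OF f ZT[OF x]]) blast
 have "continuous_on U Z" by (intro continuous_at_imp_continuous_on ballI cdiff_vector_continuous U(3))
 then have o: "open (Z -` W Int U)" using continuous_on_open_vimage[OF U(1)] W(1) by blast
 show "EX U F. open U & x \<in> U & (\<forall>y\<in>U Int S. F y = (f \<circ> Z) y) & (\<forall>y\<in>U. cdiff F y)"
 proof (rule exI[of _ "Z -` W Int U"], rule exI[of _ "G \<circ> Z"], intro conjI ballI)
  show "open (Z -` W Int U)" by (rule o)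
  show "x \<in> Z -` W Int U" using U W by blast
  show "(G \<circ> Z) y = (f \<circ> Z) y" if "y \<in> Z -` W Int U Int S" for y using that W(3) ZT by auto
  show "cdiff (G \<circ> Z) y" if "y \<in> Z -` W Int U" for y using that U(3) W(4) by (intro cdiff_compose) auto
 qed
qed

text \<open>
  Restriction to the complex line through two points reduces the identity theorem to one variable.
\<close>

lemma cdiff_identity:
 fixes f :: "complex ^ 'n => complex"
 assumes B: "open B" "convex B" and f: "!!x. x \<in> B ==> cdiff f x"
  and W: "open W" "W \<subseteq> B" "w \<in> W" "!!x. x \<in> W ==> f x = 0" and y: "y \<in> B"
 shows "f y = 0"
proof -
 define h where "h t = w + t *s (y - w)" for t :: complex
 have hd: "(h has_derivative (%t. t *s (y - w))) (at t)" for t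
  unfolding h_def using has_derivative_add[OF has_derivative_const[of w] bounded_linear_imp_has_derivative[OF bounded_linear_smult_left[of "y - w"]]] by simp
 have hc: "continuous_on UNIV h" using hd has_derivative_continuous by (intro continuous_at_imp_continuous_on) blast
 have op: "open (h -` V)" if "open V" for V using open_vimage[OF that hc] .
 have aff: "h ((1 - u) *\<^sub>R a + u *\<^sub>R b) = (1 - u) *\<^sub>R h a + u *\<^sub>R h b" for u a b
  unfolding h_def by (simp add: vec_eq_iff scaleR_conv_of_real[where 'a = complex] algebra_simps)
 have cv: "convex (h -` B)"
  unfolding convex_alt using B(2)[unfolded convex_alt] by (auto simp: aff)
 have hol: "(f \<circ> h) holomorphic_on (h -` B)"
  unfolding holomorphic_on_open[OF op[OF B(1)]]
 proof
  fix t assume "t \<in> h -` B"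
  then obtain f' where f': "(f has_derivative f') (at (h t))" "ALL c v. f' (c *s v) = c * f' v" using f unfolding cdiff_def by blast
  have "((f \<circ> h) has_derivative (%t. f' (t *s (y - w)))) (at t)" using diff_chain_at[OF hd f'(1)] unfolding o_def .
  moreover have "(%t. f' (t *s (y - w))) = (*) (f' (y - w))" unfolding f'(2)[rule_format] by (intro ext) (rule mult.commute)
  ultimately have "((f \<circ> h) has_field_derivative f' (y - w)) (at t)" unfolding has_field_derivative_def by simp
  then show "EX d. ((f \<circ> h) has_field_derivative d) (at t)" by blast
 qed
 have h01: "h 0 = w" "h 1 = y" unfolding h_def by simp_all
 have "(f \<circ> h) 1 = 0"
 proof (rule analytic_continuation[OF hol op[OF B(1)] convex_connected[OF cv], of "h -` W" 0])
  show "h -` W \<subseteq> h -` B" using W(2) by blast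
  show "0 \<in> h -` B" "1 \<in> h -` B" using h01 W y by auto
  have "0 \<in> interior (h -` W)" using interior_open[OF op[OF W(1)]] h01 W(3) by simp
  then show "0 islimpt h -` W" by (rule interior_limit_point)
  show "(f \<circ> h) z = 0" if "z \<in> h -` W" for z using that W(4) by simp
 qed
 then show ?thesis using h01 by simp
qed

definition locally_analytic :: "(complex ^ 'n) set => (complex ^ 'n) set => bool" where
 "locally_analytic \<Omega> A \<longleftrightarrow> A \<subseteq> \<Omega> & (\<forall>x\<in>\<Omega>. EX U F. open U & x \<in> U & U \<subseteq> \<Omega> &
  (\<forall>f\<in>F. \<forall>y\<in>U. cdiff f y) & A Int U = {y \<in> U. \<forall>f\<in>F. f y = 0})"

text \<open>
  By the identity theorem the interior of an analytic set is closed as well.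
\<close>

lemma locally_analytic_interior:
 assumes c: "connected \<Omega>" and A: "locally_analytic \<Omega> A" and ne: "interior A ~= {}"
 shows "A = \<Omega>"
proof -
 let ?T = "interior A"
 have sub: "A \<subseteq> \<Omega>" using A unfolding locally_analytic_def by blast
 have T\<Omega>: "?T \<subseteq> \<Omega>" using sub interior_subset by blast
 have cl: "x \<in> ?T" if x: "x \<in> \<Omega>" "x \<in> closure ?T" for x
 proof -
  obtain U F where U: "open U" "x \<in> U" "U \<subseteq> \<Omega>" "\<forall>f\<in>F. \<forall>y\<in>U. cdiff f y" "A Int U = {y \<in> U. \<forall>f\<in>F. f y = 0}"
   using A x(1) unfolding locally_analytic_def by meson
  obtain e where e: "e > 0" "ball x e \<subseteq> U" using U(1,2) open_contains_ball by blast
  have "x \<in> ball x e" using e(1) by simp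
  then have "?T Int ball x e ~= {}" using x(2) open_ball by (metis closure_iff_nhds_not_empty disjoint_iff subset_refl Int_commute)
  then obtain w where w: "w \<in> ?T Int ball x e" by blast
  have "f y = 0" if fy: "f \<in> F" "y \<in> ball x e" for f y
  proof (rule cdiff_identity[of "ball x e" f "?T Int ball x e" w y])
   show "cdiff f x'" if "x' \<in> ball x e" for x' using U(4) fy(1) that e(2) by blast
   show "f x' = 0" if x': "x' \<in> ?T Int ball x e" for x'
   proof -
   have "x' \<in> A Int U" using x' e(2) interior_subset[of A] by blast
   then show ?thesis unfolding U(5) using fy(1) by blast
   qed
  qed (use w fy in auto)
  then have "ball x e \<subseteq> A Int U" unfolding U(5) using e(2) by blast
  then show ?thesis using e(1) by (meson interiorI open_ball centre_in_ball le_inf_iff)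
 qed
 have "closedin (top_of_set \<Omega>) ?T" unfolding closedin_closed
  by (rule exI[of _ "closure ?T"]) (use cl T\<Omega> closure_subset in auto)
 moreover have "openin (top_of_set \<Omega>) ?T" using T\<Omega> by (simp add: open_subset)
 ultimately have "?T = \<Omega>" using c ne unfolding connected_clopen by blast
 then show ?thesis using sub interior_subset by blast
qed

lemma locally_analytic_irreducible:
 assumes c: "connected \<Omega>" and A: "locally_analytic \<Omega> A" "locally_analytic \<Omega> B" and un: "\<Omega> = A \<union> B"
 shows "A = \<Omega> \<or> B = \<Omega>"
proof (cases "A = \<Omega>")
 case False
 then obtain x where x: "x \<in> \<Omega>" "x \<notin> A" using un by blast
 obtain U F where U: "open U" "x \<in> U" "U \<subseteq> \<Omega>" "\<forall>f\<in>F. \<forall>y\<in>U. cdiff f y" "A Int U = {y \<in> U. \<forall>f\<in>F. f y = 0}"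
  using A(1) x(1) unfolding locally_analytic_def by meson
 have "x \<notin> {y \<in> U. \<forall>f\<in>F. f y = 0}" unfolding U(5)[symmetric] using x(2) by blast
 then obtain f where f: "f \<in> F" "f x ~= 0" using U(2) by blast
 have "continuous_on U f" using U(4) f(1) by (intro continuous_at_imp_continuous_on ballI cdiff_continuous) blast
 then have o: "open (f -` (- {0}) Int U)" using continuous_on_open_vimage[OF U(1)] by blast
 have "f -` (- {0}) Int U \<subseteq> B"
 proof
  fix y assume y: "y \<in> f -` (- {0}) Int U"
  then have "y \<notin> {y \<in> U. \<forall>f\<in>F. f y = 0}" using f(1) by auto
  then have "y \<notin> A" unfolding U(5)[symmetric] using y by blast
  then show "y \<in> B" using y U(3) un by blast
 qed
 then have "x \<in> interior B" using o f(2) U(2) by (intro interiorI[of "f -` (- {0}) Int U"]) auto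
 then show ?thesis using locally_analytic_interior[OF c A(2)] by blast
qed simp

section \<open>Open and closed parts of spaces with functions\<close>

lemma analytic_subset_Int_clopen:
 assumes mono: "!!U V. V \<subseteq> U ==> hol X U \<subseteq> hol X V" and one: "!!U. (%_. 1) \<in> hol X U"
  and C: "openin (tspace X) C" "closedin (tspace X) C" and Z: "analytic_subset X Z"
 shows "analytic_subset X (Z Int C)"
 unfolding analytic_subset_def
proof (intro conjI ballI)
 show "closedin (tspace X) (Z Int C)" using Z C(2) unfolding analytic_subset_def by (blast intro: closedin_Int)
 fix x assume x: "x \<in> topspace (tspace X)"
 show "EX U F. openin (tspace X) U & x \<in> U & finite F & F \<subseteq> hol X U & Z Int C Int U = {y \<in> U. \<forall>f\<in>F. f y = 0}"
 proof (cases "x \<in> C")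
  case True
  obtain U F where U: "openin (tspace X) U" "x \<in> U" "finite F" "F \<subseteq> hol X U" "Z Int U = {y \<in> U. \<forall>f\<in>F. f y = 0}"
   using Z x unfolding analytic_subset_def by meson
  show ?thesis
  proof (rule exI[of _ "U Int C"], rule exI[of _ F], intro conjI)
   show "F \<subseteq> hol X (U Int C)" using U(4) mono[of "U Int C" U] by blast
   have "Z Int C Int (U Int C) = (Z Int U) Int C" by blast
   then show "Z Int C Int (U Int C) = {y \<in> U Int C. \<forall>f\<in>F. f y = 0}" unfolding U(5) by blast
  qed (use U C True openin_Int in auto)
 next
  case False
  show ?thesis
  proof (rule exI[of _ "topspace (tspace X) - C"], rule exI[of _ "{%_. 1}"], intro conjI)
   show "openin (tspace X) (topspace (tspace X) - C)" using C(2) by (simp add: closedin_def)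
  qed (use False x one in auto)
 qed
qed

lemma analytic_subset_topspace: "analytic_subset X (topspace (tspace X))"
 unfolding analytic_subset_def
 by (intro conjI ballI closedin_topspace, rule exI[of _ "topspace (tspace X)"], rule exI[of _ "{}"]) auto

text \<open>
  An irreducible set cannot be cut by an open and closed set, hence lies in one member of the partition.
\<close>

lemma irreducible_components_clopen:
 assumes mono: "!!U V. V \<subseteq> U ==> hol X U \<subseteq> hol X V" and one: "!!U. (%_. 1) \<in> hol X U"
  and C: "!!C. C \<in> \<C> ==> openin (tspace X) C" "!!C. C \<in> \<C> ==> closedin (tspace X) C"
  and irr: "!!C. C \<in> \<C> ==> irreducible_subset X C"
  and un: "\<Union>\<C> = topspace (tspace X)" and dj: "!!C C'. C \<in> \<C> ==> C' \<in> \<C> ==> C Int C' ~= {} ==> C = C'"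
 shows "irreducible_components X = \<C>"
proof -
 have inC: "\<exists>C\<in>\<C>. Z \<subseteq> C" if Z: "irreducible_subset X Z" for Z
 proof -
  have an: "analytic_subset X Z" and ne: "Z ~= {}" using Z unfolding irreducible_subset_def by blast+
  have "Z \<subseteq> topspace (tspace X)" using an unfolding analytic_subset_def by (blast dest: closedin_subset)
  then obtain C where CC: "C \<in> \<C>" "Z Int C ~= {}" using ne un by blast
  let ?C' = "topspace (tspace X) - C"
  have "openin (tspace X) ?C'" "closedin (tspace X) ?C'" using C[OF CC(1)] by (auto simp: closedin_def intro: closedin_diff)
  from analytic_subset_Int_clopen[OF mono one this an] analytic_subset_Int_clopen[OF mono one C(1)[OF CC(1)] C(2)[OF CC(1)] an]
  have "analytic_subset X (Z Int C)" "analytic_subset X (Z Int ?C')" by auto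
  moreover have "Z = (Z Int C) \<union> (Z Int ?C')" using \<open>Z \<subseteq> topspace (tspace X)\<close> by blast
  ultimately have "Z = Z Int C \<or> Z = Z Int ?C'" using Z unfolding irreducible_subset_def by blast
  then show ?thesis using CC by blast
 qed
 show ?thesis
 proof (intro equalityI subsetI)
  fix Z assume "Z \<in> irreducible_components X"
  then have Z: "irreducible_subset X Z" "!!Z'. irreducible_subset X Z' ==> Z \<subseteq> Z' ==> Z' = Z" unfolding irreducible_components_def by blast+
  obtain C where CC: "C \<in> \<C>" "Z \<subseteq> C" using inC[OF Z(1)] by blast
  then show "Z \<in> \<C>" using Z(2)[OF irr[OF CC(1)] CC(2)] by simp
 next
  fix C assume CC: "C \<in> \<C>"
  have "Z' = C" if Z': "irreducible_subset X Z'" "C \<subseteq> Z'" for Z'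
  proof -
   obtain C' where C': "C' \<in> \<C>" "Z' \<subseteq> C'" using inC[OF Z'(1)] by blast
   moreover have "C ~= {}" using irr[OF CC] unfolding irreducible_subset_def by blast
   ultimately have "C = C'" using dj[OF CC] Z'(2) by blast
   then show ?thesis using C' Z' by blast
  qed
  then show "C \<in> irreducible_components X" unfolding irreducible_components_def using irr[OF CC] by blast
 qed
qed

lemma moduli_open_iff: "openin (tspace (moduli_space D d)) U \<longleftrightarrow>
  U \<subseteq> moduli_set D d & (ALL P q. (P, q) \<in> classifying_maps D d --> openin (top_of_set P) {p \<in> P. q p \<in> U})"
 unfolding moduli_space_def openin_final_fspace final_open_def by auto

lemma moduli_hol_iff: "f \<in> hol (moduli_space D d) U \<longleftrightarrow>
  (ALL P q. (P, q) \<in> classifying_maps D d --> cn_holomorphic_on (f \<circ> q) {p \<in> P. q p \<in> U})"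
 unfolding moduli_space_def final_fspace_def by auto

lemma moduli_hol_mono: assumes "V \<subseteq> U" shows "hol (moduli_space D d) U \<subseteq> hol (moduli_space D d) V"
proof
 fix f assume f: "f \<in> hol (moduli_space D d) U"
 show "f \<in> hol (moduli_space D d) V" unfolding moduli_hol_iff
 proof (intro allI impI)
  fix P and q assume "(P, q) \<in> classifying_maps D d"
  then have "cn_holomorphic_on (f \<circ> q) {p \<in> P. q p \<in> U}" using f unfolding moduli_hol_iff by blast
  then show "cn_holomorphic_on (f \<circ> q) {p \<in> P. q p \<in> V}" by (rule holo_subset) (use assms in blast)
 qed
qed

lemma moduli_hol_one: "(%_. 1) \<in> hol (moduli_space D d) U"
 unfolding moduli_hol_iff o_def by (simp add: holo_const)

section \<open>Uniformization of the loci\<close>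

text \<open>
  Every additive map from \<open>\<int>\<^sup>6\<close> is given by a matrix; this is used to change the marking of a period matrix.
\<close>

lemma period_hom_mat_additive:
 assumes add: "!!m n. f (m + n) = f m + f n"
 shows "period_hom (mat6 (\<chi> j. f (axis j 1))) n = f n"
proof -
 have f0: "f 0 = 0" using add[of 0 0] by simp
 have fd: "f (m - n) = f m - f n" for m n using add[of "m - n" n] by simp
 have ax: "f (axis j k) = k *. f (axis j 1)" for j and k :: int
 proof (induction k rule: int_induct[where k = 0])
  case base
  have "axis j (0::int) = 0" by (simp add: axis_def vec_eq_iff)
  then show ?case by (simp only: f0 of_int_0 scaleR_zero_left)
 next
  case (step1 i)
  have "axis j (i + 1) = axis j i + axis j (1::int)" by (simp add: axis_def vec_eq_iff)
  then show ?case using add step1 by (simp add: scaleR_add_left)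
 next
  case (step2 i)
  have "axis j (i - 1) = axis j i - axis j (1::int)" by (simp add: axis_def vec_eq_iff)
  then show ?case using fd step2 by (simp add: scaleR_diff_left)
 qed
 have "n = axis 1 (n $ 1) + axis 2 (n $ 2) + axis 3 (n $ 3) + axis 4 (n $ 4) + axis 5 (n $ 5) + axis 6 (n $ 6)"
  by (simp add: vec_eq_iff forall_6 axis_def)
 then have "f n = f (axis 1 (n $ 1) + axis 2 (n $ 2) + axis 3 (n $ 3) + axis 4 (n $ 4) + axis 5 (n $ 5) + axis 6 (n $ 6))" by simp
 also have "\<dots> = n $ 1 *. f (axis 1 1) + n $ 2 *. f (axis 2 1) + n $ 3 *. f (axis 3 1) + n $ 4 *. f (axis 4 1) + n $ 5 *. f (axis 5 1) + n $ 6 *. f (axis 6 1)"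
  unfolding add by (metis ax)
 finally show ?thesis unfolding period_hom_6 by simp
qed

lemma cdiff_period_hom: "cdiff (%M. period_hom M n $ i) M"
proof -
 have "(%M. period_hom M n $ i) = (%M. of_int (n $ 1) * M $ (i, 1) + of_int (n $ 2) * M $ (i, 2) + of_int (n $ 3) * M $ (i, 3)
  + of_int (n $ 4) * M $ (i, 4) + of_int (n $ 5) * M $ (i, 5) + of_int (n $ 6) * M $ (i, 6))"
  by (intro ext) (simp add: period_hom_def sum_6)
 then show ?thesis by (simp only:) (intro cdiff_intros)
qed

lemma cdiff_det3:
 assumes "!!i. cdiff (%x. a x $ i) x" "!!i. cdiff (%x. b x $ i) x" "!!i. cdiff (%x. c x $ i) x"
 shows "cdiff (%x. det3 (a x) (b x) (c x)) x"
 unfolding det3_def by (intro cdiff_intros assms)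

lemma upper_half3_open: "open HH"
proof -
 have "HH = (\<Inter>i. {z. Im (z $ i) > 0})" unfolding upper_half3_def by blast
 moreover have "open (\<Inter>i. {z :: complex ^ 3. Im (z $ i) > 0})"
  by (intro open_INT ballI open_Collect_less continuous_intros) simp_all
 ultimately show ?thesis by (simp only:)
qed

lemma upper_half3_convex: "convex HH"
 unfolding convex_alt
proof (intro ballI allI impI)
 fix x y :: "complex ^ 3" and u :: real
 assume x: "x \<in> HH" and y: "y \<in> HH" and u: "0 \<le> u & u \<le> 1"
 have "(1 - u) * Im (x $ i) + u * Im (y $ i) > 0" for i
 proof (cases "u = 0")
  case False
  have "(1 - u) * Im (x $ i) \<ge> 0" using u x unfolding upper_half3_def by (simp add: less_imp_le)
  moreover have "u * Im (y $ i) > 0" using u y False unfolding upper_half3_def by simp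
  ultimately show ?thesis by linarith
 qed (use x in \<open>simp add: upper_half3_def\<close>)
 then show "(1 - u) *\<^sub>R x + u *\<^sub>R y \<in> HH" unfolding upper_half3_def by simp
qed

context smart
begin

lemma cdiff_Pz: "cdiff (%z. Pz z $ p) z"
proof -
 obtain i j where p: "p = (i, j)" by (cases p)
 show ?thesis using exhaust_3[of i] exhaust_6[of j] unfolding p
  by (elim disjE; simp only: Pz_def mat6_def period_lambda_def period_mu_def vec_lambda_beta fst_conv snd_conv
   vec6_nth nth_Cons_0 nth_Cons_Suc nth_Cons_numeral vector_3 One_nat_def numeral_2_eq_2; (intro cdiff_intros)?)
qed

lemma cdiff_zeta:
 fixes Y :: "complex ^ 'm => complex ^ (3 \<times> 6)"
 assumes Y: "!!j i. cdiff (%x. col (Y x) j $ i) x" and ne: "det3 (col (Y x) 1) (col (Y x) 2) (col (Y x) 3) ~= 0"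
 shows "cdiff (%x. zeta (Y x) $ k) x"
 using exhaust_3[of k] unfolding zeta_def Let_def
 by (elim disjE; simp only: vector_3; intro cdiff_intros cdiff_divide cdiff_det3 Y ne)

abbreviation pi where "pi z \<equiv> rm_class D d (Xz z)"

lemma pi_eq_iff: "z \<in> HH ==> z' \<in> HH ==> pi z = pi z' \<longleftrightarrow> rm_isomorphic D (Xz z) (Xz z')"
 using rm_class_eq_iff Xz_is_rm_threefold by blast

lemma standard_period_matrix:
 assumes X: "is_rm_threefold D d X" "rm_class D d X \<in> ideal_locus D d \<aa>"
 shows "EX M. is_period_matrix D E0 L0 R0 X M"
proof -
 obtain g where g: "ideal_marking D \<aa> X g" using ideal_locus_iff[OF X(1)] X(2) by blast
 interpret marked3 D d X \<aa> \<eta>1 \<eta>2 g by unfold_locales (use X g in simp_all)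
 show ?thesis by (rule standard_marking)
qed

lemma standard_period_matrix_class:
 assumes X: "is_rm_threefold D d X" and M: "is_period_matrix D E0 L0 R0 X M"
 shows "zeta M \<in> HH" "rm_class D d X = pi (zeta M)" "det3 (col M 1) (col M 2) (col M 3) ~= 0"
proof -
 interpret period3 D d X \<aa> \<eta>1 \<eta>2 M by unfold_locales (use X M in simp_all)
 show 1: "zeta M \<in> HH" unfolding zeta_eq by (rule z_upper)
 show "rm_class D d X = pi (zeta M)"
  using isomorphic_to_model rm_class_eq_iff[OF Xz_is_rm_threefold[OF 1] X] unfolding zeta_eq by simp
 show "det3 (col M 1) (col M 2) (col M 3) ~= 0" using det3_lambda unfolding cols .
qed

lemma locus_eq: "ideal_locus D d \<aa> = pi ` HH"
proof (intro equalityI subsetI)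
 fix C assume C: "C \<in> ideal_locus D d \<aa>"
 then obtain X where X: "is_rm_threefold D d X" "C = rm_class D d X" unfolding ideal_locus_eq by blast
 then obtain M where "is_period_matrix D E0 L0 R0 X M" using standard_period_matrix C by blast
 from standard_period_matrix_class(1,2)[OF X(1) this] show "C \<in> pi ` HH" unfolding X(2) by blast
qed (use Xz_in_locus in blast)

lemma locus_subset: "ideal_locus D d \<aa> \<subseteq> moduli_set D d"
 unfolding ideal_locus_eq moduli_set_def by blast

text \<open>
  One period matrix in the locus fixes a change of coordinates \<open>N\<close> of \<open>\<int>\<^sup>6\<close> that turns its marking into
  the standard one. The same \<open>N\<close> works for all period matrices with the same integral data, so the whole
  period domain lies in the locus, and \<open>M \<mapsto> M N\<close> followed by \<open>zeta\<close> is the map to \<open>\<H>\<^sup>3\<close>.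
\<close>

lemma uniformizing_map:
 assumes Pq: "(P, q) \<in> classifying_maps D d" and p0: "p0 \<in> P" "q p0 \<in> ideal_locus D d \<aa>"
 obtains \<zeta> where "!!M. M \<in> P ==> \<zeta> M \<in> HH" "!!M. M \<in> P ==> q M = pi (\<zeta> M)"
  "!!M. M \<in> P ==> EX U. open U & M \<in> U & (\<forall>y\<in>U. ALL i. cdiff (%x. \<zeta> x $ i) y)"
proof -
 obtain E L R where P: "P = period_domain D d E L R"
  and q: "!!M. M \<in> P ==> EX X. is_rm_threefold D d X & is_period_matrix D E L R X M & q M = rm_class D d X"
  using Pq unfolding classifying_maps_def by blast
 obtain X0 where X0: "is_rm_threefold D d X0" "is_period_matrix D E L R X0 p0" "q p0 = rm_class D d X0" using q[OF p0(1)] by blast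
 obtain M1 where M1: "is_period_matrix D E0 L0 R0 X0 M1" using standard_period_matrix[OF X0(1)] p0(2) X0(3) by auto
 note a = X0(2)[unfolded is_period_matrix_def] and b = M1[unfolded is_period_matrix_def]
 note a0 = a[THEN conjunct1, unfolded bij_betw_def] and b0 = b[THEN conjunct1, unfolded bij_betw_def]
 note a1 = a0[THEN conjunct1] a0[THEN conjunct2] and b1 = b0[THEN conjunct1] b0[THEN conjunct2]
 note a2 = a[THEN conjunct2, THEN conjunct1, rule_format] and b2 = b[THEN conjunct2, THEN conjunct1, rule_format]
 note a3 = a[THEN conjunct2, THEN conjunct2, THEN conjunct1] and b3 = b[THEN conjunct2, THEN conjunct2, THEN conjunct1]
 note a4 = a[THEN conjunct2, THEN conjunct2, THEN conjunct2, rule_format] and b4 = b[THEN conjunct2, THEN conjunct2, THEN conjunct2, rule_format]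
 define N where "N n = inv_into UNIV (period_hom p0) (period_hom M1 n)" for n
 have N: "period_hom p0 (N n) = period_hom M1 n" for n unfolding N_def
  by (rule f_inv_into_f) (use a1(2) b1(2) in blast)
 have N_add: "N (m + n) = N m + N n" for m n
  by (rule injD[OF a1(1)]) (simp add: N period_hom_add)
 have N_bij: "bij N" unfolding bij_def
 proof
  show "inj N" by (rule injI) (metis N b1(1) injD)
  show "surj N"
   unfolding surj_def
  proof
   fix n
   have "period_hom p0 n \<in> range (period_hom M1)" unfolding b1(2) a1(2)[symmetric] by blast
   then obtain m where "period_hom p0 n = period_hom M1 m" by blast
   then have "period_hom p0 n = period_hom p0 (N m)" unfolding N .
   then show "EX m. n = N m" using injD[OF a1(1)] by metis
  qed
 qed
 have EN: "E (N m) (N n) = E0 m n" for m n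
  using a2[of "N m" "N n"] b2[of m n] unfolding N by simp
 have "period_hom p0 ` (N ` L0) = period_hom p0 ` L" unfolding a3 image_image N b3 ..
 then have LN: "N ` L0 = L" by (simp only: inj_image_eq_iff[OF a1(1)])
 have RN: "R k (N n) = N (R0 k n)" if k: "k \<in> Od" and n: "n \<in> L0" for k n
 proof -
  have "N n \<in> L" using LN n by blast
  then have "period_hom p0 (R k (N n)) = act X0 k (period_hom p0 (N n))" by (rule a4[OF k, symmetric])
  also have "\<dots> = period_hom p0 (N (R0 k n))" unfolding N by (rule b4[OF k n])
  finally show ?thesis by (rule injD[OF a1(1)])
 qed
 define Y where "Y M = mat6 (\<chi> j. period_hom M (N (axis j 1)))" for M
 have Y: "period_hom (Y M) n = period_hom M (N n)" for M n
  unfolding Y_def by (rule period_hom_mat_additive) (simp add: N_add period_hom_add)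
 have Yp: "is_period_matrix D E0 L0 R0 X (Y M)" if M: "is_period_matrix D E L R X M" for X M
 proof -
  note c = M[unfolded is_period_matrix_def]
  note c2 = c[THEN conjunct2, THEN conjunct1, rule_format] and c3 = c[THEN conjunct2, THEN conjunct2, THEN conjunct1]
   and c4 = c[THEN conjunct2, THEN conjunct2, THEN conjunct2, rule_format]
  show ?thesis unfolding is_period_matrix_def
  proof (intro conjI allI ballI)
   have "period_hom (Y M) = period_hom M \<circ> N" using Y by (simp add: fun_eq_iff)
   then show "bij_betw (period_hom (Y M)) UNIV (lat X)" using bij_betw_trans[OF N_bij c[THEN conjunct1]] by simp
   show "Im (pol X (period_hom (Y M) m) (period_hom (Y M) n)) = of_int (E0 m n)" for m n unfolding Y c2 EN ..
   show "period_hom (Y M) ` L0 = sub X Int lat X" unfolding c3[symmetric] LN[symmetric] image_image Y ..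
   fix k n assume k: "k \<in> Od" and n: "n \<in> L0"
   have "N n \<in> L" using LN n by blast
   from c4[OF k this] show "act X k (period_hom (Y M) n) = period_hom (Y M) (R0 k n)" unfolding Y RN[OF k n] .
  qed
 qed
 have Yd: "cdiff (%M. col (Y M) j $ i) M" for j i M unfolding Y_def col_mat6 vec_lambda_beta by (rule cdiff_period_hom)
 have MP: "zeta (Y M) \<in> HH & q M = pi (zeta (Y M)) & det3 (col (Y M) 1) (col (Y M) 2) (col (Y M) 3) ~= 0" if MP: "M \<in> P" for M
 proof -
  obtain X where X: "is_rm_threefold D d X" "is_period_matrix D E L R X M" "q M = rm_class D d X" using q[OF MP] by blast
  show ?thesis using standard_period_matrix_class[OF X(1) Yp[OF X(2)]] X(3) by simp
 qed
 show thesis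
 proof (rule that[of "%M. zeta (Y M)"])
  fix M assume M: "M \<in> P"
  show "zeta (Y M) \<in> HH" "q M = pi (zeta (Y M))" using MP[OF M] by blast+
  let ?U = "{M. det3 (col (Y M) 1) (col (Y M) 2) (col (Y M) 3) ~= 0}"
  have "continuous_on UNIV (%M. det3 (col (Y M) 1) (col (Y M) 2) (col (Y M) 3))"
   by (intro continuous_at_imp_continuous_on ballI cdiff_continuous cdiff_det3 Yd)
  then have "open ?U" by (intro open_Collect_neq continuous_on_const)
  then show "EX U. open U & M \<in> U & (\<forall>y\<in>U. ALL i. cdiff (%x. zeta (Y x) $ i) y)"
   using MP[OF M] cdiff_zeta[OF Yd] by (intro exI[of _ ?U]) auto
 qed
qed

lemma model_classifying_map:
 obtains P q where "(P, q) \<in> classifying_maps D d" "!!z. z \<in> HH ==> Pz z \<in> P" "!!z. z \<in> HH ==> q (Pz z) = pi z"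
proof -
 define P where "P = period_domain D d E0 L0 R0"
 define q where "q M = rm_class D d (SOME X. is_rm_threefold D d X & is_period_matrix D E0 L0 R0 X M)" for M
 have some: "is_rm_threefold D d (SOME X. is_rm_threefold D d X & is_period_matrix D E0 L0 R0 X M) &
   is_period_matrix D E0 L0 R0 (SOME X. is_rm_threefold D d X & is_period_matrix D E0 L0 R0 X M) M" if "M \<in> P" for M
  by (rule someI_ex) (use that in \<open>simp add: P_def period_domain_def\<close>)
 have zP: "Pz z \<in> P" if "z \<in> HH" for z
  unfolding P_def period_domain_def using Xz_is_rm_threefold[OF that] Xz_marking[OF that] by blast
 have "(P, q) \<in> classifying_maps D d" unfolding classifying_maps_def mem_Collect_eq case_prod_conv
  by (intro exI[of _ E0] exI[of _ L0] exI[of _ R0] conjI ballI P_def) (use some q_def in blast)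
 moreover have "q (Pz z) = pi z" if z: "z \<in> HH" for z
  unfolding q_def standard_period_matrix_class(2)[OF some[OF zP[OF z], THEN conjunct1] some[OF zP[OF z], THEN conjunct2]]
   standard_period_matrix_class(2)[OF Xz_is_rm_threefold[OF z] Xz_marking[OF z]] ..
 ultimately show thesis using that zP by blast
qed

text \<open>
  The structure of the moduli space on the locus is the quotient structure from \<open>\<H>\<^sup>3\<close>: the model family is
  one of the classifying maps, and all others that meet the locus factor through \<open>\<H>\<^sup>3\<close>. The next lemma is the
  same statement for functions.
\<close>

lemma open_iff:
 assumes U: "U \<subseteq> ideal_locus D d \<aa>"
 shows "openin (tspace (moduli_space D d)) U \<longleftrightarrow> open {z \<in> upper_half3. pi z \<in> U}"
proof
 assume o: "openin (tspace (moduli_space D d)) U"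
 obtain P q where Pq: "(P, q) \<in> classifying_maps D d" "!!z. z \<in> HH ==> Pz z \<in> P" "!!z. z \<in> HH ==> q (Pz z) = pi z"
  by (rule model_classifying_map) blast
 have "openin (top_of_set P) {p \<in> P. q p \<in> U}" using o Pq(1) unfolding moduli_open_iff by blast
 then obtain T where T: "open T" "{p \<in> P. q p \<in> U} = P Int T" unfolding openin_open by blast
 have "continuous_on UNIV Pz" by (intro continuous_at_imp_continuous_on ballI cdiff_vector_continuous cdiff_Pz)
 then have "open (Pz -` T)" using open_vimage[OF T(1)] by blast
 moreover have "{z \<in> upper_half3. pi z \<in> U} = HH Int Pz -` T"
 proof (intro equalityI subsetI)
  fix z assume z: "z \<in> {z \<in> upper_half3. pi z \<in> U}"
  then have "Pz z \<in> {p \<in> P. q p \<in> U}" using Pq(2,3) by simp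
  then show "z \<in> HH Int Pz -` T" unfolding T(2) using z by blast
 next
  fix z assume z: "z \<in> HH Int Pz -` T"
  then have "Pz z \<in> P Int T" using Pq(2) by blast
  then show "z \<in> {z \<in> upper_half3. pi z \<in> U}" unfolding T(2)[symmetric] using z Pq(3) by simp
 qed
 ultimately show "open {z \<in> upper_half3. pi z \<in> U}" using upper_half3_open by (simp add: open_Int)
next
 assume o: "open {z \<in> upper_half3. pi z \<in> U}"
 show "openin (tspace (moduli_space D d)) U" unfolding moduli_open_iff
 proof (intro conjI allI impI)
  show "U \<subseteq> moduli_set D d" using U locus_subset by blast
  fix P and q assume Pq: "(P, q) \<in> classifying_maps D d"
  show "openin (top_of_set P) {p \<in> P. q p \<in> U}"
  proof (cases "{p \<in> P. q p \<in> U} = {}")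
   case False
   then obtain p0 where "p0 \<in> P" "q p0 \<in> ideal_locus D d \<aa>" using U by blast
   then obtain \<zeta> where z: "!!M. M \<in> P ==> \<zeta> M \<in> HH" "!!M. M \<in> P ==> q M = pi (\<zeta> M)"
   "!!M. M \<in> P ==> EX U. open U & M \<in> U & (\<forall>y\<in>U. ALL i. cdiff (%x. \<zeta> x $ i) y)"
   by (rule uniformizing_map[OF Pq]) blast
   have "isCont \<zeta> M" if "M \<in> P" for M using z(3)[OF that] cdiff_vector_continuous[of \<zeta> M] by blast
   then have "continuous_on P \<zeta>" by (intro continuous_at_imp_continuous_on) blast
   from continuous_openin_preimage_gen[OF this o] have "openin (top_of_set P) (P Int \<zeta> -` {z \<in> upper_half3. pi z \<in> U})" .
   moreover have "P Int \<zeta> -` {z \<in> upper_half3. pi z \<in> U} = {p \<in> P. q p \<in> U}" using z(1,2) by auto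
   ultimately show ?thesis by simp
  qed (simp only: openin_empty)
 qed
qed

lemma hol_iff:
 assumes U: "U \<subseteq> ideal_locus D d \<aa>"
 shows "f \<in> hol (moduli_space D d) U \<longleftrightarrow> cn_holomorphic_on (f \<circ> pi) {z \<in> upper_half3. pi z \<in> U}"
proof
 assume h: "f \<in> hol (moduli_space D d) U"
 obtain P q where Pq: "(P, q) \<in> classifying_maps D d" "!!z. z \<in> HH ==> Pz z \<in> P" "!!z. z \<in> HH ==> q (Pz z) = pi z"
  by (rule model_classifying_map) blast
 have "cn_holomorphic_on (f \<circ> q) {p \<in> P. q p \<in> U}" using h Pq(1) unfolding moduli_hol_iff by blast
 then have "cn_holomorphic_on ((f \<circ> q) \<circ> Pz) {z \<in> upper_half3. pi z \<in> U}"
 proof (rule holo_compose)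
  fix z assume z: "z \<in> {z \<in> upper_half3. pi z \<in> U}"
  then show "Pz z \<in> {p \<in> P. q p \<in> U}" using Pq(2,3) by simp
  show "EX U. open U & z \<in> U & (\<forall>y\<in>U. ALL i. cdiff (%x. Pz x $ i) y)"
   by (intro exI[of _ UNIV]) (simp add: cdiff_Pz)
 qed
 then show "cn_holomorphic_on (f \<circ> pi) {z \<in> upper_half3. pi z \<in> U}"
  by (rule holo_cong) (simp add: Pq(3))
next
 assume h: "cn_holomorphic_on (f \<circ> pi) {z \<in> upper_half3. pi z \<in> U}"
 show "f \<in> hol (moduli_space D d) U" unfolding moduli_hol_iff
 proof (intro allI impI)
  fix P and q assume Pq: "(P, q) \<in> classifying_maps D d"
  show "cn_holomorphic_on (f \<circ> q) {p \<in> P. q p \<in> U}"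
  proof (cases "{p \<in> P. q p \<in> U} = {}")
   case True
   show ?thesis unfolding True holo_iff by simp
  next
   case False
   then obtain p0 where "p0 \<in> P" "q p0 \<in> ideal_locus D d \<aa>" using U by blast
   then obtain \<zeta> where z: "!!M. M \<in> P ==> \<zeta> M \<in> HH" "!!M. M \<in> P ==> q M = pi (\<zeta> M)"
   "!!M. M \<in> P ==> EX U. open U & M \<in> U & (\<forall>y\<in>U. ALL i. cdiff (%x. \<zeta> x $ i) y)"
   by (rule uniformizing_map[OF Pq]) blast
   have "cn_holomorphic_on ((f \<circ> pi) \<circ> \<zeta>) {p \<in> P. q p \<in> U}"
   proof (rule holo_compose[OF h])
   fix p assume p: "p \<in> {p \<in> P. q p \<in> U}"
   then show "\<zeta> p \<in> {z \<in> upper_half3. pi z \<in> U}" using z(1)[of p] z(2)[of p] by simp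
   show "EX U. open U & p \<in> U & (\<forall>y\<in>U. ALL i. cdiff (%x. \<zeta> x $ i) y)" using z(3)[of p] p by blast
   qed
   then show ?thesis by (rule holo_cong) (simp add: z(2))
  qed
 qed
qed

lemma locus_clopen: "openin (tspace (moduli_space D d)) (ideal_locus D d \<aa>)" "closedin (tspace (moduli_space D d)) (ideal_locus D d \<aa>)"
proof -
 have "{z \<in> upper_half3. pi z \<in> ideal_locus D d \<aa>} = HH" using Xz_in_locus by blast
 then show "openin (tspace (moduli_space D d)) (ideal_locus D d \<aa>)" unfolding open_iff[OF subset_refl] using upper_half3_open by simp
 have "openin (tspace (moduli_space D d)) (moduli_set D d - ideal_locus D d \<aa>)" unfolding moduli_open_iff
 proof (intro conjI allI impI)
  fix P and q assume Pq: "(P, q) \<in> classifying_maps D d"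
  have qm: "q p \<in> moduli_set D d" if "p \<in> P" for p using Pq that unfolding classifying_maps_def moduli_set_def by blast
  have "{p \<in> P. q p \<in> moduli_set D d - ideal_locus D d \<aa>} = {} \<or> {p \<in> P. q p \<in> moduli_set D d - ideal_locus D d \<aa>} = P"
  proof (cases "\<exists>p0\<in>P. q p0 \<in> ideal_locus D d \<aa>")
   case True
   then obtain p0 where "p0 \<in> P" "q p0 \<in> ideal_locus D d \<aa>" by blast
   then obtain \<zeta> where "!!M. M \<in> P ==> \<zeta> M \<in> HH" "!!M. M \<in> P ==> q M = pi (\<zeta> M)"
   by (rule uniformizing_map[OF Pq]) blast
   then show ?thesis using Xz_in_locus by auto
  qed (use qm in blast)
  then show "openin (top_of_set P) {p \<in> P. q p \<in> moduli_set D d - ideal_locus D d \<aa>}"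
   by (elim disjE) (simp_all only: openin_empty openin_subtopology_self)
 qed blast
 then show "closedin (tspace (moduli_space D d)) (ideal_locus D d \<aa>)"
  unfolding closedin_def topspace_moduli_space using locus_subset by blast
qed

text \<open>
  A decomposition of the locus pulls back to a decomposition of \<open>\<H>\<^sup>3\<close> into two analytic sets.
\<close>

lemma locus_irreducible: "irreducible_subset (moduli_space D d) (ideal_locus D d \<aa>)"
proof -
 let ?M = "moduli_space D d" and ?C = "ideal_locus D d \<aa>"
 have an: "analytic_subset ?M (topspace (tspace ?M) Int ?C)"
  by (rule analytic_subset_Int_clopen[OF moduli_hol_mono moduli_hol_one locus_clopen analytic_subset_topspace])
 have pull: "locally_analytic HH {z \<in> upper_half3. pi z \<in> Z}" if Z: "analytic_subset ?M Z" for Z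
  unfolding locally_analytic_def
 proof (intro conjI ballI)
  fix x assume x: "x \<in> HH"
  then have "pi x \<in> topspace (tspace ?M)" unfolding topspace_moduli_space using Xz_in_locus locus_subset by blast
  then obtain U F where U: "openin (tspace ?M) U" "pi x \<in> U" "F \<subseteq> hol ?M U" "Z Int U = {y \<in> U. \<forall>f\<in>F. f y = 0}"
   using Z unfolding analytic_subset_def by meson
  define O' where "O' = {z \<in> upper_half3. pi z \<in> U Int ?C}"
  have oU: "openin (tspace ?M) (U Int ?C)" using U(1) locus_clopen(1) by (rule openin_Int)
  have O': "open O'" unfolding O'_def using oU open_iff[of "U Int ?C"] by blast
  have cd: "cdiff (f \<circ> pi) y" if "f \<in> F" "y \<in> O'" for f y
  proof (rule holo_open[OF O' _ that(2)])
   have "f \<in> hol ?M (U Int ?C)" using U(3) that(1) moduli_hol_mono[of "U Int ?C" U] by blast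
   then show "cn_holomorphic_on (f \<circ> pi) O'" unfolding O'_def using hol_iff[of "U Int ?C"] by blast
  qed
  have "{z \<in> upper_half3. pi z \<in> Z} Int O' = {y \<in> O'. pi y \<in> Z Int U}" unfolding O'_def by blast
  also have "\<dots> = {y \<in> O'. \<forall>f\<in>(%f. f \<circ> pi) ` F. f y = 0}" unfolding U(4) O'_def by auto
  finally have e: "{z \<in> upper_half3. pi z \<in> Z} Int O' = {y \<in> O'. \<forall>f\<in>(%f. f \<circ> pi) ` F. f y = 0}" .
  show "EX U F. open U & x \<in> U & U \<subseteq> HH & (\<forall>f\<in>F. \<forall>y\<in>U. cdiff f y) &
   {z \<in> upper_half3. pi z \<in> Z} Int U = {y \<in> U. \<forall>f\<in>F. f y = 0}"
  proof (rule exI[of _ O'], rule exI[of _ "(%f. f \<circ> pi) ` F"], intro conjI)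
   show "x \<in> O'" unfolding O'_def using x U(2) Xz_in_locus[OF x] by blast
   show "O' \<subseteq> HH" unfolding O'_def by blast
   show "\<forall>f\<in>(%f. f \<circ> pi) ` F. \<forall>y\<in>O'. cdiff f y" using cd by blast
  qed (rule O', rule e)
 qed blast
 show ?thesis unfolding irreducible_subset_def
 proof (intro conjI allI impI)
  show "analytic_subset ?M ?C" using an locus_subset unfolding topspace_moduli_space by (simp add: Int_absorb1)
  have "(\<chi> i. \<i>) \<in> HH" unfolding upper_half3_def by simp
  then show "?C ~= {}" using Xz_in_locus by blast
  fix Z1 Z2 assume Z: "analytic_subset ?M Z1 & analytic_subset ?M Z2 & ?C = Z1 \<union> Z2"
  have "{z \<in> upper_half3. pi z \<in> Z1} = HH \<or> {z \<in> upper_half3. pi z \<in> Z2} = HH"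
  proof (rule locally_analytic_irreducible[OF convex_connected[OF upper_half3_convex] pull pull])
   show "HH = {z \<in> upper_half3. pi z \<in> Z1} \<union> {z \<in> upper_half3. pi z \<in> Z2}" using Z Xz_in_locus by blast
  qed (use Z in blast)+
  then show "?C = Z1 \<or> ?C = Z2" using Z unfolding locus_eq by blast
 qed
qed

text \<open>
  The two directions of the isomorphism criterion say that the fibres of \<open>z \<mapsto> [X_z]\<close> are the orbits.
\<close>

lemma uniformization:
 assumes cop: "coprime d (conductor D)"
 shows "\<exists>\<Phi>. fspace_iso \<Phi> (hilbert_modular_variety D (Gamma_group D d \<aa> \<eta>1 \<eta>2))
   (sub_fspace (moduli_space D d) (ideal_locus D d \<aa>)) &
   (\<forall>z\<in>upper_half3. \<Phi> (hilbert_orbit D (Gamma_group D d \<aa> \<eta>1 \<eta>2) z) = pi z)"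
proof -
 let ?G = "Gamma_group D d \<aa> \<eta>1 \<eta>2" and ?C = "ideal_locus D d \<aa>" and ?M = "moduli_space D d" and ?H = "HH"
 let ?V = "hilbert_modular_variety D ?G" and ?S = "sub_fspace ?M ?C"
 define orb where "orb = hilbert_orbit D ?G"
 have orbI: "z' \<in> orb z \<longleftrightarrow> z' \<in> ?H & pi z' = pi z" if z: "z \<in> ?H" for z z'
 proof
  assume "z' \<in> orb z"
  then obtain A B where g: "(A, B) \<in> ?G" "z' = hilbert_act D (A, B) z" unfolding orb_def hilbert_orbit_def by auto
  have z': "z' \<in> ?H & rm_isomorphic D (Xz z) (Xz z')" unfolding g(2) by (rule Gamma_imp_isomorphic[OF z g(1)])
  then have "pi z = pi z'" using pi_eq_iff[OF z, of z'] by simp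
  then show "z' \<in> ?H & pi z' = pi z" using z' by simp
 next
  assume z': "z' \<in> ?H & pi z' = pi z"
  then have "rm_isomorphic D (Xz z) (Xz z')" using pi_eq_iff[OF z, of z'] by simp
  then show "z' \<in> orb z" using isomorphic_imp_Gamma[OF cop z, of z'] z' unfolding orb_def hilbert_orbit_def by blast
 qed
 have orb_eq: "orb z = orb z' \<longleftrightarrow> pi z = pi z'" if z: "z \<in> ?H" "z' \<in> ?H" for z z'
  using orbI[OF z(1)] orbI[OF z(2)] z by blast
 define \<Phi> where "\<Phi> C = pi (SOME z. z \<in> ?H & orb z = C)" for C
 have Phi: "\<Phi> (orb z) = pi z" if z: "z \<in> ?H" for z
 proof -
  have "(SOME w. w \<in> ?H & orb w = orb z) \<in> ?H & orb (SOME w. w \<in> ?H & orb w = orb z) = orb z"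
   by (rule someI_ex) (use z in blast)
  then show ?thesis unfolding \<Phi>_def using orb_eq z by blast
 qed
 have V: "?V = final_fspace (orb ` ?H) {(?H, orb)}" unfolding hilbert_modular_variety_def orb_def ..
 have top: "topspace (tspace ?V) = orb ` ?H" unfolding V by (rule topspace_final_fspace) auto
 have Vopen: "openin (tspace ?V) U \<longleftrightarrow> U \<subseteq> orb ` ?H & open {z \<in> ?H. orb z \<in> U}" for U
  unfolding V openin_final_fspace final_open_def using openin_open_eq[OF upper_half3_open] by auto
 have Vhol: "f \<in> hol ?V U \<longleftrightarrow> cn_holomorphic_on (f \<circ> orb) {z \<in> ?H. orb z \<in> U}" for f U
  unfolding V final_fspace_def by auto
 have Stop: "tspace ?S = subtopology (tspace ?M) ?C" unfolding sub_fspace_def by simp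
 have Sopen: "openin (tspace ?S) U \<longleftrightarrow> openin (tspace ?M) U & U \<subseteq> ?C" for U
  unfolding Stop by (rule openin_open_subtopology[OF locus_clopen(1)])
 have Stopspace: "topspace (tspace ?S) = ?C" unfolding Stop topspace_subtopology topspace_moduli_space using locus_subset by blast
 have pre: "{z \<in> ?H. orb z \<in> {x \<in> topspace (tspace ?V). \<Phi> x \<in> W}} = {z \<in> ?H. pi z \<in> W}" for W
  unfolding top using Phi by auto
 have hom: "homeomorphic_map (tspace ?V) (tspace ?S) \<Phi>" unfolding homeomorphic_map_def quotient_map_def top Stopspace
 proof (intro conjI allI impI)
  show "\<Phi> ` orb ` ?H = ?C" unfolding locus_eq image_image using Phi by (auto simp: image_iff)
  show "inj_on \<Phi> (orb ` ?H)" 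
  proof (rule inj_onI)
   fix C C' assume "C \<in> orb ` ?H" "C' \<in> orb ` ?H" and eq: "\<Phi> C = \<Phi> C'"
   then obtain z z' where z: "z \<in> ?H" "z' \<in> ?H" and C: "C = orb z" "C' = orb z'" by blast
   have "pi z = pi z'" using eq unfolding C Phi[OF z(1)] Phi[OF z(2)] .
   then show "C = C'" unfolding C by (rule orb_eq[OF z, THEN iffD2])
  qed
  fix W assume W: "W \<subseteq> ?C"
  show "openin (tspace ?V) {x \<in> orb ` ?H. \<Phi> x \<in> W} \<longleftrightarrow> openin (tspace ?S) W"
   unfolding Sopen Vopen open_iff[OF W] using pre[of W, unfolded top] W by auto
 qed
 have holS: "f \<in> hol ?S W \<longleftrightarrow> f \<in> hol ?M W" if W: "openin (tspace ?S) W" for f W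
 proof
  assume f: "f \<in> hol ?M W"
  have "openin (tspace ?M) W" using W unfolding Sopen by blast
  then have "EX U. openin (tspace ?M) U & x \<in> U & (\<exists>F\<in>hol ?M U. \<forall>y\<in>U Int W. F y = f y)" if "x \<in> W" for x
   using that f by (intro exI[of _ W] conjI bexI[of _ f] ballI refl)
  then show "f \<in> hol ?S W" unfolding sub_fspace_def by simp
 next
  have WC: "W \<subseteq> ?C" and Wo: "openin (tspace ?M) W" using W unfolding Sopen by blast+
  assume f: "f \<in> hol ?S W"
  show "f \<in> hol ?M W" unfolding hol_iff[OF WC]
  proof (rule holo_local)
   fix x assume x: "x \<in> {z \<in> ?H. pi z \<in> W}"
   then have "EX U. openin (tspace ?M) U & pi x \<in> U & (\<exists>F\<in>hol ?M U. \<forall>y\<in>U Int W. F y = f y)"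
   using f unfolding sub_fspace_def by simp
   then obtain U F where U: "openin (tspace ?M) U" "pi x \<in> U" "F \<in> hol ?M U" "\<forall>y\<in>U Int W. F y = f y" by blast
   have UC: "U Int W \<subseteq> ?C" using WC by blast
   have oU: "openin (tspace ?M) (U Int W)" using U(1) Wo by (rule openin_Int)
   have "F \<in> hol ?M (U Int W)" using U(3) moduli_hol_mono[of "U Int W" U] by blast
   then have "cn_holomorphic_on (F \<circ> pi) {z \<in> ?H. pi z \<in> U Int W}" unfolding hol_iff[OF UC] .
   then have "cn_holomorphic_on (f \<circ> pi) {z \<in> ?H. pi z \<in> U Int W}" by (rule holo_cong) (use U(4) in simp)
   moreover have "{z \<in> ?H. pi z \<in> W} Int {z \<in> ?H. pi z \<in> U Int W} = {z \<in> ?H. pi z \<in> U Int W}" by blast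
   ultimately show "EX O'. open O' & x \<in> O' & cn_holomorphic_on (f \<circ> pi) ({z \<in> ?H. pi z \<in> W} Int O')"
   using oU[unfolded open_iff[OF UC]] x U(2) by (intro exI[of _ "{z \<in> ?H. pi z \<in> U Int W}"]) simp
  qed
 qed
 have "fspace_iso \<Phi> ?V ?S" unfolding fspace_iso_def
 proof (intro conjI allI impI hom)
  fix W f assume W: "openin (tspace ?S) W"
  then have WC: "W \<subseteq> ?C" unfolding Sopen by blast
  have "f \<circ> \<Phi> \<in> hol ?V {x \<in> topspace (tspace ?V). \<Phi> x \<in> W} \<longleftrightarrow> cn_holomorphic_on (f \<circ> \<Phi> \<circ> orb) {z \<in> ?H. pi z \<in> W}"
   unfolding Vhol pre ..
  also have "\<dots> \<longleftrightarrow> cn_holomorphic_on (f \<circ> pi) {z \<in> ?H. pi z \<in> W}"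
   using holo_cong[of "f \<circ> \<Phi> \<circ> orb" "{z \<in> ?H. pi z \<in> W}" "f \<circ> pi"]
   holo_cong[of "f \<circ> pi" "{z \<in> ?H. pi z \<in> W}" "f \<circ> \<Phi> \<circ> orb"] Phi by auto
  finally show "f \<in> hol ?S W \<longleftrightarrow> f \<circ> \<Phi> \<in> hol ?V {x \<in> topspace (tspace ?V). \<Phi> x \<in> W}"
   unfolding holS[OF W] hol_iff[OF WC] by blast
 qed
 then show ?thesis using Phi unfolding orb_def by blast
qed

end

section \<open>The structure of the moduli space\<close>

theorem theorem6p16:
  fixes D d :: nat
  assumes "nonsquare_discriminant D"
    and "d > 0"
    and "coprime d (conductor D)"
  shows "(moduli_set D d \<noteq> {} \<longleftrightarrow> prime_factor_condition D d) \<and>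
    (prime_factor_condition D d \<longrightarrow>
       card (irreducible_components (moduli_space D d)) =
         2 ^ card {p. prime p \<and> p dvd d \<and> splits D p} \<and>
       \<Union> (irreducible_components (moduli_space D d)) = moduli_set D d \<and>
       bij_betw (ideal_locus D d) (primitive_ideals D d) (irreducible_components (moduli_space D d)) \<and>
       (\<forall>\<aa>\<in>primitive_ideals D d.
          (\<exists>\<eta>1 \<eta>2. smart_basis D d \<aa> \<eta>1 \<eta>2) \<and>
          (\<forall>\<eta>1 \<eta>2. smart_basis D d \<aa> \<eta>1 \<eta>2 \<longrightarrow>
             (\<exists>\<Phi>. fspace_iso \<Phi>
                    (hilbert_modular_variety D (Gamma_group D d \<aa> \<eta>1 \<eta>2))
                    (sub_fspace (moduli_space D d) (ideal_locus D d \<aa>)) \<and>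
                  (\<forall>z\<in>upper_half3.
                     \<Phi> (hilbert_orbit D (Gamma_group D d \<aa> \<eta>1 \<eta>2) z) =
                       rm_class D d (rm_threefold_of D d \<eta>1 \<eta>2 z))))))"
proof -
  interpret real_quadratic D by unfold_locales (rule assms(1))
  let ?I = "primitive_ideals D d" and ?M = "moduli_space D d"
  have ex: "\<exists>\<eta>1 \<eta>2. smart_basis D d \<aa> \<eta>1 \<eta>2" if "\<aa> \<in> ?I" for \<aa> using smart_basis_exists[OF assms(2) that] .
  have sm: "smart D d \<aa> \<eta>1 \<eta>2" if "\<aa> \<in> ?I" "smart_basis D d \<aa> \<eta>1 \<eta>2" for \<aa> \<eta>1 \<eta>2
    by unfold_locales (use that assms in simp_all)
  have ex': "\<exists>\<eta>1 \<eta>2. smart D d \<aa> \<eta>1 \<eta>2" if "\<aa> \<in> ?I" for \<aa> using ex[OF that] sm[OF that] by blast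
  have clopen: "openin (tspace ?M) (ideal_locus D d \<aa>)" "closedin (tspace ?M) (ideal_locus D d \<aa>)"
    and irr: "irreducible_subset ?M (ideal_locus D d \<aa>)" if "\<aa> \<in> ?I" for \<aa>
    using ex'[OF that] smart.locus_clopen smart.locus_irreducible by blast+
  have union: "\<Union> (ideal_locus D d ` ?I) = moduli_set D d"
  proof (intro equalityI subsetI)
    fix C assume "C \<in> moduli_set D d"
    then obtain X where XC: "is_rm_threefold D d X" "C = rm_class D d X" unfolding moduli_set_def by blast
    interpret rm3 D d X by unfold_locales (rule XC(1))
    show "C \<in> \<Union> (ideal_locus D d ` ?I)" using ideal_marking_exists ideal_locus_iff[OF XC(1)] unfolding XC(2) by blast
  qed (auto simp: ideal_locus_eq moduli_set_def)
  have disj: "\<aa> = \<bb>" if ab: "\<aa> \<in> ?I" "\<bb> \<in> ?I" "ideal_locus D d \<aa> \<inter> ideal_locus D d \<bb> \<noteq> {}" for \<aa> \<bb>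
  proof -
    obtain C where C: "C \<in> ideal_locus D d \<aa>" "C \<in> ideal_locus D d \<bb>" using ab(3) by blast
    then obtain X where X: "is_rm_threefold D d X" "C = rm_class D d X" unfolding ideal_locus_eq by blast
    then obtain g g' where "ideal_marking D \<aa> X g" "ideal_marking D \<bb> X g'" using C ideal_locus_iff[OF X(1)] by blast
    then show ?thesis using ideal_marking_unique[OF assms(1) X(1) ab(1) _ ab(2)] by blast
  qed
  have ne: "ideal_locus D d \<aa> \<noteq> {}" if "\<aa> \<in> ?I" for \<aa> using irr[OF that] unfolding irreducible_subset_def by blast
  have comps: "irreducible_components ?M = ideal_locus D d ` ?I"
  proof (rule irreducible_components_clopen[OF moduli_hol_mono moduli_hol_one])
    show "\<Union> (ideal_locus D d ` ?I) = topspace (tspace ?M)" unfolding union topspace_moduli_space ..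
    show "C = C'" if "C \<in> ideal_locus D d ` ?I" "C' \<in> ideal_locus D d ` ?I" "C \<inter> C' \<noteq> {}" for C C' using that disj by blast
  qed (use clopen irr in blast)+
  have bij: "bij_betw (ideal_locus D d) ?I (irreducible_components ?M)" unfolding comps bij_betw_def
  proof (intro conjI inj_onI refl)
    fix \<aa> \<bb> assume ab: "\<aa> \<in> ?I" "\<bb> \<in> ?I" "ideal_locus D d \<aa> = ideal_locus D d \<bb>"
    show "\<aa> = \<bb>" by (rule disj[OF ab(1,2)]) (use ne[OF ab(1)] ab(3) in simp)
  qed
  have "card ?I = card (roots_mod d)" using bij_betw_same_card[OF primitive_ideals_eq[OF assms(2)]] by simp
  then have card: "card ?I = 2 ^ card {p. prime p \<and> p dvd d \<and> splits D p}" if "prime_factor_condition D d"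
    using card_roots_mod_PFC[OF assms(2,3) that] by simp
  have pfc: "prime_factor_condition D d" if I: "?I \<noteq> {}"
  proof -
    obtain \<aa> where "\<aa> \<in> ?I" using I by blast
    then obtain a where "int d dvd minpol a" using primitive_ideal_is_root_ideal[OF assms(2)] by blast
    then show ?thesis by (rule prime_factor_condition_if_root[OF assms(2,3)])
  qed
  have "moduli_set D d \<noteq> {} \<longleftrightarrow> ?I \<noteq> {}" unfolding union[symmetric] using ne by blast
  moreover have "?I \<noteq> {}" if "prime_factor_condition D d" using card[OF that] by auto
  ultimately have 1: "moduli_set D d \<noteq> {} \<longleftrightarrow> prime_factor_condition D d" using pfc by blast
  show ?thesis
    using 1 card bij_betw_same_card[OF bij] union comps bij ex smart.uniformization[OF sm assms(3)] by auto
qed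

end
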